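(* Assume that $0<b_2<b_1<1$ and let $\omega$ be a $\mathcal P(b_1,b_2)$-distributed random configuration of the six-vertex model in the quadrant, with height function $H(x,y;\omega)$. For any $x,y>0$ such that $\frac{1-b_1}{1-b_2}<\frac{x}{y}<\frac{1-b_2}{1-b_1}$ and any $s\in\mathbb R$ we have $$\lim_{L\to\infty}\mathbb P\left(\frac{\mathcal H(x,y)L-H(Lx,Ly;\omega)}{\sigma_{x,y}L^{1/3}}\le s\right)=F_{\rm GUE}(s),$$ where $$\mathcal H(x,y)=\frac{\left(\sqrt{y(1-b_1)}-\sqrt{x(1-b_2)}\right)^2}{b_1-b_2},$$ $$\sigma_{x,y}=\kappa^{-1/3}\frac{x^{1/6}y^{1/6}}{\kappa^{-1/2}-\kappa^{1/2}}\left(1-\sqrt{\kappa x/y}\right)^{2/3}\left(1-\sqrt{\kappa y/x}\right)^{2/3},\qquad \kappa=\frac{1-b_1}{1-b_2},$$ and $F_{\rm GUE}$ is the GUE Tracy-Widom distribution function.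
   Context: Six-vertex configurations in the quadrant. To each vertex of the grid $\mathbb Z_{>0}\times\mathbb Z_{>0}$ (first coordinate horizontal, second vertical) one assigns one of six types, specified by which of the four adjacent edges (west, south, east, north) are bold: $a_1$: none; $a_2$: all four; $b_1$: south and north; $b_2$: west and east; $c_1$: south and east; $c_2$: west and north. The assignment must be consistent (an edge shared by two adjacent vertices is bold for both or for neither), the south edge of every vertex $(x,1)$, $x>0$, is bold, and the west edge of every vertex $(1,y)$, $y>0$, is not bold. $\Omega$ is the set of all such configurations. The measure $\mathcal P(b_1,b_2)$, $0<b_1,b_2<1$, is the probability measure on $\Omega$ obtained by the following sequential sampling: vertices $(x,y)$ are processed in increasing order of $x+y$; when $(x,y)$ is processed it is known whether its west and south edges are bold. If both are bold, the type is $a_2$. If neither is bold, the type is $a_1$. If west is bold and south is not, the type is $b_2$ with probability $b_2$ and $c_2$ with probability $1-b_2$. If south is bold and west is not, the type is $b_1$ with probability $b_1$ and $c_1$ with probability $1-b_1$. All random choices are independent. Height function: for real $x,y>0$, $H(x,y;\omega)$ is the number of integers $i$ with $1\le i\le x$ such that the vertex $(i,\lceil y\rceil)$ has a bold south edge (i.e. is of type $a_2$, $b_1$ or $c_1$) in $\omega$. The GUE Tracy-Widom distribution is $F_{\rm GUE}(s)=\det(I-A)_{L_2(s,+\infty)}$ (Fredholm determinant), where $A$ is the integral operator with kernel $A(x,y)=\frac{Ai(x)Ai'(y)-Ai(y)Ai'(x)}{x-y}$ and $Ai$ is the Airy function. *)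

theory Defs
  imports
    "HOL-Probability.Probability"
    "Jordan_Normal_Form.Determinant"
begin

section \<open>Six-vertex configurations in the quadrant\<close>

datatype vertex_type = Type_a1 | Type_a2 | Type_b1 | Type_b2 | Type_c1 | Type_c2

definition bold_west :: "vertex_type \<Rightarrow> bool" where
  "bold_west t \<longleftrightarrow> t \<in> {Type_a2, Type_b2, Type_c2}"

definition bold_south :: "vertex_type \<Rightarrow> bool" where
  "bold_south t \<longleftrightarrow> t \<in> {Type_a2, Type_b1, Type_c1}"

definition bold_east :: "vertex_type \<Rightarrow> bool" where
  "bold_east t \<longleftrightarrow> t \<in> {Type_a2, Type_b2, Type_c1}"

definition bold_north :: "vertex_type \<Rightarrow> bool" where
  "bold_north t \<longleftrightarrow> t \<in> {Type_a2, Type_b1, Type_c2}"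

definition quadrant :: "(nat \<times> nat) set" where
  "quadrant = {1..} \<times> {1..}"

text \<open>Configurations are \<^const>\<open>undefined\<close> off the quadrant, so that each one is represented by
  exactly one function.\<close>

definition configs :: "(nat \<times> nat \<Rightarrow> vertex_type) set" where
  "configs = {\<omega> \<in> quadrant \<rightarrow>\<^sub>E UNIV.
     (\<forall>x\<ge>1. \<forall>y\<ge>1. bold_east (\<omega> (x, y)) \<longleftrightarrow> bold_west (\<omega> (x + 1, y))) \<and>
     (\<forall>x\<ge>1. \<forall>y\<ge>1. bold_north (\<omega> (x, y)) \<longleftrightarrow> bold_south (\<omega> (x, y + 1))) \<and>
     (\<forall>x\<ge>1. bold_south (\<omega> (x, 1))) \<and>
     (\<forall>y\<ge>1. \<not> bold_west (\<omega> (1, y)))}"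

definition config_space :: "(nat \<times> nat \<Rightarrow> vertex_type) measure" where
  "config_space = restrict_space (Pi\<^sub>M quadrant (\<lambda>_. count_space UNIV)) configs"

text \<open>\<open>height_function\<close> is only meaningful for positive arguments.\<close>

definition height_function :: "real \<Rightarrow> real \<Rightarrow> (nat \<times> nat \<Rightarrow> vertex_type) \<Rightarrow> nat" where
  "height_function x y \<omega> = card {i::nat. 1 \<le> i \<and> real i \<le> x \<and> bold_south (\<omega> (i, nat \<lceil>y\<rceil>))}"


section \<open>The stochastic six-vertex measure\<close>

text \<open>The randomness consists of two coins at every vertex, all independent: the first, with
  success probability \<open>b1\<close>, decides whether a single bold edge from the south continues straight
  (type \<open>b\<^sub>1\<close>) or turns (type \<open>c\<^sub>1\<close>); the second, with success probability \<open>b2\<close>, does the same for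
  a single bold edge from the west. At most one of the two coins is used at each vertex.\<close>

type_synonym coins = "nat \<times> nat \<Rightarrow> bool \<times> bool"

definition coin_space :: "real \<Rightarrow> real \<Rightarrow> coins measure" where
  "coin_space b1 b2 =
     Pi\<^sub>M quadrant (\<lambda>_. measure_pmf (pair_pmf (bernoulli_pmf b1) (bernoulli_pmf b2)))"

text \<open>The type of a vertex, given whether its west (\<open>w\<close>) and south (\<open>s\<close>) edges are bold.\<close>

definition choose_type :: "bool \<Rightarrow> bool \<Rightarrow> bool \<times> bool \<Rightarrow> vertex_type" where
  "choose_type w s c =
     (if w \<and> s then Type_a2
      else if \<not> w \<and> \<not> s then Type_a1
      else if w then (if snd c then Type_b2 else Type_c2)
      else (if fst c then Type_b1 else Type_c1))"

function sampled :: "coins \<Rightarrow> nat \<Rightarrow> nat \<Rightarrow> vertex_type" where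
  "sampled c x y =
     choose_type
       (if x \<le> 1 then False else bold_east (sampled c (x - 1) y))
       (if y \<le> 1 then True else bold_north (sampled c x (y - 1)))
       (c (x, y))"
  by auto
termination by (relation "Wellfounded.measure (\<lambda>(c, x, y). x + y)") auto

declare sampled.simps [simp del]

definition sampled_config :: "coins \<Rightarrow> nat \<times> nat \<Rightarrow> vertex_type" where
  "sampled_config c = restrict (\<lambda>(x, y). sampled c x y) quadrant"

definition six_vertex_measure :: "real \<Rightarrow> real \<Rightarrow> (nat \<times> nat \<Rightarrow> vertex_type) measure" where
  "six_vertex_measure b1 b2 = distr (coin_space b1 b2) config_space sampled_config"


subsection \<open>Well-definedness\<close>

lemma bold_choose_type [simp]:
  "bold_west (choose_type w s c) = w" "bold_south (choose_type w s c) = s"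
  by (auto simp: choose_type_def bold_west_def bold_south_def)

lemma sampled_config_in_configs: "sampled_config c \<in> configs"
proof -
  have "bold_west (sampled c x y) \<longleftrightarrow> x > 1 \<and> bold_east (sampled c (x - 1) y)" for x y
    by (subst sampled.simps) auto
  moreover have "bold_south (sampled c x y) \<longleftrightarrow> y \<le> 1 \<or> bold_north (sampled c x (y - 1))" for x y
    by (subst sampled.simps) auto
  ultimately show ?thesis
    by (auto simp: configs_def sampled_config_def quadrant_def)
qed

lemma measurable_sampled:
  assumes "x \<ge> 1" "y \<ge> 1"
  shows "(\<lambda>c. sampled c x y) \<in> coin_space b1 b2 \<rightarrow>\<^sub>M count_space UNIV"
  using assms
proof (induction "x + y" arbitrary: x y rule: less_induct)
  case less
  let ?M = "coin_space b1 b2"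
  have coin: "(\<lambda>c. c (x, y)) \<in> ?M \<rightarrow>\<^sub>M count_space UNIV"
  proof -
    have "(\<lambda>c. c (x, y)) \<in> ?M \<rightarrow>\<^sub>M
        measure_pmf (pair_pmf (bernoulli_pmf b1) (bernoulli_pmf b2))"
      unfolding coin_space_def
      using less.prems by (intro measurable_component_singleton) (auto simp: quadrant_def)
    then show ?thesis by simp
  qed
  have w: "(\<lambda>c. if x \<le> 1 then False else bold_east (sampled c (x - 1) y))
      \<in> ?M \<rightarrow>\<^sub>M count_space UNIV"
  proof (cases "x \<le> 1")
    case False
    then have "(\<lambda>c. sampled c (x - 1) y) \<in> ?M \<rightarrow>\<^sub>M count_space UNIV"
      using less.prems by (intro less.hyps) auto
    then have "(\<lambda>c. bold_east (sampled c (x - 1) y)) \<in> ?M \<rightarrow>\<^sub>M count_space UNIV"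
      by (rule measurable_compose) simp
    with False show ?thesis by simp
  qed simp
  have s: "(\<lambda>c. if y \<le> 1 then True else bold_north (sampled c x (y - 1)))
      \<in> ?M \<rightarrow>\<^sub>M count_space UNIV"
  proof (cases "y \<le> 1")
    case False
    then have "(\<lambda>c. sampled c x (y - 1)) \<in> ?M \<rightarrow>\<^sub>M count_space UNIV"
      using less.prems by (intro less.hyps) auto
    then have "(\<lambda>c. bold_north (sampled c x (y - 1))) \<in> ?M \<rightarrow>\<^sub>M count_space UNIV"
      by (rule measurable_compose) simp
    with False show ?thesis by simp
  qed simp
  have "(\<lambda>c. choose_type
           (if x \<le> 1 then False else bold_east (sampled c (x - 1) y))
           (if y \<le> 1 then True else bold_north (sampled c x (y - 1)))
           (c (x, y))) \<in> ?M \<rightarrow>\<^sub>M count_space UNIV"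
    by (rule measurable_compose_countable[OF _ w],
        rule measurable_compose_countable[OF _ s],
        rule measurable_compose[OF coin]) simp
  then show ?case
    by (subst sampled.simps)
qed

lemma measurable_sampled_config:
  "sampled_config \<in> coin_space b1 b2 \<rightarrow>\<^sub>M config_space"
  unfolding config_space_def
proof (rule measurable_restrict_space2)
  show "sampled_config \<in> space (coin_space b1 b2) \<rightarrow> configs"
    by (simp add: sampled_config_in_configs)
  have "(\<lambda>c. restrict (\<lambda>v. sampled c (fst v) (snd v)) quadrant)
      \<in> coin_space b1 b2 \<rightarrow>\<^sub>M Pi\<^sub>M quadrant (\<lambda>_. count_space UNIV)"
    by (rule measurable_restrict, rule measurable_sampled) (auto simp: quadrant_def)
  then show "sampled_config \<in> coin_space b1 b2 \<rightarrow>\<^sub>M Pi\<^sub>M quadrant (\<lambda>_. count_space UNIV)"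
    by (simp add: sampled_config_def[abs_def] case_prod_unfold)
qed

lemma prob_space_six_vertex_measure: "prob_space (six_vertex_measure b1 b2)"
  unfolding six_vertex_measure_def
proof (rule prob_space.prob_space_distr[OF _ measurable_sampled_config])
  show "prob_space (coin_space b1 b2)"
    unfolding coin_space_def by (intro prob_space_PiM measure_pmf.prob_space_axioms)
qed

lemma space_six_vertex_measure: "space (six_vertex_measure b1 b2) = configs"
  by (auto simp: six_vertex_measure_def config_space_def space_restrict_space space_PiM
      configs_def)

lemma measurable_height_function:
  assumes "y > 0"
  shows "height_function x y \<in> config_space \<rightarrow>\<^sub>M count_space UNIV"
proof -
  let ?I = "{i::nat. 1 \<le> i \<and> real i \<le> x}"
  have fin: "finite ?I"
    by (rule finite_subset[of _ "{..nat \<lfloor>x\<rfloor>}"]) (auto simp: le_nat_floor)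
  have eval: "(\<lambda>\<omega>. \<omega> (i, nat \<lceil>y\<rceil>)) \<in> config_space \<rightarrow>\<^sub>M count_space UNIV" if "i \<in> ?I" for i
    unfolding config_space_def
    by (rule measurable_restrict_space1, rule measurable_component_singleton)
       (use that assms in \<open>auto simp: quadrant_def; linarith\<close>)
  have "(\<lambda>\<omega>. of_bool (bold_south (\<omega> (i, nat \<lceil>y\<rceil>))) :: nat)
      \<in> config_space \<rightarrow>\<^sub>M count_space UNIV" if "i \<in> ?I" for i
    by (rule measurable_compose[OF eval[OF that]]) simp
  then have "(\<lambda>\<omega>. \<Sum>i\<in>?I. of_bool (bold_south (\<omega> (i, nat \<lceil>y\<rceil>))) :: nat)
      \<in> config_space \<rightarrow>\<^sub>M count_space UNIV"
    by (rule measurable_sum_nat)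
  moreover have "height_function x y = (\<lambda>\<omega>. \<Sum>i\<in>?I. of_bool (bold_south (\<omega> (i, nat \<lceil>y\<rceil>))))"
    using fin by (auto simp: height_function_def fun_eq_iff sum_of_bool_eq Collect_conj_eq Int_assoc)
  ultimately show ?thesis by simp
qed


section \<open>The GUE Tracy-Widom distribution\<close>

definition airy :: "real \<Rightarrow> real" where
  "airy x = Lim at_top (\<lambda>T. integral {0..T} (\<lambda>t. cos (t ^ 3 / 3 + x * t))) / pi"

text \<open>On the diagonal the kernel is defined by continuity.\<close>

definition airy_kernel :: "real \<Rightarrow> real \<Rightarrow> real" where
  "airy_kernel x y =
     (let k = (\<lambda>u v. (airy u * deriv airy v - airy v * deriv airy u) / (u - v))
      in if x = y then Lim (at x) (\<lambda>v. k x v) else k x y)"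

text \<open>The Fredholm determinant of \<open>I - K\<close> on \<open>L\<^sub>2(M)\<close>, for the integral operator with kernel \<open>K\<close>,
  as the Fredholm series
  \<open>\<Sum>n. (-1)^n / n! \<integral> det [K(x\<^sub>i, x\<^sub>j)]\<^bsub>i,j<n\<^esub> dM(x\<^sub>0) \<dots> dM(x\<^bsub>n-1\<^esub>)\<close>;
  the term for \<open>n = 0\<close> is 1.\<close>

definition fredholm_det :: "real measure \<Rightarrow> (real \<Rightarrow> real \<Rightarrow> real) \<Rightarrow> real" where
  "fredholm_det M K =
     (\<Sum>n. (-1) ^ n / fact n *
        (\<integral>x. Determinant.det (mat n n (\<lambda>(i, j). K (x i) (x j))) \<partial>Pi\<^sub>M {..<n} (\<lambda>_. M)))"

definition F_GUE :: "real \<Rightarrow> real" where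
  "F_GUE s = fredholm_det (restrict_space lborel {s<..}) airy_kernel"


section \<open>Limit shape and fluctuation scale\<close>

definition limit_shape :: "real \<Rightarrow> real \<Rightarrow> real \<Rightarrow> real \<Rightarrow> real" where
  "limit_shape b1 b2 x y = (sqrt (y * (1 - b1)) - sqrt (x * (1 - b2)))\<^sup>2 / (b1 - b2)"

definition fluctuation_scale :: "real \<Rightarrow> real \<Rightarrow> real \<Rightarrow> real \<Rightarrow> real" where
  "fluctuation_scale b1 b2 x y =
     (let \<kappa> = (1 - b1) / (1 - b2)
      in \<kappa> powr (-1/3) * (x powr (1/6) * y powr (1/6) / (\<kappa> powr (-1/2) - \<kappa> powr (1/2)))
         * (1 - sqrt (\<kappa> * x / y)) powr (2/3) * (1 - sqrt (\<kappa> * y / x)) powr (2/3))"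

end

theory Submission
  imports Defs "HOL-Complex_Analysis.Complex_Analysis" "HOL-Real_Asymp.Real_Asymp"
begin

text \<open>The operators \<open>sv_row\<close> that add one row of vertices satisfy a Yang--Baxter equation, which
  makes \<open>E \<Prod>\<^bsub>j<H\<^esub> (1 + u t\<^sup>j)\<close>, with \<open>t = b\<^sub>2 / b\<^sub>1\<close> and \<open>H\<close> the height, a ratio of determinants. By
  the Cauchy--Binet formula the same ratio is an average over a Schur measure, so that the tails of
  \<open>H\<close> are sandwiched between hole probabilities of the Schur measure, up to shifts by \<open>m\<close> and errors
  \<open>t\<^sup>m\<close>. These hole probabilities are discrete Fredholm expansions of a kernel
  \<open>\<Sum>\<^sub>m b(i + m) b'(j + m)\<close>, where \<open>b\<close> and \<open>b'\<close> are Taylor coefficients of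
  \<open>(1 - \<alpha> + \<alpha> \<xi>)\<^sup>N / (1 - \<beta> + \<beta> \<xi>)\<^sup>M\<close> and of its mirror image. On the scale of the theorem the phase
  has a double critical point at \<open>\<xi> = 1\<close>; steepest descent along circles through a point just
  inside it turns both coefficients into Airy functions, and Hadamard's inequality dominates the
  expansion.\<close>

section \<open>Transfer operators of the six-vertex model\<close>

text \<open>The height is not a statistic of a determinantal process; only the averages of
  \<open>qfac t u\<close> agree with averages over a Schur measure. For u = t^(-n) the factor 1 + u
  t^j drops from large values to almost 1 near j = n, so the average divided by
  \<open>qfac t u (n + m)\<close> is a smoothed indicator of the event H \<ge> n. The width of the
  smoothing does not grow with L, hence it is invisible on the scale L^(1/3). The determinants need
  distinct parameters and as many rows as columns, whereas the model has N columns, M rows and every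
  parameter equal to r, with r^2 = \<kappa>. Zeros are added, the parameters are separated, and the
  limit is taken in inequalities between finite expressions. The dilation z = - r w \<xi> acts on
  the kernel as a conjugation, so w > 0 is free. Asking for a double critical point at \<xi> = 1
  means x \<alpha> (1 - \<alpha>) = y \<beta> (1 - \<beta>), that is (1 + \<kappa> w) / (1 + w) =
  sqrt (\<kappa> y / x); the condition on the slope x / y says exactly that this equation has a
  positive solution.\<close>

fun sv_row :: "real \<Rightarrow> real \<Rightarrow> bool \<Rightarrow> real list \<Rightarrow> bool list \<Rightarrow> (bool list \<Rightarrow> real) \<Rightarrow> real" where
  "sv_row t y h (x # xs) (v # vs) F =
     (if h = v then (1 - t * x * y) * sv_row t y h xs vs (\<lambda>ws. F (v # ws))
      else (if h then t else 1) * (1 - x * y) * sv_row t y h xs vs (\<lambda>ws. F (v # ws))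
         + (1 - t) * (if h then 1 else x * y) * sv_row t y v xs vs (\<lambda>ws. F (h # ws)))"
| "sv_row t y h [] vs F = F []"
| "sv_row t y h xs [] F = F []"

text \<open>In \<open>sv_row\<close> the continuation F receives the outgoing vertical edges, and
  the horizontal edge that leaves on the right is summed freely. Divided by 1 - t x y the weights
  are stochastic: a lone path from the south goes straight with probability (1 - x y) / (1 - t x y),
  one from the west with t times that.\<close>

fun sv_rows :: "real \<Rightarrow> real list \<Rightarrow> real list \<Rightarrow> bool list \<Rightarrow> (bool list \<Rightarrow> real) \<Rightarrow> real" where
  "sv_rows t [] xs vs F = F vs"
| "sv_rows t (y # ys) xs vs F = sv_row t y False xs vs (\<lambda>ws. sv_rows t ys xs ws F)"

lemma sv_row_linear:
  "sv_row t y h xs vs (\<lambda>ws. a * F ws + b * G ws) = a * sv_row t y h xs vs F + b * sv_row t y h xs vs G"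
proof (induction xs arbitrary: h vs F G)
  case (Cons x xs)
  show ?case
  proof (cases vs)
    case V: (Cons v us)
    show ?thesis unfolding V sv_row.simps Cons.IH by (simp add: algebra_simps)
  qed simp
qed simp

lemma sv_row_add: "sv_row t y h xs vs (\<lambda>ws. F ws + G ws) = sv_row t y h xs vs F + sv_row t y h xs vs G"
  using sv_row_linear[of t y h xs vs 1 F 1 G] by simp

lemma sv_row_cmult: "sv_row t y h xs vs (\<lambda>ws. a * F ws) = a * sv_row t y h xs vs F"
  using sv_row_linear[of t y h xs vs a F 0 F] by simp

lemma sv_row_cong:
  assumes "\<And>ws. length ws = min (length xs) (length vs) \<Longrightarrow> F ws = G ws"
  shows "sv_row t y h xs vs F = sv_row t y h xs vs G"
  using assms
proof (induction xs arbitrary: h vs F G)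
  case (Cons x xs)
  show ?case
  proof (cases vs)
    case V: (Cons v us)
    have *: "sv_row t y b xs us (\<lambda>ws. F (c # ws)) = sv_row t y b xs us (\<lambda>ws. G (c # ws))" for b c
      by (rule Cons.IH, rule Cons.prems) (simp add: V)
    show ?thesis by (simp add: V *)
  qed (use Cons.prems in auto)
qed auto

text \<open>The Yang--Baxter equation, summed over what leaves the two rows on the right.\<close>

lemma rows_exchange:
  fixes t y1 y2 :: real
  defines "A \<equiv> \<lambda>y z h k xs vs F. sv_row t y h xs vs (\<lambda>ws. sv_row t z k xs ws F)"
  shows "(y1 - t * y2) * A y1 y2 h k xs vs F =
     (if h = k then (y1 - t * y2) * A y2 y1 h k xs vs F
      else (1 - t) * (if h then y2 else y1) * A y2 y1 h k xs vs F
         + (if h then 1 else t) * (y1 - y2) * A y2 y1 k h xs vs F)"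
proof (induction xs arbitrary: vs F h k)
  case Nil
  show ?case by (cases h; cases k) (auto simp: A_def algebra_simps)
next
  case (Cons x xs)
  show ?case
  proof (cases vs)
    case Nil
    show ?thesis unfolding Nil by (cases h; cases k) (auto simp: A_def algebra_simps)
  next
    case V: (Cons v us)
    have E: "A y z h k (x # xs) (v # us) F =
      (if h = v then (1 - t * x * y) * 
          (if k = v then (1 - t * x * z) * A y z h k xs us (\<lambda>ws. F (v # ws))
           else (if k then t else 1) * (1 - x * z) * A y z h k xs us (\<lambda>ws. F (v # ws))
              + (1 - t) * (if k then 1 else x * z) * A y z h v xs us (\<lambda>ws. F (k # ws)))
       else (if h then t else 1) * (1 - x * y) *
          (if k = v then (1 - t * x * z) * A y z h k xs us (\<lambda>ws. F (v # ws))
           else (if k then t else 1) * (1 - x * z) * A y z h k xs us (\<lambda>ws. F (v # ws))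
              + (1 - t) * (if k then 1 else x * z) * A y z h v xs us (\<lambda>ws. F (k # ws)))
         + (1 - t) * (if h then 1 else x * y) * 
          (if k = h then (1 - t * x * z) * A y z v k xs us (\<lambda>ws. F (h # ws))
           else (if k then t else 1) * (1 - x * z) * A y z v k xs us (\<lambda>ws. F (h # ws))
              + (1 - t) * (if k then 1 else x * z) * A y z v h xs us (\<lambda>ws. F (k # ws))))" for y z h k
      unfolding A_def by (simp add: sv_row_add sv_row_cmult)
    \<comment> \<open>The scalar is pushed down to the innermost operators: the induction hypotheses
      speak only of A multiplied by y1 - t y2, a factor that may vanish and cannot be
      cancelled.\<close>
    have E': "c * A y z h k (x # xs) (v # us) F = (if h = v then (1 - t * x * y) * 
          (if k = v then (1 - t * x * z) * (c * A y z h k xs us (\<lambda>ws. F (v # ws)))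
           else (if k then t else 1) * (1 - x * z) * (c * A y z h k xs us (\<lambda>ws. F (v # ws)))
              + (1 - t) * (if k then 1 else x * z) * (c * A y z h v xs us (\<lambda>ws. F (k # ws))))
       else (if h then t else 1) * (1 - x * y) *
          (if k = v then (1 - t * x * z) * (c * A y z h k xs us (\<lambda>ws. F (v # ws)))
           else (if k then t else 1) * (1 - x * z) * (c * A y z h k xs us (\<lambda>ws. F (v # ws)))
              + (1 - t) * (if k then 1 else x * z) * (c * A y z h v xs us (\<lambda>ws. F (k # ws))))
         + (1 - t) * (if h then 1 else x * y) * 
          (if k = h then (1 - t * x * z) * (c * A y z v k xs us (\<lambda>ws. F (h # ws)))
           else (if k then t else 1) * (1 - x * z) * (c * A y z v k xs us (\<lambda>ws. F (h # ws)))
              + (1 - t) * (if k then 1 else x * z) * (c * A y z v h xs us (\<lambda>ws. F (k # ws)))))" for c y z h k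
      unfolding E by (cases "h = v"; cases "k = v"; cases "k = h") (simp_all add: algebra_simps)
    note IH = Cons.IH[of True True us] Cons.IH[of False False us] Cons.IH[of True False us] Cons.IH[of False True us]
    show ?thesis
      unfolding V E'
      apply (cases h; cases k; cases v)
      apply (simp_all only: simp_thms if_True if_False IH E)
      apply (simp_all add: algebra_simps)
      done
  qed
qed

lemma sv_row_swap:
  fixes t y1 y2 :: real
  assumes "0 < t" "t < 1" "0 < y1" "0 < y2"
  shows "sv_row t y1 False xs vs (\<lambda>ws. sv_row t y2 False xs ws F) =
    sv_row t y2 False xs vs (\<lambda>ws. sv_row t y1 False xs ws F)"
proof (cases "y1 = t * y2")
  case False
  then show ?thesis using rows_exchange[of y1 t y2 False xs vs False F] by simp
next
  \<comment> \<open>The exchange relation is void for y1 = t y2; with y1 and y2 interchanged its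
    factor is y2 (1 - t^2), which is nonzero.\<close>
  case True
  have "t * t < 1 * 1" using assms by (intro mult_strict_mono) auto
  then have "y2 - t * y1 \<noteq> 0" using assms unfolding True by (auto simp: algebra_simps)
  then show ?thesis using rows_exchange[of y2 t y1 False xs vs False F] by simp
qed

lemma sv_rows_front:
  assumes "0 < t" "t < 1" "0 < y" "\<forall>z\<in>set as. 0 < z"
  shows "sv_rows t (as @ y # bs) xs vs F = sv_rows t (y # as @ bs) xs vs F"
  using assms(4)
proof (induction as arbitrary: vs)
  case (Cons a as)
  have "sv_rows t ((a # as) @ y # bs) xs vs F = sv_row t a False xs vs (\<lambda>ws. sv_rows t (y # as @ bs) xs ws F)"
    using Cons by simp
  also have "\<dots> = sv_rows t (y # (a # as) @ bs) xs vs F"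
    using sv_row_swap[of t a y] assms Cons.prems by simp
  finally show ?case .
qed simp

text \<open>At x = 0 the turn of a path from the south has weight 0 and going straight has weight 1,
  so the first column keeps its path through all rows and sends nothing to the right.\<close>

lemma sv_rows_zero: "sv_rows t ys (0 # xs) (True # vs) F = sv_rows t ys xs vs (\<lambda>ws. F (True # ws))"
  by (induction ys arbitrary: vs) simp_all

lemma sv_rows_False:
  "sv_rows t ys (x # xs) (False # vs) F = (\<Prod>y\<leftarrow>ys. 1 - t * x * y) * sv_rows t ys xs vs (\<lambda>ws. F (False # ws))"
proof (induction ys arbitrary: vs)
  case (Cons y ys)
  show ?case
    by (simp add: sv_row_cmult Cons.IH)
qed simp

lemma sv_row_full:
  "sv_row t y True xs (replicate (length xs) True) F = (\<Prod>x\<leftarrow>xs. 1 - t * x * y) * F (replicate (length xs) True)"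
  by (induction xs arbitrary: F) (simp_all add: algebra_simps)

lemma sv_row_poly:
  fixes g :: "bool list \<Rightarrow> real \<Rightarrow> real"
  assumes "\<And>ws. \<exists>p. degree p \<le> d \<and> (\<forall>x. poly p x = g ws x)"
  shows "\<exists>p. degree p \<le> d \<and> (\<forall>x. poly p x = sv_row t y h xs vs (\<lambda>ws. g ws x))"
  using assms
proof (induction xs arbitrary: h vs g)
  case (Cons a xs)
  show ?case
  proof (cases vs)
    case V: (Cons v us)
    have "\<exists>p. degree p \<le> d \<and> (\<forall>x. poly p x = sv_row t y b xs us (\<lambda>ws. g (c # ws) x))" for b c
      by (rule Cons.IH) (rule Cons.prems)
    then obtain q where q: "\<And>b c. degree (q b c) \<le> d"
      "\<And>b c x. poly (q b c) x = sv_row t y b xs us (\<lambda>ws. g (c # ws) x)" by metis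
    show ?thesis unfolding V
      by (rule exI[of _ "if h = v then [:1 - t * a * y:] * q h v else
        [:(if h then t else 1) * (1 - a * y):] * q h v + [:(1 - t) * (if h then 1 else a * y):] * q v h"])
        (auto simp: q intro!: degree_add_le order_trans[OF degree_smult_le])
  qed (use Cons.prems in simp)
qed simp

text \<open>Only the leftmost vertex of each row involves x, and its weight is affine in x; the rest
  of the row adds no degree by \<open>sv_row_poly\<close>.\<close>

lemma sv_rows_poly:
  "\<exists>p. degree p \<le> length ys \<and> (\<forall>x. poly p x = sv_rows t ys (x # xs) (v # vs) F)"
proof (induction ys arbitrary: v vs)
  case (Cons y ys)
  define g where "g b = (\<lambda>ws x. sv_rows t ys (x # xs) (b # ws) F)" for b
  have "\<exists>p. degree p \<le> length ys \<and> (\<forall>x. poly p x = sv_row t y h xs vs (\<lambda>ws. g b ws x))" for h b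
    by (rule sv_row_poly) (use Cons.IH in \<open>simp add: g_def\<close>)
  then obtain q where q: "\<And>h b. degree (q h b) \<le> length ys"
    "\<And>h b x. poly (q h b) x = sv_row t y h xs vs (\<lambda>ws. g b ws x)" by metis
  have d: "degree ([:c, e:] * q h b) \<le> length (y # ys)" for c e h b
    by (rule order_trans[OF degree_mult_le]) (use q(1)[of h b] in \<open>simp add: degree_pCons_eq_if\<close>)
  show ?case
  proof (cases v)
    case False
    show ?thesis
      by (rule exI[of _ "[:1, - t * y:] * q False False"], intro conjI)
         (rule d, simp add: False q g_def algebra_simps)
  next
    case True
    show ?thesis
      by (rule exI[of _ "[:1, - y:] * q False True + [:0, (1 - t) * y:] * q True False"], intro conjI)
         (rule degree_add_le, rule d, rule d, simp add: True q g_def algebra_simps)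
  qed
next
  case Nil
  show ?case by (rule exI[of _ "[:F (v # vs):]"]) simp
qed

section \<open>Elementary operations on determinants\<close>

lemma det_first_row:
  fixes f :: "nat \<Rightarrow> nat \<Rightarrow> 'a :: comm_ring_1"
  assumes "\<And>k. 0 < k \<Longrightarrow> k \<le> n \<Longrightarrow> f 0 k = 0"
  shows "Determinant.det (mat (Suc n) (Suc n) (\<lambda>(i, j). f i j)) =
    f 0 0 * Determinant.det (mat n n (\<lambda>(i, j). f (Suc i) (Suc j)))"
proof -
  let ?A = "mat (Suc n) (Suc n) (\<lambda>(i, j). f i j)"
  have "Determinant.det ?A = (\<Sum>j<Suc n. ?A $$ (0, j) * cofactor ?A 0 j)"
    by (rule laplace_expansion_row) auto
  also have "\<dots> = ?A $$ (0, 0) * cofactor ?A 0 0"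
    by (subst sum.remove[of _ 0]) (auto intro!: sum.neutral simp: assms)
  also have "mat_delete ?A 0 0 = mat n n (\<lambda>(i, j). f (Suc i) (Suc j))"
    by (rule eq_matI) (auto simp: mat_delete_def)
  then have "cofactor ?A 0 0 = Determinant.det (mat n n (\<lambda>(i, j). f (Suc i) (Suc j)))"
    by (simp add: cofactor_def)
  finally show ?thesis by simp
qed

lemma det_scale:
  fixes f :: "nat \<Rightarrow> nat \<Rightarrow> 'a :: comm_ring_1"
  shows "Determinant.det (mat n n (\<lambda>(i, j). a i * f i j * b j)) =
    (\<Prod>i<n. a i) * (\<Prod>i<n. b i) * Determinant.det (mat n n (\<lambda>(i, j). f i j))"
proof -
  have "(\<Prod>i<n. b (p i)) = (\<Prod>i<n. b i)" if "p permutes {0..<n}" for p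
    using prod.permute[OF that, of b] by (simp add: lessThan_atLeast0 comp_def)
  then show ?thesis
    by (subst (1 2) det_def'[where n = n])
       (auto simp: sum_distrib_left prod.distrib lessThan_atLeast0 mult_ac intro!: sum.cong prod.cong)
qed

lemma det_scale_rows:
  fixes f :: "nat \<Rightarrow> nat \<Rightarrow> 'a :: comm_ring_1"
  shows "Determinant.det (mat n n (\<lambda>(i, j). a i * f i j)) = (\<Prod>i<n. a i) * Determinant.det (mat n n (\<lambda>(i, j). f i j))"
  using det_scale[of n a f "\<lambda>_. 1"] by simp

text \<open>Multiplication by a unipotent bidiagonal matrix. When c is the ratio of consecutive
  entries of a row, that row is cleared beyond its first entry.\<close>

lemma det_column_shift:
  fixes f :: "nat \<Rightarrow> nat \<Rightarrow> 'a :: idom"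
  shows "Determinant.det (mat n n (\<lambda>(i, j). f i j)) =
    Determinant.det (mat n n (\<lambda>(i, j). f i j - (if j = 0 then 0 else c * f i (j - 1))))"
proof -
  let ?A = "mat n n (\<lambda>(i, j). f i j)"
  let ?U = "mat n n (\<lambda>(i, j). if i = j then 1 else if Suc i = j then - c else 0)"
  have "?A * ?U = mat n n (\<lambda>(i, j). f i j - (if j = 0 then 0 else c * f i (j - 1)))"
  proof (rule eq_matI)
    fix i j assume "i < dim_row (mat n n (\<lambda>(i, j). f i j - (if j = 0 then 0 else c * f i (j - 1))))"
      "j < dim_col (mat n n (\<lambda>(i, j). f i j - (if j = 0 then 0 else c * f i (j - 1))))"
    then have ij: "i < n" "j < n" by auto
    have "(?A * ?U) $$ (i, j) = (\<Sum>k<n. f i k * (if k = j then 1 else if Suc k = j then - c else 0))"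
      using ij by (simp add: scalar_prod_def lessThan_atLeast0)
    also have "\<dots> = (\<Sum>k<n. (if k = j then f i k else 0) + (if k = j - 1 \<and> j > 0 then - c * f i k else 0))"
      by (intro sum.cong) auto
    also have "\<dots> = f i j - (if j = 0 then 0 else c * f i (j - 1))"
      using ij by (cases j) (auto simp: sum.distrib)
    finally show "(?A * ?U) $$ (i, j) = mat n n (\<lambda>(i, j). f i j - (if j = 0 then 0 else c * f i (j - 1))) $$ (i, j)"
      using ij by simp
  qed auto
  moreover have "Determinant.det ?U = 1"
    by (subst det_upper_triangular[where n = n]) (auto simp: diag_mat_def prod.list_conv_set_nth intro!: prod.neutral)
  moreover have "Determinant.det (?A * ?U) = Determinant.det ?A * Determinant.det ?U"
    by (rule det_mult[of _ n]) auto
  ultimately show ?thesis by simp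
qed

section \<open>A determinant for the average of the t-Pochhammer symbol of the height\<close>

definition psi :: "real list \<Rightarrow> real \<Rightarrow> real" where
  "psi ys z = (\<Prod>y\<leftarrow>ys. 1 - z * y)"

definition vdet :: "real list \<Rightarrow> real" where
  "vdet xs = Determinant.det (mat (length xs) (length xs) (\<lambda>(i, k). (xs ! i) ^ k))"

text \<open>Row i is the sum of x_i^k \<psi>(t x_i) and u (t x_i)^k \<psi>(x_i). Up to the
  Vandermonde determinant and denominators this is the generating function of Macdonald's difference
  operators at q = t, applied to the Cauchy product of the 1 / (1 - x_i y_j).\<close>

definition psidet :: "real \<Rightarrow> real \<Rightarrow> real list \<Rightarrow> real list \<Rightarrow> real" where
  "psidet t u ys xs = Determinant.det (mat (length xs) (length xs)
     (\<lambda>(i, k). (xs ! i) ^ k * (psi ys (t * xs ! i) + u * t ^ k * psi ys (xs ! i))))"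

text \<open>The t-Pochhammer symbol (-u; t)_n.\<close>

definition qfac :: "real \<Rightarrow> real \<Rightarrow> nat \<Rightarrow> real" where
  "qfac t u n = (\<Prod>j<n. 1 + u * t ^ j)"

definition part :: "real \<Rightarrow> real \<Rightarrow> real list \<Rightarrow> real list \<Rightarrow> real" where
  "part t u ys xs = sv_rows t ys xs (replicate (length xs) True) (\<lambda>ws. qfac t u (count_list ws True))"

lemma det_cong:
  assumes "\<And>i j. i < n \<Longrightarrow> j < n \<Longrightarrow> f i j = g i j"
  shows "Determinant.det (mat n n (\<lambda>(i, j). f i j)) = Determinant.det (mat n n (\<lambda>(i, j). g i j))"
  by (rule arg_cong[of _ _ Determinant.det], rule eq_matI) (auto simp: assms)

lemma qfac_Suc: "qfac t u (Suc n) = (1 + u) * qfac t (u * t) n"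
  unfolding qfac_def by (subst prod.lessThan_Suc_shift) (simp add: mult_ac)

lemma prod_list_nth: "(\<Prod>i<length xs. f (xs ! i)) = (\<Prod>x\<leftarrow>xs. f x :: real)"
  by (subst prod.list_conv_set_nth) (simp add: lessThan_atLeast0)

lemma vdet_zero: "vdet (0 # xs) = (\<Prod>x\<leftarrow>xs. x) * vdet xs"
proof -
  have "vdet (0 # xs) = Determinant.det (mat (length xs) (length xs) (\<lambda>(i, k). xs ! i * (xs ! i) ^ k))"
    unfolding vdet_def list.size by (simp only: add_Suc_right add_0_right, subst det_first_row) (auto intro!: det_cong)
  then show ?thesis by (simp add: det_scale_rows vdet_def prod_list_nth[of "\<lambda>x. x"])
qed

lemma psidet_zero: "psidet t u ys (0 # xs) = (1 + u) * (\<Prod>x\<leftarrow>xs. x) * psidet t (u * t) ys xs"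
proof -
  have "psi ys 0 = 1" unfolding psi_def by (induction ys) auto
  then have "psidet t u ys (0 # xs) = (1 + u) * Determinant.det (mat (length xs) (length xs)
     (\<lambda>(i, k). xs ! i * ((xs ! i) ^ k * (psi ys (t * xs ! i) + (u * t) * t ^ k * psi ys (xs ! i)))))"
    unfolding psidet_def list.size by (simp only: add_Suc_right add_0_right, subst det_first_row) (auto intro!: det_cong simp: algebra_simps power_0_left)
  then show ?thesis by (simp add: det_scale_rows psidet_def prod_list_nth[of "\<lambda>x. x"])
qed

lemma part_zero: "part t u ys (0 # xs) = (1 + u) * part t (u * t) ys xs"
proof -
  have "sv_rows t ys xs vs (\<lambda>ws. a * F ws) = a * sv_rows t ys xs vs F" for a vs F
    by (induction ys arbitrary: vs) (simp_all add: sv_row_cmult)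
  then show ?thesis by (simp add: part_def sv_rows_zero qfac_Suc)
qed

lemma vdet_reduce: "vdet (x # xs) = (\<Prod>z\<leftarrow>xs. z - x) * vdet xs"
proof -
  have "vdet (x # xs) = Determinant.det (mat (length xs) (length xs) (\<lambda>(i, k). (xs ! i - x) * (xs ! i) ^ k))"
    unfolding vdet_def list.size
    by (simp only: add_Suc_right add_0_right, subst det_column_shift[where c = x], subst det_first_row)
       (auto intro!: det_cong simp: power_eq_if algebra_simps)
  then show ?thesis by (simp add: det_scale_rows vdet_def prod_list_nth[of "\<lambda>z. z - x"])
qed

text \<open>At x = 1 / y the factor \<open>psi\<close> vanishes at x, so the first row is geometric
  with ratio x and a column shift isolates its first entry. The remaining minor factors because (1 -
  z y) (t z - x) = (1 - t z y) (z - x) when x y = 1.\<close>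

lemma psidet_reduce:
  assumes "x * y = 1"
  shows "psidet t u (y # ys) (x # xs) =
    (1 - t) * psi ys (t * x) * (\<Prod>z\<leftarrow>xs. (1 - t * z * y) * (z - x)) * psidet t u ys xs"
proof -
  have p2: "psi (y # ys) z = (1 - z * y) * psi ys z" for z by (simp add: psi_def)
  have p0: "psi (y # ys) x = 0" unfolding p2 assms by simp
  have p1: "psi (y # ys) (t * x) = (1 - t) * psi ys (t * x)" unfolding p2 mult.assoc assms by simp
  have e: "z ^ Suc k * (psi (y # ys) (t * z) + u * t ^ Suc k * psi (y # ys) z)
       - x * (z ^ k * (psi (y # ys) (t * z) + u * t ^ k * psi (y # ys) z)) =
      ((1 - t * z * y) * (z - x)) * (z ^ k * (psi ys (t * z) + u * t ^ k * psi ys z))" for z k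
  proof -
    have h: "x * (y * z) = z" unfolding mult.assoc[symmetric] assms by simp
    have "(1 - z * y) * (t * z - x) - (1 - t * z * y) * (z - x) = (t - 1) * (z - x * (y * z))"
      by (simp add: algebra_simps)
    then have c: "(1 - z * y) * (t * z - x) = (1 - t * z * y) * (z - x)" unfolding h by simp
    have "z ^ Suc k * (psi (y # ys) (t * z) + u * t ^ Suc k * psi (y # ys) z)
       - x * (z ^ k * (psi (y # ys) (t * z) + u * t ^ k * psi (y # ys) z)) =
       z ^ k * ((z - x) * (1 - t * z * y) * psi ys (t * z) + u * t ^ k * psi ys z * ((1 - z * y) * (t * z - x)))"
      unfolding p2 by (simp add: algebra_simps)
    then show ?thesis unfolding c by (simp add: algebra_simps)
  qed
  define f where "f i k = ((x # xs) ! i) ^ k * (psi (y # ys) (t * (x # xs) ! i) + u * t ^ k * psi (y # ys) ((x # xs) ! i))" for i k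
  have z: "f 0 (Suc k) = x * f 0 k" for k by (simp add: f_def p0)
  have "psidet t u (y # ys) (x # xs) = Determinant.det (mat (Suc (length xs)) (Suc (length xs)) (\<lambda>(i, j). f i j))"
    by (simp add: psidet_def f_def)
  also have "\<dots> = Determinant.det (mat (Suc (length xs)) (Suc (length xs)) (\<lambda>(i, j). f i j - (if j = 0 then 0 else x * f i (j - 1))))"
    by (rule det_column_shift)
  also have "\<dots> = f 0 0 * Determinant.det (mat (length xs) (length xs) (\<lambda>(i, j). f (Suc i) (Suc j) - x * f (Suc i) j))"
    by (subst det_first_row) (auto simp: gr0_conv_Suc z)
  finally have 1: "psidet t u (y # ys) (x # xs) =
    f 0 0 * Determinant.det (mat (length xs) (length xs) (\<lambda>(i, j). f (Suc i) (Suc j) - x * f (Suc i) j))" .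
  have 2: "f 0 0 = (1 - t) * psi ys (t * x)" by (simp add: f_def p0 p1)
  have "Determinant.det (mat (length xs) (length xs) (\<lambda>(i, j). f (Suc i) (Suc j) - x * f (Suc i) j)) =
     Determinant.det (mat (length xs) (length xs)
     (\<lambda>(i, k). ((1 - t * xs ! i * y) * (xs ! i - x)) * ((xs ! i) ^ k * (psi ys (t * xs ! i) + u * t ^ k * psi ys (xs ! i)))))"
    by (rule det_cong) (simp only: f_def nth_Cons_Suc e)
  then have 3: "Determinant.det (mat (length xs) (length xs) (\<lambda>(i, j). f (Suc i) (Suc j) - x * f (Suc i) j)) =
     (\<Prod>z\<leftarrow>xs. (1 - t * z * y) * (z - x)) * psidet t u ys xs"
    using det_scale_rows[of "length xs" "\<lambda>i. (1 - t * xs ! i * y) * (xs ! i - x)"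
        "\<lambda>i k. (xs ! i) ^ k * (psi ys (t * xs ! i) + u * t ^ k * psi ys (xs ! i))"]
    unfolding psidet_def prod_list_nth[of "\<lambda>z. (1 - t * z * y) * (z - x)"] by (rule trans)
  show ?thesis unfolding 1 2 3 by (simp only: mult.assoc)
qed

text \<open>For x y = 1 the straight weight 1 - x y vanishes: the path of the first column turns in
  the first row, runs through full columns, and leaves the first column empty for all later
  rows.\<close>

lemma part_reduce:
  assumes "x * y = 1"
  shows "part t u (y # ys) (x # xs) = (1 - t) * psi ys (t * x) * (\<Prod>z\<leftarrow>xs. 1 - t * z * y) * part t u ys xs"
proof -
  define R where "R = replicate (length xs) True"
  define Q where "Q ws = qfac t u (count_list ws True)" for ws
  define G where "G ws = sv_rows t ys (x # xs) ws Q" for ws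
  have "part t u (y # ys) (x # xs) = sv_row t y False (x # xs) (True # R) G"
    unfolding part_def R_def G_def Q_def by simp
  also have "\<dots> = (1 - t) * sv_row t y True xs R (\<lambda>ws. G (False # ws))"
    unfolding sv_row.simps assms by simp
  also have "\<dots> = (1 - t) * ((\<Prod>z\<leftarrow>xs. 1 - t * z * y) * G (False # R))"
    unfolding R_def sv_row_full ..
  also have "G (False # R) = psi ys (t * x) * sv_rows t ys xs R (\<lambda>ws. Q (False # ws))"
    unfolding G_def sv_rows_False psi_def by simp
  also have "(\<lambda>ws. Q (False # ws)) = Q" by (simp add: Q_def fun_eq_iff)
  also have "sv_rows t ys xs R Q = part t u ys xs"
    unfolding part_def R_def Q_def ..
  finally show ?thesis by (simp only: mult_ac)
qed

lemma psi_front: "psi (as @ y # bs) = psi (y # as @ bs)"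
  by (rule ext) (simp add: psi_def)

lemma psi_poly: "\<exists>p. degree p \<le> length ys \<and> (\<forall>x. poly p x = psi ys (c * x))"
proof (induction ys)
  case (Cons y ys)
  then obtain p where p: "degree p \<le> length ys" "\<And>x. poly p x = psi ys (c * x)" by blast
  have "degree ([:1, - c * y:] * p) \<le> length (y # ys)"
    by (rule order_trans[OF degree_mult_le]) (use p(1) in \<open>simp add: degree_pCons_eq_if\<close>)
  then show ?case by (intro exI[of _ "[:1, - c * y:] * p"]) (simp add: p psi_def algebra_simps)
qed (auto intro!: exI[of _ "1"] simp: psi_def)

lemma det_row_poly:
  fixes g :: "nat \<Rightarrow> nat \<Rightarrow> real"
  assumes "\<And>k. k < Suc n \<Longrightarrow> degree (p k) \<le> d"
  shows "\<exists>q. degree q \<le> d \<and>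
    (\<forall>x. poly q x = Determinant.det (mat (Suc n) (Suc n) (\<lambda>(i, k). if i = 0 then poly (p k) x else g i k)))"
proof -
  define A where "A x = mat (Suc n) (Suc n) (\<lambda>(i, k). if i = 0 then poly (p k) x else g i k)" for x
  have c: "cofactor (A x) 0 k = cofactor (A 0) 0 k" if "k < Suc n" for x k
  proof -
    have "mat_delete (A x) 0 k = mat_delete (A 0) 0 k"
      by (rule eq_matI) (auto simp: mat_delete_def A_def)
    then show ?thesis by (simp add: cofactor_def)
  qed
  have "Determinant.det (A x) = (\<Sum>k<Suc n. poly (p k) x * cofactor (A 0) 0 k)" for x
  proof -
    have "Determinant.det (A x) = (\<Sum>k<Suc n. A x $$ (0, k) * cofactor (A x) 0 k)"
      by (rule laplace_expansion_row) (auto simp: A_def)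
    also have "\<dots> = (\<Sum>k<Suc n. poly (p k) x * cofactor (A 0) 0 k)"
      by (rule sum.cong[OF refl], subst c) (auto simp: A_def)
    finally show ?thesis .
  qed
  then show ?thesis unfolding A_def[symmetric]
    by (intro exI[of _ "\<Sum>k<Suc n. p k * [:cofactor (A 0) 0 k:]"])
       (auto simp: poly_sum mult.commute simp del: sum.lessThan_Suc intro!: degree_sum_le order_trans[OF degree_mult_le] assms)
qed

text \<open>Both sides are polynomials in the first column parameter \<open>x\<close>, of degree less than the number
  of points \<open>0\<close>, \<open>1 / y\<close> and \<open>x = x\<^sub>j\<close> at which they agree.\<close>

theorem part_eq_psidet:
  assumes "0 < t" "t < 1" "distinct xs" "\<forall>x\<in>set xs. x \<noteq> 0" "distinct ys" "\<forall>y\<in>set ys. 0 < y"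
    "\<forall>x\<in>set xs. \<forall>y\<in>set ys. x * y \<noteq> 1"
  shows "part t u ys xs * vdet xs = psidet t u ys xs"
  using assms(3-)
\<comment> \<open>Evaluation at x = 0 passes to u t, evaluation at x = 1 / y removes the row y;
  hence both are generalised.\<close>
proof (induction xs arbitrary: u ys)
  case Nil
  have "sv_rows t ys [] [] F = F []" for F by (induction ys) auto
  then show ?case by (simp add: part_def psidet_def vdet_def qfac_def)
next
  case (Cons x0 xs)
  let ?n = "length xs" and ?m = "length ys"
  obtain pp where pp: "degree pp \<le> ?m" "\<And>x. poly pp x = part t u ys (x # xs)"
    using sv_rows_poly[of ys t xs True "replicate ?n True" "\<lambda>ws. qfac t u (count_list ws True)"]
    unfolding part_def by auto
  obtain pv where pv: "degree pv \<le> ?n" "\<And>x. poly pv x = vdet (x # xs)"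
  proof -
    have "\<exists>q. degree q \<le> ?n \<and> (\<forall>x. poly q x =
        Determinant.det (mat (Suc ?n) (Suc ?n) (\<lambda>(i, k). if i = 0 then poly (monom 1 k) x else (xs ! (i - 1)) ^ k)))"
      by (rule det_row_poly) (auto intro: order_trans[OF degree_monom_le])
    moreover have "Determinant.det (mat (Suc ?n) (Suc ?n) (\<lambda>(i, k). if i = 0 then poly (monom 1 k) x else (xs ! (i - 1)) ^ k)) = vdet (x # xs)" for x
      unfolding vdet_def list.size add_Suc_right add_0_right by (rule det_cong) (auto simp: poly_monom nth_Cons')
    ultimately show ?thesis using that by auto
  qed
  obtain pd where pd: "degree pd \<le> ?n + ?m" "\<And>x. poly pd x = psidet t u ys (x # xs)"
  proof -
    obtain q1 where q1: "degree q1 \<le> ?m" "\<And>x. poly q1 x = psi ys (t * x)" using psi_poly[of ys t] by blast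
    obtain q2 where q2: "degree q2 \<le> ?m" "\<And>x. poly q2 x = psi ys x" using psi_poly[of ys 1] by auto
    define p where "p k = monom 1 k * (q1 + [:u * t ^ k:] * q2)" for k
    have "degree (p k) \<le> ?n + ?m" if "k < Suc ?n" for k
    proof -
      have "degree (q1 + [:u * t ^ k:] * q2) \<le> ?m"
        by (intro degree_add_le q1 order_trans[OF degree_mult_le]) (use q2 in simp)
      then show ?thesis unfolding p_def using that
        by (intro order_trans[OF degree_mult_le] add_mono order_trans[OF degree_monom_le]) auto
    qed
    then have "\<exists>q. degree q \<le> ?n + ?m \<and> (\<forall>x. poly q x =
        Determinant.det (mat (Suc ?n) (Suc ?n) (\<lambda>(i, k). if i = 0 then poly (p k) x else
          (xs ! (i - 1)) ^ k * (psi ys (t * xs ! (i - 1)) + u * t ^ k * psi ys (xs ! (i - 1))))))"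
      by (rule det_row_poly)
    moreover have "Determinant.det (mat (Suc ?n) (Suc ?n) (\<lambda>(i, k). if i = 0 then poly (p k) x else
          (xs ! (i - 1)) ^ k * (psi ys (t * xs ! (i - 1)) + u * t ^ k * psi ys (xs ! (i - 1))))) = psidet t u ys (x # xs)" for x
      unfolding psidet_def list.size add_Suc_right add_0_right
      by (rule det_cong) (auto simp: poly_monom nth_Cons' p_def q1 q2)
    ultimately show ?thesis using that by auto
  qed
  define P where "P = pp * pv - pd"
  have P: "poly P x = part t u ys (x # xs) * vdet (x # xs) - psidet t u ys (x # xs)" for x
    by (simp add: P_def pp pv pd)
  have dP: "degree P \<le> ?n + ?m" unfolding P_def
    by (intro degree_diff_le pd order_trans[OF degree_mult_le]) (use pp pv in simp)
  define Z where "Z = insert 0 (set xs \<union> (\<lambda>y. 1 / y) ` set ys)"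
  have cZ: "card Z = ?n + ?m + 1"
  proof -
    have "1 / y \<notin> set xs" if "y \<in> set ys" for y
    proof
      assume "1 / y \<in> set xs"
      moreover have "\<forall>x\<in>set xs. \<forall>y\<in>set ys. x * y \<noteq> 1" using Cons.prems(5) by simp
      ultimately have "1 / y * y \<noteq> 1" using that by blast
      moreover have "0 < y" using that Cons.prems by auto
      ultimately show False by simp
    qed
    then have "set xs \<inter> (\<lambda>y. 1 / y) ` set ys = {}" by auto
    moreover have "card ((\<lambda>y. 1 / y) ` set ys) = ?m"
      using Cons.prems by (subst card_image) (auto simp: inj_on_def distinct_card)
    moreover have "card (set xs) = ?n" using Cons.prems by (simp add: distinct_card)
    moreover have "0 \<notin> set xs \<union> (\<lambda>y. 1 / y) ` set ys" using Cons.prems by auto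
    ultimately show ?thesis unfolding Z_def by (simp add: card_Un_disjoint)
  qed
  have root: "poly P x = 0" if xZ: "x \<in> Z" for x
  proof -
    consider "x = 0" | "x \<in> set xs" | y where "y \<in> set ys" "x = 1 / y" using xZ unfolding Z_def by blast
    then show ?thesis
    proof cases
      case 1
      have e: "part t (u * t) ys xs * vdet xs = psidet t (u * t) ys xs"
        by (rule Cons.IH) (use Cons.prems in auto)
      show ?thesis unfolding P 1 part_zero vdet_zero psidet_zero e[symmetric] by (simp only: mult_ac diff_self)
    next
      case 2
      then obtain i where i: "i < ?n" "x = xs ! i" by (auto simp: in_set_conv_nth)
      have "vdet (x # xs) = 0" unfolding vdet_def
        by (rule det_identical_rows[where n = "Suc ?n" and i = 0 and j = "Suc i"]) (use i in \<open>auto intro!: eq_vecI\<close>)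
      moreover have "psidet t u ys (x # xs) = 0" unfolding psidet_def
        by (rule det_identical_rows[where n = "Suc ?n" and i = 0 and j = "Suc i"]) (use i in \<open>auto intro!: eq_vecI\<close>)
      ultimately show ?thesis by (simp add: P)
    next
      case 3
      then obtain as bs where ys: "ys = as @ y # bs" by (meson split_list)
      have y0: "0 < y" using 3 Cons.prems by auto
      have xy: "x * y = 1" using 3 y0 by simp
      \<comment> \<open>The Yang--Baxter symmetry moves the row with parameter y to the front, where
        the collapse at x y = 1 becomes visible.\<close>
      have e1: "part t u ys (x # xs) = part t u (y # as @ bs) (x # xs)"
        unfolding part_def ys by (rule sv_rows_front) (use assms y0 Cons.prems ys in auto)
      have e2: "psidet t u ys (x # xs) = psidet t u (y # as @ bs) (x # xs)"
        unfolding psidet_def ys psi_front ..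
      have IH: "part t u (as @ bs) xs * vdet xs = psidet t u (as @ bs) xs"
        by (rule Cons.IH) (use Cons.prems in \<open>auto simp: ys\<close>)
      have pl: "(\<Prod>z\<leftarrow>xs. f z * g z) = (\<Prod>z\<leftarrow>xs. f z) * (\<Prod>z\<leftarrow>xs. g z :: real)" for f g
        by (induction xs) (auto simp: mult_ac)
      show ?thesis unfolding P e1 e2 part_reduce[OF xy] psidet_reduce[OF xy] vdet_reduce pl IH[symmetric]
        by (simp add: mult_ac)
    qed
  qed
  have "P = 0"
  proof (rule ccontr)
    assume "P \<noteq> 0"
    then have "card {x. poly P x = 0} \<le> degree P" "finite {x. poly P x = 0}"
      using card_poly_roots_bound poly_roots_finite by auto
    moreover have "card Z \<le> card {x. poly P x = 0}"
      by (rule card_mono) (use calculation root in auto)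
    ultimately show False using cZ dP by simp
  qed
  then show ?case using P[of x0] by simp
qed

section \<open>Determinantal identities\<close>

text \<open>Sylvester's identity, from two triangular factorisations of the block matrix with blocks
  1, A, B, 1.\<close>

lemma det_one_minus_mult_commute:
  fixes A B :: "'a :: idom mat"
  assumes A: "A \<in> carrier_mat m n" and B: "B \<in> carrier_mat n m"
  shows "Determinant.det (1\<^sub>m m - A * B) = Determinant.det (1\<^sub>m n - B * A)"
proof -
  let ?L = "four_block_mat (1\<^sub>m m) (0\<^sub>m m n) B (1\<^sub>m n)"
  let ?U1 = "four_block_mat (1\<^sub>m m) A (0\<^sub>m n m) (1\<^sub>m n - B * A)"
  let ?U2 = "four_block_mat (1\<^sub>m m - A * B) A (0\<^sub>m n m) (1\<^sub>m n)"
  have c: "?L \<in> carrier_mat (m + n) (m + n)" "?U1 \<in> carrier_mat (m + n) (m + n)" "?U2 \<in> carrier_mat (m + n) (m + n)"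
    using A B by auto
  have BA: "B * A \<in> carrier_mat n n" and AB: "A * B \<in> carrier_mat m m" using A B by auto
  have m: "X + (1\<^sub>m k - X) = 1\<^sub>m k" "1\<^sub>m k - X + X = 1\<^sub>m k" if "X \<in> carrier_mat k k" for X :: "'a mat" and k
    by (rule eq_matI; use that in auto)+
  note m1 = m(1)[OF BA] and m2 = m(2)[OF AB]
  have "?L * ?U1 = four_block_mat (1\<^sub>m m) A B (1\<^sub>m n)"
    using A B BA m1 by (subst mult_four_block_mat[of _ m m _ n _ n _ _ m _ n]) auto
  also have "\<dots> = ?U2 * ?L"
    using A B AB m2 by (subst mult_four_block_mat[of _ m m _ n _ n _ _ m _ n]) auto
  finally have "Determinant.det (?L * ?U1) = Determinant.det (?U2 * ?L)" by simp
  moreover have "Determinant.det (?L * ?U1) = Determinant.det ?L * Determinant.det ?U1"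
    "Determinant.det (?U2 * ?L) = Determinant.det ?U2 * Determinant.det ?L"
    by (rule det_mult[OF c(1,2)], rule det_mult[OF c(3,1)])
  moreover have "Determinant.det ?L = 1"
    using det_four_block_mat_upper_right_zero[OF one_carrier_mat refl B one_carrier_mat] by simp
  moreover have "Determinant.det ?U1 = Determinant.det (1\<^sub>m n - B * A)"
    using det_four_block_mat_lower_left_zero[OF one_carrier_mat A refl minus_carrier_mat[OF BA, of "1\<^sub>m n"]] by simp
  moreover have "Determinant.det ?U2 = Determinant.det (1\<^sub>m m - A * B)"
    using det_four_block_mat_lower_left_zero[OF minus_carrier_mat[OF AB, of "1\<^sub>m m"] A refl one_carrier_mat] by simp
  ultimately show ?thesis by simp
qed

section \<open>Antisymmetrisation and the Cauchy--Binet formula\<close>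

lemma det_fun:
  fixes f :: "nat \<Rightarrow> nat \<Rightarrow> 'a :: comm_ring_1"
  shows "Determinant.det (mat n n (\<lambda>(i, j). f i j)) =
    (\<Sum>p | p permutes {..<n}. signof p * (\<Prod>i<n. f i (p i)))"
  by (subst det_def'[of _ n]) (auto simp: lessThan_atLeast0 intro!: sum.cong prod.cong)

lemma det_fun_transpose:
  fixes f :: "nat \<Rightarrow> nat \<Rightarrow> 'a :: comm_ring_1"
  shows "Determinant.det (mat n n (\<lambda>(i, j). f j i)) = Determinant.det (mat n n (\<lambda>(i, j). f i j))"
proof -
  have "mat n n (\<lambda>(i, j). f j i) = transpose_mat (mat n n (\<lambda>(i, j). f i j))"
    by (rule eq_matI) auto
  then show ?thesis by (simp add: det_transpose[of _ n])
qed

lemma det_permute_fun_rows: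
  fixes f :: "nat \<Rightarrow> nat \<Rightarrow> 'a :: comm_ring_1"
  assumes "p permutes {..<n}"
  shows "Determinant.det (mat n n (\<lambda>(i, j). f (p i) j)) = signof p * Determinant.det (mat n n (\<lambda>(i, j). f i j))"
proof -
  have "mat n n (\<lambda>(i, j). f (p i) j) = mat n n (\<lambda>(i, j). mat n n (\<lambda>(i, j). f i j) $$ (p i, j))"
    by (rule eq_matI) (use assms permutes_in_image[OF assms] in auto)
  then show ?thesis
    using det_permute_rows[of "mat n n (\<lambda>(i, j). f i j)" n p] assms by (simp add: lessThan_atLeast0)
qed

lemma bij_betw_comp_perm:
  assumes "p permutes {..<n}"
  shows "bij_betw (\<lambda>f. f \<circ> p) ({..<n} \<rightarrow>\<^sub>E A) ({..<n :: nat} \<rightarrow>\<^sub>E A)"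
proof -
  have *: "f \<circ> q \<in> {..<n} \<rightarrow>\<^sub>E A" if "f \<in> {..<n} \<rightarrow>\<^sub>E A" "q permutes {..<n}" for f and q :: "nat \<Rightarrow> nat"
    using that permutes_in_image[OF that(2)] permutes_not_in[OF that(2)]
    by (auto simp: PiE_def Pi_def extensional_def)
  show ?thesis
    by (rule bij_betwI[where g = "\<lambda>f. f \<circ> inv_into UNIV p"])
       (auto intro!: * assms permutes_inv simp: comp_assoc permutes_inv_o[OF assms])
qed

text \<open>Summing over all tuples instead of increasing ones produces the factor n!.
  Multilinearity gives the alternant in y; averaging over permutations of the tuple, under which
  that alternant changes by the sign, assembles the alternant in x.\<close>

lemma cauchy_binet_tuples:
  fixes x y :: "nat \<Rightarrow> real" and g :: "nat \<Rightarrow> real"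
  shows "fact n * Determinant.det (mat n n (\<lambda>(i, j). \<Sum>k<r. g k * x i ^ k * y j ^ k)) =
    (\<Sum>f\<in>{..<n} \<rightarrow>\<^sub>E {..<r}. Determinant.det (mat n n (\<lambda>(i, j). x i ^ f j)) *
        Determinant.det (mat n n (\<lambda>(i, j). y i ^ f j)) * (\<Prod>i<n. g (f i)))"
proof -
  let ?F = "{..<n} \<rightarrow>\<^sub>E {..<r}"
  define dy where "dy f = Determinant.det (mat n n (\<lambda>(i, j). y j ^ f i))" for f :: "nat \<Rightarrow> nat"
  define A where "A f = (\<Prod>i<n. g (f i)) * (\<Prod>i<n. x i ^ f i) * dy f" for f
  have dy: "dy f = Determinant.det (mat n n (\<lambda>(i, j). y i ^ f j))" for f
    unfolding dy_def by (rule det_fun_transpose)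
  have "Determinant.det (mat n n (\<lambda>(i, j). \<Sum>k<r. g k * x i ^ k * y j ^ k)) =
    (\<Sum>p | p permutes {..<n}. signof p * (\<Sum>f\<in>?F. \<Prod>i<n. g (f i) * x i ^ f i * y (p i) ^ f i))"
    unfolding det_fun by (subst prod_sum_PiE) auto
  also have "\<dots> = (\<Sum>f\<in>?F. \<Sum>p | p permutes {..<n}. signof p * (\<Prod>i<n. g (f i) * x i ^ f i * y (p i) ^ f i))"
    unfolding sum_distrib_left by (rule sum.swap)
  also have "\<dots> = (\<Sum>f\<in>?F. A f)"
    unfolding A_def dy_def det_fun
    by (simp add: sum_distrib_left prod.distrib mult_ac)
  finally have D: "Determinant.det (mat n n (\<lambda>(i, j). \<Sum>k<r. g k * x i ^ k * y j ^ k)) = (\<Sum>f\<in>?F. A f)" .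
  have "fact n * (\<Sum>f\<in>?F. A f) = (\<Sum>p | p permutes {..<n}. \<Sum>f\<in>?F. A f)"
    by (simp add: card_permutations)
  also have "\<dots> = (\<Sum>p | p permutes {..<n}. \<Sum>f\<in>?F. A (f \<circ> p))"
  proof (rule sum.cong[OF refl])
    fix p assume "p \<in> {p. p permutes {..<n}}"
    then show "(\<Sum>f\<in>?F. A f) = (\<Sum>f\<in>?F. A (f \<circ> p))"
      using sum.reindex_bij_betw[OF bij_betw_comp_perm[of p n], of A] by simp
  qed
  also have "\<dots> = (\<Sum>p | p permutes {..<n}. \<Sum>f\<in>?F. (\<Prod>i<n. g (f i)) * dy f * (signof p * (\<Prod>i<n. x i ^ f (p i))))"
  proof (intro sum.cong refl)
    fix p f assume p: "p \<in> {p. p permutes {..<n}}"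
    have "dy (f \<circ> p) = signof p * dy f"
      unfolding dy_def using det_permute_fun_rows[of p n "\<lambda>i j. y j ^ f i"] p by simp
    moreover have "(\<Prod>i<n. g (f (p i))) = (\<Prod>i<n. g (f i))"
      using prod.permute[of p "{..<n}" "\<lambda>i. g (f i)"] p by (simp add: comp_def)
    ultimately show "A (f \<circ> p) = (\<Prod>i<n. g (f i)) * dy f * (signof p * (\<Prod>i<n. x i ^ f (p i)))"
      by (simp add: A_def)
  qed
  also have "\<dots> = (\<Sum>f\<in>?F. (\<Prod>i<n. g (f i)) * dy f * Determinant.det (mat n n (\<lambda>(i, j). x i ^ f j)))"
    unfolding det_fun sum_distrib_left by (rule sum.swap)
  finally show ?thesis unfolding D by (simp add: dy mult_ac)
qed

section \<open>Positivity of generalized Vandermonde determinants\<close>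

lemma Rolle_finite_set:
  fixes h h' :: "real \<Rightarrow> real"
  assumes "\<And>z. (h has_real_derivative h' z) (at z)"
  shows "finite S \<Longrightarrow> card S = Suc n \<Longrightarrow> (\<forall>z\<in>S. 0 < z \<and> h z = 0) \<Longrightarrow>
    \<exists>S'. finite S' \<and> card S' = n \<and> (\<forall>z\<in>S'. 0 < z \<and> z < Max S \<and> h' z = 0)"
proof (induction n arbitrary: S)
  case 0
  then show ?case by (intro exI[of _ "{}"]) auto
next
  case (Suc n)
  define b where "b = Max S"
  define S0 where "S0 = S - {b}"
  have bS: "b \<in> S" unfolding b_def using Suc.prems by (intro Max_in) auto
  have c0: "finite S0" "card S0 = Suc n" "\<forall>z\<in>S0. 0 < z \<and> h z = 0"
    using Suc.prems bS by (auto simp: S0_def)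
  define a where "a = Max S0"
  have aS: "a \<in> S0" unfolding a_def using c0 by (intro Max_in) auto
  have ab: "a < b" using aS Suc.prems Max_ge[of S a] by (auto simp: S0_def b_def[symmetric] order.strict_iff_order)
  obtain S' where S': "finite S'" "card S' = n" "\<forall>z\<in>S'. 0 < z \<and> z < a \<and> h' z = 0"
    using Suc.IH[OF c0] unfolding a_def by blast
  have "\<exists>z>a. z < b \<and> (h has_real_derivative 0) (at z)"
  proof (rule Rolle[OF ab, of h])
    show "h a = h b" using aS bS Suc.prems by (auto simp: S0_def)
    show "continuous_on {a..b} h" by (intro DERIV_atLeastAtMost_imp_continuous_on) (use assms in blast)
    show "h differentiable (at z)" if "a < z" "z < b" for z
      using assms[of z] real_differentiable_def by blast
  qed
  then obtain z where z: "a < z" "z < b" "h' z = 0" using assms DERIV_unique by blast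
  show ?case
  proof (intro exI[of _ "insert z S'"] conjI)
    have "z \<notin> S'" using S' z by auto
    then show "card (insert z S') = Suc n" using S' by simp
    have "0 < a" using aS Suc.prems by (auto simp: S0_def)
    then show "\<forall>w\<in>insert z S'. 0 < w \<and> w < Max S \<and> h' w = 0"
      using S' z ab unfolding b_def[symmetric] by auto
  qed (use S' in simp)
qed

text \<open>A weak form of Descartes' rule: dividing by the lowest monomial and differentiating
  removes one monomial and, by Rolle, costs one positive zero.\<close>

lemma sparse_polynomial_zero:
  fixes c :: "nat \<Rightarrow> real"
  assumes "finite A" "finite S" "card A \<le> card S" "\<forall>z\<in>S. 0 < z \<and> (\<Sum>k\<in>A. c k * z ^ k) = 0"
  shows "\<forall>k\<in>A. c k = 0"
  using assms
proof (induction "card A" arbitrary: A S c)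
  case 0
  then show ?case by auto
next
  case (Suc n)
  then have ne: "A \<noteq> {}" by auto
  define m where "m = Min A"
  have mA: "m \<in> A" "\<And>k. k \<in> A \<Longrightarrow> m \<le> k" using ne Suc.prems by (auto simp: m_def)
  define h where "h z = (\<Sum>k\<in>A. c k * z ^ (k - m))" for z :: real
  define h' where "h' z = (\<Sum>k\<in>A. c k * (real (k - m) * z ^ (k - m - 1)))" for z :: real
  have hd: "(h has_real_derivative h' z) (at z)" for z
    unfolding h_def h'_def by (auto intro!: derivative_eq_intros DERIV_sum)
  have hz: "z ^ m * h z = (\<Sum>k\<in>A. c k * z ^ k)" for z
    unfolding h_def sum_distrib_left
    by (intro sum.cong refl) (use mA in \<open>simp add: power_add[symmetric] algebra_simps\<close>)
  obtain S1 where S1: "S1 \<subseteq> S" "card S1 = Suc n" using Suc by (metis obtain_subset_with_card_n)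
  have fS1: "finite S1" using S1 Suc.prems finite_subset by blast
  have "\<forall>z\<in>S1. 0 < z \<and> h z = 0"
  proof
    fix z assume "z \<in> S1"
    then have "0 < z" "z ^ m * h z = 0" using Suc.prems S1 by (auto simp: hz)
    then show "0 < z \<and> h z = 0" by simp
  qed
  then obtain S' where S': "finite S'" "card S' = n" "\<forall>z\<in>S'. 0 < z \<and> h' z = 0"
    using Rolle_finite_set[OF hd fS1 S1(2)] by blast
  let ?s = "\<lambda>k. k - m - 1"
  let ?A = "?s ` (A - {m})"
  have inj: "inj_on ?s (A - {m})"
  proof (rule inj_onI)
    fix a b assume "a \<in> A - {m}" "b \<in> A - {m}" "a - m - 1 = b - m - 1"
    moreover from this have "m < a" "m < b" using mA(2)[of a] mA(2)[of b] by auto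
    ultimately show "a = b" by simp
  qed
  define e where "e j = c (j + m + 1) * real (j + 1)" for j
  have cA: "card ?A = n" unfolding card_image[OF inj] using Suc.hyps(2) Suc.prems(1) mA(1) by simp
  have h'e: "h' z = (\<Sum>j\<in>?A. e j * z ^ j)" for z
  proof -
    have "h' z = (\<Sum>k\<in>A - {m}. c k * (real (k - m) * z ^ (k - m - 1)))"
      unfolding h'_def using mA Suc.prems by (subst sum.remove[of A m]) auto
    also have "\<dots> = (\<Sum>k\<in>A - {m}. e (?s k) * z ^ ?s k)"
    proof (intro sum.cong refl)
      fix k assume "k \<in> A - {m}"
      then have "m < k" using mA(2)[of k] by auto
      then show "c k * (real (k - m) * z ^ (k - m - 1)) = e (?s k) * z ^ ?s k"
        by (simp add: e_def Suc_diff_Suc del: of_nat_Suc)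
    qed
    also have "\<dots> = (\<Sum>j\<in>?A. e j * z ^ j)" by (subst sum.reindex[OF inj]) simp
    finally show ?thesis .
  qed
  have "\<forall>j\<in>?A. e j = 0"
    by (rule Suc.hyps(1)[OF cA[symmetric], of S']) (use Suc.prems S' cA h'e in auto)
  then have c0: "c k = 0" if "k \<in> A - {m}" for k
  proof -
    have "m < k" using that mA(2)[of k] by auto
    moreover have "e (?s k) = 0" using that \<open>\<forall>j\<in>?A. e j = 0\<close> by blast
    ultimately show ?thesis by (simp add: e_def del: of_nat_Suc of_nat_add)
  qed
  obtain z where z: "z \<in> S" using Suc by (metis card.empty equals0I le_zero_eq old.nat.distinct(1))
  have "(\<Sum>k\<in>A. c k * z ^ k) = c m * z ^ m"
    using mA Suc.prems c0 by (subst sum.remove[of A m]) auto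
  then have "c m = 0" using Suc.prems z by auto
  with c0 show ?case by blast
qed

text \<open>A vector in the kernel would be a polynomial with n monomials and n positive
  zeros.\<close>

lemma generalized_vandermonde_nonzero:
  fixes x :: "nat \<Rightarrow> real"
  assumes x: "inj_on x {..<n}" "\<And>i. i < n \<Longrightarrow> 0 < x i" and f: "inj_on f {..<n}"
  shows "Determinant.det (mat n n (\<lambda>(i, j). x i ^ f j)) \<noteq> 0"
proof
  let ?M = "mat n n (\<lambda>(i, j). x i ^ f j)"
  assume "Determinant.det ?M = 0"
  then obtain v where v: "v \<in> carrier_vec n" "v \<noteq> 0\<^sub>v n" "?M *\<^sub>v v = 0\<^sub>v n"
    using det_0_iff_vec_prod_zero[of ?M n] by auto
  define g where "g = the_inv_into {..<n} f"
  have g: "g (f j) = j" if "j < n" for j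
    unfolding g_def by (rule the_inv_into_f_f[OF f]) (use that in auto)
  have s: "(\<Sum>k\<in>f ` {..<n}. v $ g k * x i ^ k) = 0" if "i < n" for i
  proof -
    have "(\<Sum>k\<in>f ` {..<n}. v $ g k * x i ^ k) = (\<Sum>j<n. v $ j * x i ^ f j)"
      by (subst sum.reindex[OF f]) (auto simp: g)
    also have "\<dots> = (?M *\<^sub>v v) $ i"
      using that v(1) by (auto simp: scalar_prod_def mult.commute lessThan_atLeast0 intro!: sum.cong)
    also have "\<dots> = 0" using v(3) that by simp
    finally show ?thesis .
  qed
  have "\<forall>k\<in>f ` {..<n}. v $ g k = 0"
    by (rule sparse_polynomial_zero[where S = "x ` {..<n}"])
       (use s x in \<open>auto simp: card_image[OF x(1)] card_image[OF f]\<close>)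
  then have "v $ j = 0" if "j < n" for j using g that by force
  then have "v = 0\<^sub>v n" using v(1) by (intro eq_vecI) auto
  then show False using v(2) by simp
qed

text \<open>The sign depends on f alone: along the segment from x to y the nodes stay increasing and
  positive, so the determinant never vanishes. This makes the weights of the Schur measure
  nonnegative.\<close>

lemma generalized_vandermonde_sign:
  fixes x y :: "nat \<Rightarrow> real"
  assumes x: "\<And>i j. i < j \<Longrightarrow> j < n \<Longrightarrow> x i < x j" "\<And>i. i < n \<Longrightarrow> 0 < x i"
    and y: "\<And>i j. i < j \<Longrightarrow> j < n \<Longrightarrow> y i < y j" "\<And>i. i < n \<Longrightarrow> 0 < y i" and f: "inj_on f {..<n}"
  shows "0 < Determinant.det (mat n n (\<lambda>(i, j). x i ^ f j)) * Determinant.det (mat n n (\<lambda>(i, j). y i ^ f j))"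
proof -
  define z where "z s i = (1 - s) * x i + s * y i" for s i
  define d where "d s = Determinant.det (mat n n (\<lambda>(i, j). z s i ^ f j))" for s
  have nz: "d s \<noteq> 0" if "0 \<le> s" "s \<le> 1" for s
  proof -
    have cc: "(1 - s) * a + s * b < (1 - s) * a' + s * b'" if "a < a'" "b < b'" for a a' b b' :: real
    proof (cases "s = 1")
      case False
      then have "(1 - s) * a < (1 - s) * a'" using that \<open>s \<le> 1\<close> by simp
      moreover have "s * b \<le> s * b'" using that \<open>0 \<le> s\<close> by (simp add: mult_left_mono)
      ultimately show ?thesis by simp
    qed (use that in simp)
    have lt: "z s i < z s j" if "i < j" "j < n" for i j
      unfolding z_def using cc x(1)[OF that] y(1)[OF that] by blast
    have inj: "inj_on (z s) {..<n}"
    proof (rule inj_onI)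
      fix i j assume "i \<in> {..<n}" "j \<in> {..<n}" "z s i = z s j"
      then show "i = j" using lt[of i j] lt[of j i] by (cases i j rule: linorder_cases) auto
    qed
    moreover have "0 < z s i" if "i < n" for i
      using cc[of 0 "x i" 0 "y i"] x(2) y(2) that by (simp add: z_def)
    ultimately show ?thesis unfolding d_def by (intro generalized_vandermonde_nonzero f)
  qed
  have cont: "continuous_on {0..1} d"
    unfolding d_def det_fun z_def by (intro continuous_intros)
  have "d 0 * d 1 > 0"
  proof (rule ccontr)
    assume "\<not> d 0 * d 1 > 0"
    then have "d 0 \<le> 0 \<and> 0 \<le> d 1 \<or> d 1 \<le> 0 \<and> 0 \<le> d 0" by (auto simp: zero_less_mult_iff)
    then have "\<exists>s\<ge>0. s \<le> 1 \<and> d s = 0"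
      using IVT'[of d 0 0 1] IVT2'[of d 1 0 0] cont by auto
    then show False using nz by auto
  qed
  then show ?thesis by (simp add: d_def z_def)
qed

section \<open>The hole kernel and the inverse of the Cauchy matrix\<close>

definition geo_fps :: "real \<Rightarrow> real fps" where
  "geo_fps y = Abs_fps (\<lambda>k. y ^ k)"

text \<open>The power series of \<open>om_poly xs\<close> divided by
  \<open>ps_poly ys\<close>.\<close>

definition bfps :: "real list \<Rightarrow> real list \<Rightarrow> real fps" where
  "bfps xs ys = (\<Prod>x\<leftarrow>xs. fps_X - fps_const x) * (\<Prod>y\<leftarrow>ys. geo_fps y)"

text \<open>The correlation kernel of the holes of the Schur measure: its principal minors are the
  limits of the probabilities that given points are unoccupied.\<close>

definition hkernel :: "real list \<Rightarrow> real list \<Rightarrow> nat \<Rightarrow> nat \<Rightarrow> real" where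
  "hkernel xs ys k l = (\<Sum>m\<le>min k l. fps_nth (bfps xs ys) (k - m) * fps_nth (bfps ys xs) (l - m))"

definition om_poly :: "real list \<Rightarrow> real poly" where
  "om_poly xs = (\<Prod>x\<leftarrow>xs. [:- x, 1:])"

definition ps_poly :: "real list \<Rightarrow> real poly" where
  "ps_poly ys = (\<Prod>y\<leftarrow>ys. [:1, - y:])"

lemma geo_fps_mult: "(1 - fps_const y * fps_X) * geo_fps y = 1"
proof (rule fps_ext)
  fix n
  show "fps_nth ((1 - fps_const y * fps_X) * geo_fps y) n = fps_nth 1 n"
    by (cases n) (simp_all add: geo_fps_def left_diff_distrib mult.assoc)
qed

lemma ps_poly_geo: "fps_of_poly (ps_poly ys) * (\<Prod>y\<leftarrow>ys. geo_fps y) = 1"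
proof (induction ys)
  case (Cons y ys)
  have "fps_of_poly [:1, - y:] = 1 - fps_const y * fps_X"
    by (simp add: fps_of_poly_pCons)
  then have "fps_of_poly (ps_poly (y # ys)) * (\<Prod>y\<leftarrow>y # ys. geo_fps y) =
    ((1 - fps_const y * fps_X) * geo_fps y) * (fps_of_poly (ps_poly ys) * (\<Prod>y\<leftarrow>ys. geo_fps y))"
    by (simp add: ps_poly_def fps_of_poly_mult mult_ac)
  then show ?case by (simp add: Cons geo_fps_mult)
qed (simp add: ps_poly_def)

lemma om_poly_fps: "fps_of_poly (om_poly xs) = (\<Prod>x\<leftarrow>xs. fps_X - fps_const x)"
proof (induction xs)
  case (Cons x xs)
  have "fps_of_poly [:- x, 1:] = fps_X - fps_const x"
    by (simp add: fps_of_poly_pCons)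
  then show ?case using Cons by (simp add: om_poly_def fps_of_poly_mult del: mult_pCons_left)
qed (simp add: om_poly_def)

lemma bfps_ps: "bfps ys xs * fps_of_poly (ps_poly xs) = fps_of_poly (om_poly ys)"
  using ps_poly_geo[of xs] by (simp add: bfps_def om_poly_fps mult_ac)

lemma degree_om: "degree (om_poly xs) = length xs"
proof (induction xs)
  case (Cons x xs)
  have "om_poly xs \<noteq> 0" by (auto simp: om_poly_def prod_list_zero_iff)
  then show ?case using Cons by (simp add: om_poly_def degree_mult_eq del: mult_pCons_left)
qed (simp add: om_poly_def)

lemma degree_ps: "degree (ps_poly xs) \<le> length xs"
proof (induction xs)
  case (Cons x xs)
  then show ?case unfolding ps_poly_def
    by (simp del: mult_pCons_left) (rule order_trans[OF degree_mult_le], simp add: degree_pCons_eq_if)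
qed (simp add: ps_poly_def)

text \<open>For one and the same list, \<open>ps_poly\<close> is the reversed polynomial of
  \<open>om_poly\<close>.\<close>

lemma coeff_om_ps:
  assumes "a \<le> length xs"
  shows "coeff (om_poly xs) (length xs - a) = coeff (ps_poly xs) a"
proof -
  have r: "reflect_poly [:- x, 1:] = [:1, - x:]" for x :: real
    by (simp add: reflect_poly_def coeffs_def)
  have "reflect_poly (om_poly xs) = ps_poly xs"
    unfolding om_poly_def ps_poly_def reflect_poly_prod_list by (simp add: comp_def r)
  then show ?thesis using coeff_reflect_poly[of "om_poly xs" a] assms by (simp add: degree_om)
qed

lemma coeff_ps_om:
  assumes "a \<le> length xs"
  shows "coeff (ps_poly xs) (length xs - a) = coeff (om_poly xs) a"
  using coeff_om_ps[of "length xs - a" xs] assms by simp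

lemma poly_om: "poly (om_poly xs) z = (\<Prod>x\<leftarrow>xs. z - x)"
  by (induction xs) (auto simp: om_poly_def algebra_simps)

lemma poly_ps: "poly (ps_poly ys) z = psi ys z"
  unfolding psi_def by (induction ys) (auto simp: ps_poly_def algebra_simps)

text \<open>q is the polynomial part at infinity of z^l \<psi>(z) / \<omega>(z), with \<psi> formed
  from ys and \<omega> from xs: in the variable 1 / z both polynomials are reversed and the
  expansion is that of \<open>bfps ys xs\<close>. What remains has degree below Q.\<close>

lemma remainder_coeff:
  fixes xs ys :: "real list" and l :: nat
  assumes "length xs = Q" "length ys = Q"
  defines "q \<equiv> \<Sum>m\<le>l. monom (fps_nth (bfps ys xs) (l - m)) m"
  shows "coeff (monom 1 l * ps_poly ys - om_poly xs * q) (Q + i) = 0"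
proof -
  have q: "coeff q m = (if m \<le> l then fps_nth (bfps ys xs) (l - m) else 0)" for m
    unfolding q_def coeff_sum by (auto simp: sum.delta)
  have A: "coeff (monom 1 l * ps_poly ys) (Q + i) = (if i \<le> l then coeff (om_poly ys) (l - i) else 0)"
  proof (cases "Q + i < l")
    case True
    have "coeff (om_poly ys) (l - i) = 0" using True assms by (intro coeff_eq_0) (simp add: degree_om)
    then show ?thesis using True by (simp add: coeff_monom_mult)
  next
    case False
    then have e: "coeff (monom 1 l * ps_poly ys) (Q + i) = coeff (ps_poly ys) (Q + i - l)"
      by (simp add: coeff_monom_mult)
    show ?thesis
    proof (cases "i \<le> l")
      case True
      then have "Q + i - l = length ys - (l - i)" using assms by simp
      then show ?thesis using e True False assms coeff_ps_om[of "l - i" ys] by simp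
    next
      case False
      have "coeff (ps_poly ys) (Q + i - l) = 0"
        by (rule coeff_eq_0, rule le_less_trans[OF degree_ps]) (use False assms in simp)
      then show ?thesis using e False by simp
    qed
  qed
  have B: "coeff (om_poly xs * q) (Q + i) = (if i \<le> l then coeff (om_poly ys) (l - i) else 0)"
  proof -
    have "coeff (om_poly xs * q) (Q + i) = (\<Sum>m\<le>Q + i. coeff q m * coeff (om_poly xs) (Q + i - m))"
      by (subst mult.commute) (simp add: coeff_mult)
    also have "\<dots> = (\<Sum>m | i \<le> m \<and> m \<le> l. fps_nth (bfps ys xs) (l - m) * coeff (ps_poly xs) (m - i))"
    proof (rule sum.mono_neutral_cong)
      fix m assume "m \<in> {..Q + i} - {m. i \<le> m \<and> m \<le> l}"
      then have "l < m \<or> Q < Q + i - m" by auto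
      then show "coeff q m * coeff (om_poly xs) (Q + i - m) = 0"
      proof
        assume "Q < Q + i - m"
        then have "coeff (om_poly xs) (Q + i - m) = 0" using assms by (intro coeff_eq_0) (simp add: degree_om)
        then show ?thesis by simp
      qed (simp add: q)
    next
      fix m assume "m \<in> {m. i \<le> m \<and> m \<le> l} - {..Q + i}"
      then show "fps_nth (bfps ys xs) (l - m) * coeff (ps_poly xs) (m - i) = 0"
        using assms by (auto intro!: coeff_eq_0 le_less_trans[OF degree_ps])
    next
      fix m assume "m \<in> {..Q + i} \<inter> {m. i \<le> m \<and> m \<le> l}"
      then have m: "i \<le> m" "m \<le> l" "m \<le> Q + i" by auto
      then have "Q + i - m = length xs - (m - i)" using assms by simp
      then show "coeff q m * coeff (om_poly xs) (Q + i - m) = fps_nth (bfps ys xs) (l - m) * coeff (ps_poly xs) (m - i)"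
        using m assms(1,2) coeff_om_ps[of "m - i" xs] by (simp add: q)
    qed auto
    also have "\<dots> = (if i \<le> l then fps_nth (bfps ys xs * fps_of_poly (ps_poly xs)) (l - i) else 0)"
    proof (cases "i \<le> l")
      case True
      have "(\<Sum>m | i \<le> m \<and> m \<le> l. fps_nth (bfps ys xs) (l - m) * coeff (ps_poly xs) (m - i)) =
        (\<Sum>j\<in>{0..l - i}. fps_nth (bfps ys xs) j * coeff (ps_poly xs) (l - i - j))"
        by (rule sum.reindex_bij_witness[of _ "\<lambda>j. l - j" "\<lambda>m. l - m"]) (use True in auto)
      then show ?thesis using True by (simp add: fps_mult_nth)
    qed (auto intro!: sum.neutral)
    also have "\<dots> = (if i \<le> l then coeff (om_poly ys) (l - i) else 0)"
      unfolding bfps_ps by simp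
    finally show ?thesis .
  qed
  show ?thesis using A B by simp
qed

lemma poly_eq_0_many_roots:
  fixes p :: "real poly"
  assumes "\<And>i. Q \<le> i \<Longrightarrow> coeff p i = 0" "finite A" "card A = Q" "\<And>z. z \<in> A \<Longrightarrow> poly p z = 0"
  shows "p = 0"
proof (rule ccontr)
  assume p: "p \<noteq> 0"
  then have "degree p < Q" using assms(1)[of "degree p"] by (metis leading_coeff_0_iff not_le)
  moreover have "card A \<le> card {z. poly p z = 0}"
    using p assms by (intro card_mono poly_roots_finite) auto
  ultimately show False using card_poly_roots_bound[OF p] assms by simp
qed

text \<open>Interpolation at the column parameters: the remainder of \<open>z\<^sup>l \<psi>(z)\<close> modulo \<open>\<omega>(z)\<close> solves the
  linear system with the Cauchy matrix, and the quotient produces the kernel.\<close>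

lemma cauchy_solution_kernel:
  fixes d :: "nat \<Rightarrow> real"
  assumes len: "length xs = Q" "length ys = Q" and dis: "distinct xs"
    and ne: "\<And>i m. i < Q \<Longrightarrow> m < Q \<Longrightarrow> xs ! i * ys ! m \<noteq> 1"
    and sol: "\<And>i. i < Q \<Longrightarrow> (\<Sum>m<Q. d m / (1 - xs ! i * ys ! m)) = (xs ! i) ^ l"
  shows "(\<Sum>m<Q. (ys ! m) ^ k * d m) = (if k = l then 1 else 0) - hkernel xs ys k l"
proof -
  define e where "e m = (\<Prod>j\<in>{..<Q} - {m}. [:1, - (ys ! j):])" for m
  define c where "c = (\<Sum>m<Q. Polynomial.smult (d m) (e m))"
  define q where "q = (\<Sum>m\<le>l. monom (fps_nth (bfps ys xs) (l - m)) m)"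
  have ps: "ps_poly ys = (\<Prod>j<Q. [:1, - (ys ! j):])"
    unfolding ps_poly_def using len by (simp add: prod.list_conv_set_nth lessThan_atLeast0)
  have ps_e: "ps_poly ys = [:1, - (ys ! m):] * e m" if "m < Q" for m
    unfolding ps e_def using that by (subst prod.remove[of _ m]) auto
  \<comment> \<open>Both sides have degree below Q and agree at the Q nodes: c divided by
    \<open>ps_poly ys\<close> is the partial fraction sum of the d m / (1 - z y_m), which the linear
    system prescribes at each node.\<close>
  have "c = monom 1 l * ps_poly ys - om_poly xs * q"
  proof -
    define p where "p = c - (monom 1 l * ps_poly ys - om_poly xs * q)"
    have "p = 0"
    proof (rule poly_eq_0_many_roots[of Q _ "set xs"])
      fix i assume i: "Q \<le> i"
      have "coeff (e m) i = 0" if "m < Q" for m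
      proof (rule coeff_eq_0)
        have "degree (e m) \<le> (\<Sum>j\<in>{..<Q} - {m}. degree [:1, - (ys ! j):])"
          using degree_prod_sum_le[of "{..<Q} - {m}" "\<lambda>j. [:1, - (ys ! j):]"] by (simp add: e_def comp_def)
        also have "\<dots> \<le> (\<Sum>j\<in>{..<Q} - {m}. 1)" by (rule sum_mono) (auto simp: degree_pCons_eq_if)
        also have "\<dots> < Q" using that by simp
        finally show "degree (e m) < i" using i by simp
      qed
      then have "coeff c i = 0" by (simp add: c_def coeff_sum)
      moreover have "coeff (monom 1 l * ps_poly ys - om_poly xs * q) i = 0"
        using remainder_coeff[OF len, of l "i - Q"] i unfolding q_def by simp
      ultimately show "coeff p i = 0" by (simp add: p_def)
    next
      fix z assume "z \<in> set xs"
      then obtain i where i: "i < Q" "z = xs ! i" using len by (auto simp: in_set_conv_nth)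
      have "poly c z = (\<Sum>m<Q. d m / (1 - z * ys ! m) * psi ys z)"
        unfolding c_def poly_sum
      proof (rule sum.cong[OF refl])
        fix m assume "m \<in> {..<Q}"
        then have m: "m < Q" by simp
        have "psi ys z = (1 - z * ys ! m) * poly (e m) z"
          unfolding poly_ps[symmetric] ps_e[OF m] by (simp add: algebra_simps)
        then show "poly (Polynomial.smult (d m) (e m)) z = d m / (1 - z * ys ! m) * psi ys z"
          using ne[OF i(1) m] i(2) by simp
      qed
      also have "\<dots> = z ^ l * psi ys z"
        unfolding sum_distrib_right[symmetric] using sol[OF i(1)] i(2) by simp
      finally have "poly c z = z ^ l * psi ys z" .
      moreover have "poly (om_poly xs) z = 0" using \<open>z \<in> set xs\<close> by (auto simp: poly_om prod_list_zero_iff)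
      ultimately show "poly p z = 0" by (simp add: p_def poly_monom poly_ps)
    qed (use len dis in \<open>auto simp: distinct_card\<close>)
    then show ?thesis by (simp add: p_def)
  qed
  then have cf: "fps_of_poly c = fps_X ^ l * fps_of_poly (ps_poly ys) - fps_of_poly (om_poly xs) * fps_of_poly q"
    by (simp add: fps_of_poly_diff fps_of_poly_mult fps_of_poly_monom)
  let ?G = "\<Prod>y\<leftarrow>ys. geo_fps y"
  have G: "fps_of_poly (e m) * ?G = geo_fps (ys ! m)" if "m < Q" for m
  proof -
    have "fps_of_poly [:1, - (ys ! m):] = 1 - fps_const (ys ! m) * fps_X"
      by (simp add: fps_of_poly_pCons)
    moreover have "(fps_of_poly [:1, - (ys ! m):] * fps_of_poly (e m)) * ?G = 1"
      using ps_poly_geo[of ys] unfolding ps_e[OF that] fps_of_poly_mult .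
    ultimately have "(1 - fps_const (ys ! m) * fps_X) * (fps_of_poly (e m) * ?G) = 1"
      by (simp only: mult.assoc)
    then have "geo_fps (ys ! m) * ((1 - fps_const (ys ! m) * fps_X) * (fps_of_poly (e m) * ?G)) = geo_fps (ys ! m)" by simp
    then show ?thesis using geo_fps_mult[of "ys ! m"] by (simp add: mult.assoc[symmetric] mult.commute[of "geo_fps _"])
  qed
  \<comment> \<open>The moments of d are the Taylor coefficients of c / \<psi>, and division of the
    remainder formula by \<psi> gives z^l - q \<omega> / \<psi>, where \<omega> / \<psi> is
    \<open>bfps xs ys\<close>.\<close>
  have "(\<Sum>m<Q. fps_const (d m) * geo_fps (ys ! m)) = fps_of_poly c * ?G"
    unfolding c_def fps_of_poly_sum sum_distrib_right
    by (intro sum.cong) (auto simp: fps_of_poly_smult mult.assoc G)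
  also have "\<dots> = fps_X ^ l * (fps_of_poly (ps_poly ys) * ?G) - (fps_of_poly (om_poly xs) * ?G) * fps_of_poly q"
    unfolding cf by (simp add: algebra_simps)
  also have "\<dots> = fps_X ^ l - fps_of_poly q * bfps xs ys"
    by (simp add: ps_poly_geo bfps_def om_poly_fps mult.commute)
  finally have "fps_nth (\<Sum>m<Q. fps_const (d m) * geo_fps (ys ! m)) k = fps_nth (fps_X ^ l - fps_of_poly q * bfps xs ys) k"
    by simp
  moreover have "fps_nth (\<Sum>m<Q. fps_const (d m) * geo_fps (ys ! m)) k = (\<Sum>m<Q. (ys ! m) ^ k * d m)"
    by (simp add: fps_sum_nth geo_fps_def mult.commute)
  moreover have "fps_nth (fps_X ^ l - fps_of_poly q * bfps xs ys) k =
    (if k = l then 1 else 0) - (\<Sum>m=0..k. coeff q m * fps_nth (bfps xs ys) (k - m))"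
    by (simp add: fps_mult_nth fps_X_power_nth)
  ultimately have "(\<Sum>m<Q. (ys ! m) ^ k * d m) = (if k = l then 1 else 0) - (\<Sum>m=0..k. coeff q m * fps_nth (bfps xs ys) (k - m))"
    by simp
  also have "(\<Sum>m=0..k. coeff q m * fps_nth (bfps xs ys) (k - m)) = hkernel xs ys k l"
    unfolding hkernel_def
    by (rule sum.mono_neutral_cong_right) (auto simp: q_def coeff_sum)
  finally show ?thesis .
qed

text \<open>Right multiplication of the matrix of \<open>psidet\<close> by the coefficients of the
  polynomials \<psi>(z) / (1 - z y_m) yields both Cauchy matrices at once. The factor E is the same
  for all u, so it will cancel against the case u = 0.\<close>

lemma det_cauchy_psidet:
  assumes len: "length xs = Q" "length ys = Q"
    and ne: "\<And>i m. i < Q \<Longrightarrow> m < Q \<Longrightarrow> xs ! i * ys ! m \<noteq> 1"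
    and ne': "\<And>i m. i < Q \<Longrightarrow> m < Q \<Longrightarrow> t * xs ! i * ys ! m \<noteq> 1"
  shows "\<exists>E. \<forall>u. Determinant.det (mat Q Q (\<lambda>(i, m). 1 / (1 - xs ! i * ys ! m) + u / (1 - t * xs ! i * ys ! m)))
      * (\<Prod>i<Q. psi ys (xs ! i) * psi ys (t * xs ! i)) = psidet t u ys xs * E"
proof -
  define e where "e m = (\<Prod>j\<in>{..<Q} - {m}. [:1, - (ys ! j):])" for m
  have pe: "psi ys z = (1 - z * ys ! m) * poly (e m) z" if "m < Q" for m z
  proof -
    have "ps_poly ys = (\<Prod>j<Q. [:1, - (ys ! j):])"
      unfolding ps_poly_def using len by (simp add: prod.list_conv_set_nth lessThan_atLeast0)
    also have "\<dots> = [:1, - (ys ! m):] * e m"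
      unfolding e_def using that by (subst prod.remove[of _ m]) auto
    finally show ?thesis unfolding poly_ps[symmetric] by (simp add: algebra_simps)
  qed
  have de: "degree (e m) < Q" if "m < Q" for m
  proof -
    have "degree (e m) \<le> (\<Sum>j\<in>{..<Q} - {m}. degree [:1, - (ys ! j):])"
      using degree_prod_sum_le[of "{..<Q} - {m}" "\<lambda>j. [:1, - (ys ! j):]"] by (simp add: e_def comp_def)
    also have "\<dots> \<le> (\<Sum>j\<in>{..<Q} - {m}. 1)" by (rule sum_mono) (auto simp: degree_pCons_eq_if)
    also have "\<dots> < Q" using that by simp
    finally show ?thesis .
  qed
  have pe': "poly (e m) z = (\<Sum>j<Q. coeff (e m) j * z ^ j)" if "m < Q" for m z
    unfolding poly_altdef using de[OF that]
    by (intro sum.mono_neutral_left) (auto simp: coeff_eq_0)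
  let ?E = "mat Q Q (\<lambda>(j, m). coeff (e m) j)"
  show ?thesis
  proof (intro exI[of _ "Determinant.det ?E"] allI)
    fix u
    let ?P = "mat Q Q (\<lambda>(i, k). (xs ! i) ^ k * (psi ys (t * xs ! i) + u * t ^ k * psi ys (xs ! i)))"
    have "?P * ?E = mat Q Q (\<lambda>(i, m). (psi ys (xs ! i) * psi ys (t * xs ! i)) *
        (1 / (1 - xs ! i * ys ! m) + u / (1 - t * xs ! i * ys ! m)))" (is "_ = ?R")
    proof (rule eq_matI)
      fix i m assume "i < dim_row ?R" "m < dim_col ?R"
      then have im: "i < Q" "m < Q" by auto
      let ?x = "xs ! i"
      have "(?P * ?E) $$ (i, m) = (\<Sum>j<Q. ?x ^ j * (psi ys (t * ?x) + u * t ^ j * psi ys ?x) * coeff (e m) j)"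
        using im by (simp add: scalar_prod_def lessThan_atLeast0)
      also have "\<dots> = psi ys (t * ?x) * poly (e m) ?x + u * psi ys ?x * poly (e m) (t * ?x)"
        unfolding pe'[OF im(2)] sum_distrib_left sum.distrib[symmetric]
        by (intro sum.cong) (auto simp: algebra_simps)
      also have "poly (e m) ?x = psi ys ?x / (1 - ?x * ys ! m)"
        using pe[OF im(2), of ?x] ne[OF im] by simp
      also have "poly (e m) (t * ?x) = psi ys (t * ?x) / (1 - t * ?x * ys ! m)"
        using pe[OF im(2), of "t * ?x"] ne'[OF im] by simp
      finally show "(?P * ?E) $$ (i, m) = ?R $$ (i, m)" using im by (simp add: algebra_simps)
    qed auto
    moreover have "Determinant.det (?P * ?E) = Determinant.det ?P * Determinant.det ?E"
      by (rule det_mult[of _ Q]) auto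
    ultimately show "Determinant.det (mat Q Q (\<lambda>(i, m). 1 / (1 - xs ! i * ys ! m) + u / (1 - t * xs ! i * ys ! m)))
      * (\<Prod>i<Q. psi ys (xs ! i) * psi ys (t * xs ! i)) = psidet t u ys xs * Determinant.det ?E"
      unfolding psidet_def len by (simp add: det_scale_rows mult.commute)
  qed
qed

text \<open>With C the Cauchy matrix and D the solution of C D = X, the left side is det C times det
  (1 - D Y); Sylvester's identity turns the second factor into an n by n determinant, whose entries
  are the moments of solutions of the Cauchy system.\<close>

lemma det_rank_update:
  assumes C: "Determinant.det (mat Q Q (\<lambda>(i, m). 1 / (1 - xs ! i * ys ! m))) \<noteq> 0"
    and len: "length xs = Q" "length ys = Q" and dis: "distinct xs"
    and ne: "\<And>i m. i < Q \<Longrightarrow> m < Q \<Longrightarrow> xs ! i * ys ! m \<noteq> 1"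
    and k: "inj_on k {..<n}"
  shows "Determinant.det (mat Q Q (\<lambda>(i, m). 1 / (1 - xs ! i * ys ! m) - (\<Sum>j<n. (xs ! i) ^ k j * (ys ! m) ^ k j))) =
    Determinant.det (mat Q Q (\<lambda>(i, m). 1 / (1 - xs ! i * ys ! m))) * Determinant.det (mat n n (\<lambda>(a, b). hkernel xs ys (k a) (k b)))"
proof -
  let ?C = "mat Q Q (\<lambda>(i, m). 1 / (1 - xs ! i * ys ! m))"
  let ?X = "mat Q n (\<lambda>(i, j). (xs ! i) ^ k j)"
  let ?Y = "mat n Q (\<lambda>(j, m). (ys ! m) ^ k j)"
  define D where "D = (1 / Determinant.det ?C) \<cdot>\<^sub>m (adj_mat ?C * ?X)"
  have aC: "adj_mat ?C \<in> carrier_mat Q Q" and a2: "?C * adj_mat ?C = Determinant.det ?C \<cdot>\<^sub>m 1\<^sub>m Q"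
    using adj_mat[of ?C Q] by auto
  have D: "D \<in> carrier_mat Q n" unfolding D_def using aC by auto
  have CD: "?C * D = ?X"
  proof -
    have "?C * D = (1 / Determinant.det ?C) \<cdot>\<^sub>m ((?C * adj_mat ?C) * ?X)"
      unfolding D_def using aC by (subst mult_smult_distrib[of _ Q Q _ n]) (auto simp: assoc_mult_mat[of _ Q Q _ Q _ n])
    also have "\<dots> = ?X" unfolding a2 using C
      by (subst mult_smult_assoc_mat[of _ Q Q _ n]) (auto intro!: eq_matI)
    finally show ?thesis .
  qed
  have sol: "(\<Sum>m<Q. D $$ (m, b) / (1 - xs ! i * ys ! m)) = (xs ! i) ^ k b" if "i < Q" "b < n" for i b
  proof -
    have "(?C * D) $$ (i, b) = (\<Sum>m<Q. D $$ (m, b) / (1 - xs ! i * ys ! m))"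
      using that D by (auto simp: scalar_prod_def lessThan_atLeast0 intro!: sum.cong)
    then show ?thesis using that unfolding CD by simp
  qed
  have "mat Q Q (\<lambda>(i, m). 1 / (1 - xs ! i * ys ! m) - (\<Sum>j<n. (xs ! i) ^ k j * (ys ! m) ^ k j)) = ?C - ?X * ?Y"
    by (rule eq_matI) (auto simp: scalar_prod_def lessThan_atLeast0)
  also have "\<dots> = ?C * (1\<^sub>m Q - D * ?Y)"
    using D by (subst mult_minus_distrib_mat[of _ Q Q _ Q]) (auto simp: assoc_mult_mat[of _ Q Q _ n _ Q, symmetric] CD)
  finally have "Determinant.det (mat Q Q (\<lambda>(i, m). 1 / (1 - xs ! i * ys ! m) - (\<Sum>j<n. (xs ! i) ^ k j * (ys ! m) ^ k j))) =
     Determinant.det ?C * Determinant.det (1\<^sub>m Q - D * ?Y)"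
    by (simp only:) (rule det_mult[of _ Q], use D in \<open>auto intro!: minus_carrier_mat mult_carrier_mat\<close>)
  also have "Determinant.det (1\<^sub>m Q - D * ?Y) = Determinant.det (1\<^sub>m n - ?Y * D)"
    using D by (intro det_one_minus_mult_commute) auto
  also have "1\<^sub>m n - ?Y * D = mat n n (\<lambda>(a, b). hkernel xs ys (k a) (k b))"
  proof (rule eq_matI)
    fix a b assume "a < dim_row (mat n n (\<lambda>(a, b). hkernel xs ys (k a) (k b)))"
      "b < dim_col (mat n n (\<lambda>(a, b). hkernel xs ys (k a) (k b)))"
    then have ab: "a < n" "b < n" by auto
    have "(?Y * D) $$ (a, b) = (\<Sum>m<Q. (ys ! m) ^ k a * D $$ (m, b))"
      using ab D by (auto simp: scalar_prod_def lessThan_atLeast0 intro!: sum.cong)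
    also have "\<dots> = (if k a = k b then 1 else 0) - hkernel xs ys (k a) (k b)"
      by (rule cauchy_solution_kernel[OF len dis ne]) (use sol ab in auto)
    finally show "(1\<^sub>m n - ?Y * D) $$ (a, b) = mat n n (\<lambda>(a, b). hkernel xs ys (k a) (k b)) $$ (a, b)"
      using ab D inj_onD[OF k, of a b] by auto
  qed (use D in auto)
  finally show ?thesis .
qed

section \<open>The hole probability of a Schur measure\<close>

lemma card_injections:
  assumes "finite A"
  shows "card {k \<in> {..<n} \<rightarrow>\<^sub>E A. inj_on k {..<n}} = fact n * (card A choose n)"
proof (induction n)
  case 0
  have "{k \<in> {..<0} \<rightarrow>\<^sub>E A. inj_on k {..<0 :: nat}} = {\<lambda>_. undefined}" by auto
  then show ?case by simp
next
  case (Suc n)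
  let ?I = "\<lambda>n. {k \<in> {..<n} \<rightarrow>\<^sub>E A. inj_on k {..<n}}"
  let ?S = "SIGMA k:?I n. A - k ` {..<n}"
  have fin: "finite (?I n)" using assms by (auto intro!: finite_PiE)
  have "bij_betw (\<lambda>(k, v). k(n := v)) ?S (?I (Suc n))"
  proof (rule bij_betwI[where g = "\<lambda>k. (restrict k {..<n}, k n)"])
    show "(\<lambda>(k, v). k(n := v)) \<in> ?S \<rightarrow> ?I (Suc n)"
      by (auto simp: PiE_def Pi_def extensional_def inj_on_def)
    show "(\<lambda>k. (restrict k {..<n}, k n)) \<in> ?I (Suc n) \<rightarrow> ?S"
    proof
      fix k assume k: "k \<in> ?I (Suc n)"
      then have "k n \<noteq> k i" if "i < n" for i using inj_onD[of k "{..<Suc n}" n i] that by auto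
      then show "(restrict k {..<n}, k n) \<in> ?S" using k by (auto simp: PiE_def Pi_def inj_on_def)
    qed
    show "(\<lambda>k. (restrict k {..<n}, k n)) ((\<lambda>(k, v). k(n := v)) p) = p" if "p \<in> ?S" for p
      using that by (auto simp: PiE_def extensional_def restrict_def fun_eq_iff)
    show "(\<lambda>(k, v). k(n := v)) ((\<lambda>k. (restrict k {..<n}, k n)) k) = k" if "k \<in> ?I (Suc n)" for k
      using that by (auto simp: PiE_def extensional_def restrict_def fun_eq_iff)
  qed
  then have "card (?I (Suc n)) = card ?S" by (simp add: bij_betw_same_card)
  also have "\<dots> = (\<Sum>k\<in>?I n. card (A - k ` {..<n}))"
    using fin assms by simp
  also have "\<dots> = (\<Sum>k\<in>?I n. card A - n)"
  proof (rule sum.cong[OF refl])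
    fix k assume "k \<in> ?I n"
    then show "card (A - k ` {..<n}) = card A - n"
      by (subst card_Diff_subset) (auto simp: card_image)
  qed
  also have "\<dots> = fact n * ((card A - n) * (card A choose n))" by (simp add: Suc)
  also have "\<dots> = fact n * (Suc n * (card A choose Suc n))"
    unfolding binomial_absorb_comp binomial_absorption ..
  also have "\<dots> = fact (Suc n) * (card A choose Suc n)" by (simp add: algebra_simps)
  finally show ?case .
qed

text \<open>If h points below a are missing from S, there are n! (h choose n) injective n-tuples of
  them, and the alternating sum of the binomials is 1 exactly for h = 0.\<close>

lemma inclusion_exclusion_tuples:
  fixes S :: "nat set"
  shows "(of_bool ({..<a} \<subseteq> S) :: real) =
    (\<Sum>n\<le>a. (- 1) ^ n / fact n * (\<Sum>k | k \<in> {..<n} \<rightarrow>\<^sub>E {..<a} \<and> inj_on k {..<n}. of_bool (k ` {..<n} \<inter> S = {})))"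
proof -
  define h where "h = card ({..<a} - S)"
  have "(\<Sum>k | k \<in> {..<n} \<rightarrow>\<^sub>E {..<a} \<and> inj_on k {..<n}. of_bool (k ` {..<n} \<inter> S = {})) = (fact n * real (h choose n))" for n
  proof -
    have fin: "finite {k. k \<in> {..<n} \<rightarrow>\<^sub>E {..<a} \<and> inj_on k {..<n}}"
      by (rule finite_subset[OF _ finite_PiE[of "{..<n}" "\<lambda>_. {..<a}"]]) auto
    have "{k. k \<in> {..<n} \<rightarrow>\<^sub>E {..<a} \<and> inj_on k {..<n}} \<inter> {k. k ` {..<n} \<inter> S = {}} =
        {k \<in> {..<n} \<rightarrow>\<^sub>E ({..<a} - S). inj_on k {..<n}}"
      by (auto simp: PiE_def Pi_def)
    then show ?thesis using card_injections[of "{..<a} - S" n] fin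
      by (simp add: sum_of_bool_eq h_def)
  qed
  then have "(\<Sum>n\<le>a. (- 1) ^ n / fact n * (\<Sum>k | k \<in> {..<n} \<rightarrow>\<^sub>E {..<a} \<and> inj_on k {..<n}. of_bool (k ` {..<n} \<inter> S = {})))
     = (\<Sum>n\<le>a. (- 1) ^ n * real (h choose n))" by simp
  also have "\<dots> = (\<Sum>n\<le>h. (- 1) ^ n * real (h choose n))"
  proof (rule sum.mono_neutral_right)
    have "h \<le> card {..<a}" unfolding h_def by (intro card_mono) auto
    then show "{..h} \<subseteq> {..a}" by auto
  qed (auto simp: binomial_eq_0)
  also have "\<dots> = of_bool (h = 0)"
  proof (cases "h = 0")
    case False
    then show ?thesis using choose_alternating_sum[of h] by auto
  qed auto
  also have "h = 0 \<longleftrightarrow> {..<a} \<subseteq> S" by (auto simp: h_def)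
  finally show ?thesis by simp
qed

text \<open>The values of f are the shifted parts of a partition in arbitrary order: up to
  Vandermonde factors the two alternants are Schur polynomials, and each partition is counted once
  for every ordering.\<close>

definition schur_weight :: "real list \<Rightarrow> real list \<Rightarrow> (nat \<Rightarrow> nat) \<Rightarrow> real" where
  "schur_weight xs ys f = Determinant.det (mat (length xs) (length xs) (\<lambda>(i, j). (xs ! i) ^ f j)) *
     Determinant.det (mat (length xs) (length xs) (\<lambda>(i, j). (ys ! i) ^ f j))"

text \<open>The cut-off R keeps every sum finite; averages over the Schur measure are limits of
  ratios as R grows.\<close>

definition schur_sum :: "real list \<Rightarrow> real list \<Rightarrow> nat \<Rightarrow> ((nat \<Rightarrow> nat) \<Rightarrow> real) \<Rightarrow> real" where
  "schur_sum xs ys R F = (\<Sum>f\<in>{..<length xs} \<rightarrow>\<^sub>E {..<R}. schur_weight xs ys f * F f)"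

text \<open>The Fredholm expansion for the event that all points below a are occupied. It stops at n
  = a because longer tuples repeat an index and their determinants vanish.\<close>

definition hole_det :: "real list \<Rightarrow> real list \<Rightarrow> nat \<Rightarrow> real" where
  "hole_det xs ys a = (\<Sum>n\<le>a. (- 1) ^ n / fact n *
     (\<Sum>k\<in>{..<n} \<rightarrow>\<^sub>E {..<a}. Determinant.det (mat n n (\<lambda>(i, j). hkernel xs ys (k i) (k j)))))"

lemma tendsto_det:
  fixes f :: "'b \<Rightarrow> nat \<Rightarrow> nat \<Rightarrow> real"
  assumes "\<And>i j. i < n \<Longrightarrow> j < n \<Longrightarrow> ((\<lambda>r. f r i j) \<longlongrightarrow> l i j) F"
  shows "((\<lambda>r. Determinant.det (mat n n (\<lambda>(i, j). f r i j))) \<longlongrightarrow> Determinant.det (mat n n (\<lambda>(i, j). l i j))) F"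
  unfolding det_fun
  by (intro tendsto_sum tendsto_mult tendsto_const tendsto_prod assms) (auto dest: permutes_in_image)

lemma power_sum_tendsto:
  fixes x y :: real
  assumes "0 < x" "x < 1" "0 < y" "y < 1"
  shows "(\<lambda>R. \<Sum>k<R. x ^ k * y ^ k) \<longlonglongrightarrow> 1 / (1 - x * y)"
proof -
  have "x * y < 1 * 1" using assms by (intro mult_strict_mono) auto
  then have "(\<lambda>k. (x * y) ^ k) sums (1 / (1 - x * y))" using assms by (intro geometric_sums) auto
  then show ?thesis by (simp add: sums_def power_mult_distrib)
qed

text \<open>The increasing order gives both alternants the same sign, and entries below 1 make the
  geometric sums converge.\<close>

locale schur_parameters =
  fixes xs ys :: "real list" and Q :: nat
  assumes len: "length xs = Q" "length ys = Q"
    and xs: "\<And>i j. i < j \<Longrightarrow> j < Q \<Longrightarrow> xs ! i < xs ! j" "\<And>i. i < Q \<Longrightarrow> 0 < xs ! i" "\<And>i. i < Q \<Longrightarrow> xs ! i < 1"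
    and ys: "\<And>i j. i < j \<Longrightarrow> j < Q \<Longrightarrow> ys ! i < ys ! j" "\<And>i. i < Q \<Longrightarrow> 0 < ys ! i" "\<And>i. i < Q \<Longrightarrow> ys ! i < 1"
begin

lemma product_less_one: "i < Q \<Longrightarrow> m < Q \<Longrightarrow> xs ! i * ys ! m < 1"
  using mult_strict_mono[of "xs ! i" 1 "ys ! m" 1] xs ys by (simp add: less_imp_le)

lemma scaled_product_less_one: "0 < t \<Longrightarrow> t < 1 \<Longrightarrow> i < Q \<Longrightarrow> m < Q \<Longrightarrow> t * xs ! i * ys ! m < 1"
  using mult_strict_mono[of t 1 "xs ! i * ys ! m" 1] product_less_one[of i m] xs(2)[of i] ys(2)[of m]
  by (simp add: mult.assoc less_imp_le)

lemma distinct: "distinct xs" "distinct ys"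
proof -
  have "zs ! i \<noteq> zs ! j" if "\<And>i j. i < j \<Longrightarrow> j < Q \<Longrightarrow> zs ! i < zs ! j" "i < Q" "j < Q" "i \<noteq> j" for zs :: "real list" and i j
    using that(1)[of i j] that(1)[of j i] that(2-) by (cases i j rule: linorder_cases) auto
  then show "distinct xs" "distinct ys"
    unfolding distinct_conv_nth len using xs(1) ys(1) by blast+
qed

lemma weight_nonneg: "0 \<le> schur_weight xs ys f"
proof (cases "inj_on f {..<Q}")
  case True
  then show ?thesis unfolding schur_weight_def len
    by (intro less_imp_le generalized_vandermonde_sign) (use xs ys in auto)
next
  case False
  then obtain i j where ij: "i < Q" "j < Q" "i \<noteq> j" "f i = f j" by (auto simp: inj_on_def)
  then have "Determinant.det (mat Q Q (\<lambda>(i, j). (xs ! i) ^ f j)) = 0"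
    by (intro det_identical_columns[of _ Q i j]) (auto intro!: eq_vecI)
  then show ?thesis by (simp add: schur_weight_def len)
qed

lemma weight_zero: "\<not> inj_on f {..<Q} \<Longrightarrow> schur_weight xs ys f = 0"
proof -
  assume "\<not> inj_on f {..<Q}"
  then obtain i j where ij: "i < Q" "j < Q" "i \<noteq> j" "f i = f j" by (auto simp: inj_on_def)
  then have "Determinant.det (mat Q Q (\<lambda>(i, j). (xs ! i) ^ f j)) = 0"
    by (intro det_identical_columns[of _ Q i j]) (auto intro!: eq_vecI)
  then show ?thesis by (simp add: schur_weight_def len)
qed

lemma schur_sum_mono:
  assumes "\<And>f. f \<in> {..<Q} \<rightarrow>\<^sub>E {..<R} \<Longrightarrow> inj_on f {..<Q} \<Longrightarrow> F f \<le> G f"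
  shows "schur_sum xs ys R F \<le> schur_sum xs ys R G"
  unfolding schur_sum_def len
proof (rule sum_mono)
  fix f assume "f \<in> {..<Q} \<rightarrow>\<^sub>E {..<R}"
  then show "schur_weight xs ys f * F f \<le> schur_weight xs ys f * G f"
    using weight_nonneg[of f] weight_zero[of f] assms by (cases "inj_on f {..<Q}") (auto intro: mult_left_mono)
qed

lemma schur_sum_prod:
  "schur_sum xs ys R (\<lambda>f. \<Prod>i<Q. g (f i)) =
    fact Q * Determinant.det (mat Q Q (\<lambda>(i, j). \<Sum>k<R. g k * (xs ! i) ^ k * (ys ! j) ^ k))"
  unfolding cauchy_binet_tuples schur_sum_def schur_weight_def len ..

lemma schur_sum_one_tendsto:
  "(\<lambda>R. schur_sum xs ys R (\<lambda>_. 1)) \<longlonglongrightarrow> fact Q * Determinant.det (mat Q Q (\<lambda>(i, m). 1 / (1 - xs ! i * ys ! m)))"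
  using schur_sum_prod[of _ "\<lambda>_. 1"]
  by (auto intro!: tendsto_intros tendsto_det power_sum_tendsto xs ys)

lemma schur_sum_one_pos:
  assumes "Q \<le> R"
  shows "schur_weight xs ys (restrict id {..<Q}) \<le> schur_sum xs ys R (\<lambda>_. 1)" "0 < schur_weight xs ys (restrict id {..<Q})"
proof -
  show "0 < schur_weight xs ys (restrict id {..<Q})"
    unfolding schur_weight_def len
    by (rule generalized_vandermonde_sign) (use xs ys in \<open>auto simp: inj_on_def\<close>)
  show "schur_weight xs ys (restrict id {..<Q}) \<le> schur_sum xs ys R (\<lambda>_. 1)"
    unfolding schur_sum_def len mult_1_right
    by (rule member_le_sum) (use assms weight_nonneg in \<open>auto intro!: finite_PiE simp: restrict_PiE_iff simp del: restrict_apply\<close>)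
qed

lemma det_cauchy_pos: "0 < Determinant.det (mat Q Q (\<lambda>(i, m). 1 / (1 - xs ! i * ys ! m)))"
proof -
  have "schur_weight xs ys (restrict id {..<Q}) \<le> fact Q * Determinant.det (mat Q Q (\<lambda>(i, m). 1 / (1 - xs ! i * ys ! m)))"
    by (rule LIMSEQ_le_const[OF schur_sum_one_tendsto]) (use schur_sum_one_pos(1) in blast)
  then have "0 < fact Q * Determinant.det (mat Q Q (\<lambda>(i, m). 1 / (1 - xs ! i * ys ! m)))"
    using schur_sum_one_pos(2)[OF order_refl] by (rule less_le_trans[rotated])
  then show ?thesis by (simp add: zero_less_mult_iff)
qed

lemma schur_ratio_tendsto:
  assumes "(\<lambda>R. schur_sum xs ys R F) \<longlonglongrightarrow> fact Q * (c * Determinant.det (mat Q Q (\<lambda>(i, m). 1 / (1 - xs ! i * ys ! m))))"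
  shows "(\<lambda>R. schur_sum xs ys R F / schur_sum xs ys R (\<lambda>_. 1)) \<longlonglongrightarrow> c"
  using tendsto_divide[OF assms schur_sum_one_tendsto] det_cauchy_pos by simp

text \<open>By Cauchy--Binet the indicator of avoiding k removes finitely many exponents from each
  geometric sum, which subtracts a matrix of rank at most n from the Cauchy matrix.\<close>

lemma avoid_tendsto:
  assumes "inj_on k {..<n}"
  shows "(\<lambda>R. schur_sum xs ys R (\<lambda>f. \<Prod>i<Q. of_bool (f i \<notin> k ` {..<n})) / schur_sum xs ys R (\<lambda>_. 1))
     \<longlonglongrightarrow> Determinant.det (mat n n (\<lambda>(a, b). hkernel xs ys (k a) (k b)))"
proof (rule schur_ratio_tendsto)
  let ?T = "k ` {..<n}"
  have "(\<lambda>R. \<Sum>r<R. of_bool (r \<notin> ?T) * (xs ! i) ^ r * (ys ! m) ^ r) \<longlonglongrightarrow>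
     1 / (1 - xs ! i * ys ! m) - (\<Sum>j<n. (xs ! i) ^ k j * (ys ! m) ^ k j)" if im: "i < Q" "m < Q" for i m
  proof -
    let ?h = "\<lambda>r. (xs ! i) ^ r * (ys ! m) ^ r"
    have "(\<lambda>R. (\<Sum>r<R. ?h r) - (\<Sum>r\<in>?T. ?h r)) \<longlonglongrightarrow> 1 / (1 - xs ! i * ys ! m) - (\<Sum>r\<in>?T. ?h r)"
      by (intro tendsto_diff tendsto_const power_sum_tendsto) (use im xs ys in auto)
    moreover have "\<forall>\<^sub>F R in sequentially. (\<Sum>r<R. ?h r) - (\<Sum>r\<in>?T. ?h r) = (\<Sum>r<R. of_bool (r \<notin> ?T) * (xs ! i) ^ r * (ys ! m) ^ r)"
      using eventually_ge_at_top[of "Suc (Max (insert 0 ?T))"]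
    proof eventually_elim
      case (elim R)
      have sub: "?T \<subseteq> {..<R}" using elim by (force simp: less_eq_Suc_le[symmetric] intro: le_less_trans[OF Max_ge])
      have "(\<Sum>r<R. of_bool (r \<notin> ?T) * (xs ! i) ^ r * (ys ! m) ^ r) = (\<Sum>r\<in>{..<R} - ?T. ?h r)"
        by (rule sum.mono_neutral_cong_right) auto
      also have "\<dots> = (\<Sum>r<R. ?h r) - (\<Sum>r\<in>?T. ?h r)" by (rule sum_diff) (use sub in auto)
      finally show ?case by simp
    qed
    ultimately have "(\<lambda>R. \<Sum>r<R. of_bool (r \<notin> ?T) * (xs ! i) ^ r * (ys ! m) ^ r) \<longlonglongrightarrow> 1 / (1 - xs ! i * ys ! m) - (\<Sum>r\<in>?T. ?h r)"
      by (rule Lim_transform_eventually)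
    then show ?thesis by (simp add: sum.reindex[OF assms])
  qed
  then have "(\<lambda>R. fact Q * Determinant.det (mat Q Q (\<lambda>(i, j). \<Sum>r<R. of_bool (r \<notin> ?T) * (xs ! i) ^ r * (ys ! j) ^ r))) \<longlonglongrightarrow>
     fact Q * Determinant.det (mat Q Q (\<lambda>(i, m). 1 / (1 - xs ! i * ys ! m) - (\<Sum>j<n. (xs ! i) ^ k j * (ys ! m) ^ k j)))"
    by (intro tendsto_mult tendsto_const tendsto_det)
  also have "Determinant.det (mat Q Q (\<lambda>(i, m). 1 / (1 - xs ! i * ys ! m) - (\<Sum>j<n. (xs ! i) ^ k j * (ys ! m) ^ k j))) =
    Determinant.det (mat n n (\<lambda>(a, b). hkernel xs ys (k a) (k b))) * Determinant.det (mat Q Q (\<lambda>(i, m). 1 / (1 - xs ! i * ys ! m)))"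
    using det_rank_update[OF _ len distinct(1) _ assms] det_cauchy_pos product_less_one by (simp add: mult.commute less_le)
  finally show "(\<lambda>R. schur_sum xs ys R (\<lambda>f. \<Prod>i<Q. of_bool (f i \<notin> ?T))) \<longlonglongrightarrow> fact Q *
    (Determinant.det (mat n n (\<lambda>(a, b). hkernel xs ys (k a) (k b))) * Determinant.det (mat Q Q (\<lambda>(i, m). 1 / (1 - xs ! i * ys ! m))))"
    unfolding schur_sum_prod[of _ "\<lambda>r. of_bool (r \<notin> ?T)"] .
qed

lemma schur_sum_swap:
  "schur_sum xs ys R (\<lambda>f. \<Sum>n\<in>N. c n * (\<Sum>k\<in>K n. G n k f)) = (\<Sum>n\<in>N. c n * (\<Sum>k\<in>K n. schur_sum xs ys R (G n k)))"
proof -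
  let ?F = "{..<length xs} \<rightarrow>\<^sub>E {..<R}"
  have "schur_sum xs ys R (\<lambda>f. \<Sum>n\<in>N. c n * (\<Sum>k\<in>K n. G n k f)) =
    (\<Sum>f\<in>?F. \<Sum>n\<in>N. \<Sum>k\<in>K n. c n * (schur_weight xs ys f * G n k f))"
    unfolding schur_sum_def sum_distrib_left by (simp add: mult.left_commute)
  also have "\<dots> = (\<Sum>n\<in>N. \<Sum>f\<in>?F. \<Sum>k\<in>K n. c n * (schur_weight xs ys f * G n k f))"
    by (rule sum.swap)
  also have "\<dots> = (\<Sum>n\<in>N. \<Sum>k\<in>K n. \<Sum>f\<in>?F. c n * (schur_weight xs ys f * G n k f))"
    by (intro sum.cong refl sum.swap)
  also have "\<dots> = (\<Sum>n\<in>N. c n * (\<Sum>k\<in>K n. schur_sum xs ys R (G n k)))"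
    unfolding schur_sum_def sum_distrib_left ..
  finally show ?thesis .
qed

lemma packed_tendsto:
  "(\<lambda>R. schur_sum xs ys R (\<lambda>f. of_bool ({..<a} \<subseteq> f ` {..<Q})) / schur_sum xs ys R (\<lambda>_. 1)) \<longlonglongrightarrow> hole_det xs ys a"
proof -
  let ?K = "\<lambda>n. {k. k \<in> {..<n} \<rightarrow>\<^sub>E {..<a} \<and> inj_on k {..<n}}"
  have p: "(\<Prod>i<Q. of_bool (f i \<notin> k ` {..<n})) = (of_bool (k ` {..<n} \<inter> f ` {..<Q} = {}) :: real)" for f k n
  proof (cases "k ` {..<n} \<inter> f ` {..<Q} = {}")
    case True
    then have "f i \<notin> k ` {..<n}" if "i < Q" for i using that by blast
    then show ?thesis using True by simp
  next
    case False
    then obtain z where "z \<in> k ` {..<n}" "z \<in> f ` {..<Q}" by (meson disjoint_iff)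
    then obtain i where "i < Q" "f i \<in> k ` {..<n}" by (metis imageE lessThan_iff)
    then have "(\<Prod>i<Q. of_bool (f i \<notin> k ` {..<n}) :: real) = 0" by (intro prod_zero) auto
    then show ?thesis using False by simp
  qed
  have "schur_sum xs ys R (\<lambda>f. of_bool ({..<a} \<subseteq> f ` {..<Q})) / schur_sum xs ys R (\<lambda>_. 1) =
    (\<Sum>n\<le>a. (- 1) ^ n / fact n * (\<Sum>k\<in>?K n. schur_sum xs ys R (\<lambda>f. \<Prod>i<Q. of_bool (f i \<notin> k ` {..<n})) / schur_sum xs ys R (\<lambda>_. 1)))" for R
  proof -
    have "schur_sum xs ys R (\<lambda>f. of_bool ({..<a} \<subseteq> f ` {..<Q})) =
      (\<Sum>n\<le>a. (- 1) ^ n / fact n * (\<Sum>k\<in>?K n. schur_sum xs ys R (\<lambda>f. of_bool (k ` {..<n} \<inter> f ` {..<Q} = {}))))"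
      unfolding inclusion_exclusion_tuples
      by (rule schur_sum_swap[where N = "{..a}" and K = ?K and c = "\<lambda>n. (- 1) ^ n / fact n"
          and G = "\<lambda>n k f. of_bool (k ` {..<n} \<inter> f ` {..<Q} = {})"])
    then show ?thesis unfolding p by (simp only: sum_divide_distrib times_divide_eq_right[symmetric])
  qed
  moreover have "(\<lambda>R. \<Sum>n\<le>a. (- 1) ^ n / fact n * (\<Sum>k\<in>?K n. schur_sum xs ys R (\<lambda>f. \<Prod>i<Q. of_bool (f i \<notin> k ` {..<n})) / schur_sum xs ys R (\<lambda>_. 1)))
    \<longlonglongrightarrow> (\<Sum>n\<le>a. (- 1) ^ n / fact n * (\<Sum>k\<in>?K n. Determinant.det (mat n n (\<lambda>(i, j). hkernel xs ys (k i) (k j)))))"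
    by (intro tendsto_intros avoid_tendsto) auto
  \<comment> \<open>Tuples with a repeated index have two equal columns, so the restriction to
    injective tuples may be dropped.\<close>
  moreover have "(\<Sum>k\<in>?K n. Determinant.det (mat n n (\<lambda>(i, j). hkernel xs ys (k i) (k j)))) =
    (\<Sum>k\<in>{..<n} \<rightarrow>\<^sub>E {..<a}. Determinant.det (mat n n (\<lambda>(i, j). hkernel xs ys (k i) (k j))))" for n
  proof (rule sum.mono_neutral_left)
    show "\<forall>k\<in>({..<n} \<rightarrow>\<^sub>E {..<a}) - ?K n. Determinant.det (mat n n (\<lambda>(i, j). hkernel xs ys (k i) (k j))) = 0"
    proof
      fix k assume "k \<in> ({..<n} \<rightarrow>\<^sub>E {..<a}) - ?K n"
      then obtain i j where ij: "i < n" "j < n" "i \<noteq> j" "k i = k j" by (auto simp: inj_on_def)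
      then show "Determinant.det (mat n n (\<lambda>(i, j). hkernel xs ys (k i) (k j))) = 0"
        by (intro det_identical_columns[of _ n i j]) (auto intro!: eq_vecI)
    qed
  qed (auto intro!: finite_PiE)
  ultimately show ?thesis by (simp add: hole_det_def)
qed

text \<open>The bridge to the vertex model: the weight 1 + u t^k adds to the Cauchy matrix u times
  the Cauchy matrix with t x in place of x. Dividing the determinant identity by its case u = 0
  leaves \<open>part\<close>.\<close>

lemma part_tendsto:
  assumes t: "0 < t" "t < 1"
  shows "(\<lambda>R. schur_sum xs ys R (\<lambda>f. \<Prod>i<Q. 1 + u * t ^ f i) / schur_sum xs ys R (\<lambda>_. 1))
     \<longlonglongrightarrow> part t u ys xs / (\<Prod>i<Q. psi ys (t * xs ! i))"
proof (rule schur_ratio_tendsto)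
  let ?C = "\<lambda>u. Determinant.det (mat Q Q (\<lambda>(i, m). 1 / (1 - xs ! i * ys ! m) + u / (1 - t * xs ! i * ys ! m)))"
  let ?E = "Determinant.det (mat Q Q (\<lambda>(i, m). 1 / (1 - xs ! i * ys ! m)))"
  have Ez: "?E = ?C 0" by simp
  have "\<exists>E. \<forall>u. ?C u * (\<Prod>i<Q. psi ys (xs ! i) * psi ys (t * xs ! i)) = psidet t u ys xs * E"
    by (rule det_cauchy_psidet[OF len]) (use product_less_one scaled_product_less_one[OF t] in \<open>simp_all add: less_imp_neq\<close>)
  then obtain E where E: "\<And>u. ?C u * (\<Prod>i<Q. psi ys (xs ! i) * psi ys (t * xs ! i)) = psidet t u ys xs * E"
    by blast
  have pnz: "psi ys z \<noteq> 0" if zy: "\<And>m. m < Q \<Longrightarrow> z * ys ! m < 1" for z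
  proof -
    have "1 - z * y \<noteq> 0" if y: "y \<in> set ys" for y
    proof -
      obtain m where "m < Q" "y = ys ! m" using y len by (auto simp: in_set_conv_nth)
      then show ?thesis using zy[of m] by simp
    qed
    then show ?thesis by (auto simp: psi_def prod_list_zero_iff)
  qed
  have n1: "(\<Prod>i<Q. psi ys (xs ! i)) \<noteq> 0" and n2: "(\<Prod>i<Q. psi ys (t * xs ! i)) \<noteq> 0"
    using product_less_one scaled_product_less_one[OF t] by (simp_all add: pnz)
  have p0: "psidet t 0 ys xs = (\<Prod>i<Q. psi ys (t * xs ! i)) * vdet xs"
    unfolding psidet_def vdet_def len using det_scale_rows[of Q "\<lambda>i. psi ys (t * xs ! i)"] by (simp add: mult.commute)
  have part: "psidet t u ys xs = part t u ys xs * vdet xs"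
  proof (rule part_eq_psidet[symmetric, OF t distinct(1) _ distinct(2)])
    show "\<forall>x\<in>set xs. x \<noteq> 0" "\<forall>y\<in>set ys. 0 < y"
      using xs ys len by (force simp: in_set_conv_nth)+
    show "\<forall>x\<in>set xs. \<forall>y\<in>set ys. x * y \<noteq> 1" using product_less_one len by (force simp: in_set_conv_nth)
  qed
  have e0: "?E * (\<Prod>i<Q. psi ys (xs ! i)) = vdet xs * E"
    using E[of 0] n2 unfolding Ez p0 by (simp add: prod.distrib mult_ac)
  have eu: "?C u * (\<Prod>i<Q. psi ys (xs ! i)) * (\<Prod>i<Q. psi ys (t * xs ! i)) = part t u ys xs * (vdet xs * E)"
    using E[of u] unfolding part by (simp add: prod.distrib mult_ac)
  have lim: "?C u = part t u ys xs / (\<Prod>i<Q. psi ys (t * xs ! i)) * ?E"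
    using eu n1 n2 unfolding e0[symmetric] by (simp add: field_simps)
  have "(\<lambda>R. \<Sum>k<R. (1 + u * t ^ k) * (xs ! i) ^ k * (ys ! m) ^ k) \<longlonglongrightarrow> 1 / (1 - xs ! i * ys ! m) + u * (1 / (1 - t * xs ! i * ys ! m))"
    if im: "i < Q" "m < Q" for i m
  proof -
    have 1: "(\<Sum>k<R. (1 + u * t ^ k) * (xs ! i) ^ k * (ys ! m) ^ k) =
      (\<Sum>k<R. (xs ! i) ^ k * (ys ! m) ^ k) + u * (\<Sum>k<R. (t * xs ! i) ^ k * (ys ! m) ^ k)" for R
      by (simp add: sum_distrib_left sum.distrib[symmetric] power_mult_distrib algebra_simps)
    have "t * xs ! i < 1" using mult_strict_mono[of t 1 "xs ! i" 1] t xs im by (simp add: less_imp_le)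
    then show ?thesis unfolding 1
      by (intro tendsto_intros power_sum_tendsto) (use im xs ys t in auto)
  qed
  then have "(\<lambda>R. fact Q * Determinant.det (mat Q Q (\<lambda>(i, m). \<Sum>k<R. (1 + u * t ^ k) * (xs ! i) ^ k * (ys ! m) ^ k))) \<longlonglongrightarrow> fact Q * ?C u"
    by (intro tendsto_mult tendsto_const tendsto_det) simp
  then show "(\<lambda>R. schur_sum xs ys R (\<lambda>f. \<Prod>i<Q. 1 + u * t ^ f i)) \<longlonglongrightarrow> fact Q * (part t u ys xs / (\<Prod>i<Q. psi ys (t * xs ! i)) * ?E)"
    unfolding lim schur_sum_prod[of _ "\<lambda>k. 1 + u * t ^ k"] .
qed

text \<open>The inequality 1 + a \<le> exp a bounds the factors from b on, and there the u t^j sum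
  to at most u t^b / (1 - t).\<close>

lemma prod_qfac_upper:
  assumes t: "0 < t" "t < 1" and u: "0 \<le> u"
  shows "qfac t u R \<le> qfac t u b * exp (u * t ^ b / (1 - t))"
proof (cases "b \<le> R")
  case False
  have "qfac t u R \<le> qfac t u b"
  proof -
    have "{..<b} = {..<R} \<union> {R..<b}" using False by auto
    then have "qfac t u b = qfac t u R * (\<Prod>j\<in>{R..<b}. 1 + u * t ^ j)"
      unfolding qfac_def by (simp add: prod.union_disjoint ivl_disj_int)
    moreover have "1 \<le> (\<Prod>j\<in>{R..<b}. 1 + u * t ^ j)" using t u by (intro prod_ge_1) auto
    moreover have "0 \<le> qfac t u R" unfolding qfac_def using t u by (intro prod_nonneg) auto
    ultimately show ?thesis using mult_left_mono[of 1 _ "qfac t u R"] by simp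
  qed
  moreover have "1 \<le> exp (u * t ^ b / (1 - t))" "0 \<le> qfac t u b"
    unfolding qfac_def using t u by (auto intro!: prod_nonneg)
  ultimately show ?thesis using mult_left_mono[of 1 "exp (u * t ^ b / (1 - t))" "qfac t u b"] by simp
next
  case True
  have "{..<R} = {..<b} \<union> {b..<R}" using True by auto
  then have e: "qfac t u R = qfac t u b * (\<Prod>j\<in>{b..<R}. 1 + u * t ^ j)"
    unfolding qfac_def by (simp add: prod.union_disjoint ivl_disj_int)
  have "(\<Prod>j\<in>{b..<R}. 1 + u * t ^ j) \<le> (\<Prod>j\<in>{b..<R}. exp (u * t ^ j))"
    using t u by (intro prod_mono) auto
  also have "\<dots> = exp (u * (\<Sum>j\<in>{b..<R}. t ^ j))" by (simp add: exp_sum sum_distrib_left)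
  also have "(\<Sum>j\<in>{b..<R}. t ^ j) = (t ^ b - t ^ R) / (1 - t)"
  proof -
    have "(\<Sum>j\<in>{b..<R}. t ^ j) * (1 - t) = t ^ b - t ^ R"
      using True
    proof (induction R rule: dec_induct)
      case (step n)
      have "(\<Sum>j\<in>{b..<Suc n}. t ^ j) * (1 - t) = (\<Sum>j\<in>{b..<n}. t ^ j) * (1 - t) + t ^ n * (1 - t)"
        using step.hyps by (simp add: distrib_right)
      then show ?case unfolding step.IH by (simp add: algebra_simps)
    qed simp
    then show ?thesis using t by (simp add: eq_divide_eq)
  qed
  finally have "(\<Prod>j\<in>{b..<R}. 1 + u * t ^ j) \<le> exp (u * ((t ^ b - t ^ R) / (1 - t)))" .
  also have "\<dots> \<le> exp (u * t ^ b / (1 - t))"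
    using t u by (auto intro!: divide_right_mono mult_left_mono)
  finally show ?thesis unfolding e
    using t u by (intro mult_left_mono) (auto simp: qfac_def intro!: prod_nonneg)
qed

text \<open>A configuration that misses some \<open>h < a\<close> lacks the factor \<open>1 + u t\<^sup>h\<close>, which is at least
  \<open>1 + u t\<^sup>a\<close>.\<close>

theorem hole_det_bounds:
  assumes t: "0 < t" "t < 1" and u: "0 \<le> u"
  shows "qfac t u b * hole_det xs ys b \<le> part t u ys xs / (\<Prod>i<Q. psi ys (t * xs ! i))"
    and "part t u ys xs / (\<Prod>i<Q. psi ys (t * xs ! i)) \<le>
      qfac t u b * exp (u * t ^ b / (1 - t)) * (hole_det xs ys a + 1 / (1 + u * t ^ a))"
proof -
  let ?Z = "\<lambda>R. schur_sum xs ys R (\<lambda>_. 1)"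
  have Z: "0 < ?Z R" if "Q \<le> R" for R using schur_sum_one_pos[OF that] by simp
  have P: "(\<Prod>i<Q. 1 + u * t ^ f i) = (\<Prod>k\<in>f ` {..<Q}. 1 + u * t ^ k)" if "inj_on f {..<Q}" for f
    by (simp add: prod.reindex[OF that])
  have pos: "1 \<le> 1 + u * t ^ k" for k using t u by simp
  have q0: "0 \<le> qfac t u b" for b unfolding qfac_def using t u by (intro prod_nonneg) auto
  have lin: "schur_sum xs ys R (\<lambda>f. c * F f + d * G f) = c * schur_sum xs ys R F + d * schur_sum xs ys R G" for R c d F G
    unfolding schur_sum_def by (simp add: sum_distrib_left sum.distrib algebra_simps)
  have lin1: "schur_sum xs ys R (\<lambda>f. c * F f) = c * schur_sum xs ys R F" for R c F
    using lin[of R c F 0 F] by simp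
  show "qfac t u b * hole_det xs ys b \<le> part t u ys xs / (\<Prod>i<Q. psi ys (t * xs ! i))"
  proof (rule LIMSEQ_le[OF tendsto_mult[OF tendsto_const packed_tendsto] part_tendsto[OF t]], intro exI[of _ Q] allI impI)
    fix R assume R: "Q \<le> R"
    have "schur_sum xs ys R (\<lambda>f. qfac t u b * of_bool ({..<b} \<subseteq> f ` {..<Q})) \<le> schur_sum xs ys R (\<lambda>f. \<Prod>i<Q. 1 + u * t ^ f i)"
    proof (rule schur_sum_mono)
      fix f assume f: "f \<in> {..<Q} \<rightarrow>\<^sub>E {..<R}" "inj_on f {..<Q}"
      show "qfac t u b * of_bool ({..<b} \<subseteq> f ` {..<Q}) \<le> (\<Prod>i<Q. 1 + u * t ^ f i)"
      proof (cases "{..<b} \<subseteq> f ` {..<Q}")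
        \<comment> \<open>All points below b are occupied, so \<open>qfac t u b\<close> is a partial
          product of factors that are at least 1.\<close>
        case True
        then show ?thesis unfolding P[OF f(2)] qfac_def
          using t u by (auto intro!: prod_mono2)
      qed (use t u in \<open>auto intro!: prod_nonneg\<close>)
    qed
    then show "qfac t u b * (schur_sum xs ys R (\<lambda>f. of_bool ({..<b} \<subseteq> f ` {..<Q})) / ?Z R)
      \<le> schur_sum xs ys R (\<lambda>f. \<Prod>i<Q. 1 + u * t ^ f i) / ?Z R"
      unfolding lin1 using Z[OF R] by (simp add: divide_right_mono)
  qed
  let ?c = "qfac t u b * exp (u * t ^ b / (1 - t))"
  have c0: "0 \<le> ?c" using q0 by simp
  show "part t u ys xs / (\<Prod>i<Q. psi ys (t * xs ! i)) \<le> ?c * (hole_det xs ys a + 1 / (1 + u * t ^ a))"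
  proof (rule LIMSEQ_le[OF part_tendsto[OF t] tendsto_mult[OF tendsto_const tendsto_add[OF packed_tendsto tendsto_const]]], intro exI[of _ Q] allI impI)
    fix R assume R: "Q \<le> R"
    have "schur_sum xs ys R (\<lambda>f. \<Prod>i<Q. 1 + u * t ^ f i) \<le>
      schur_sum xs ys R (\<lambda>f. ?c * of_bool ({..<a} \<subseteq> f ` {..<Q}) + ?c * (1 / (1 + u * t ^ a)) * 1)"
    proof (rule schur_sum_mono)
      fix f assume f: "f \<in> {..<Q} \<rightarrow>\<^sub>E {..<R}" "inj_on f {..<Q}"
      have sub: "f ` {..<Q} \<subseteq> {..<R}" using f by auto
      show "(\<Prod>i<Q. 1 + u * t ^ f i) \<le> ?c * of_bool ({..<a} \<subseteq> f ` {..<Q}) + ?c * (1 / (1 + u * t ^ a)) * 1"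
      proof (cases "{..<a} \<subseteq> f ` {..<Q}")
        case True
        have "(\<Prod>i<Q. 1 + u * t ^ f i) \<le> qfac t u R"
          unfolding P[OF f(2)] qfac_def using sub t u by (intro prod_mono2) auto
        also have "\<dots> \<le> ?c" by (rule prod_qfac_upper[OF t u])
        moreover have "0 \<le> ?c * (1 / (1 + u * t ^ a)) * 1" using c0 t u by simp
        ultimately show ?thesis using True by simp
      next
        case False
        then obtain h where h: "h < a" "h \<notin> f ` {..<Q}" by auto
        have "(\<Prod>i<Q. 1 + u * t ^ f i) * (1 + u * t ^ a) \<le> (\<Prod>i<Q. 1 + u * t ^ f i) * (1 + u * t ^ h)"
          using h t u by (intro mult_left_mono prod_nonneg) (auto intro!: mult_left_mono power_decreasing)
        also have "\<dots> = (\<Prod>k\<in>insert h (f ` {..<Q}). 1 + u * t ^ k)"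
          unfolding P[OF f(2)] using h by (subst prod.insert) (auto simp: mult.commute)
        \<comment> \<open>The hole h has been filled; it may lie beyond the cut-off, whence the
          maximum.\<close>
        also have "\<dots> \<le> qfac t u (max R (Suc h))"
          unfolding qfac_def using sub t u by (intro prod_mono2) auto
        also have "\<dots> \<le> ?c" by (rule prod_qfac_upper[OF t u])
        finally show ?thesis using False pos[of a] by (simp add: field_simps)
      qed
    qed
    then have "schur_sum xs ys R (\<lambda>f. \<Prod>i<Q. 1 + u * t ^ f i) / ?Z R \<le>
      (?c * schur_sum xs ys R (\<lambda>f. of_bool ({..<a} \<subseteq> f ` {..<Q})) + ?c * (1 / (1 + u * t ^ a)) * ?Z R) / ?Z R"
      unfolding lin using Z[OF R] by (simp add: divide_right_mono)
    also have "\<dots> = ?c * (schur_sum xs ys R (\<lambda>f. of_bool ({..<a} \<subseteq> f ` {..<Q})) / ?Z R + 1 / (1 + u * t ^ a))"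
      using Z[OF R] by (simp add: add_divide_distrib distrib_left)
    finally show "schur_sum xs ys R (\<lambda>f. \<Prod>i<Q. 1 + u * t ^ f i) / ?Z R \<le>
      ?c * (schur_sum xs ys R (\<lambda>f. of_bool ({..<a} \<subseteq> f ` {..<Q})) / ?Z R + 1 / (1 + u * t ^ a))" .
  qed
qed

end

section \<open>Probabilities in the vertex model\<close>

lemma sv_row_const: "length xs = length vs \<Longrightarrow> sv_row t y h xs vs (\<lambda>_. c) = (\<Prod>x\<leftarrow>xs. 1 - t * x * y) * c"
  by (induction xs vs arbitrary: h rule: list_induct2) (auto simp: algebra_simps)

lemma sv_row_length_cong:
  assumes "length vs = length xs" "\<And>ws. length ws = length xs \<Longrightarrow> F ws = G ws"
  shows "sv_row t y h xs vs F = sv_row t y h xs vs G"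
  using assms by (intro sv_row_cong) auto

lemma sv_rows_const:
  "length vs = length xs \<Longrightarrow> sv_rows t ys xs vs (\<lambda>_. 1) = (\<Prod>y\<leftarrow>ys. \<Prod>x\<leftarrow>xs. 1 - t * x * y)"
proof (induction ys arbitrary: vs)
  case (Cons y ys)
  have "sv_rows t (y # ys) xs vs (\<lambda>_. 1) = sv_row t y False xs vs (\<lambda>_. \<Prod>y\<leftarrow>ys. \<Prod>x\<leftarrow>xs. 1 - t * x * y)"
    unfolding sv_rows.simps by (rule sv_row_length_cong) (use Cons in auto)
  then show ?case using Cons.prems by (simp add: sv_row_const)
qed simp

text \<open>All vertex weights are nonnegative in this range of t and x y.\<close>

lemma sv_row_mono:
  assumes "0 \<le> t" "t \<le> 1" "\<forall>x\<in>set xs. 0 \<le> x * y \<and> x * y \<le> 1" "length vs = length xs"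
    "\<And>ws. length ws = length xs \<Longrightarrow> F ws \<le> G ws"
  shows "sv_row t y h xs vs F \<le> sv_row t y h xs vs G"
  using assms(3-)
proof (induction xs arbitrary: h vs F G)
  case (Cons x xs)
  obtain v us where V: "vs = v # us" "length us = length xs" using Cons.prems(2) by (cases vs) auto
  have *: "sv_row t y b xs us (\<lambda>ws. F (c # ws)) \<le> sv_row t y b xs us (\<lambda>ws. G (c # ws))" for b c
    by (rule Cons.IH) (use Cons.prems V in auto)
  have xy: "0 \<le> x * y" "x * y \<le> 1" using Cons.prems by auto
  then have "t * (x * y) \<le> 1" using assms(1,2) mult_mono[of t 1 "x * y" 1] by simp
  then have c: "0 \<le> 1 - t * x * y" "0 \<le> (if h then t else 1) * (1 - x * y)" "0 \<le> (1 - t) * (if h then 1 else x * y)"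
    using xy assms(1,2) by (auto simp: mult.assoc)
  show ?case unfolding V sv_row.simps using * c by (auto intro!: add_mono mult_left_mono)
qed (use Cons in auto)

lemma sv_rows_mono:
  assumes "0 \<le> t" "t \<le> 1" "\<forall>x\<in>set xs. \<forall>y\<in>set ys. 0 \<le> x * y \<and> x * y \<le> 1" "length vs = length xs"
    "\<And>ws. length ws = length xs \<Longrightarrow> F ws \<le> G ws"
  shows "sv_rows t ys xs vs F \<le> sv_rows t ys xs vs G"
  using assms(3-)
proof (induction ys arbitrary: vs)
  case (Cons y ys)
  show ?case unfolding sv_rows.simps
    by (rule sv_row_mono) (use Cons assms(1,2) in auto)
qed auto

lemma sv_rows_linear:
  "sv_rows t ys xs vs (\<lambda>ws. a * F ws + b * G ws) = a * sv_rows t ys xs vs F + b * sv_rows t ys xs vs G"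
  by (induction ys arbitrary: vs) (simp_all add: sv_row_linear)

lemma sv_rows_cmult: "sv_rows t ys xs vs (\<lambda>ws. a * F ws) = a * sv_rows t ys xs vs F"
  using sv_rows_linear[of t ys xs vs a F 0 F] by simp

text \<open>At every vertex, whatever enters it, the weights sum to 1 - t x y; hence the total mass
  is the same for all boundary data.\<close>

definition sv_norm :: "real \<Rightarrow> real list \<Rightarrow> real list \<Rightarrow> real" where
  "sv_norm t ys xs = (\<Prod>y\<leftarrow>ys. \<Prod>x\<leftarrow>xs. 1 - t * x * y)"

definition sv_tail :: "real \<Rightarrow> real list \<Rightarrow> real list \<Rightarrow> nat \<Rightarrow> real" where
  "sv_tail t ys xs b = sv_rows t ys xs (replicate (length xs) True) (\<lambda>ws. of_bool (b \<le> count_list ws True)) / sv_norm t ys xs"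

lemma sv_norm_pos:
  assumes "0 \<le> t" "t < 1" "\<forall>x\<in>set xs. \<forall>y\<in>set ys. 0 \<le> x * y \<and> x * y \<le> 1"
  shows "0 < sv_norm t ys xs"
proof -
  have "0 < 1 - t * x * y" if "x \<in> set xs" "y \<in> set ys" for x y
  proof -
    have "t * (x * y) \<le> t * 1" using assms that by (intro mult_left_mono) auto
    then show ?thesis using assms by (simp add: mult.assoc)
  qed
  then show ?thesis unfolding sv_norm_def
  proof (induction ys)
    case (Cons y ys)
    have "0 < (\<Prod>x\<leftarrow>xs. 1 - t * x * y)"
      using Cons.prems by (induction xs) auto
    then show ?case using Cons by auto
  qed simp
qed

lemma qfac_mono:
  assumes "0 \<le> t" "0 \<le> u" "a \<le> b"
  shows "qfac t u a \<le> qfac t u b"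
  unfolding qfac_def using assms by (intro prod_mono2) auto

lemma qfac_pos: "0 \<le> t \<Longrightarrow> 0 \<le> u \<Longrightarrow> 0 < qfac t u a"
  unfolding qfac_def by (intro prod_pos) (simp add: add_pos_nonneg)

text \<open>The counterpart of \<open>hole_det_bounds\<close>, with the integers below the height H
  in place of the occupied points: for H < a the missing factor 1 + u t^H is at least 1 + u
  t^a.\<close>

lemma part_bounds:
  assumes t: "0 < t" "t < 1" and u: "0 \<le> u" and xy: "\<forall>x\<in>set xs. \<forall>y\<in>set ys. 0 \<le> x * y \<and> x * y \<le> 1"
  shows "qfac t u b * sv_tail t ys xs b \<le> part t u ys xs / sv_norm t ys xs"
    and "part t u ys xs / sv_norm t ys xs \<le> qfac t u b * exp (u * t ^ b / (1 - t)) * (sv_tail t ys xs a + 1 / (1 + u * t ^ a))"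
proof -
  let ?v = "replicate (length xs) True"
  have n: "0 < sv_norm t ys xs" using sv_norm_pos[of t xs ys] t xy by simp
  have "sv_rows t ys xs ?v (\<lambda>ws. qfac t u b * of_bool (b \<le> count_list ws True)) \<le> part t u ys xs"
    unfolding part_def
    by (rule sv_rows_mono) (use t u xy qfac_mono[of t u b] qfac_pos[of t u] in \<open>auto simp: less_imp_le\<close>)
  then show "qfac t u b * sv_tail t ys xs b \<le> part t u ys xs / sv_norm t ys xs"
    unfolding sv_rows_cmult sv_tail_def using n by (simp add: divide_right_mono)
  let ?c = "qfac t u b * exp (u * t ^ b / (1 - t))"
  \<comment> \<open>The empty lists satisfy the conditions of \<open>schur_parameters\<close>
    vacuously.\<close>
  have c: "qfac t u R \<le> ?c" for R
    using schur_parameters.prod_qfac_upper[OF _ t u, of "[]" "[]" 0 R b] by (simp add: schur_parameters_def)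
  have c0: "0 \<le> ?c" using qfac_pos[of t u b] t u by simp
  have p: "0 < 1 + u * t ^ a" using t u by (intro add_pos_nonneg) auto
  have "part t u ys xs \<le> sv_rows t ys xs ?v (\<lambda>ws. ?c * of_bool (a \<le> count_list ws True) + (?c * (1 / (1 + u * t ^ a))) * 1)"
    unfolding part_def
  proof (rule sv_rows_mono)
    fix ws :: "bool list"
    let ?H = "count_list ws True"
    show "qfac t u ?H \<le> ?c * of_bool (a \<le> ?H) + (?c * (1 / (1 + u * t ^ a))) * 1"
    proof (cases "a \<le> ?H")
      case True
      then show ?thesis using c[of ?H] c0 p by (simp add: add_increasing2)
    next
      case False
      have "qfac t u ?H * (1 + u * t ^ a) \<le> qfac t u ?H * (1 + u * t ^ ?H)"
        using False t u qfac_pos[of t u ?H] by (intro mult_left_mono) (auto intro!: mult_left_mono power_decreasing)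
      also have "\<dots> = qfac t u (Suc ?H)" by (simp add: qfac_def)
      also have "\<dots> \<le> ?c" by (rule c)
      finally show ?thesis using False p by (simp add: field_simps)
    qed
  qed (use t xy in auto)
  also have "\<dots> = ?c * (sv_tail t ys xs a * sv_norm t ys xs) + ?c * (1 / (1 + u * t ^ a)) * sv_norm t ys xs"
  proof -
    have "sv_rows t ys xs ?v (\<lambda>_. 1) = sv_norm t ys xs" by (simp add: sv_rows_const sv_norm_def)
    then show ?thesis unfolding sv_rows_linear sv_tail_def using n by simp
  qed
  also have "\<dots> = ?c * (sv_tail t ys xs a + 1 / (1 + u * t ^ a)) * sv_norm t ys xs"
    by (simp only: distrib_left distrib_right mult.assoc)
  finally show "part t u ys xs / sv_norm t ys xs \<le> ?c * (sv_tail t ys xs a + 1 / (1 + u * t ^ a))"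
    using n by (simp add: divide_le_eq)
qed

text \<open>Both probabilities are compared with the same average of the t-Pochhammer symbol;
  eliminating the average costs a shift of the threshold by 2 m and errors that vanish with
  t^m.\<close>

lemma (in schur_parameters) tail_hole_bounds:
  assumes t: "0 < t" "t < 1" and m: "m \<le> n"
  shows "sv_tail t ys xs (n + m) \<le> exp (t ^ m / (1 - t)) * (hole_det xs ys (n - m) + t ^ m)"
    and "hole_det xs ys (n + m) \<le> exp (t ^ m / (1 - t)) * (sv_tail t ys xs (n - m) + t ^ m)"
proof -
  \<comment> \<open>The transition of 1 + u t^j is placed at j = n: u t^(n + m) = t^m and u t^(n -
    m) = t^(-m).\<close>
  define u where "u = 1 / t ^ n"
  have u: "0 \<le> u" using t by (simp add: u_def)
  have ub: "u * t ^ (n + m) = t ^ m" using t by (simp add: u_def power_add)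
  have um: "u * t ^ (n - m) = 1 / t ^ m" using t m by (simp add: u_def power_diff)
  have "1 / (1 + u * t ^ (n - m)) = t ^ m / (t ^ m + 1)" unfolding um using t by (simp add: field_simps)
  also have "\<dots> \<le> t ^ m / 1" using t by (intro divide_left_mono) (auto simp: add_nonneg_pos)
  finally have ua: "1 / (1 + u * t ^ (n - m)) \<le> t ^ m" by simp
  have xy: "\<forall>x\<in>set xs. \<forall>y\<in>set ys. 0 \<le> x * y \<and> x * y \<le> 1"
    using product_less_one xs ys len by (auto simp: in_set_conv_nth intro!: mult_nonneg_nonneg less_imp_le)
  have N: "(\<Prod>i<Q. psi ys (t * xs ! i)) = sv_norm t ys xs"
  proof -
    have "(\<Prod>i<Q. psi ys (t * xs ! i)) = (\<Prod>x\<leftarrow>xs. \<Prod>y\<leftarrow>ys. 1 - t * x * y)"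
      using prod_list_nth[of "\<lambda>x. psi ys (t * x)" xs] len by (simp add: psi_def)
    also have "\<dots> = (\<Prod>y\<leftarrow>ys. \<Prod>x\<leftarrow>xs. 1 - t * x * y)"
    proof (induction xs)
      case Nil
      show ?case by (induction ys) auto
    next
      case (Cons x xs)
      have "(\<Prod>y\<leftarrow>ys. f y * g y) = (\<Prod>y\<leftarrow>ys. f y) * (\<Prod>y\<leftarrow>ys. g y)" for f g :: "real \<Rightarrow> real"
        by (induction ys) auto
      then show ?case using Cons by simp
    qed
    finally show ?thesis by (simp add: sv_norm_def)
  qed
  have q: "0 < qfac t u (n + m)" using t u by (intro qfac_pos) auto
  let ?e = "exp (t ^ m / (1 - t))"
  have e: "F + 1 / (1 + u * t ^ (n - m)) \<le> F + t ^ m" for F using ua by simp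
  have "qfac t u (n + m) * sv_tail t ys xs (n + m) \<le> qfac t u (n + m) * (?e * (hole_det xs ys (n - m) + t ^ m))"
    using part_bounds(1)[OF t u xy, of "n + m"] hole_det_bounds(2)[OF t u, of "n + m" "n - m"] e[of "hole_det xs ys (n - m)"] q
    unfolding N ub by (smt (verit) exp_gt_zero mult.assoc mult_left_mono)
  then show "sv_tail t ys xs (n + m) \<le> ?e * (hole_det xs ys (n - m) + t ^ m)" using q by simp
  have "qfac t u (n + m) * hole_det xs ys (n + m) \<le> qfac t u (n + m) * (?e * (sv_tail t ys xs (n - m) + t ^ m))"
    using part_bounds(2)[OF t u xy, of "n + m" "n - m"] hole_det_bounds(1)[OF t u, of "n + m"] e[of "sv_tail t ys xs (n - m)"] q
    unfolding N ub by (smt (verit) exp_gt_zero mult.assoc mult_left_mono)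
  then show "hole_det xs ys (n + m) \<le> ?e * (sv_tail t ys xs (n - m) + t ^ m)" using q by simp
qed

subsection \<open>Confluent parameters\<close>

lemma sv_row_tendsto:
  assumes "\<And>i. i \<in> set is \<Longrightarrow> ((\<lambda>n. X n i) \<longlongrightarrow> X0 i) G" "(y \<longlongrightarrow> y0) G" "\<And>ws. ((\<lambda>n. F n ws) \<longlongrightarrow> F0 ws) G"
  shows "((\<lambda>n. sv_row t (y n) h (map (X n) is) vs (F n)) \<longlongrightarrow> sv_row t y0 h (map X0 is) vs F0) G"
  using assms(1,3)
proof (induction "is" arbitrary: h vs F F0)
  case (Cons i "is")
  show ?case
  proof (cases vs)
    case (Cons v us)
    have *: "((\<lambda>n. sv_row t (y n) b (map (X n) is) us (\<lambda>ws. F n (c # ws))) \<longlongrightarrow> sv_row t y0 b (map X0 is) us (\<lambda>ws. F0 (c # ws))) G" for b c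
      by (rule Cons.IH) (use Cons.prems in auto)
    have "((\<lambda>n. X n i) \<longlongrightarrow> X0 i) G" using Cons.prems by simp
    then show ?thesis unfolding \<open>vs = v # us\<close> list.map sv_row.simps
      by (cases "h = v"; cases h) (auto intro!: tendsto_intros * assms(2))
  qed (use Cons.prems in simp)
qed simp

lemma sv_rows_tendsto:
  assumes "\<And>i. i \<in> set is \<Longrightarrow> ((\<lambda>n. X n i) \<longlongrightarrow> X0 i) G" "\<And>j. j \<in> set js \<Longrightarrow> ((\<lambda>n. Y n j) \<longlongrightarrow> Y0 j) G"
  shows "((\<lambda>n. sv_rows t (map (Y n) js) (map (X n) is) vs F) \<longlongrightarrow> sv_rows t (map Y0 js) (map X0 is) vs F) G"
  using assms(2)
  by (induction js arbitrary: vs) (auto intro!: sv_row_tendsto assms(1))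

lemma prod_list_tendsto:
  fixes f :: "'b \<Rightarrow> 'c \<Rightarrow> real"
  assumes "\<And>i. i \<in> set is \<Longrightarrow> ((\<lambda>n. f n i) \<longlongrightarrow> f0 i) G"
  shows "((\<lambda>n. prod_list (map (f n) is)) \<longlongrightarrow> prod_list (map f0 is)) G"
  using assms by (induction "is") (auto intro!: tendsto_intros)

lemma fps_mult_tendsto:
  fixes A B :: "'b \<Rightarrow> real fps"
  assumes "\<And>k. ((\<lambda>n. fps_nth (A n) k) \<longlongrightarrow> fps_nth A0 k) G" "\<And>k. ((\<lambda>n. fps_nth (B n) k) \<longlongrightarrow> fps_nth B0 k) G"
  shows "((\<lambda>n. fps_nth (A n * B n) k) \<longlongrightarrow> fps_nth (A0 * B0) k) G"
  unfolding fps_mult_nth by (intro tendsto_intros assms)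

lemma fps_prod_list_tendsto:
  fixes f :: "'b \<Rightarrow> 'c \<Rightarrow> real fps"
  assumes "\<And>i k. i \<in> set is \<Longrightarrow> ((\<lambda>n. fps_nth (f n i) k) \<longlongrightarrow> fps_nth (f0 i) k) G"
  shows "((\<lambda>n. fps_nth (prod_list (map (f n) is)) k) \<longlongrightarrow> fps_nth (prod_list (map f0 is)) k) G"
  using assms
proof (induction "is" arbitrary: k)
  case (Cons i "is")
  then show ?case by (auto intro!: fps_mult_tendsto)
qed simp

lemma bfps_tendsto:
  assumes "\<And>i. i \<in> set is \<Longrightarrow> ((\<lambda>n. X n i) \<longlongrightarrow> X0 i) G" "\<And>j. j \<in> set js \<Longrightarrow> ((\<lambda>n. Y n j) \<longlongrightarrow> Y0 j) G"
  shows "((\<lambda>n. fps_nth (bfps (map (X n) is) (map (Y n) js)) k) \<longlongrightarrow> fps_nth (bfps (map X0 is) (map Y0 js)) k) G"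
proof -
  have e: "fps_nth (fps_X - fps_const x) k = (if k = 1 then 1 else 0) - (if k = 0 then x else 0)" for x :: real and k
    by simp
  have 1: "((\<lambda>n. fps_nth (fps_X - fps_const (X n i)) k) \<longlongrightarrow> fps_nth (fps_X - fps_const (X0 i)) k) G" if "i \<in> set is" for i k
    unfolding e using assms(1)[OF that] by (cases "k = 0") (auto intro!: tendsto_intros)
  have 2: "((\<lambda>n. fps_nth (geo_fps (Y n j)) k) \<longlongrightarrow> fps_nth (geo_fps (Y0 j)) k) G" if "j \<in> set js" for j k
    unfolding geo_fps_def using assms(2)[OF that] by (auto intro!: tendsto_intros)
  show ?thesis
    unfolding bfps_def map_map o_def
    by (rule fps_mult_tendsto; rule fps_prod_list_tendsto; rule 1 2)
qed

lemma hole_det_tendsto: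
  assumes "\<And>i. i \<in> set is \<Longrightarrow> ((\<lambda>n. X n i) \<longlongrightarrow> X0 i) G" "\<And>j. j \<in> set js \<Longrightarrow> ((\<lambda>n. Y n j) \<longlongrightarrow> Y0 j) G"
  shows "((\<lambda>n. hole_det (map (X n) is) (map (Y n) js) a) \<longlongrightarrow> hole_det (map X0 is) (map Y0 js) a) G"
  unfolding hole_det_def hkernel_def
  by (intro tendsto_intros tendsto_det bfps_tendsto assms)

lemma sv_tail_tendsto:
  assumes "\<And>i. i \<in> set is \<Longrightarrow> ((\<lambda>n. X n i) \<longlongrightarrow> X0 i) G" "\<And>j. j \<in> set js \<Longrightarrow> ((\<lambda>n. Y n j) \<longlongrightarrow> Y0 j) G"
    and "sv_norm t (map Y0 js) (map X0 is) \<noteq> 0"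
  shows "((\<lambda>n. sv_tail t (map (Y n) js) (map (X n) is) a) \<longlongrightarrow> sv_tail t (map Y0 js) (map X0 is) a) G"
proof -
  have "((\<lambda>n. sv_norm t (map (Y n) js) (map (X n) is)) \<longlongrightarrow> sv_norm t (map Y0 js) (map X0 is)) G"
    unfolding sv_norm_def map_map o_def
    by (intro prod_list_tendsto tendsto_intros assms)
  then show ?thesis unfolding sv_tail_def length_map
    by (intro tendsto_divide sv_rows_tendsto assms)
qed

lemma sv_row_trivial: "length vs = length xs \<Longrightarrow> sv_row t 0 False xs vs F = F vs"
proof (induction xs arbitrary: vs F)
  case (Cons x xs)
  then show ?case by (cases vs) auto
qed simp

lemma sv_rows_trivial:
  "length vs = length xs \<Longrightarrow> sv_rows t (replicate n 0 @ ys) xs vs F = sv_rows t ys xs vs F"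
  by (induction n) (auto simp: sv_row_trivial)

lemma sv_rows_zeros:
  "sv_rows t ys (replicate n 0 @ xs) (replicate n True @ vs) F = sv_rows t ys xs vs (\<lambda>ws. F (replicate n True @ ws))"
  by (induction n arbitrary: F) (auto simp: sv_rows_zero)

text \<open>A zero row changes nothing, and each zero column keeps the path that enters it; so m
  zero columns shift the height by m.\<close>

lemma sv_tail_padded:
  "sv_tail t (replicate n 0 @ ys) (replicate m 0 @ xs) (m + b) = sv_tail t ys xs b"
proof -
  have r: "(\<Prod>y\<leftarrow>ys. \<Prod>x\<leftarrow>replicate m 0 @ xs. 1 - t * x * y) = (\<Prod>y\<leftarrow>ys. \<Prod>x\<leftarrow>xs. 1 - t * x * y)"
    by (induction ys) (simp_all add: prod_list_replicate)
  have p: "prod_list (replicate k 1) = (1 :: real)" for k by (induction k) auto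
  have s: "sv_norm t (replicate n 0 @ ys) (replicate m 0 @ xs) = sv_norm t ys xs"
  proof -
    have "(\<Prod>x\<leftarrow>zs. 1 - t * x * 0) = 1" for zs by (induction zs) auto
    then have "(\<Prod>y\<leftarrow>replicate n 0. \<Prod>x\<leftarrow>replicate m 0 @ xs. 1 - t * x * y) = 1" by (simp add: p)
    then show ?thesis unfolding sv_norm_def using r by simp
  qed
  have e: "replicate (length (replicate m (0 :: real) @ xs)) True = replicate m True @ replicate (length xs) True"
    by (simp add: replicate_add)
  have c: "count_list (replicate m True) True = m"
    by (induction m) auto
  show ?thesis
    unfolding sv_tail_def s e
    by (subst sv_rows_trivial) (simp, simp add: sv_rows_zeros c)
qed

text \<open>The Schur identity asks for two lists of equal length with distinct entries in (0, 1).
  Both are padded by zeros to length M + N and perturbed; the inequalities, being between finite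
  expressions for fixed n and m, survive the removal of the perturbation.\<close>

theorem confluent_tail_bounds:
  fixes r t :: real and M N :: nat
  assumes t: "0 < t" "t < 1" and r: "0 < r" "r < 1" and m: "m \<le> n"
  defines "X0 \<equiv> replicate M 0 @ replicate N r" and "Y0 \<equiv> replicate N 0 @ replicate M r"
  shows "sv_tail t (replicate M r) (replicate N r) (n + m) \<le> exp (t ^ m / (1 - t)) * (hole_det X0 Y0 (M + n - m) + t ^ m)"
    and "hole_det X0 Y0 (M + n + m) \<le> exp (t ^ m / (1 - t)) * (sv_tail t (replicate M r) (replicate N r) (n - m) + t ^ m)"
proof -
  define Q where "Q = M + N"
  have lX: "length X0 = Q" and lY: "length Y0 = Q" by (auto simp: X0_def Y0_def Q_def)
  have X0: "X0 ! i = (if i < M then 0 else r)" if "i < Q" for i using that by (auto simp: X0_def Q_def nth_append)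
  have Y0: "Y0 ! i = (if i < N then 0 else r)" if "i < Q" for i using that by (auto simp: Y0_def Q_def nth_append)
  \<comment> \<open>Positive, strictly increasing in i, below 1 - r for i < Q, and tending to 0 with
    k: added to the sorted lists it makes the entries distinct and keeps them in (0, 1).\<close>
  define d where "d k i = (1 - r) / real (Q + 1) * (real (i + 1) / real (k + 1))" for k i :: nat
  have d0: "(\<lambda>k. d k i) \<longlonglongrightarrow> 0" for i
  proof -
    have "(\<lambda>k. (1 - r) / real (Q + 1) * (real (i + 1) * inverse (real (Suc k)))) \<longlonglongrightarrow> (1 - r) / real (Q + 1) * (real (i + 1) * 0)"
      by (intro tendsto_mult tendsto_const LIMSEQ_inverse_real_of_nat)
    then show ?thesis by (simp add: d_def divide_inverse)
  qed
  have dpos: "0 < d k i" for k i using r by (simp add: d_def)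
  have dmono: "d k i < d k j" if "i < j" for k i j
    unfolding d_def using r that by (intro mult_strict_left_mono divide_strict_right_mono) auto
  have d1: "d k i < 1 - r" if "i < Q" for k i
  proof -
    have "real (i + 1) / real (k + 1) \<le> real (i + 1) / 1" by (intro divide_left_mono) auto
    also have "\<dots> < real (Q + 1)" using that by simp
    finally have "(1 - r) / real (Q + 1) * (real (i + 1) / real (k + 1)) < (1 - r) / real (Q + 1) * real (Q + 1)"
      using r by (intro mult_strict_left_mono) auto
    then show ?thesis unfolding d_def by simp
  qed
  define X where "X k = map (\<lambda>i. X0 ! i + d k i) [0..<Q]" for k
  define Y where "Y k = map (\<lambda>i. Y0 ! i + d k i) [0..<Q]" for k
  have S: "schur_parameters (X k) (Y k) Q" for k
  proof
    fix i j :: nat assume ij: "i < j" "j < Q"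
    show "X k ! i < X k ! j" "Y k ! i < Y k ! j"
      using ij dmono[OF ij(1), of k] r by (auto simp: X_def Y_def X0 Y0)
  next
    fix i :: nat assume i: "i < Q"
    show "0 < X k ! i" "0 < Y k ! i" "X k ! i < 1" "Y k ! i < 1"
      using i dpos[of k i] d1[OF i, of k] r by (auto simp: X_def Y_def X0 Y0)
  qed (auto simp: X_def Y_def)
  have eX: "map (\<lambda>i. X0 ! i) [0..<Q] = X0" and eY: "map (\<lambda>i. Y0 ! i) [0..<Q] = Y0"
    using lX lY by (metis map_nth)+
  have cX: "(\<lambda>k. X0 ! i + d k i) \<longlonglongrightarrow> X0 ! i" and cY: "(\<lambda>k. Y0 ! i + d k i) \<longlonglongrightarrow> Y0 ! i" for i
    using tendsto_add[OF tendsto_const d0, of "X0 ! i" i] tendsto_add[OF tendsto_const d0, of "Y0 ! i" i] by auto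
  have H: "(\<lambda>k. hole_det (X k) (Y k) a) \<longlonglongrightarrow> hole_det X0 Y0 a" for a
    using hole_det_tendsto[of "[0..<Q]" "\<lambda>k i. X0 ! i + d k i" "\<lambda>i. X0 ! i" sequentially "[0..<Q]" "\<lambda>k i. Y0 ! i + d k i" "\<lambda>i. Y0 ! i" a, OF cX cY]
    unfolding eX eY X_def Y_def .
  have rr: "0 \<le> r * r" "r * r \<le> 1" using r mult_mono[of r 1 r 1] by auto
  have N: "sv_norm t Y0 X0 \<noteq> 0"
    using sv_norm_pos[of t X0 Y0] t r rr by (force simp: X0_def Y0_def)
  have T: "(\<lambda>k. sv_tail t (Y k) (X k) a) \<longlonglongrightarrow> sv_tail t Y0 X0 a" for a
    using sv_tail_tendsto[of "[0..<Q]" "\<lambda>k i. X0 ! i + d k i" "\<lambda>i. X0 ! i" sequentially "[0..<Q]" "\<lambda>k i. Y0 ! i + d k i" "\<lambda>i. Y0 ! i" t a, OF cX cY]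
    unfolding eX eY X_def Y_def using N by simp
  have T0: "sv_tail t Y0 X0 (M + b) = sv_tail t (replicate M r) (replicate N r) b" for b
    unfolding X0_def Y0_def by (rule sv_tail_padded)
  have m': "m \<le> M + n" using m by simp
  have 1: "(\<lambda>k. exp (t ^ m / (1 - t)) * (hole_det (X k) (Y k) a + t ^ m)) \<longlonglongrightarrow> exp (t ^ m / (1 - t)) * (hole_det X0 Y0 a + t ^ m)" for a
    by (intro tendsto_intros H)
  have 2: "(\<lambda>k. exp (t ^ m / (1 - t)) * (sv_tail t (Y k) (X k) a + t ^ m)) \<longlonglongrightarrow> exp (t ^ m / (1 - t)) * (sv_tail t Y0 X0 a + t ^ m)" for a
    by (intro tendsto_intros T)
  have "sv_tail t Y0 X0 (M + n + m) \<le> exp (t ^ m / (1 - t)) * (hole_det X0 Y0 (M + n - m) + t ^ m)"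
    by (rule LIMSEQ_le[OF T 1]) (use schur_parameters.tail_hole_bounds(1)[OF S t m'] in blast)
  then show "sv_tail t (replicate M r) (replicate N r) (n + m) \<le> exp (t ^ m / (1 - t)) * (hole_det X0 Y0 (M + n - m) + t ^ m)"
    using T0[of "n + m"] by (simp add: add.assoc)
  have "hole_det X0 Y0 (M + n + m) \<le> exp (t ^ m / (1 - t)) * (sv_tail t Y0 X0 (M + n - m) + t ^ m)"
    by (rule LIMSEQ_le[OF H 2]) (use schur_parameters.tail_hole_bounds(2)[OF S t m'] in blast)
  then show "hole_det X0 Y0 (M + n + m) \<le> exp (t ^ m / (1 - t)) * (sv_tail t (replicate M r) (replicate N r) (n - m) + t ^ m)"
    using T0[of "n - m"] m by simp
qed

section \<open>The Airy kernel\<close>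

definition airy_fun :: "real \<Rightarrow> complex \<Rightarrow> complex" where
  "airy_fun x w = exp (w ^ 3 / 3 - of_real x * w)"

text \<open>Only the upper half of the line Re w = \<epsilon> is used; the lower half contributes
  the complex conjugate, so the real part divided by \<pi> is the full Airy integral. The power w^n
  produces the derivatives in x.\<close>

definition airy_int :: "real \<Rightarrow> nat \<Rightarrow> real \<Rightarrow> complex" where
  "airy_int \<epsilon> n x = (LINT y:{0..}|lborel. Complex \<epsilon> y ^ n * airy_fun x (Complex \<epsilon> y))"

section \<open>The Airy function as an integral over a vertical half-line\<close>

lemma norm_airy_fun: "norm (airy_fun x (Complex a y)) = exp (a ^ 3 / 3 - a * y\<^sup>2 - x * a)"
proof -
  have "Re (Complex a y ^ 3) = a ^ 3 - 3 * a * y\<^sup>2"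
    by (simp add: power3_eq_cube power2_eq_square algebra_simps)
  then show ?thesis by (simp add: airy_fun_def norm_exp_eq_Re algebra_simps)
qed

lemma gauss_bound:
  fixes \<epsilon> :: real
  assumes "\<epsilon> > 0" "0 \<le> c"
  obtains C where "0 \<le> C" "\<And>y. 0 \<le> y \<Longrightarrow> (\<epsilon> + y) ^ n * exp (c * (\<epsilon> + y)) * exp (- \<epsilon> * y\<^sup>2) \<le> C * exp (- y)"
proof -
  \<comment> \<open>n comes from the polynomial factor, c from the exponential, and 1 is the decay
    rate that must remain after completing the square.\<close>
  define q where "q = real n + c + 1"
  have "(\<epsilon> + y) ^ n * exp (c * (\<epsilon> + y)) * exp (- \<epsilon> * y\<^sup>2) \<le> exp ((real n + c) * \<epsilon> + q\<^sup>2 / (4 * \<epsilon>)) * exp (- y)" if y: "0 \<le> y" for y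
  proof -
    have "\<epsilon> + y \<le> exp (\<epsilon> + y)" using exp_ge_add_one_self[of "\<epsilon> + y"] by linarith
    then have "(\<epsilon> + y) ^ n \<le> exp (\<epsilon> + y) ^ n" using assms y by (intro power_mono) auto
    also have "\<dots> = exp (real n * (\<epsilon> + y))" by (simp add: exp_of_nat_mult)
    finally have "(\<epsilon> + y) ^ n * exp (c * (\<epsilon> + y)) * exp (- \<epsilon> * y\<^sup>2) \<le> exp (real n * (\<epsilon> + y)) * exp (c * (\<epsilon> + y)) * exp (- \<epsilon> * y\<^sup>2)"
      by (intro mult_right_mono) auto
    also have "\<dots> = exp (real n * (\<epsilon> + y) + c * (\<epsilon> + y) - \<epsilon> * y\<^sup>2)" by (simp add: exp_add exp_diff exp_minus field_simps)
    also have "\<dots> \<le> exp ((real n + c) * \<epsilon> + q\<^sup>2 / (4 * \<epsilon>) - y)"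
    proof -
      have "0 \<le> \<epsilon> * (y - q / (2 * \<epsilon>))\<^sup>2" using assms by simp
      also have "\<dots> = \<epsilon> * y\<^sup>2 - q * y + q\<^sup>2 / (4 * \<epsilon>)"
        using assms by (simp add: power2_eq_square field_simps)
      finally show ?thesis by (simp add: q_def algebra_simps)
    qed
    finally show ?thesis by (simp add: exp_diff exp_minus field_simps)
  qed
  then show thesis by (intro that[of "exp ((real n + c) * \<epsilon> + q\<^sup>2 / (4 * \<epsilon>))"]) auto
qed

lemma set_integrable_exp_decay: "set_integrable lborel {0..} (\<lambda>y :: real. C * exp (- y))"
proof -
  have "(\<lambda>y :: real. exp (- 1 * y)) absolutely_integrable_on {0..}"
    by (rule nonnegative_absolutely_integrable_1) (use integrable_on_exp_minus_to_infinity[of 1 0] in auto)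
  then have "set_integrable lebesgue {0..} (\<lambda>y :: real. exp (- y))" by simp
  then have "set_integrable lborel {0..} (\<lambda>y :: real. exp (- y))"
    unfolding set_integrable_def by (subst (asm) integrable_completion) auto
  then show ?thesis by (rule set_integrable_mult_right)
qed

lemma set_integrable_of_bound:
  fixes f :: "real \<Rightarrow> 'a :: {banach, second_countable_topology}"
  assumes "f \<in> borel_measurable borel" "\<And>y. 0 \<le> y \<Longrightarrow> norm (f y) \<le> C * exp (- y)"
  shows "set_integrable lborel {0..} f"
proof (rule set_integrable_bound[OF set_integrable_exp_decay[of C]])
  show "set_borel_measurable lborel {0..} f"
    unfolding set_borel_measurable_def using assms(1) by auto
  show "AE y in lborel. y \<in> {0..} \<longrightarrow> norm (f y) \<le> norm (C * exp (- y))"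
    using assms(2) by (intro AE_I2 impI order_trans[OF _ abs_ge_self[of "C * exp (- _)", folded real_norm_def]]) auto
qed

lemma cmod_Complex_le: "0 \<le> a \<Longrightarrow> 0 \<le> y \<Longrightarrow> cmod (Complex a y) \<le> a + y"
  using cmod_le[of "Complex a y"] by simp

lemma continuous_on_Complex [continuous_intros]: "continuous_on S f \<Longrightarrow> continuous_on S (\<lambda>y. Complex a (f y))"
proof -
  have e: "Complex a = (\<lambda>y. of_real a + \<i> * of_real y)" by (auto simp: complex_eq_iff)
  show "continuous_on S f \<Longrightarrow> continuous_on S (\<lambda>y. Complex a (f y))" unfolding e by (intro continuous_intros)
qed

lemma measurable_airy_fun [measurable]: "(\<lambda>y. Complex a y ^ n * airy_fun x (Complex a y)) \<in> borel_measurable borel"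
  unfolding airy_fun_def by (intro borel_measurable_continuous_onI continuous_intros) auto

text \<open>On Re w = \<epsilon> the modulus contains exp (- \<epsilon> y^2), which absorbs powers
  of w and exponentials of its modulus; x enters the modulus only through exp (- \<epsilon>
  x).\<close>

lemma airy_int_bound:
  assumes e: "\<epsilon> > 0"
  obtains C where "\<And>x y. 0 \<le> y \<Longrightarrow> norm (Complex \<epsilon> y ^ n * airy_fun x (Complex \<epsilon> y)) * exp (c * cmod (Complex \<epsilon> y)) \<le> C * exp (- \<epsilon> * x) * exp (- y)"
proof -
  obtain C where C: "0 \<le> C" "\<And>y. 0 \<le> y \<Longrightarrow> (\<epsilon> + y) ^ n * exp (\<bar>c\<bar> * (\<epsilon> + y)) * exp (- \<epsilon> * y\<^sup>2) \<le> C * exp (- y)"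
    using gauss_bound[of \<epsilon> "\<bar>c\<bar>" n] e by auto
  have "norm (Complex \<epsilon> y ^ n * airy_fun x (Complex \<epsilon> y)) * exp (c * cmod (Complex \<epsilon> y)) \<le> (exp (\<epsilon> ^ 3 / 3) * C) * exp (- \<epsilon> * x) * exp (- y)"
    if y: "0 \<le> y" for x y
  proof -
    have m: "cmod (Complex \<epsilon> y) \<le> \<epsilon> + y" using e y by (intro cmod_Complex_le) auto
    have "c * cmod (Complex \<epsilon> y) \<le> \<bar>c\<bar> * (\<epsilon> + y)"
      using m by (intro mult_mono) auto
    then have "norm (Complex \<epsilon> y ^ n * airy_fun x (Complex \<epsilon> y)) * exp (c * cmod (Complex \<epsilon> y)) \<le>
       ((\<epsilon> + y) ^ n * exp (\<epsilon> ^ 3 / 3 - \<epsilon> * y\<^sup>2 - x * \<epsilon>)) * exp (\<bar>c\<bar> * (\<epsilon> + y))"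
      unfolding norm_mult norm_power norm_airy_fun using m e y by (intro mult_mono power_mono) auto
    also have "\<dots> = exp (\<epsilon> ^ 3 / 3) * exp (- \<epsilon> * x) * ((\<epsilon> + y) ^ n * exp (\<bar>c\<bar> * (\<epsilon> + y)) * exp (- \<epsilon> * y\<^sup>2))"
    proof -
      have "exp (\<epsilon> ^ 3 / 3 - \<epsilon> * y\<^sup>2 - x * \<epsilon>) = exp (\<epsilon> ^ 3 / 3) * exp (- \<epsilon> * x) * exp (- \<epsilon> * y\<^sup>2)"
        by (simp add: exp_add[symmetric] algebra_simps)
      then show ?thesis by (simp only: mult_ac)
    qed
    also have "\<dots> \<le> exp (\<epsilon> ^ 3 / 3) * exp (- \<epsilon> * x) * (C * exp (- y))"
      by (intro mult_left_mono C y) auto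
    finally show ?thesis by (simp add: mult_ac)
  qed
  then show thesis by (rule that)
qed

lemma airy_int_integrable:
  assumes "\<epsilon> > 0"
  shows "set_integrable lborel {0..} (\<lambda>y. Complex \<epsilon> y ^ n * airy_fun x (Complex \<epsilon> y))"
proof -
  obtain C where C: "\<And>x y. 0 \<le> y \<Longrightarrow> norm (Complex \<epsilon> y ^ n * airy_fun x (Complex \<epsilon> y)) * exp (0 * cmod (Complex \<epsilon> y)) \<le> C * exp (- \<epsilon> * x) * exp (- y)"
    using airy_int_bound[OF assms, of n 0] by blast
  show ?thesis
    by (rule set_integrable_of_bound[of _ "C * exp (- \<epsilon> * x)"]) (use C in simp_all)
qed

lemma airy_int_decay:
  assumes "\<epsilon> > 0"
  obtains C where "0 \<le> C" "\<And>x. norm (airy_int \<epsilon> n x) \<le> C * exp (- \<epsilon> * x)"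
proof -
  obtain C where C: "\<And>x y. 0 \<le> y \<Longrightarrow> norm (Complex \<epsilon> y ^ n * airy_fun x (Complex \<epsilon> y)) * exp (0 * cmod (Complex \<epsilon> y)) \<le> C * exp (- \<epsilon> * x) * exp (- y)"
    using airy_int_bound[OF assms, of n 0] by blast
  define I where "I = (LINT y:{0..}|lborel. exp (- y) :: real)"
  have I0: "0 \<le> I" unfolding I_def set_lebesgue_integral_def by (intro Bochner_Integration.integral_nonneg) auto
  have "norm (airy_int \<epsilon> n x) \<le> (C * I) * exp (- \<epsilon> * x)" for x
  proof -
    have "norm (airy_int \<epsilon> n x) \<le> (LINT y:{0..}|lborel. norm (Complex \<epsilon> y ^ n * airy_fun x (Complex \<epsilon> y)))"
      unfolding airy_int_def by (rule set_integral_norm_bound[OF airy_int_integrable[OF assms]])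
    also have "\<dots> \<le> (LINT y:{0..}|lborel. C * exp (- \<epsilon> * x) * exp (- y))"
      by (rule set_integral_mono) (use C in \<open>auto intro!: set_integrable_norm airy_int_integrable assms set_integrable_exp_decay\<close>)
    also have "\<dots> = (C * I) * exp (- \<epsilon> * x)" by (simp add: I_def)
    finally show ?thesis .
  qed
  moreover have "0 \<le> C"
  proof -
    have "0 \<le> C * exp (- \<epsilon> * 0) * exp (- 0)"
      by (rule order_trans[OF _ C[of 0 0]]) auto
    then show ?thesis by simp
  qed
  ultimately show thesis using I0 by (intro that[of "C * I"]) auto
qed

lemma exp_quadratic_remainder:
  fixes z :: complex
  shows "norm (exp z - 1 - z) \<le> (norm z)\<^sup>2 * exp (norm z)"
proof -
  have "norm (exp z - (\<Sum>i\<le>1. z ^ i / fact i)) \<le> exp \<bar>Re z\<bar> * norm z ^ Suc 1 / fact 1"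
    by (rule Taylor_exp)
  also have "\<dots> \<le> (norm z)\<^sup>2 * exp (norm z)"
    using abs_Re_le_cmod[of z] by (simp add: power2_eq_square mult_ac mult_left_mono)
  finally show ?thesis by (simp add: algebra_simps)
qed

text \<open>Differentiation under the integral with the explicit remainder of exp: its quadratic
  bound costs two more powers of w and the exponential of the modulus of w.\<close>

lemma airy_int_derivative:
  assumes "\<epsilon> > 0"
  shows "((airy_int \<epsilon> n) has_vector_derivative - airy_int \<epsilon> (Suc n) x) (at x)"
proof -
  obtain C where C: "\<And>x y. 0 \<le> y \<Longrightarrow> norm (Complex \<epsilon> y ^ (n + 2) * airy_fun x (Complex \<epsilon> y)) * exp (1 * cmod (Complex \<epsilon> y)) \<le> C * exp (- \<epsilon> * x) * exp (- y)"
    using airy_int_bound[OF assms, of "n + 2" 1] by blast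
  define I where "I = (LINT y:{0..}|lborel. exp (- y) :: real)"
  let ?g = "\<lambda>n x y. Complex \<epsilon> y ^ n * airy_fun x (Complex \<epsilon> y)"
  have bnd: "norm (airy_int \<epsilon> n (x + h) - airy_int \<epsilon> n x + of_real h * airy_int \<epsilon> (Suc n) x) \<le> C * exp (- \<epsilon> * x) * I * h\<^sup>2"
    if h: "\<bar>h\<bar> \<le> 1" for h
  proof -
    have pw: "norm (?g n (x + h) y - ?g n x y + of_real h * ?g (Suc n) x y) \<le> (C * exp (- \<epsilon> * x) * h\<^sup>2) * exp (- y)"
      if y: "0 \<le> y" for y
    proof -
      define w where "w = Complex \<epsilon> y"
      define z where "z = - of_real h * w"
      have nz: "norm z \<le> 1 * norm w" unfolding z_def norm_mult norm_minus_cancel norm_of_real using h by (intro mult_right_mono) auto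
      have e: "airy_fun (x + h) w = airy_fun x w * exp z"
        unfolding airy_fun_def exp_add[symmetric] z_def
        by (rule arg_cong[of _ _ exp]) (simp add: algebra_simps)
      have "w ^ n * airy_fun (x + h) w - w ^ n * airy_fun x w + of_real h * (w ^ Suc n * airy_fun x w) = w ^ n * airy_fun x w * (exp z - 1 - z)"
        unfolding e power_Suc by (simp add: z_def algebra_simps)
      then have "norm (w ^ n * airy_fun (x + h) w - w ^ n * airy_fun x w + of_real h * (w ^ Suc n * airy_fun x w)) \<le> norm (w ^ n * airy_fun x w) * ((norm z)\<^sup>2 * exp (norm z))"
        by (simp only: norm_mult[of "w ^ n * airy_fun x w"]) (intro mult_left_mono exp_quadratic_remainder, auto)
      also have "\<dots> \<le> norm (w ^ n * airy_fun x w) * ((norm z)\<^sup>2 * exp (1 * norm w))"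
        using nz by (intro mult_left_mono) auto
      also have "\<dots> = h\<^sup>2 * (norm (w ^ (n + 2) * airy_fun x w) * exp (1 * norm w))"
        unfolding z_def by (simp add: norm_mult norm_power power_mult_distrib power_add power2_eq_square)
      also have "\<dots> \<le> h\<^sup>2 * (C * exp (- \<epsilon> * x) * exp (- y))"
        using C[OF y, of x] unfolding w_def by (intro mult_left_mono) auto
      finally show ?thesis by (simp add: w_def mult_ac)
    qed
    have int: "set_integrable lborel {0..} (\<lambda>y. ?g n (x + h) y - ?g n x y + of_real h * ?g (Suc n) x y)"
      by (intro set_integral_add set_integral_diff airy_int_integrable assms set_integrable_mult_right)
    have eq: "airy_int \<epsilon> n (x + h) - airy_int \<epsilon> n x + of_real h * airy_int \<epsilon> (Suc n) x =
      (LINT y:{0..}|lborel. ?g n (x + h) y - ?g n x y + of_real h * ?g (Suc n) x y)"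
    proof -
      note i = airy_int_integrable[OF assms]
      have "(LINT y:{0..}|lborel. ?g n (x + h) y - ?g n x y + of_real h * ?g (Suc n) x y) =
          (LINT y:{0..}|lborel. ?g n (x + h) y - ?g n x y) + (LINT y:{0..}|lborel. of_real h * ?g (Suc n) x y)"
        by (rule set_integral_add(2)) (intro set_integral_diff i set_integrable_mult_right)+
      also have "(LINT y:{0..}|lborel. ?g n (x + h) y - ?g n x y) = (LINT y:{0..}|lborel. ?g n (x + h) y) - (LINT y:{0..}|lborel. ?g n x y)"
        by (rule set_integral_diff(2)[OF i i])
      also have "(LINT y:{0..}|lborel. of_real h * ?g (Suc n) x y) = of_real h * (LINT y:{0..}|lborel. ?g (Suc n) x y)"
        by (rule set_integral_mult_right)
      finally show ?thesis by (simp only: airy_int_def)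
    qed
    have "norm (airy_int \<epsilon> n (x + h) - airy_int \<epsilon> n x + of_real h * airy_int \<epsilon> (Suc n) x) \<le>
        (LINT y:{0..}|lborel. norm (?g n (x + h) y - ?g n x y + of_real h * ?g (Suc n) x y))"
      unfolding eq by (rule set_integral_norm_bound[OF int])
    also have "\<dots> \<le> (LINT y:{0..}|lborel. (C * exp (- \<epsilon> * x) * h\<^sup>2) * exp (- y))"
    proof (rule set_integral_mono)
      show "set_integrable lborel {0..} (\<lambda>y. norm (?g n (x + h) y - ?g n x y + of_real h * ?g (Suc n) x y))"
        by (rule set_integrable_norm[OF int])
      show "set_integrable lborel {0..} (\<lambda>y. (C * exp (- \<epsilon> * x) * h\<^sup>2) * exp (- y))"
        by (rule set_integrable_exp_decay)
      show "norm (?g n (x + h) y - ?g n x y + of_real h * ?g (Suc n) x y) \<le> (C * exp (- \<epsilon> * x) * h\<^sup>2) * exp (- y)"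
        if "y \<in> {0..}" for y
        using that by (intro pw) simp
    qed
    also have "\<dots> = (C * exp (- \<epsilon> * x) * h\<^sup>2) * I" unfolding I_def by (rule set_integral_mult_right)
    also have "\<dots> = C * exp (- \<epsilon> * x) * I * h\<^sup>2" by (simp only: mult_ac)
    finally show ?thesis .
  qed
  show ?thesis
    unfolding has_vector_derivative_def has_derivative_at
  proof (intro conjI bounded_linear_scaleR_left)
    let ?K = "C * exp (- \<epsilon> * x) * I"
    show "(\<lambda>h. norm (airy_int \<epsilon> n (x + h) - airy_int \<epsilon> n x - h *\<^sub>R - airy_int \<epsilon> (Suc n) x) / norm h) \<midarrow>0\<rightarrow> 0"
    proof (rule Lim_null_comparison)
      show "((\<lambda>h. ?K * \<bar>h\<bar>) \<longlongrightarrow> 0) (at 0)" by (auto intro!: tendsto_eq_intros)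
      have "\<forall>\<^sub>F h in at (0 :: real). h \<in> {-1<..<1}" by (intro eventually_at_topological[THEN iffD2] exI[of _ "{-1<..<1}"]) auto
      then show "\<forall>\<^sub>F h in at 0. norm (norm (airy_int \<epsilon> n (x + h) - airy_int \<epsilon> n x - h *\<^sub>R - airy_int \<epsilon> (Suc n) x) / norm h) \<le> ?K * \<bar>h\<bar>"
      proof eventually_elim
        case (elim h)
        define d where "d = norm (airy_int \<epsilon> n (x + h) - airy_int \<epsilon> n x + of_real h * airy_int \<epsilon> (Suc n) x)"
        have "d \<le> ?K * (\<bar>h\<bar> * \<bar>h\<bar>)" using bnd[of h] elim by (auto simp: d_def power2_eq_square abs_le_iff)
        then have "d / \<bar>h\<bar> \<le> ?K * \<bar>h\<bar>" by (cases "h = 0") (auto simp: divide_le_eq mult.assoc)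
        moreover have "norm (airy_int \<epsilon> n (x + h) - airy_int \<epsilon> n x - h *\<^sub>R - airy_int \<epsilon> (Suc n) x) = d"
          by (simp add: d_def scaleR_conv_of_real)
        moreover have "0 \<le> d" by (simp add: d_def)
        ultimately show ?case by simp
      qed
    qed
  qed
qed


text \<open>An entire primitive shifts the contour from the imaginary axis to \<open>Re w = \<epsilon>\<close>.\<close>

lemma airy_primitive:
  obtains G where "\<And>w. (G has_field_derivative airy_fun x w) (at w)"
proof -
  have "airy_fun x holomorphic_on UNIV" unfolding airy_fun_def by (intro holomorphic_intros) auto
  then obtain G where "\<And>w. w \<in> UNIV \<Longrightarrow> (G has_field_derivative airy_fun x w) (at w within UNIV)"
    by (rule holomorphic_convex_primitive'[OF convex_UNIV open_UNIV]) blast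
  then show thesis using that by auto
qed

lemma airy_primitive_vertical:
  assumes "\<And>w. (G has_field_derivative airy_fun x w) (at w)" "0 \<le> T"
  shows "((\<lambda>y. airy_fun x (Complex a y)) has_integral (G (Complex a T) - G (Complex a 0)) / \<i>) {0..T}"
proof -
  have e: "Complex a y = of_real a + \<i> * of_real y" for y by (simp add: complex_eq_iff)
  have "((\<lambda>y. G (Complex a y)) has_vector_derivative \<i> * airy_fun x (Complex a y)) (at y within {0..T})" for y
  proof -
    have "((\<lambda>y. Complex a y) has_vector_derivative \<i>) (at y within {0..T})"
      unfolding e by (auto intro!: derivative_eq_intros simp: has_vector_derivative_def scaleR_conv_of_real mult.commute)
    from field_vector_diff_chain_within[OF this has_field_derivative_at_within[OF assms(1)]]
    show ?thesis by (simp add: o_def mult.commute)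
  qed
  then have "((\<lambda>y. \<i> * airy_fun x (Complex a y)) has_integral (G (Complex a T) - G (Complex a 0))) {0..T}"
    by (intro fundamental_theorem_of_calculus assms)
  from has_integral_mult_right[OF this, of "1 / \<i>"] show ?thesis by simp
qed

lemma airy_primitive_horizontal:
  assumes "\<And>w. (G has_field_derivative airy_fun x w) (at w)" "0 \<le> \<epsilon>"
  shows "((\<lambda>a. airy_fun x (Complex a T)) has_integral (G (Complex \<epsilon> T) - G (Complex 0 T))) {0..\<epsilon>}"
proof -
  have e: "Complex a T = of_real a + \<i> * of_real T" for a by (simp add: complex_eq_iff)
  have "((\<lambda>a. G (Complex a T)) has_vector_derivative airy_fun x (Complex a T)) (at a within {0..\<epsilon>})" for a
  proof -
    have "((\<lambda>a. Complex a T) has_vector_derivative 1) (at a within {0..\<epsilon>})"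
      unfolding e by (auto intro!: derivative_eq_intros simp: has_vector_derivative_def scaleR_conv_of_real)
    from field_vector_diff_chain_within[OF this has_field_derivative_at_within[OF assms(1)]]
    show ?thesis by (simp add: o_def)
  qed
  then show ?thesis by (intro fundamental_theorem_of_calculus assms)
qed

text \<open>For 0 \<le> a \<le> \<epsilon> the integrand at height T is O(exp (- T^2 a)), so the
  connecting segment contributes O(1 / T^2).\<close>

lemma airy_horizontal_tendsto:
  assumes G: "\<And>w. (G has_field_derivative airy_fun x w) (at w)" and e: "0 < \<epsilon>"
  shows "((\<lambda>T. G (Complex \<epsilon> T) - G (Complex 0 T)) \<longlongrightarrow> 0) at_top"
proof (rule Lim_null_comparison)
  define K where "K = exp (\<epsilon> ^ 3 / 3 + \<bar>x\<bar> * \<epsilon>)"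
  have "norm (G (Complex \<epsilon> T) - G (Complex 0 T)) \<le> K / T\<^sup>2" if T: "T > 0" for T
  proof -
    have hi: "((\<lambda>a. K * exp (- (T\<^sup>2 * a))) has_integral (- (K / T\<^sup>2) * exp (- (T\<^sup>2 * \<epsilon>)) - - (K / T\<^sup>2) * exp (- (T\<^sup>2 * 0)))) {0..\<epsilon>}"
      by (rule fundamental_theorem_of_calculus)
         (use e T in \<open>auto intro!: derivative_eq_intros simp flip: has_real_derivative_iff_has_vector_derivative simp: field_simps\<close>)
    have "norm (G (Complex \<epsilon> T) - G (Complex 0 T)) \<le> - (K / T\<^sup>2) * exp (- (T\<^sup>2 * \<epsilon>)) - - (K / T\<^sup>2) * exp (- (T\<^sup>2 * 0))"
    proof -
      have pw: "norm (airy_fun x (Complex a T)) \<le> K * exp (- (T\<^sup>2 * a))" if a: "a \<in> {0..\<epsilon>}" for a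
      proof -
      have "a ^ 3 / 3 - a * T\<^sup>2 - x * a \<le> (\<epsilon> ^ 3 / 3 + \<bar>x\<bar> * \<epsilon>) - T\<^sup>2 * a"
      proof -
        have "a ^ 3 \<le> \<epsilon> ^ 3" using a by (intro power_mono) auto
        moreover have "- (x * a) \<le> \<bar>x\<bar> * \<epsilon>"
          using a mult_mono[of "\<bar>x\<bar>" "\<bar>x\<bar>" a \<epsilon>] abs_ge_minus_self[of "x * a"] by (simp add: abs_mult)
        ultimately show ?thesis by (simp add: mult.commute)
      qed
      then show ?thesis
        unfolding norm_airy_fun K_def exp_add[symmetric] by simp
      qed
      have hp: "((\<lambda>a. airy_fun x (Complex a T)) has_integral (G (Complex \<epsilon> T) - G (Complex 0 T))) {0..\<epsilon>}"
        using airy_primitive_horizontal[OF G] e by simp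
      have "norm (integral {0..\<epsilon>} (\<lambda>a. airy_fun x (Complex a T))) \<le> integral {0..\<epsilon>} (\<lambda>a. K * exp (- (T\<^sup>2 * a)))"
        using pw hp hi by (intro integral_norm_bound_integral) (auto simp: integrable_on_def)
      then show ?thesis using hp hi by (simp only: integral_unique)
    qed
    also have "\<dots> \<le> K / T\<^sup>2" by (simp add: K_def)
    finally show ?thesis .
  qed
  then show "\<forall>\<^sub>F T in at_top. norm (G (Complex \<epsilon> T) - G (Complex 0 T)) \<le> K / T\<^sup>2"
    by (intro eventually_mono[OF eventually_gt_at_top[of 0]]) auto
  show "((\<lambda>T. K / T\<^sup>2) \<longlongrightarrow> 0) at_top" by real_asymp
qed

text \<open>The freedom in \<epsilon> is used later: \<epsilon> = 1 for the bounds and the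
  differential equation, \<epsilon> = \<sigma> for the contour of steepest descent.\<close>

theorem airy_eq_Re_airy_int:
  assumes e: "0 < \<epsilon>"
  shows "airy x = Re (airy_int \<epsilon> 0 x) / pi"
proof -
  obtain G where G: "\<And>w. (G has_field_derivative airy_fun x w) (at w)" using airy_primitive by blast
  have z0: "Complex 0 0 = 0" by (simp add: complex_eq_iff)
  have cos_int: "integral {0..T} (\<lambda>t. cos (t ^ 3 / 3 + x * t)) = Re ((G (Complex 0 T) - G 0) / \<i>)" if "0 \<le> T" for T
  proof -
    have "((\<lambda>y. Re (airy_fun x (Complex 0 y))) has_integral Re ((G (Complex 0 T) - G (Complex 0 0)) / \<i>)) {0..T}"
      using has_integral_linear[OF airy_primitive_vertical[OF G that] bounded_linear_Re] by (simp add: o_def)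
    moreover have "Re (airy_fun x (Complex 0 y)) = cos (y ^ 3 / 3 + x * y)" for y
    proof -
      have "Complex 0 y ^ 3 / 3 - of_real x * Complex 0 y = \<i> * of_real (- (y ^ 3 / 3 + x * y))"
        by (simp add: complex_eq_iff power3_eq_cube)
      then have "airy_fun x (Complex 0 y) = exp (\<i> * of_real (- (y ^ 3 / 3 + x * y)))" by (simp only: airy_fun_def)
      moreover have "cos (- (y ^ 3 / 3 + x * y)) = cos (y ^ 3 / 3 + x * y)" by (rule cos_minus)
      ultimately show ?thesis by (simp only: Re_exp) (simp del: minus_add_distrib)
    qed
    ultimately show ?thesis by (simp add: integral_unique z0)
  qed
  \<comment> \<open>The increment of the primitive along the real axis is real; divided by the
    imaginary unit it disappears from the real part.\<close>
  have real_G: "Im (G (Complex \<epsilon> 0) - G 0) = 0"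
  proof -
    have "((\<lambda>a. Im (airy_fun x (Complex a 0))) has_integral Im (G (Complex \<epsilon> 0) - G (Complex 0 0))) {0..\<epsilon>}"
      using has_integral_linear[OF airy_primitive_horizontal[OF G, of \<epsilon> 0] bounded_linear_Im] e by (simp add: o_def)
    moreover have "Im (airy_fun x (Complex a 0)) = 0" for a
    proof -
      have e: "Complex a 0 = of_real a" by (simp add: complex_eq_iff)
      have "airy_fun x (Complex a 0) = exp (of_real (a ^ 3 / 3 - x * a))" unfolding airy_fun_def e by simp
      then show ?thesis by (simp only: exp_of_real Im_complex_of_real)
    qed
    ultimately show ?thesis using has_integral_unique[of _ _ "{0..\<epsilon>}" 0] has_integral_0[of "{0..\<epsilon>}"] by (simp add: z0)
  qed
  have "((\<lambda>T. (G (Complex \<epsilon> T) - G (Complex \<epsilon> 0)) / \<i>) \<longlongrightarrow> airy_int \<epsilon> 0 x) at_top"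
  proof -
    have i: "set_integrable lborel {0..} (\<lambda>y. airy_fun x (Complex \<epsilon> y))"
      using airy_int_integrable[OF e, of 0 x] by simp
    have "((\<lambda>T. LINT y:{0..T}|lborel. airy_fun x (Complex \<epsilon> y)) \<longlongrightarrow> (LINT y:{0..}|lborel. airy_fun x (Complex \<epsilon> y))) at_top"
      by (rule tendsto_set_lebesgue_integral_at_top) (use i in \<open>auto intro: set_integrable_subset\<close>)
    moreover have "(LINT y:{0..T}|lborel. airy_fun x (Complex \<epsilon> y)) = (G (Complex \<epsilon> T) - G (Complex \<epsilon> 0)) / \<i>" if "0 \<le> T" for T
    proof -
      have "set_integrable lborel {0..T} (\<lambda>y. airy_fun x (Complex \<epsilon> y))" by (rule set_integrable_subset[OF i]) auto
      then have "(LINT y:{0..T}|lborel. airy_fun x (Complex \<epsilon> y)) = integral {0..T} (\<lambda>y. airy_fun x (Complex \<epsilon> y))"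
        by (rule set_borel_integral_eq_integral(2))
      then show ?thesis using airy_primitive_vertical[OF G that, of \<epsilon>] by (simp add: integral_unique)
    qed
    ultimately show ?thesis unfolding airy_int_def
      by (simp only: power_0 mult_1_left) (rule Lim_transform_eventually, assumption, auto intro!: eventually_mono[OF eventually_ge_at_top[of 0]])
  qed
  then have "((\<lambda>T. Re ((G (Complex \<epsilon> T) - G (Complex \<epsilon> 0)) / \<i> - (G (Complex \<epsilon> T) - G (Complex 0 T)) / \<i> + (G (Complex \<epsilon> 0) - G 0) / \<i>)) \<longlongrightarrow>
       Re (airy_int \<epsilon> 0 x - 0 / \<i> + (G (Complex \<epsilon> 0) - G 0) / \<i>)) at_top"
    by (intro tendsto_intros airy_horizontal_tendsto[OF G e]) auto
  also have "Re (airy_int \<epsilon> 0 x - 0 / \<i> + (G (Complex \<epsilon> 0) - G 0) / \<i>) = Re (airy_int \<epsilon> 0 x)"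
    using real_G by (simp add: divide_complex_def)
  finally have "((\<lambda>T. Re ((G (Complex 0 T) - G 0) / \<i>)) \<longlongrightarrow> Re (airy_int \<epsilon> 0 x)) at_top"
    by (simp add: diff_divide_distrib add_divide_distrib algebra_simps)
  then have "((\<lambda>T. integral {0..T} (\<lambda>t. cos (t ^ 3 / 3 + x * t))) \<longlongrightarrow> Re (airy_int \<epsilon> 0 x)) at_top"
    by (rule Lim_transform_eventually) (auto intro!: eventually_mono[OF eventually_ge_at_top[of 0]] simp: cos_int)
  then show ?thesis unfolding airy_def by (simp add: tendsto_Lim trivial_limit_at_top_linorder)
qed


section \<open>The Airy equation and the product formula for the kernel\<close>

lemma airy_bound: obtains C where "0 \<le> C" "\<And>x. \<bar>airy x\<bar> \<le> C * exp (- x)"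
proof -
  obtain C where C: "0 \<le> C" "\<And>x. norm (airy_int 1 0 x) \<le> C * exp (- 1 * x)"
    using airy_int_decay[of 1 0] by auto
  have "\<bar>airy x\<bar> \<le> C / pi * exp (- x)" for x
    using order_trans[OF abs_Re_le_cmod C(2)[of x]] by (simp add: airy_eq_Re_airy_int[of 1] divide_right_mono)
  then show thesis using C(1) by (intro that[of "C / pi"]) auto
qed

lemma Re_airy_int_derivative:
  "((\<lambda>x. Re (airy_int 1 n x) / pi) has_real_derivative - Re (airy_int 1 (Suc n) x) / pi) (at x)"
proof -
  have "((\<lambda>x. Re (airy_int 1 n x)) has_vector_derivative Re (- airy_int 1 (Suc n) x)) (at x)"
    by (rule bounded_linear.has_vector_derivative[OF bounded_linear_Re airy_int_derivative]) simp
  then have "((\<lambda>x. Re (airy_int 1 n x)) has_real_derivative - Re (airy_int 1 (Suc n) x)) (at x)"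
    by (simp add: has_real_derivative_iff_has_vector_derivative)
  then show ?thesis by (rule DERIV_cdivide)
qed

lemma deriv_airy: "deriv airy x = - Re (airy_int 1 1 x) / pi"
  and airy_has_derivative: "(airy has_real_derivative deriv airy x) (at x)"
proof -
  have e: "airy = (\<lambda>x. Re (airy_int 1 0 x) / pi)" by (rule ext) (rule airy_eq_Re_airy_int, simp)
  have "(airy has_real_derivative - Re (airy_int 1 1 x) / pi) (at x)"
    unfolding e using Re_airy_int_derivative[of 0 x] by simp
  then show "deriv airy x = - Re (airy_int 1 1 x) / pi" "(airy has_real_derivative deriv airy x) (at x)"
    by (auto simp: DERIV_imp_deriv)
qed

text \<open>The integrand times w^2 - x is the derivative of \<open>airy_fun\<close> in w. The
  boundary value at the real point w = 1 is real, and integration in y instead of w makes it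
  imaginary.\<close>

lemma airy_int_ode: "Re (airy_int 1 2 x) = x * Re (airy_int 1 0 x)"
proof -
  let ?f = "\<lambda>y. Complex 1 y ^ 2 * airy_fun x (Complex 1 y) - of_real x * (Complex 1 y ^ 0 * airy_fun x (Complex 1 y))"
  have i: "set_integrable lborel {0..} ?f"
    by (intro set_integral_diff airy_int_integrable set_integrable_mult_right) auto
  have e: "Complex 1 y = 1 + \<i> * of_real y" for y by (simp add: complex_eq_iff)
  have d: "((\<lambda>y. airy_fun x (Complex 1 y)) has_vector_derivative \<i> * ?f y) (at y within S)" for y S
  proof -
    have 1: "((\<lambda>y. Complex 1 y) has_vector_derivative \<i>) (at y within S)"
      unfolding e by (auto intro!: derivative_eq_intros simp: has_vector_derivative_def scaleR_conv_of_real mult.commute)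
    have "(airy_fun x has_field_derivative (w\<^sup>2 - of_real x) * airy_fun x w) (at w)" for w
      unfolding airy_fun_def by (auto intro!: derivative_eq_intros)
    from field_vector_diff_chain_within[OF 1 has_field_derivative_at_within[OF this]]
    show ?thesis by (simp add: o_def algebra_simps)
  qed
  have F: "(LINT y:{0..T}|lborel. ?f y) = (airy_fun x (Complex 1 T) - airy_fun x (Complex 1 0)) / \<i>" if "0 \<le> T" for T
  proof -
    have "((\<lambda>y. \<i> * ?f y) has_integral (airy_fun x (Complex 1 T) - airy_fun x (Complex 1 0))) {0..T}"
      using d by (intro fundamental_theorem_of_calculus that) auto
    from has_integral_mult_right[OF this, of "1 / \<i>"]
    have hi: "(?f has_integral (airy_fun x (Complex 1 T) - airy_fun x (Complex 1 0)) / \<i>) {0..T}" by simp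
    have "set_integrable lborel {0..T} ?f" by (rule set_integrable_subset[OF i]) auto
    from set_borel_integral_eq_integral(2)[OF this] show ?thesis unfolding integral_unique[OF hi] .
  qed
  have "((\<lambda>T. LINT y:{0..T}|lborel. ?f y) \<longlongrightarrow> (LINT y:{0..}|lborel. ?f y)) at_top"
    by (rule tendsto_set_lebesgue_integral_at_top) (use i in \<open>auto intro: set_integrable_subset\<close>)
  moreover have "((\<lambda>T. (airy_fun x (Complex 1 T) - airy_fun x (Complex 1 0)) / \<i>) \<longlongrightarrow> (0 - airy_fun x (Complex 1 0)) / \<i>) at_top"
  proof (intro tendsto_intros)
    have "((\<lambda>T. norm (airy_fun x (Complex 1 T))) \<longlongrightarrow> 0) at_top"
      unfolding norm_airy_fun by real_asymp
    then show "((\<lambda>T. airy_fun x (Complex 1 T)) \<longlongrightarrow> 0) at_top" by (rule tendsto_norm_zero_cancel)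
  qed auto
  then have "((\<lambda>T. LINT y:{0..T}|lborel. ?f y) \<longlongrightarrow> (0 - airy_fun x (Complex 1 0)) / \<i>) at_top"
    by (rule Lim_transform_eventually) (rule eventually_mono[OF eventually_ge_at_top[of 0]], rule F[symmetric])
  ultimately have "(LINT y:{0..}|lborel. ?f y) = (0 - airy_fun x (Complex 1 0)) / \<i>"
    by (intro tendsto_unique[OF trivial_limit_at_top_linorder])
  moreover have "(LINT y:{0..}|lborel. ?f y) = airy_int 1 2 x - of_real x * airy_int 1 0 x"
  proof -
    have "(LINT y:{0..}|lborel. ?f y) = (LINT y:{0..}|lborel. Complex 1 y ^ 2 * airy_fun x (Complex 1 y))
       - (LINT y:{0..}|lborel. of_real x * (Complex 1 y ^ 0 * airy_fun x (Complex 1 y)))"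
      by (intro set_integral_diff(2) airy_int_integrable set_integrable_mult_right) auto
    then show ?thesis by (simp only: airy_int_def set_integral_mult_right)
  qed
  moreover have "airy_fun x (Complex 1 0) = of_real (exp (1 / 3 - x))"
  proof -
    have "Complex 1 0 = 1" by (simp add: complex_eq_iff)
    then show ?thesis unfolding airy_fun_def exp_of_real[symmetric] by simp
  qed
  ultimately have "airy_int 1 2 x - of_real x * airy_int 1 0 x = \<i> * of_real (exp (1 / 3 - x))" by simp
  then have "Re (airy_int 1 2 x - of_real x * airy_int 1 0 x) = 0" by simp
  then show ?thesis by simp
qed

lemma airy_ode: "(deriv airy has_real_derivative x * airy x) (at x)"
proof -
  have e: "deriv airy = (\<lambda>x. - (Re (airy_int 1 1 x) / pi))" by (rule ext) (simp add: deriv_airy)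
  have "(deriv airy has_real_derivative - (- Re (airy_int 1 (Suc 1) x) / pi)) (at x)"
    unfolding e by (rule DERIV_minus[OF Re_airy_int_derivative])
  then show ?thesis using airy_int_ode[of x] by (simp add: airy_eq_Re_airy_int[of 1] numeral_2_eq_2)
qed

lemma isCont_airy: "isCont airy x"
  using airy_has_derivative by (rule DERIV_isCont)

lemma airy_measurable [measurable]: "airy \<in> borel_measurable borel"
  using isCont_airy by (intro borel_measurable_continuous_onI continuous_at_imp_continuous_on) auto

lemma airy_product_integrable: "set_integrable lborel {0..} (\<lambda>l. airy (x + l) * airy (y + l))"
proof -
  obtain C where C: "0 \<le> C" "\<And>x. \<bar>airy x\<bar> \<le> C * exp (- x)" using airy_bound by blast
  show ?thesis
  proof (rule set_integrable_of_bound)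
    fix l :: real assume l: "0 \<le> l"
    have "norm (airy (x + l) * airy (y + l)) \<le> (C * exp (- (x + l))) * (C * exp (- (y + l)))"
      unfolding real_norm_def abs_mult by (intro mult_mono C) (use C in auto)
    also have "\<dots> = C\<^sup>2 * exp (- x - y) * exp (- 2 * l)"
      by (simp add: power2_eq_square exp_add[symmetric] mult_ac)
    also have "\<dots> \<le> C\<^sup>2 * exp (- x - y) * exp (- l)" using l by (intro mult_left_mono) auto
    finally show "norm (airy (x + l) * airy (y + l)) \<le> C\<^sup>2 * exp (- x - y) * exp (- l)" .
  qed measurable
qed

text \<open>By the Airy equation the Wronskian W of the two shifted functions has derivative y - x
  times the integrand, and it vanishes at infinity.\<close>

lemma airy_product_integral:
  assumes "x \<noteq> y"
  shows "(LINT l:{0..}|lborel. airy (x + l) * airy (y + l)) = (airy x * deriv airy y - airy y * deriv airy x) / (x - y)"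
proof -
  define W where "W l = airy (x + l) * deriv airy (y + l) - airy (y + l) * deriv airy (x + l)" for l
  have dA: "((\<lambda>l. airy (z + l)) has_real_derivative deriv airy (z + l)) (at l)" for z l
    using airy_has_derivative[of "l + z"] unfolding DERIV_shift by (simp add: add.commute)
  have dD: "((\<lambda>l. deriv airy (z + l)) has_real_derivative (z + l) * airy (z + l)) (at l)" for z l
    using airy_ode[of "l + z"] unfolding DERIV_shift by (simp add: add.commute)
  have dW: "(W has_real_derivative (y - x) * (airy (x + l) * airy (y + l))) (at l)" for l
    unfolding W_def by (rule derivative_eq_intros dA dD refl)+ (simp add: algebra_simps)
  have F: "(LINT l:{0..T}|lborel. airy (x + l) * airy (y + l)) = (W T - W 0) / (y - x)" if "0 \<le> T" for T
  proof -
    have "((\<lambda>l. (y - x) * (airy (x + l) * airy (y + l))) has_integral (W T - W 0)) {0..T}"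
      using dW by (intro fundamental_theorem_of_calculus that)
        (auto simp: has_real_derivative_iff_has_vector_derivative intro: has_vector_derivative_at_within)
    from has_integral_mult_right[OF this, of "1 / (y - x)"] assms
    have hi: "((\<lambda>l. airy (x + l) * airy (y + l)) has_integral (W T - W 0) / (y - x)) {0..T}" by simp
    have "set_integrable lborel {0..T} (\<lambda>l. airy (x + l) * airy (y + l))"
      by (rule set_integrable_subset[OF airy_product_integrable]) auto
    from set_borel_integral_eq_integral(2)[OF this] show ?thesis unfolding integral_unique[OF hi] .
  qed
  have lim: "((\<lambda>T. LINT l:{0..T}|lborel. airy (x + l) * airy (y + l)) \<longlongrightarrow> (LINT l:{0..}|lborel. airy (x + l) * airy (y + l))) at_top"
    by (rule tendsto_set_lebesgue_integral_at_top) (use airy_product_integrable in \<open>auto intro: set_integrable_subset\<close>)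
  obtain C where C: "0 \<le> C" "\<And>n. n \<le> 1 \<Longrightarrow> \<forall>x. norm (airy_int 1 n x) \<le> C * exp (- x)"
  proof -
    obtain C0 where C0: "0 \<le> C0" "\<And>x. norm (airy_int 1 0 x) \<le> C0 * exp (- 1 * x)" using airy_int_decay[of 1 0] by auto
    obtain C1 where C1: "0 \<le> C1" "\<And>x. norm (airy_int 1 1 x) \<le> C1 * exp (- 1 * x)" using airy_int_decay[of 1 1] by auto
    have "norm (airy_int 1 n x) \<le> max C0 C1 * exp (- x)" if "n \<le> 1" for n x
    proof -
      have "n = 0 \<or> n = 1" using that by auto
      then have "norm (airy_int 1 n x) \<le> C0 * exp (- x) \<or> norm (airy_int 1 n x) \<le> C1 * exp (- x)" using C0(2) C1(2) by auto
      moreover have "C0 * exp (- x) \<le> max C0 C1 * exp (- x)" "C1 * exp (- x) \<le> max C0 C1 * exp (- x)" by (auto intro: mult_right_mono)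
      ultimately show ?thesis by linarith
    qed
    then show thesis using C0 by (intro that[of "max C0 C1"]) auto
  qed
  have to0: "((\<lambda>l. Re (airy_int 1 n (z + l)) / pi) \<longlongrightarrow> 0) at_top" if "n \<le> 1" for n z
  proof (rule Lim_null_comparison)
    show "((\<lambda>l. C * exp (- (z + l)) / pi) \<longlongrightarrow> 0) at_top" by real_asymp
    show "\<forall>\<^sub>F l in at_top. norm (Re (airy_int 1 n (z + l)) / pi) \<le> C * exp (- (z + l)) / pi"
    proof (intro always_eventually allI)
      fix l
      show "norm (Re (airy_int 1 n (z + l)) / pi) \<le> C * exp (- (z + l)) / pi"
        using order_trans[OF abs_Re_le_cmod C(2)[OF that, THEN spec, of "z + l"]] by (simp add: divide_right_mono)
    qed
  qed
  have A0: "((\<lambda>T. airy (z + T)) \<longlongrightarrow> 0) at_top" for z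
    using to0[of 0 z] by (simp add: airy_eq_Re_airy_int[of 1])
  have D0: "((\<lambda>T. deriv airy (z + T)) \<longlongrightarrow> 0) at_top" for z
    using tendsto_minus[OF to0[of 1 z]] by (simp add: deriv_airy)
  have "((\<lambda>T. W T) \<longlongrightarrow> 0 * 0 - 0 * 0) at_top"
    unfolding W_def by (intro tendsto_intros A0 D0)
  then have "((\<lambda>T. (W T - W 0) / (y - x)) \<longlongrightarrow> (0 * 0 - 0 * 0 - W 0) / (y - x)) at_top"
    using assms by (intro tendsto_divide tendsto_diff tendsto_const) auto
  then have "((\<lambda>T. LINT l:{0..T}|lborel. airy (x + l) * airy (y + l)) \<longlongrightarrow> (0 * 0 - 0 * 0 - W 0) / (y - x)) at_top"
    by (rule Lim_transform_eventually) (auto intro!: eventually_mono[OF eventually_ge_at_top[of 0]] simp: F)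
  with lim have "(LINT l:{0..}|lborel. airy (x + l) * airy (y + l)) = (0 * 0 - 0 * 0 - W 0) / (y - x)"
    by (intro tendsto_unique[OF trivial_limit_at_top_linorder])
  then show ?thesis using assms by (simp add: W_def field_simps)
qed

text \<open>This is the form in which the kernel will arise as a limit of sums. On the diagonal the
  defining limit is taken inside the integral by dominated convergence.\<close>

theorem airy_kernel_eq: "airy_kernel x y = (LINT l:{0..}|lborel. airy (x + l) * airy (y + l))"
proof (cases "x = y")
  case False
  then show ?thesis by (simp add: airy_kernel_def airy_product_integral)
next
  case True
  obtain C where C: "0 \<le> C" "\<And>x. \<bar>airy x\<bar> \<le> C * exp (- x)" using airy_bound by blast
  have "((\<lambda>v. LINT l:{0..}|lborel. airy (x + l) * airy (v + l)) \<longlongrightarrow> (LINT l:{0..}|lborel. airy (x + l) * airy (x + l))) (at x)"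
    unfolding tendsto_at_iff_sequentially comp_def
  proof (intro allI impI)
    fix X :: "nat \<Rightarrow> real" assume X: "\<forall>i. X i \<in> UNIV - {x}" "X \<longlonglongrightarrow> x"
    obtain B where B: "\<And>i. - X i \<le> B"
      using convergent_imp_Bseq[OF convergentI[OF X(2)]] unfolding Bseq_def by (metis abs_le_D2 real_norm_def)
    show "(\<lambda>i. LINT l:{0..}|lborel. airy (x + l) * airy (X i + l)) \<longlonglongrightarrow> (LINT l:{0..}|lborel. airy (x + l) * airy (x + l))"
      unfolding set_lebesgue_integral_def
    proof (rule integral_dominated_convergence[where w = "\<lambda>l. indicator {0..} l *\<^sub>R ((C * exp (- x)) * (C * exp B) * exp (- l))"])
      show "integrable lborel (\<lambda>l. indicator {0..} l *\<^sub>R ((C * exp (- x)) * (C * exp B) * exp (- l)))"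
        using set_integrable_exp_decay[of "(C * exp (- x)) * (C * exp B)"] unfolding set_integrable_def .
      show "AE l in lborel. (\<lambda>i. indicator {0..} l *\<^sub>R (airy (x + l) * airy (X i + l))) \<longlonglongrightarrow> indicator {0..} l *\<^sub>R (airy (x + l) * airy (x + l))"
        by (intro AE_I2 tendsto_intros isCont_tendsto_compose[OF isCont_airy] X)
      show "AE l in lborel. norm (indicator {0..} l *\<^sub>R (airy (x + l) * airy (X i + l))) \<le> indicator {0..} l *\<^sub>R ((C * exp (- x)) * (C * exp B) * exp (- l))" for i
      proof (intro AE_I2)
        fix l :: real
        show "norm (indicator {0..} l *\<^sub>R (airy (x + l) * airy (X i + l))) \<le> indicator {0..} l *\<^sub>R ((C * exp (- x)) * (C * exp B) * exp (- l))"
        proof (cases "0 \<le> l")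
          case True
          have "\<bar>airy (x + l)\<bar> * \<bar>airy (X i + l)\<bar> \<le> (C * exp (- (x + l))) * (C * exp (- (X i + l)))"
            by (intro mult_mono C) (use C in auto)
          also have "\<dots> \<le> (C * exp (- x)) * (C * exp (B - l))"
            using B[of i] True C by (intro mult_mono mult_left_mono) auto
          finally show ?thesis using True by (simp add: abs_mult exp_diff exp_minus field_simps)
        qed auto
      qed
    qed measurable
  qed
  then have "((\<lambda>v. (airy x * deriv airy v - airy v * deriv airy x) / (x - v)) \<longlongrightarrow> (LINT l:{0..}|lborel. airy (x + l) * airy (x + l))) (at x)"
    by (rule Lim_transform_eventually) (auto simp: eventually_at_filter airy_product_integral)
  then show ?thesis using True by (simp add: airy_kernel_def tendsto_Lim)
qed

section \<open>Hadamard's inequality\<close>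

text \<open>Column elimination; the smaller matrix is the Schur complement of the pivot.\<close>

lemma det_pivot:
  fixes M :: "nat \<Rightarrow> nat \<Rightarrow> real"
  assumes p: "M 0 0 \<noteq> 0"
  shows "Determinant.det (mat (Suc n) (Suc n) (\<lambda>(i, j). M i j)) =
    M 0 0 * Determinant.det (mat n n (\<lambda>(i, j). M (Suc i) (Suc j) - M (Suc i) 0 * M 0 (Suc j) / M 0 0))"
proof -
  let ?A = "mat (Suc n) (Suc n) (\<lambda>(i, j). M i j)"
  let ?U = "mat (Suc n) (Suc n) (\<lambda>(i, j). if i = j then 1 else if i = 0 then - M 0 j / M 0 0 else 0)"
  let ?B = "mat (Suc n) (Suc n) (\<lambda>(i, j). if j = 0 then M i 0 else M i j - M i 0 * M 0 j / M 0 0)"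
  have "?A * ?U = ?B"
  proof (rule eq_matI)
    fix i j assume "i < dim_row ?B" "j < dim_col ?B"
    then have ij: "i < Suc n" "j < Suc n" by auto
    have "(?A * ?U) $$ (i, j) = (\<Sum>k<Suc n. M i k * (if k = j then 1 else if k = 0 then - M 0 j / M 0 0 else 0))"
      using ij by (simp add: scalar_prod_def lessThan_atLeast0 del: sum.op_ivl_Suc sum.lessThan_Suc)
    also have "\<dots> = (\<Sum>k<Suc n. (if k = j then M i k else 0) + (if k = 0 then (if j = 0 then 0 else M i 0 * (- M 0 j / M 0 0)) else 0))"
      by (intro sum.cong) auto
    also have "\<dots> = ?B $$ (i, j)" using ij by (simp add: sum.distrib del: sum.lessThan_Suc)
    finally show "(?A * ?U) $$ (i, j) = ?B $$ (i, j)" .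
  qed auto
  moreover have "Determinant.det ?U = 1"
  proof -
    have "diag_mat ?U = replicate (Suc n) 1"
      by (rule replicate_eqI) (auto simp: diag_mat_def simp del: upt_Suc)
    moreover have "Determinant.det ?U = prod_list (diag_mat ?U)"
      by (rule det_upper_triangular[where n = "Suc n"]) auto
    ultimately show ?thesis by (simp add: prod_list_replicate)
  qed
  moreover have "Determinant.det (?A * ?U) = Determinant.det ?A * Determinant.det ?U"
    by (rule det_mult[of _ "Suc n"]) auto
  ultimately have "Determinant.det ?A = Determinant.det ?B" by simp
  also have "\<dots> = M 0 0 * Determinant.det (mat n n (\<lambda>(i, j). M (Suc i) (Suc j) - M (Suc i) 0 * M 0 (Suc j) / M 0 0))"
    using p by (subst det_first_row) auto
  finally show ?thesis .
qed

text \<open>The vector is written as a sum of two terms so that i = j is allowed; that case gives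
  the diagonal entries.\<close>

lemma quadratic_form_two:
  fixes M :: "nat \<Rightarrow> nat \<Rightarrow> real" and r :: real
  assumes "i < m" "j < m"
  defines "v \<equiv> \<lambda>k. (if k = i then r else 0) + (if k = j then 1 else 0)"
  shows "(\<Sum>k<m. \<Sum>l<m. v k * v l * M k l) = r * r * M i i + r * M i j + r * M j i + M j j"
proof -
  have S: "(\<Sum>l<m. v l * h l) = r * h i + h j" for h :: "nat \<Rightarrow> real"
  proof -
    have "(\<Sum>l<m. v l * h l) = (\<Sum>l<m. (if l = i then r * h l else 0) + (if l = j then h l else 0))"
      unfolding v_def by (intro sum.cong) (auto simp: distrib_right)
    also have "\<dots> = (\<Sum>l<m. if l = i then r * h l else 0) + (\<Sum>l<m. if l = j then h l else 0)" by (rule sum.distrib)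
    also have "(\<Sum>l<m. if l = i then r * h l else 0) = r * h i" using assms(1) by simp
    also have "(\<Sum>l<m. if l = j then h l else 0) = h j" using assms(2) by simp
    finally show ?thesis .
  qed
  have "(\<Sum>k<m. \<Sum>l<m. v k * v l * M k l) = (\<Sum>k<m. v k * (\<Sum>l<m. v l * M k l))"
    by (simp add: sum_distrib_left mult.assoc)
  also have "\<dots> = (\<Sum>k<m. v k * (r * M k i + M k j))" unfolding S ..
  also have "\<dots> = r * (r * M i i + M i j) + (r * M j i + M j j)" by (rule S)
  finally show ?thesis by (simp add: algebra_simps)
qed

lemma psd_diag_nonneg:
  fixes M :: "nat \<Rightarrow> nat \<Rightarrow> real"
  assumes "\<And>v. 0 \<le> (\<Sum>i<n. \<Sum>j<n. v i * v j * M i j)" "i < n"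
  shows "0 \<le> M i i"
  using assms(1)[of "\<lambda>k. (if k = i then 0 else 0) + (if k = i then 1 else 0)"]
  unfolding quadratic_form_two[OF assms(2) assms(2)] by simp

text \<open>Induction over Schur complements: they stay positive semidefinite, and their diagonal
  entries do not exceed the original ones.\<close>

lemma det_psd_le_prod_diag:
  fixes M :: "nat \<Rightarrow> nat \<Rightarrow> real"
  assumes "\<And>i j. M i j = M j i" "\<And>v. 0 \<le> (\<Sum>i<n. \<Sum>j<n. v i * v j * M i j)"
  shows "0 \<le> Determinant.det (mat n n (\<lambda>(i, j). M i j)) \<and> Determinant.det (mat n n (\<lambda>(i, j). M i j)) \<le> (\<Prod>i<n. M i i)"
  using assms
proof (induction n arbitrary: M)
  case (Suc n)
  note sym = Suc.prems(1) and psd = Suc.prems(2)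
  have diag: "0 \<le> M i i" if "i < Suc n" for i
    using psd_diag_nonneg[OF psd that] .
  show ?case
  proof (cases "M 0 0 = 0")
    case True
    have row0: "M 0 j = 0" if j: "j < Suc n" "j \<noteq> 0" for j
    proof (rule ccontr)
      assume nz: "M 0 j \<noteq> 0"
      \<comment> \<open>Makes 2 r (M 0 j) + M j j equal to -1, contradicting
        semidefiniteness.\<close>
      define r where "r = - (M j j + 1) / (2 * M 0 j)"
      have 0: "0 < Suc n" by simp
      have 1: "0 \<le> r * r * M 0 0 + r * M 0 j + r * M j 0 + M j j"
        using psd[of "\<lambda>k. (if k = 0 then r else 0) + (if k = j then 1 else 0)"]
        unfolding quadratic_form_two[OF 0 j(1)] .
      have 2: "r * M 0 j = - (M j j + 1) / 2" using nz by (simp add: r_def)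
      have 3: "M j 0 = M 0 j" by (rule sym)
      show False using 1 unfolding True 3 2 by simp
    qed
    have "Determinant.det (mat (Suc n) (Suc n) (\<lambda>(i, j). M i j)) = M 0 0 * Determinant.det (mat n n (\<lambda>(i, j). M (Suc i) (Suc j)))"
      by (rule det_first_row) (rule row0, simp_all)
    then have d: "Determinant.det (mat (Suc n) (Suc n) (\<lambda>(i, j). M i j)) = 0" unfolding True by (simp only: mult_zero_left)
    have pz: "(\<Prod>i<Suc n. M i i) = 0" by (rule prod_zero) (use True in \<open>auto intro: bexI[of _ 0]\<close>)
    show ?thesis unfolding d pz by simp
  next
    case False
    have "0 \<le> M 0 0" by (rule diag) simp
    with False have p: "0 < M 0 0" by linarith
    define N where "N i j = M (Suc i) (Suc j) - M (Suc i) 0 * M 0 (Suc j) / M 0 0" for i j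
    have symN: "N i j = N j i" for i j 
    proof -
      have 1: "M (Suc i) 0 = M 0 (Suc i)" "M (Suc j) 0 = M 0 (Suc j)" "M (Suc i) (Suc j) = M (Suc j) (Suc i)" by (rule sym)+
      show ?thesis unfolding N_def 1 by (simp only: mult.commute)
    qed
    have psdN: "0 \<le> (\<Sum>i<n. \<Sum>j<n. v i * v j * N i j)" for v
    proof -
      define S where "S = (\<Sum>j<n. v j * M 0 (Suc j))"
      \<comment> \<open>For given v this first coordinate minimises the form of M; the minimum is
        the form of the Schur complement.\<close>
      define w where "w k = (case k of 0 \<Rightarrow> - S / M 0 0 | Suc i \<Rightarrow> v i)" for k
      have S': "(\<Sum>i<n. v i * M (Suc i) 0) = S" unfolding S_def using sym by simp
      have "(\<Sum>k<Suc n. \<Sum>l<Suc n. w k * w l * M k l) =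
        (w 0 * w 0 * M 0 0 + (\<Sum>l<n. w 0 * v l * M 0 (Suc l))) + (\<Sum>k<n. v k * w 0 * M (Suc k) 0 + (\<Sum>l<n. v k * v l * M (Suc k) (Suc l)))"
        by (simp add: sum.lessThan_Suc_shift w_def del: sum.lessThan_Suc)
      also have "(\<Sum>l<n. w 0 * v l * M 0 (Suc l)) = w 0 * S" by (simp add: S_def sum_distrib_left mult_ac)
      also have "(\<Sum>k<n. v k * w 0 * M (Suc k) 0 + (\<Sum>l<n. v k * v l * M (Suc k) (Suc l))) = w 0 * S + (\<Sum>k<n. \<Sum>l<n. v k * v l * M (Suc k) (Suc l))"
        by (simp add: sum.distrib S'[symmetric] sum_distrib_left mult_ac)
      also have "w 0 * w 0 * M 0 0 + w 0 * S + (w 0 * S + (\<Sum>k<n. \<Sum>l<n. v k * v l * M (Suc k) (Suc l))) =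
        (\<Sum>k<n. \<Sum>l<n. v k * v l * M (Suc k) (Suc l)) - S * S / M 0 0"
        using p by (simp add: w_def field_simps)
      also have "S * S / M 0 0 = (\<Sum>k<n. \<Sum>l<n. v k * v l * (M (Suc k) 0 * M 0 (Suc l) / M 0 0))"
      proof -
        have "S * S = (\<Sum>k<n. v k * M (Suc k) 0) * (\<Sum>l<n. v l * M 0 (Suc l))" unfolding S' by (simp only: S_def)
        also have "\<dots> = (\<Sum>k<n. \<Sum>l<n. v k * v l * (M (Suc k) 0 * M 0 (Suc l)))"
          unfolding sum_product by (intro sum.cong refl) (simp only: mult_ac)
        finally show ?thesis by (simp add: sum_divide_distrib)
      qed
      also have "(\<Sum>k<n. \<Sum>l<n. v k * v l * M (Suc k) (Suc l)) - (\<Sum>k<n. \<Sum>l<n. v k * v l * (M (Suc k) 0 * M 0 (Suc l) / M 0 0)) =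
         (\<Sum>i<n. \<Sum>j<n. v i * v j * N i j)"
        by (simp add: N_def sum_subtractf right_diff_distrib)
      finally show ?thesis using psd[of w] by simp
    qed
    have IH: "0 \<le> Determinant.det (mat n n (\<lambda>(i, j). N i j))" "Determinant.det (mat n n (\<lambda>(i, j). N i j)) \<le> (\<Prod>i<n. N i i)"
      using Suc.IH[OF symN psdN] by auto
    have diagN: "0 \<le> N i i" if "i < n" for i
      using psd_diag_nonneg[OF psdN that] .
    have "(\<Prod>i<n. N i i) \<le> (\<Prod>i<n. M (Suc i) (Suc i))"
      using diagN p sym by (intro prod_mono) (auto simp: N_def)
    with IH have "Determinant.det (mat n n (\<lambda>(i, j). N i j)) \<le> (\<Prod>i<n. M (Suc i) (Suc i))" by simp
    moreover have "Determinant.det (mat (Suc n) (Suc n) (\<lambda>(i, j). M i j)) = M 0 0 * Determinant.det (mat n n (\<lambda>(i, j). N i j))"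
      unfolding N_def by (rule det_pivot) (use False in simp)
    moreover have "(\<Prod>i<Suc n. M i i) = M 0 0 * (\<Prod>i<n. M (Suc i) (Suc i))" by (rule prod.lessThan_Suc_shift)
    ultimately show ?thesis using IH(1) p by (simp add: mult_left_mono)
  qed
qed simp

text \<open>The Gram matrix of the rows is positive semidefinite, its determinant is the square of
  the given one, and its diagonal consists of the squared row norms.\<close>

lemma hadamard_inequality:
  fixes f :: "nat \<Rightarrow> nat \<Rightarrow> real"
  shows "(Determinant.det (mat n n (\<lambda>(i, j). f i j)))\<^sup>2 \<le> (\<Prod>i<n. \<Sum>k<n. (f i k)\<^sup>2)"
proof -
  define M where "M i j = (\<Sum>k<n. f i k * f j k)" for i j
  let ?A = "mat n n (\<lambda>(i, j). f i j)"
  have "?A * transpose_mat ?A = mat n n (\<lambda>(i, j). M i j)"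
    by (rule eq_matI) (auto simp: M_def scalar_prod_def lessThan_atLeast0)
  moreover have "Determinant.det (?A * transpose_mat ?A) = Determinant.det ?A * Determinant.det (transpose_mat ?A)"
    by (rule det_mult[of _ n]) auto
  ultimately have "(Determinant.det ?A)\<^sup>2 = Determinant.det (mat n n (\<lambda>(i, j). M i j))"
    by (simp add: det_transpose[of _ n] power2_eq_square)
  also have "\<dots> \<le> (\<Prod>i<n. M i i)"
  proof -
    have "0 \<le> (\<Sum>i<n. \<Sum>j<n. v i * v j * M i j)" for v
    proof -
      have "(\<Sum>i<n. \<Sum>j<n. v i * v j * M i j) = (\<Sum>i<n. \<Sum>j<n. \<Sum>k<n. (v i * f i k) * (v j * f j k))"
        unfolding M_def sum_distrib_left by (simp add: mult_ac)
      also have "\<dots> = (\<Sum>k<n. (\<Sum>i<n. v i * f i k) * (\<Sum>j<n. v j * f j k))"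
      proof -
        have "(\<Sum>i<n. \<Sum>j<n. \<Sum>k<n. (v i * f i k) * (v j * f j k)) = (\<Sum>i<n. \<Sum>k<n. \<Sum>j<n. (v i * f i k) * (v j * f j k))"
          by (intro sum.cong refl sum.swap)
        also have "\<dots> = (\<Sum>k<n. \<Sum>i<n. \<Sum>j<n. (v i * f i k) * (v j * f j k))" by (rule sum.swap)
        finally show ?thesis by (simp only: sum_product)
      qed
      finally have e: "(\<Sum>i<n. \<Sum>j<n. v i * v j * M i j) = (\<Sum>k<n. (\<Sum>i<n. v i * f i k) * (\<Sum>j<n. v j * f j k))" .
      show ?thesis unfolding e by (intro sum_nonneg) simp
    qed
    then show ?thesis using det_psd_le_prod_diag[of M n] by (simp add: M_def mult.commute)
  qed
  finally show ?thesis by (simp add: M_def power2_eq_square)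
qed

text \<open>Scaling out u i and u j leaves entries bounded by C, hence rows of norm at most C sqrt
  n. The resulting growth in n is weaker than n!.\<close>

lemma det_bound:
  fixes f :: "nat \<Rightarrow> nat \<Rightarrow> real"
  assumes "\<And>i j. i < n \<Longrightarrow> j < n \<Longrightarrow> \<bar>f i j\<bar> \<le> C * u i * u j" "0 \<le> C" "\<And>i. 0 < u i"
  shows "\<bar>Determinant.det (mat n n (\<lambda>(i, j). f i j))\<bar> \<le> sqrt (real n) ^ n * C ^ n * (\<Prod>i<n. (u i)\<^sup>2)"
proof -
  define h where "h i j = f i j / (u i * u j)" for i j
  have nz: "u i \<noteq> 0" for i using assms(3)[of i] by simp
  have hb: "\<bar>h i j\<bar> \<le> C" if "i < n" "j < n" for i j
    using assms(1)[OF that] assms(3)[of i] assms(3)[of j] by (simp add: h_def abs_mult divide_le_eq mult.assoc)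
  have "Determinant.det (mat n n (\<lambda>(i, j). f i j)) = Determinant.det (mat n n (\<lambda>(i, j). u i * h i j * u j))"
    by (rule det_cong) (simp add: h_def nz)
  also have "\<dots> = (\<Prod>i<n. u i) * (\<Prod>i<n. u i) * Determinant.det (mat n n (\<lambda>(i, j). h i j))" by (rule det_scale)
  finally have e: "Determinant.det (mat n n (\<lambda>(i, j). f i j)) = (\<Prod>i<n. (u i)\<^sup>2) * Determinant.det (mat n n (\<lambda>(i, j). h i j))"
    by (simp add: power2_eq_square prod.distrib)
  have "(Determinant.det (mat n n (\<lambda>(i, j). h i j)))\<^sup>2 \<le> (\<Prod>i<n. \<Sum>k<n. (h i k)\<^sup>2)" by (rule hadamard_inequality)
  also have "\<dots> \<le> (\<Prod>i<n. \<Sum>k<n. C\<^sup>2)"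
    by (intro prod_mono conjI sum_nonneg sum_mono) (use hb assms(2) in \<open>auto simp: abs_le_square_iff[symmetric]\<close>)
  also have "\<dots> = (sqrt (real n) ^ n * C ^ n)\<^sup>2"
    by (simp add: power_mult_distrib[symmetric] power2_eq_square mult_ac)
  finally have "\<bar>Determinant.det (mat n n (\<lambda>(i, j). h i j))\<bar>\<^sup>2 \<le> (sqrt (real n) ^ n * C ^ n)\<^sup>2" by simp
  then have dB: "\<bar>Determinant.det (mat n n (\<lambda>(i, j). h i j))\<bar> \<le> sqrt (real n) ^ n * C ^ n"
    by (rule power2_le_imp_le) (use assms(2) in simp)
  have u0: "0 \<le> (\<Prod>i<n. (u i)\<^sup>2)" by (intro prod_nonneg) simp
  have "\<bar>Determinant.det (mat n n (\<lambda>(i, j). f i j))\<bar> = (\<Prod>i<n. (u i)\<^sup>2) * \<bar>Determinant.det (mat n n (\<lambda>(i, j). h i j))\<bar>"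
    unfolding e abs_mult using u0 by simp
  also have "\<dots> \<le> (\<Prod>i<n. (u i)\<^sup>2) * (sqrt (real n) ^ n * C ^ n)" by (rule mult_left_mono[OF dB u0])
  finally show ?thesis by (simp only: mult_ac)
qed

text \<open>Since n^n / n! \<le> e^n, the n-th term is at most the n-th power of a constant divided
  by sqrt n, eventually below 2^(-n).\<close>

lemma summable_hadamard: "summable (\<lambda>n. sqrt (real n) ^ n * B ^ n / fact n)"
proof -
  define D where "D = exp 1 * \<bar>B\<bar>"
  obtain m :: nat where m: "(2 * D)\<^sup>2 \<le> real m" using real_arch_simple by blast
  have "norm (sqrt (real n) ^ n * B ^ n / fact n) \<le> (1 / 2) ^ n" if n: "n \<ge> max m 1" for n
  proof -
    have n1: "1 \<le> n" "m \<le> n" using n by auto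
    have "real n ^ n / fact n \<le> exp (real n)"
    proof -
      have "(\<Sum>k\<in>{n}. real n ^ k /\<^sub>R fact k) \<le> (\<Sum>k. real n ^ k /\<^sub>R fact k)"
        by (rule sum_le_suminf) (auto intro: summable_exp)
      then show ?thesis by (simp add: exp_def divide_inverse mult.commute)
    qed
    also have "\<dots> = exp 1 ^ n" by (simp add: exp_of_nat_mult[symmetric])
    finally have 1: "real n ^ n / fact n \<le> exp 1 ^ n" .
    have s: "sqrt (real n) * sqrt (real n) = real n" by simp
    have sp: "0 < sqrt (real n)" using n1 by simp
    have "norm (sqrt (real n) ^ n * B ^ n / fact n) = real n ^ n / fact n * \<bar>B\<bar> ^ n / sqrt (real n) ^ n"
    proof -
      have "real n ^ n = sqrt (real n) ^ n * sqrt (real n) ^ n" unfolding power_mult_distrib[symmetric] s ..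
      then show ?thesis using sp by (simp add: abs_mult power_abs)
    qed
    also have "\<dots> \<le> exp 1 ^ n * \<bar>B\<bar> ^ n / sqrt (real n) ^ n"
      using 1 sp by (intro divide_right_mono mult_right_mono) auto
    also have "\<dots> = (D / sqrt (real n)) ^ n" by (simp add: D_def power_mult_distrib power_divide)
    also have "\<dots> \<le> (1 / 2) ^ n"
    proof (rule power_mono)
      have "2 * D \<le> sqrt (real n)" by (rule real_le_rsqrt) (use m n1 in linarith)
      then show "D / sqrt (real n) \<le> 1 / 2" using sp by (simp add: field_simps)
      show "0 \<le> D / sqrt (real n)" by (simp add: D_def)
    qed
    finally show ?thesis .
  qed
  then show ?thesis
    by (intro summable_comparison_test'[OF summable_geometric[of "1 / 2"], of "max m 1"]) auto
qed

section \<open>Convergence of discrete Fredholm expansions\<close>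

text \<open>The number of the mesh interval of length 1 / c, counted from s, that contains x.
  Composition with it turns sums over naturals into integrals of step functions over a ray.\<close>

definition cell :: "real \<Rightarrow> real \<Rightarrow> real \<Rightarrow> nat" where
  "cell s c x = nat \<lfloor>(x - s) * c\<rfloor>"

lemma cell_eq_iff: "s < x \<Longrightarrow> 0 < c \<Longrightarrow> cell s c x = i \<longleftrightarrow> s + real i / c \<le> x \<and> x < s + real (Suc i) / c"
proof -
  assume "s < x" "0 < c"
  then have "0 \<le> \<lfloor>(x - s) * c\<rfloor>" by simp
  then have "cell s c x = i \<longleftrightarrow> \<lfloor>(x - s) * c\<rfloor> = int i" by (auto simp: cell_def)
  also have "\<dots> \<longleftrightarrow> real i \<le> (x - s) * c \<and> (x - s) * c < real i + 1" by (simp add: floor_eq_iff)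
  also have "\<dots> \<longleftrightarrow> s + real i / c \<le> x \<and> x < s + real (Suc i) / c"
    using \<open>0 < c\<close> by (simp add: field_simps)
  finally show ?thesis .
qed

abbreviation ray :: "real \<Rightarrow> real measure" where
  "ray s \<equiv> restrict_space lborel {s<..}"

lemma sigma_finite_ray: "sigma_finite_measure (ray s)"
  by (rule sigma_finite_measure_restrict_space) (auto intro: lborel.sigma_finite_measure_axioms)

lemma cell_integral:
  assumes c: "0 < c"
  shows "integrable (ray s) (\<lambda>x. of_bool (cell s c x = i) :: real)" "(\<integral>x. of_bool (cell s c x = i) \<partial>ray s) = 1 / c"
proof -
  let ?I = "{s + real i / c..<s + real (Suc i) / c}"
  have i0: "0 \<le> real i / c" using c by simp
  have ae: "AE x in lborel. indicator {s<..} x *\<^sub>R (of_bool (cell s c x = i) :: real) = indicator ?I x"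
    using AE_lborel_singleton[of s]
  proof eventually_elim
    case (elim x)
    show ?case
    proof (cases "s < x")
      case True
      then show ?thesis using cell_eq_iff[OF True c, of i] by (auto simp: indicator_def)
    next
      case False
      then have "x < s + real i / c" using elim i0 by linarith
      then show ?thesis using False by (auto simp: indicator_def)
    qed
  qed
  have m: "(\<lambda>x. indicator {s<..} x *\<^sub>R (of_bool (cell s c x = i) :: real)) \<in> borel_measurable lborel"
    unfolding cell_def by measurable
  have len: "s + real i / c \<le> s + real (Suc i) / c" using c by (simp add: divide_right_mono)
  have hi: "has_bochner_integral lborel (indicator ?I :: real \<Rightarrow> real) (1 / c)"
    using has_bochner_integral_real_indicator[of ?I lborel] len c
    by (simp add: add_divide_distrib)
  then have "has_bochner_integral lborel (\<lambda>x. indicator {s<..} x *\<^sub>R (of_bool (cell s c x = i) :: real)) (1 / c)"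
    using has_bochner_integralI_AE ae m by (subst has_bochner_integral_cong_AE[OF m _ ae]) auto
  then show "integrable (ray s) (\<lambda>x. of_bool (cell s c x = i) :: real)" "(\<integral>x. of_bool (cell s c x = i) \<partial>ray s) = 1 / c"
    by (auto simp: has_bochner_integral_iff integrable_restrict_space integral_restrict_space)
qed

lemma exp_ray_integral:
  assumes e: "0 < (\<eta> :: real)"
  shows "integrable (ray s) (\<lambda>x. exp (- \<eta> * (x - s)))" "(\<integral>x. exp (- \<eta> * (x - s)) \<partial>ray s) = 1 / \<eta>"
proof -
  have hi: "((\<lambda>x. exp (\<eta> * s) * exp (- \<eta> * x)) has_integral (exp (\<eta> * s) * (exp (- \<eta> * s) / \<eta>))) {s..}"
    by (intro has_integral_mult_right has_integral_exp_minus_to_infinity e)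
  have ei: "exp (\<eta> * s) * exp (- \<eta> * x) = exp (- \<eta> * (x - s))" for x
    by (simp add: exp_add[symmetric] algebra_simps)
  have hi': "((\<lambda>x. exp (- \<eta> * (x - s))) has_integral 1 / \<eta>) {s..}"
    using hi unfolding ei by (simp add: exp_add[symmetric])
  have hi'': "((\<lambda>x. exp (- \<eta> * (x - s))) has_integral 1 / \<eta>) {s<..}"
    using hi' by (subst has_integral_spike_set_eq[of _ "{s..}"]) (auto intro: negligible_subset[of "{s}"])
  have ai: "(\<lambda>x. exp (- \<eta> * (x - s))) absolutely_integrable_on {s<..}"
    by (rule nonnegative_absolutely_integrable_1) (use hi'' in \<open>auto simp: integrable_on_def\<close>)
  have sl: "set_integrable lborel {s<..} (\<lambda>x. exp (- \<eta> * (x - s)))"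
    using ai unfolding set_integrable_def by (subst (asm) integrable_completion) auto
  then show "integrable (ray s) (\<lambda>x. exp (- \<eta> * (x - s)))"
    by (simp add: integrable_restrict_space set_integrable_def)
  have "(\<integral>x. exp (- \<eta> * (x - s)) \<partial>ray s) = (LINT x:{s<..}|lborel. exp (- \<eta> * (x - s)))"
    by (simp add: integral_restrict_space set_lebesgue_integral_def)
  also have "\<dots> = integral {s<..} (\<lambda>x. exp (- \<eta> * (x - s)))" by (rule set_borel_integral_eq_integral(2)[OF sl])
  also have "\<dots> = 1 / \<eta>" using hi'' by (rule integral_unique)
  finally show "(\<integral>x. exp (- \<eta> * (x - s)) \<partial>ray s) = 1 / \<eta>" .
qed

lemma det_row_0_fun:
  fixes f :: "nat \<Rightarrow> nat \<Rightarrow> real"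
  assumes "p < n" "\<And>q. q < n \<Longrightarrow> f p q = 0"
  shows "Determinant.det (mat n n (\<lambda>(p, q). f p q)) = 0"
  unfolding det_fun
proof (rule sum.neutral, intro ballI)
  fix r assume "r \<in> {r. r permutes {..<n}}"
  then have "r p < n" using permutes_in_image[of r "{..<n}" p] assms(1) by auto
  then have "(\<Prod>i<n. f i (r i)) = 0" using assms by (intro prod_zero) auto
  then show "signof r * (\<Prod>i<n. f i (r i)) = 0" by simp
qed

text \<open>If all cells lie below A, exactly one tuple i matches them; a cell beyond A gives a zero
  row.\<close>

lemma det_cell_decomposition:
  fixes K :: "nat \<Rightarrow> nat \<Rightarrow> real"
  assumes z: "\<And>i j. A \<le> i \<Longrightarrow> K i j = 0"
  shows "Determinant.det (mat n n (\<lambda>(p, q). K (g p) (g q))) =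
    (\<Sum>i\<in>{..<n} \<rightarrow>\<^sub>E {..<A}. Determinant.det (mat n n (\<lambda>(p, q). K (i p) (i q))) * (\<Prod>p<n. of_bool (g p = i p)))"
proof (cases "\<forall>p<n. g p < A")
  case True
  define i0 where "i0 = restrict g {..<n}"
  have i0: "i0 \<in> {..<n} \<rightarrow>\<^sub>E {..<A}" using True by (auto simp: i0_def)
  have "(\<Sum>i\<in>{..<n} \<rightarrow>\<^sub>E {..<A}. Determinant.det (mat n n (\<lambda>(p, q). K (i p) (i q))) * (\<Prod>p<n. of_bool (g p = i p))) =
    (\<Sum>i\<in>{i0}. Determinant.det (mat n n (\<lambda>(p, q). K (i p) (i q))) * (\<Prod>p<n. of_bool (g p = i p)))"
  proof (rule sum.mono_neutral_right)
    show "\<forall>i\<in>({..<n} \<rightarrow>\<^sub>E {..<A}) - {i0}. Determinant.det (mat n n (\<lambda>(p, q). K (i p) (i q))) * (\<Prod>p<n. of_bool (g p = i p)) = 0"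
    proof
      fix i assume i: "i \<in> ({..<n} \<rightarrow>\<^sub>E {..<A}) - {i0}"
      have "\<exists>p<n. g p \<noteq> i p"
      proof (rule ccontr)
        assume "\<not> (\<exists>p<n. g p \<noteq> i p)"
        then have "i = i0" unfolding i0_def using i by (intro extensionalityI[of _ "{..<n}"]) (auto simp: PiE_def)
        then show False using i by simp
      qed
      then have "(\<Prod>p<n. of_bool (g p = i p) :: real) = 0" by (intro prod_zero) auto
      then show "Determinant.det (mat n n (\<lambda>(p, q). K (i p) (i q))) * (\<Prod>p<n. of_bool (g p = i p)) = 0" by simp
    qed
  qed (use i0 in \<open>auto intro!: finite_PiE\<close>)
  also have "\<dots> = Determinant.det (mat n n (\<lambda>(p, q). K (i0 p) (i0 q))) * (\<Prod>p<n. of_bool (g p = i0 p))" by simp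
  also have "(\<Prod>p<n. of_bool (g p = i0 p) :: real) = 1" by (intro prod.neutral) (auto simp: i0_def)
  also have "Determinant.det (mat n n (\<lambda>(p, q). K (i0 p) (i0 q))) = Determinant.det (mat n n (\<lambda>(p, q). K (g p) (g q)))"
    by (rule det_cong) (simp add: i0_def)
  finally show ?thesis by simp
next
  case False
  then obtain p where p: "p < n" "A \<le> g p" by (auto simp: not_less)
  have "Determinant.det (mat n n (\<lambda>(p, q). K (g p) (g q))) = 0"
    using p z by (intro det_row_0_fun[of p]) auto
  moreover have "(\<Prod>p<n. of_bool (g p = i p) :: real) = 0" if "i \<in> {..<n} \<rightarrow>\<^sub>E {..<A}" for i
  proof (rule prod_zero)
    have "i p < A" using that p by auto
    then show "\<exists>p\<in>{..<n}. of_bool (g p = i p) = (0 :: real)" using p by (intro bexI[of _ p]) auto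
  qed auto
  ultimately show ?thesis by (simp only:) (rule sum.neutral[symmetric], intro ballI, simp only: mult_zero_right)
qed

text \<open>Each cell has length 1 / c, which the factor c in front of every entry
  compensates.\<close>

lemma det_sum_eq_integral:
  fixes K :: "nat \<Rightarrow> nat \<Rightarrow> real"
  assumes z: "\<And>i j. A \<le> i \<Longrightarrow> K i j = 0" and c: "0 < c"
  shows "(\<lambda>x. Determinant.det (mat n n (\<lambda>(p, q). c * K (cell s c (x p)) (cell s c (x q))))) \<in> borel_measurable (Pi\<^sub>M {..<n} (\<lambda>_. ray s))"
    and "(\<integral>x. Determinant.det (mat n n (\<lambda>(p, q). c * K (cell s c (x p)) (cell s c (x q)))) \<partial>Pi\<^sub>M {..<n} (\<lambda>_. ray s)) =
      (\<Sum>i\<in>{..<n} \<rightarrow>\<^sub>E {..<A}. Determinant.det (mat n n (\<lambda>(p, q). K (i p) (i q))))"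
proof -
  interpret product_sigma_finite "\<lambda>_ :: nat. ray s" by standard (rule sigma_finite_ray[unfolded sigma_finite_measure_def])
  let ?D = "\<lambda>i. Determinant.det (mat n n (\<lambda>(p, q). c * K (i p) (i q)))"
  let ?F = "\<lambda>x. \<Sum>i\<in>{..<n} \<rightarrow>\<^sub>E {..<A}. ?D i * (\<Prod>p<n. of_bool (cell s c (x p) = i p))"
  have e: "(\<lambda>x. Determinant.det (mat n n (\<lambda>(p, q). c * K (cell s c (x p)) (cell s c (x q))))) = ?F"
    by (rule ext) (rule det_cell_decomposition, use z in simp)
  have int: "integrable (Pi\<^sub>M {..<n} (\<lambda>_. ray s)) (\<lambda>x. \<Prod>p<n. of_bool (cell s c (x p) = i p) :: real)" for i :: "nat \<Rightarrow> nat"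
    by (intro product_integrable_prod cell_integral c) auto
  show "(\<lambda>x. Determinant.det (mat n n (\<lambda>(p, q). c * K (cell s c (x p)) (cell s c (x q))))) \<in> borel_measurable (Pi\<^sub>M {..<n} (\<lambda>_. ray s))"
    unfolding e by (intro borel_measurable_sum borel_measurable_times borel_measurable_const borel_measurable_integrable[OF int])
  have "(\<integral>x. ?F x \<partial>Pi\<^sub>M {..<n} (\<lambda>_. ray s)) = (\<Sum>i\<in>{..<n} \<rightarrow>\<^sub>E {..<A}. \<integral>x. ?D i * (\<Prod>p<n. of_bool (cell s c (x p) = i p)) \<partial>Pi\<^sub>M {..<n} (\<lambda>_. ray s))"
    by (rule Bochner_Integration.integral_sum) (intro integrable_mult_right int)
  also have "\<dots> = (\<Sum>i\<in>{..<n} \<rightarrow>\<^sub>E {..<A}. Determinant.det (mat n n (\<lambda>(p, q). K (i p) (i q))))"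
  proof (rule sum.cong[OF refl])
    fix i :: "nat \<Rightarrow> nat" assume "i \<in> {..<n} \<rightarrow>\<^sub>E {..<A}"
    have "(\<integral>x. (\<Prod>p<n. of_bool (cell s c (x p) = i p) :: real) \<partial>Pi\<^sub>M {..<n} (\<lambda>_. ray s)) = (\<Prod>p<n. 1 / c)"
      by (subst product_integral_prod) (auto simp: cell_integral c)
    moreover have "?D i = c ^ n * Determinant.det (mat n n (\<lambda>(p, q). K (i p) (i q)))"
      using det_scale_rows[of n "\<lambda>_. c" "\<lambda>p q. K (i p) (i q)"] by simp
    ultimately show "(\<integral>x. ?D i * (\<Prod>p<n. of_bool (cell s c (x p) = i p)) \<partial>Pi\<^sub>M {..<n} (\<lambda>_. ray s)) =
        Determinant.det (mat n n (\<lambda>(p, q). K (i p) (i q)))"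
      using c by (simp add: power_divide)
  qed
  finally show "(\<integral>x. Determinant.det (mat n n (\<lambda>(p, q). c * K (cell s c (x p)) (cell s c (x q)))) \<partial>Pi\<^sub>M {..<n} (\<lambda>_. ray s)) =
      (\<Sum>i\<in>{..<n} \<rightarrow>\<^sub>E {..<A}. Determinant.det (mat n n (\<lambda>(p, q). K (i p) (i q))))"
    unfolding e .
qed

text \<open>Hadamard's inequality serves twice: for fixed n it gives an integrable majorant in x for
  dominated convergence, and the integrals of these majorants are summable after division by n!, so
  that Tannery's theorem exchanges limit and series.\<close>

theorem discrete_fredholm_tendsto:
  fixes K :: "nat \<Rightarrow> nat \<Rightarrow> nat \<Rightarrow> real" and A :: "nat \<Rightarrow> nat" and c :: "nat \<Rightarrow> real" and L :: "real \<Rightarrow> real \<Rightarrow> real"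
  assumes c: "filterlim c at_top sequentially" and A: "filterlim A at_top sequentially"
    and z: "\<And>k i j. A k \<le> i \<Longrightarrow> K k i j = 0"
    and bound: "0 \<le> C" "0 < \<eta>" "\<forall>\<^sub>F k in sequentially. \<forall>i j. \<bar>c k * K k i j\<bar> \<le> C * exp (- \<eta> * real i / c k) * exp (- \<eta> * real j / c k)"
    and lim: "\<And>x y. s < x \<Longrightarrow> s < y \<Longrightarrow> (\<lambda>k. c k * K k (cell s (c k) x) (cell s (c k) y)) \<longlonglongrightarrow> L x y"
  shows "(\<lambda>k. \<Sum>n\<le>A k. (- 1) ^ n / fact n * (\<Sum>i\<in>{..<n} \<rightarrow>\<^sub>E {..<A k}. Determinant.det (mat n n (\<lambda>(p, q). K k (i p) (i q)))))
    \<longlonglongrightarrow> fredholm_det (ray s) L"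
proof -
  interpret product_sigma_finite "\<lambda>_ :: nat. ray s" by standard (rule sigma_finite_ray[unfolded sigma_finite_measure_def])
  let ?M = "\<lambda>n. Pi\<^sub>M {..<n} (\<lambda>_ :: nat. ray s)"
  let ?F = "\<lambda>n k x. Determinant.det (mat n n (\<lambda>(p, q). c k * K k (cell s (c k) (x p)) (cell s (c k) (x q))))"
  define T where "T n k = (\<Sum>i\<in>{..<n} \<rightarrow>\<^sub>E {..<A k}. Determinant.det (mat n n (\<lambda>(p, q). K k (i p) (i q))))" for n k
  define T' where "T' n = (\<integral>x. Determinant.det (mat n n (\<lambda>(p, q). L (x p) (x q))) \<partial>?M n)" for n
  \<comment> \<open>Once c k \<ge> 1, a cell index divided by c k is at least x - s - 1; the
    rounding costs exp \<eta> in each of the two exponential factors, whence exp (2 \<eta>).\<close>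
  define W where "W n x = sqrt (real n) ^ n * (C * exp (2 * \<eta>)) ^ n * (\<Prod>p<n. exp (- (2 * \<eta>) * (x p - s)))" for n and x :: "nat \<Rightarrow> real"
  have c1: "\<forall>\<^sub>F k in sequentially. 1 \<le> c k" using c unfolding filterlim_at_top by blast
  have Wint: "integrable (?M n) (W n)" for n
    unfolding W_def using bound(2) by (intro integrable_mult_right product_integrable_prod exp_ray_integral) auto
  have Wval: "(\<integral>x. W n x \<partial>?M n) = sqrt (real n) ^ n * (C * exp (2 * \<eta>) / (2 * \<eta>)) ^ n" for n
  proof -
    have "(\<integral>x. W n x \<partial>?M n) = sqrt (real n) ^ n * (C * exp (2 * \<eta>)) ^ n * (\<Prod>p<n. \<integral>x. exp (- (2 * \<eta>) * (x - s)) \<partial>ray s)"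
      unfolding W_def using bound(2) 
      by (simp only: integral_mult_right_zero) (subst product_integral_prod, simp, rule exp_ray_integral(1), simp, rule refl)
    also have "(\<integral>x. exp (- (2 * \<eta>) * (x - s)) \<partial>ray s) = 1 / (2 * \<eta>)"
      by (rule exp_ray_integral) (use bound in auto)
    finally show ?thesis by (simp add: power_divide)
  qed
  have dom: "\<bar>?F n k x\<bar> \<le> W n x"
    if k: "1 \<le> c k" "\<forall>i j. \<bar>c k * K k i j\<bar> \<le> C * exp (- \<eta> * real i / c k) * exp (- \<eta> * real j / c k)" and x: "\<forall>p<n. s < x p" for n k x
  proof -
    define u where "u p = exp (- \<eta> * real (cell s (c k) (x p)) / c k)" for p
    have "\<bar>?F n k x\<bar> \<le> sqrt (real n) ^ n * C ^ n * (\<Prod>p<n. (u p)\<^sup>2)"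
      by (rule det_bound) (use k bound in \<open>auto simp: u_def\<close>)
    also have "\<dots> \<le> sqrt (real n) ^ n * C ^ n * (\<Prod>p<n. exp (2 * \<eta>) * exp (- (2 * \<eta>) * (x p - s)))"
    proof (intro mult_left_mono prod_mono conjI)
      fix p assume "p \<in> {..<n}"
      then have xp: "s < x p" using x by auto
      have "(x p - s) * c k - 1 \<le> real (cell s (c k) (x p))"
        using xp k unfolding cell_def by (simp add: of_nat_nat)
      then have "((x p - s) * c k - 1) / c k \<le> real (cell s (c k) (x p)) / c k" using k by (intro divide_right_mono) auto
      moreover have "((x p - s) * c k - 1) / c k = (x p - s) - 1 / c k" using k by (simp add: diff_divide_distrib)
      moreover have "1 / c k \<le> 1" using k by simp
      ultimately have q0: "(x p - s) - 1 \<le> real (cell s (c k) (x p)) / c k" by linarith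
      define q where "q = real (cell s (c k) (x p)) / c k"
      have e: "- \<eta> * real (cell s (c k) (x p)) / c k = - (\<eta> * q)" by (simp add: q_def)
      have "\<eta> * ((x p - s) - 1) \<le> \<eta> * q" using bound q0 unfolding q_def by (intro mult_left_mono) auto
      then have "2 * - (\<eta> * q) \<le> 2 * \<eta> + - (2 * \<eta>) * (x p - s)" by (simp add: algebra_simps)
      then have "2 * (- \<eta> * real (cell s (c k) (x p)) / c k) \<le> 2 * \<eta> + - (2 * \<eta>) * (x p - s)" unfolding e .
      then show "(u p)\<^sup>2 \<le> exp (2 * \<eta>) * exp (- (2 * \<eta>) * (x p - s))"
        unfolding u_def exp_double[symmetric] exp_add[symmetric] by simp
    qed (use bound in auto)
    also have "\<dots> = W n x" by (simp add: W_def prod.distrib power_mult_distrib)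
    finally show ?thesis .
  qed
  have sp: "s < x p" if "x \<in> space (?M n)" "p < n" for x n p
    using that by (auto simp: space_PiM space_restrict_space PiE_def Pi_def)
  have ev: "\<forall>\<^sub>F k in sequentially. 1 \<le> c k \<and> (\<forall>i j. \<bar>c k * K k i j\<bar> \<le> C * exp (- \<eta> * real i / c k) * exp (- \<eta> * real j / c k))"
    using c1 bound(3) by eventually_elim auto
  \<comment> \<open>The bounds hold only eventually, so all sequences are shifted by k0, and the
    shift is undone at the end.\<close>
  then obtain k0 where k0: "\<And>k. k0 \<le> k \<Longrightarrow> 1 \<le> c k \<and> (\<forall>i j. \<bar>c k * K k i j\<bar> \<le> C * exp (- \<eta> * real i / c k) * exp (- \<eta> * real j / c k))"
    unfolding eventually_sequentially by blast
  have Teq: "T n k = (\<integral>x. ?F n k x \<partial>?M n)" if "k0 \<le> k" for n k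
    unfolding T_def using det_sum_eq_integral(2)[of "A k" "K k" "c k" n s] z k0[OF that] by simp
  have Fm: "?F n (k0 + k) \<in> borel_measurable (?M n)" for n k
    by (rule det_sum_eq_integral(1)[of "A (k0 + k)"]) (use z k0[of "k0 + k"] in auto)
  have Flim: "(\<lambda>k. ?F n (k0 + k) x) \<longlonglongrightarrow> Determinant.det (mat n n (\<lambda>(p, q). L (x p) (x q)))" if "x \<in> space (?M n)" for n x
    by (intro tendsto_det LIMSEQ_ignore_initial_segment[OF lim, of _ _ k0, unfolded add.commute[of _ k0]] sp[OF that])
  have Tlim: "(\<lambda>k. T n (k0 + k)) \<longlonglongrightarrow> T' n" for n
    unfolding T'_def
  proof (subst Teq)
    show "(\<lambda>k. \<integral>x. ?F n (k0 + k) x \<partial>?M n) \<longlonglongrightarrow> (\<integral>x. Determinant.det (mat n n (\<lambda>(p, q). L (x p) (x q))) \<partial>?M n)"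
    proof (rule integral_dominated_convergence[where w = "W n"])
      show "(\<lambda>x. Determinant.det (mat n n (\<lambda>(p, q). L (x p) (x q)))) \<in> borel_measurable (?M n)"
        by (rule borel_measurable_LIMSEQ_metric[OF Fm Flim])
      show "AE x in ?M n. norm (?F n (k0 + k) x) \<le> W n x" for k
        using dom[of "k0 + k" n] k0[of "k0 + k"] sp by (intro AE_I2) auto
    qed (use Fm Flim Wint in auto)
  qed simp
  define a where "a n k = (if n \<le> A (k0 + k) then (- 1) ^ n / fact n * T n (k0 + k) else 0)" for n k
  define B where "B = C * exp (2 * \<eta>) / (2 * \<eta>)"
  have alim: "(\<lambda>k. a n k) \<longlonglongrightarrow> (- 1) ^ n / fact n * T' n" for n
  proof -
    obtain m where "\<And>k. m \<le> k \<Longrightarrow> n \<le> A k"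
      using A unfolding filterlim_at_top eventually_sequentially by blast
    then have "\<forall>\<^sub>F k in sequentially. n \<le> A (k0 + k)"
      by (intro eventually_sequentiallyI[of m]) auto
    then have "\<forall>\<^sub>F k in sequentially. (- 1) ^ n / fact n * T n (k0 + k) = a n k"
      by eventually_elim (simp add: a_def)
    then show ?thesis by (rule Lim_transform_eventually[rotated]) (intro tendsto_intros Tlim)
  qed
  have abound: "norm (a n k) \<le> sqrt (real n) ^ n * B ^ n / fact n" for n k
  proof -
    have "\<bar>T n (k0 + k)\<bar> \<le> (\<integral>x. W n x \<partial>?M n)"
      unfolding Teq[of "k0 + k", OF le_add1]
    proof (rule order_trans[OF integral_abs_bound integral_mono])
      show "integrable (?M n) (\<lambda>x. \<bar>?F n (k0 + k) x\<bar>)"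
        by (rule Bochner_Integration.integrable_bound[OF Wint[of n]])
           (use Fm dom[of "k0 + k" n] k0[of "k0 + k"] sp in \<open>auto intro!: AE_I2 order_trans[OF _ abs_ge_self]\<close>)
      show "\<bar>?F n (k0 + k) x\<bar> \<le> W n x" if "x \<in> space (?M n)" for x
        using dom[of "k0 + k" n x] k0[of "k0 + k"] sp[OF that] by auto
    qed (rule Wint)
    then have "\<bar>T n (k0 + k)\<bar> \<le> sqrt (real n) ^ n * B ^ n" unfolding Wval B_def .
    then show ?thesis using bound unfolding a_def
      by (auto simp: abs_mult power_abs divide_right_mono B_def)
  qed
  have "(\<lambda>k. \<Sum>n. a n k) \<longlonglongrightarrow> (\<Sum>n. (- 1) ^ n / fact n * T' n)"
    using tannerys_theorem[of a "\<lambda>n. (- 1) ^ n / fact n * T' n" sequentially "\<lambda>n. sqrt (real n) ^ n * B ^ n / fact n"]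
      alim abound summable_hadamard[of B] by (auto simp: case_prod_unfold)
  moreover have "(\<Sum>n. a n k) = (\<Sum>n\<le>A (k0 + k). (- 1) ^ n / fact n * T n (k0 + k))" for k
    by (subst suminf_finite[of "{..A (k0 + k)}"]) (auto simp: a_def)
  ultimately have "(\<lambda>k. \<Sum>n\<le>A (k0 + k). (- 1) ^ n / fact n * T n (k0 + k)) \<longlonglongrightarrow> fredholm_det (ray s) L"
    by (simp add: fredholm_det_def T'_def)
  then have "(\<lambda>k. \<Sum>n\<le>A (k + k0). (- 1) ^ n / fact n * T n (k + k0)) \<longlonglongrightarrow> fredholm_det (ray s) L"
    by (simp only: add.commute[of k0])
  then have "(\<lambda>k. \<Sum>n\<le>A k. (- 1) ^ n / fact n * T n k) \<longlonglongrightarrow> fredholm_det (ray s) L"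
    by (rule LIMSEQ_offset)
  then show ?thesis unfolding T_def .
qed

section \<open>Steepest descent for the kernel\<close>

text \<open>A quotient of powers of two Bernoulli generating functions, normalised to the value 1 at
  u = 1.\<close>

definition saddle_quot :: "nat \<Rightarrow> nat \<Rightarrow> real \<Rightarrow> real \<Rightarrow> complex \<Rightarrow> complex" where
  "saddle_quot N M \<alpha> \<beta> u = (1 - of_real \<alpha> + of_real \<alpha> * u) ^ N / (1 - of_real \<beta> + of_real \<beta> * u) ^ M"

section \<open>Decay of the modulus along a circle\<close>

lemma power_log_concave:
  fixes r r1 \<delta> :: real
  assumes "0 \<le> r" "r \<le> r1" "0 < r1" "0 \<le> \<delta>" "r1 * \<delta> < 1"
  shows "r / r1 * ln (1 - r1 * \<delta>) \<le> ln (1 - r * \<delta>)"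
proof -
  have "concave_on {0<..} (ln :: real \<Rightarrow> real)" by (rule ln_concave)
  then have "(1 - r / r1) * ln 1 + r / r1 * ln (1 - r1 * \<delta>) \<le> ln ((1 - r / r1) *\<^sub>R 1 + (r / r1) *\<^sub>R (1 - r1 * \<delta>))"
    using assms by (intro concave_onD) auto
  moreover have "(1 - r / r1) *\<^sub>R 1 + (r / r1) *\<^sub>R (1 - r1 * \<delta>) = 1 - r * \<delta>"
    using assms by (simp add: field_simps)
  ultimately show ?thesis by (simp only: ln_one mult_zero_right add_0)
qed

text \<open>Concavity compares the logarithms of the two smaller rates with ln (1 - r1 \<delta>), so
  that everything combines into this one logarithm with a nonnegative coefficient; ln (1 - a) \<le>
  - a finishes.\<close>

lemma weighted_log_bound:
  fixes r0 r1 r2 \<delta> N M n :: real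
  assumes r: "0 \<le> r0" "r0 \<le> r1" "0 \<le> r2" "r2 \<le> r1" "0 < r1"
    and \<delta>: "0 \<le> \<delta>" "r1 * \<delta> < 1" and n: "0 \<le> M" "0 \<le> n" "0 \<le> N * r1 - M * r2 - n * r0"
  shows "N * ln (1 - r1 * \<delta>) - M * ln (1 - r2 * \<delta>) - n * ln (1 - r0 * \<delta>) \<le> - (N * r1 - M * r2 - n * r0) * \<delta>"
proof -
  let ?l = "ln (1 - r1 * \<delta>)"
  have "M * (r2 / r1 * ?l) \<le> M * ln (1 - r2 * \<delta>)" "n * (r0 / r1 * ?l) \<le> n * ln (1 - r0 * \<delta>)"
    using assms by (auto intro!: mult_left_mono power_log_concave simp del: times_divide_eq_left)
  then have "N * ?l - M * ln (1 - r2 * \<delta>) - n * ln (1 - r0 * \<delta>) \<le> N * ?l - M * (r2 / r1 * ?l) - n * (r0 / r1 * ?l)"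
    by linarith
  moreover have "N * ?l - M * (r2 / r1 * ?l) - n * (r0 / r1 * ?l) = (N * r1 - M * r2 - n * r0) / r1 * ?l"
    using r by (simp add: field_simps)
  moreover have "(N * r1 - M * r2 - n * r0) / r1 * ?l \<le> (N * r1 - M * r2 - n * r0) / r1 * (- (r1 * \<delta>))"
    using ln_add_one_self_le_self2[of "- (r1 * \<delta>)"] \<delta> r n by (intro mult_left_mono divide_nonneg_pos) auto
  moreover have "Q / r1 * (- (r1 * \<delta>)) = - Q * \<delta>" for Q
    using r by simp
  ultimately show ?thesis by (simp only:)
qed

text \<open>On a circle through \<open>v\<close> with centre \<open>p\<close> the squared distance to any real point is affine in the
  real part; the centre is chosen so that the distance to the zero \<open>-d1\<close> varies at the largest rate.\<close>

definition saddle_centre :: "real \<Rightarrow> real \<Rightarrow> real" where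
  "saddle_centre d1 v = max 0 ((v - d1) / 2)"

text \<open>As a function of d the rate (d + p) / (v + d)^2 peaks at d = v - 2 p. If v > d1, the
  centre makes this point equal to d1; otherwise p = 0, the rate vanishes at d = 0, peaks at v \<le>
  d1 and decreases from there.\<close>

lemma circle_rate_le:
  fixes d d1 v :: real
  assumes "0 < d1" "0 < v" "d = 0 \<or> d1 \<le> d"
  defines "p \<equiv> saddle_centre d1 v"
  shows "(d + p) / (v + d)\<^sup>2 \<le> (d1 + p) / (v + d1)\<^sup>2"
proof (cases "v \<le> d1")
  case True
  then have p: "p = 0" by (simp add: p_def saddle_centre_def)
  show ?thesis
  proof (cases "d = 0")
    case False
    then have d: "d1 \<le> d" using assms by auto
    have "v * v \<le> d1 * d" using True d assms by (intro mult_mono) auto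
    then have "0 \<le> (d - d1) * (d1 * d - v * v)" using d by simp
    also have "\<dots> = d1 * (v + d)\<^sup>2 - d * (v + d1)\<^sup>2" by (simp add: power2_eq_square algebra_simps)
    finally show ?thesis using assms d p by (simp add: divide_simps mult_ac)
  qed (use p assms in simp)
next
  case False
  then have p: "p = (v - d1) / 2" by (simp add: p_def saddle_centre_def)
  have "(d + p) * (2 * (v + d1)) \<le> (v + d)\<^sup>2"
  proof -
    have "0 \<le> (d - d1)\<^sup>2" by simp
    also have "\<dots> = (v + d)\<^sup>2 - (d + p) * (2 * (v + d1))" by (simp add: p power2_eq_square field_simps)
    finally show ?thesis by simp
  qed
  then have "(d + p) / (v + d)\<^sup>2 \<le> 1 / (2 * (v + d1))" using assms by (auto simp: divide_simps mult_ac)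
  also have "\<dots> = (d1 + p) / (v + d1)\<^sup>2"
  proof -
    have e: "d1 + p = (v + d1) / 2" by (simp add: p field_simps)
    show ?thesis unfolding e power2_eq_square using assms(1,2) by simp
  qed
  finally show ?thesis .
qed

lemma circle_dist:
  fixes u :: complex and p v d :: real
  assumes "norm (u - of_real p) = v - p"
  shows "(norm (u + of_real d))\<^sup>2 = (v + d)\<^sup>2 - 2 * (d + p) * (v - Re u)"
proof -
  have "(Re u - p)\<^sup>2 + (Im u)\<^sup>2 = (v - p)\<^sup>2"
    using assms by (metis (no_types) cmod_power2 minus_complex.sel Im_complex_of_real Re_complex_of_real diff_zero)
  then show ?thesis unfolding cmod_power2 by (simp add: power2_eq_square algebra_simps)
qed

text \<open>With \<delta> = v - Re u, the squared distance from u to -d is (v + d)^2 (1 - r d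
  \<delta>), where r d is twice the rate of d. The rate of the zero dominates those of the pole and
  of the origin, so the logarithms combine into decay at the total rate D.\<close>

lemma saddle_modulus:
  fixes u :: complex and d1 d2 v :: real and N M n :: nat
  defines "p \<equiv> saddle_centre d1 v"
  defines "D \<equiv> N * ((d1 + p) / (v + d1)\<^sup>2) - M * ((d2 + p) / (v + d2)\<^sup>2) - n * (p / v\<^sup>2)"
  assumes d: "0 < d1" "d1 \<le> d2" and v: "0 < v" and u: "norm (u - of_real p) = v - p"
    and N: "0 < N" and D: "0 \<le> D"
  shows "norm (u + of_real d1) ^ N / (norm (u + of_real d2) ^ M * norm u ^ n)
    \<le> (v + d1) ^ N / ((v + d2) ^ M * v ^ n) * exp (- D * (v - Re u))"
proof -
  define \<delta> where "\<delta> = v - Re u"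
  define r where "r = (\<lambda>d. 2 * ((d + p) / (v + d)\<^sup>2))"
  have p: "0 \<le> p" "p < v" using d v by (auto simp: p_def saddle_centre_def)
  have \<delta>: "0 \<le> \<delta>" using u complex_Re_le_cmod[of "u - of_real p"] by (simp add: \<delta>_def)
  have sq: "(norm (u + of_real e))\<^sup>2 = (v + e)\<^sup>2 * (1 - r e * \<delta>)" if "0 \<le> e" for e
    unfolding circle_dist[OF u] r_def using v that by (simp add: field_simps \<delta>_def)
  have r_nonneg: "0 \<le> r e" if "0 \<le> e" for e using that p by (simp add: r_def)
  have r1: "r 0 \<le> r d1" "r d2 \<le> r d1"
    using circle_rate_le[OF d(1) v, of 0] circle_rate_le[OF d(1) v, of d2] d by (auto simp only: r_def p_def intro!: mult_left_mono)
  have r1p: "0 < r d1" using d p v by (simp add: r_def)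
  have le1: "r d1 * \<delta> \<le> 1"
  proof -
    have "0 \<le> (v + d1)\<^sup>2 * (1 - r d1 * \<delta>)" using sq[of d1] d by (metis less_imp_le zero_le_power2)
    then show ?thesis using v d by (simp add: zero_le_mult_iff)
  qed
  show ?thesis
  proof (cases "r d1 * \<delta> = 1")
    \<comment> \<open>Here u is the zero of the numerator and the left side vanishes; otherwise all
      logarithms have positive arguments.\<close>
    case True
    then have "u + of_real d1 = 0" using sq[of d1] d by simp
    then have "norm (u + of_real d1) ^ N = 0" using N by simp
    then show ?thesis unfolding \<open>norm (u + of_real d1) ^ N = 0\<close> using v d by simp
  next
    case False
    then have l1: "r d1 * \<delta> < 1" using le1 by simp
    have l: "0 < 1 - r e * \<delta>" if "r e \<le> r d1" for e
      using mult_right_mono[OF that \<delta>] l1 by simp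
    have nz: "norm (u + of_real e) = (v + e) * exp (ln (1 - r e * \<delta>) / 2)" if "0 \<le> e" "r e \<le> r d1" for e
    proof -
      have "((v + e) * exp (ln (1 - r e * \<delta>) / 2))\<^sup>2 = (v + e)\<^sup>2 * (1 - r e * \<delta>)"
        using l[OF that(2)] by (simp add: power_mult_distrib exp_double[symmetric])
      then have "(norm (u + of_real e))\<^sup>2 = ((v + e) * exp (ln (1 - r e * \<delta>) / 2))\<^sup>2" using sq[OF that(1)] by (simp only:)
      then show ?thesis by (rule power2_eq_imp_eq) (use v that in simp_all)
    qed
    have nzp: "norm (u + of_real e) ^ k = (v + e) ^ k * exp (real k * ln (1 - r e * \<delta>) / 2)" if "0 \<le> e" "r e \<le> r d1" for e k
      unfolding nz[OF that] by (simp add: power_mult_distrib exp_of_nat_mult[symmetric])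
    have "norm u ^ n = v ^ n * exp (real n * ln (1 - r 0 * \<delta>) / 2)" using nzp[of 0 n] r1 by simp
    then have "norm (u + of_real d1) ^ N / (norm (u + of_real d2) ^ M * norm u ^ n) =
        ((v + d1) ^ N * exp (real N * ln (1 - r d1 * \<delta>) / 2)) / (((v + d2) ^ M * exp (real M * ln (1 - r d2 * \<delta>) / 2)) * (v ^ n * exp (real n * ln (1 - r 0 * \<delta>) / 2)))"
      using nzp[of d1 N] nzp[of d2 M] d r1 by simp
    also have "\<dots> = (v + d1) ^ N / ((v + d2) ^ M * v ^ n) * exp ((real N * ln (1 - r d1 * \<delta>) - real M * ln (1 - r d2 * \<delta>) - real n * ln (1 - r 0 * \<delta>)) / 2)"
      unfolding diff_divide_distrib exp_diff by (simp only: times_divide_times_eq divide_divide_eq_left mult_ac)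
    also have "\<dots> \<le> (v + d1) ^ N / ((v + d2) ^ M * v ^ n) * exp (- D * \<delta>)"
    proof -
      have D2: "real N * r d1 - real M * r d2 - real n * r 0 = 2 * D" by (simp add: D_def r_def algebra_simps)
      have "real N * ln (1 - r d1 * \<delta>) - real M * ln (1 - r d2 * \<delta>) - real n * ln (1 - r 0 * \<delta>) \<le> - (2 * D) * \<delta>"
        using weighted_log_bound[of "r 0" "r d1" "r d2" \<delta> "real M" "real n" "real N"] r_nonneg[of 0] r_nonneg[of d2] r1 r1p \<delta> l1 d D
        unfolding D2 by simp
      then show ?thesis using v d by (intro mult_left_mono) auto
    qed
    finally show ?thesis by (simp add: \<delta>_def)
  qed
qed

section \<open>Third-order expansion at the double critical point\<close>

lemma Ln_cubic_bound:
  assumes z: "norm z \<le> 1 / 2"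
  shows "norm (Ln (1 + z) - z + z\<^sup>2 / 2 - z ^ 3 / 3) \<le> 2 * norm z ^ 4"
proof -
  define h where "h = (\<lambda>z. Ln (1 + z) - z + z\<^sup>2 / 2 - z ^ 3 / 3)"
  have nonneg: "1 + w \<notin> \<real>\<^sub>\<le>\<^sub>0" if "norm w \<le> 1 / 2" for w :: complex
    using that abs_Re_le_cmod[of w] by (auto simp: complex_nonpos_Reals_iff)
  \<comment> \<open>Differentiation cancels all terms below the third power; on the disc of radius
    at most 1 / 2 the denominator stays above 1 / 2.\<close>
  have deriv: "(h has_field_derivative (- (w ^ 3) / (1 + w))) (at w within (cball 0 (norm z)))" if "w \<in> cball 0 (norm z)" for w
  proof -
    have w: "norm w \<le> 1 / 2" using that z by simp
    have nz: "1 + w \<noteq> 0" using nonneg[OF w] by auto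
    have "(h has_field_derivative (1 / (1 + w) - 1 + w - w\<^sup>2)) (at w within (cball 0 (norm z)))"
      unfolding h_def by (rule derivative_eq_intros refl nonneg[OF w] | simp add: divide_simps)+
    moreover have "1 / (1 + w) - 1 + w - w\<^sup>2 = - (w ^ 3) / (1 + w)"
      using nz by (simp add: divide_simps) (simp add: power2_eq_square power3_eq_cube algebra_simps)
    ultimately show ?thesis by simp
  qed
  have "norm (- (w ^ 3) / (1 + w)) \<le> 2 * norm z ^ 3" if "w \<in> cball 0 (norm z)" for w :: complex
  proof -
    have w: "norm w \<le> norm z" using that by simp
    have "1 / 2 \<le> norm (1 + w)" using w z norm_triangle_ineq2[of 1 "- w"] unfolding norm_minus_cancel norm_one diff_minus_eq_add by linarith
    then have "norm (- (w ^ 3) / (1 + w)) \<le> norm w ^ 3 / (1 / 2)"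
      unfolding norm_divide norm_minus_cancel norm_power by (intro divide_left_mono) auto
    also have "\<dots> \<le> norm z ^ 3 / (1 / 2)" using w by (intro divide_right_mono power_mono) auto
    finally show ?thesis by simp
  qed
  then have "norm (h z - h 0) \<le> 2 * norm z ^ 3 * norm (z - 0)"
    by (intro field_differentiable_bound[OF _ deriv]) auto
  then show ?thesis by (simp add: h_def power_numeral_reduce algebra_simps)
qed

lemma cubic_ratio_tendsto:
  fixes P l :: "nat \<Rightarrow> real"
  assumes l: "filterlim l at_top sequentially" and P: "(\<lambda>k. (P k - X * l k ^ 3) / l k) \<longlonglongrightarrow> c"
  shows "(\<lambda>k. P k / l k ^ 3) \<longlonglongrightarrow> X"
proof -
  have il: "(\<lambda>k. 1 / l k) \<longlonglongrightarrow> 0"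
    using tendsto_inverse_0_at_top[OF l] by (simp add: inverse_eq_divide)
  have "(\<lambda>k. X + (P k - X * l k ^ 3) / l k * (1 / l k)\<^sup>2) \<longlonglongrightarrow> X + c * 0\<^sup>2"
    by (intro tendsto_intros P il)
  moreover have "\<forall>\<^sub>F k in sequentially. X + (P k - X * l k ^ 3) / l k * (1 / l k)\<^sup>2 = P k / l k ^ 3"
    using filterlim_at_top_dense[THEN iffD1, OF l, rule_format, of 0]
    by eventually_elim (simp add: field_simps power2_eq_square power3_eq_cube)
  ultimately show ?thesis by (simp add: tendsto_cong)
qed

text \<open>The exponent P grows like l^3 while w is of order 1 / l, so a remainder of fourth order
  contributes O(1 / l).\<close>

lemma Ln_remainder_tendsto:
  fixes P l :: "nat \<Rightarrow> real" and w :: "nat \<Rightarrow> complex" and c :: real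
  assumes l: "filterlim l at_top sequentially" and P: "(\<lambda>k. P k / l k ^ 3) \<longlonglongrightarrow> X"
    and w: "(\<lambda>k. of_real (l k) * w k) \<longlonglongrightarrow> \<omega>"
  defines "z \<equiv> \<lambda>k. of_real c * w k"
  shows "(\<lambda>k. of_real (P k) * (Ln (1 + z k) - z k + (z k)\<^sup>2 / 2 - z k ^ 3 / 3)) \<longlonglongrightarrow> 0"
    and "\<forall>\<^sub>F k in sequentially. norm (z k) \<le> 1 / 2"
proof -
  have il: "(\<lambda>k. 1 / l k) \<longlonglongrightarrow> 0"
    using tendsto_inverse_0_at_top[OF l] by (simp add: inverse_eq_divide)
  have lpos: "\<forall>\<^sub>F k in sequentially. 0 < l k" using l by (auto simp: filterlim_at_top_dense)
  have "(\<lambda>k. of_real c * (of_real (1 / l k) * (of_real (l k) * w k))) \<longlonglongrightarrow> of_real c * (of_real 0 * \<omega>)"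
    by (intro tendsto_intros il w)
  moreover have "\<forall>\<^sub>F k in sequentially. of_real c * (of_real (1 / l k) * (of_real (l k) * w k)) = z k"
    using lpos by eventually_elim (simp add: z_def)
  ultimately have "z \<longlonglongrightarrow> 0" by (simp add: tendsto_cong)
  then have "(\<lambda>k. norm (z k)) \<longlonglongrightarrow> 0" by (rule tendsto_norm_zero)
  then have "\<forall>\<^sub>F k in sequentially. norm (z k) < 1 / 2" by (rule order_tendstoD) simp
  then show small: "\<forall>\<^sub>F k in sequentially. norm (z k) \<le> 1 / 2" by eventually_elim simp
  show "(\<lambda>k. of_real (P k) * (Ln (1 + z k) - z k + (z k)\<^sup>2 / 2 - z k ^ 3 / 3)) \<longlonglongrightarrow> 0"
  proof (rule Lim_null_comparison)
    let ?B = "\<lambda>k. 2 * \<bar>P k / l k ^ 3\<bar> * (1 / l k) * \<bar>c\<bar> ^ 4 * norm (of_real (l k) * w k) ^ 4"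
    show "\<forall>\<^sub>F k in sequentially. norm (of_real (P k) * (Ln (1 + z k) - z k + (z k)\<^sup>2 / 2 - z k ^ 3 / 3)) \<le> ?B k"
      using small lpos
    proof eventually_elim
      case (elim k)
      have "norm (of_real (P k) * (Ln (1 + z k) - z k + (z k)\<^sup>2 / 2 - z k ^ 3 / 3)) \<le> \<bar>P k\<bar> * (2 * norm (z k) ^ 4)"
        unfolding norm_mult norm_of_real by (intro mult_left_mono Ln_cubic_bound elim) auto
      moreover have "\<bar>P k\<bar> * (2 * norm (z k) ^ 4) = ?B k"
        using elim by (simp add: z_def norm_mult power_mult_distrib power_numeral_reduce)
      ultimately show ?case by simp
    qed
    have "?B \<longlonglongrightarrow> 2 * \<bar>X\<bar> * 0 * \<bar>c\<bar> ^ 4 * norm \<omega> ^ 4"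
      by (intro tendsto_intros P il w)
    then show "?B \<longlonglongrightarrow> 0" by simp
  qed
qed

text \<open>For the phase X ln (1 - \<alpha> + \<alpha> \<xi>) - Y ln (1 - \<beta> + \<beta> \<xi>)
  - h ln \<xi>, the value of h makes the first derivative vanish at \<xi> = 1 and the common value V
  makes the second vanish; the third is -2 V (\<alpha> - \<beta>).\<close>

locale saddle_parameters =
  fixes \<alpha> \<beta> X Y V h :: real
  assumes \<beta>_pos: "0 < \<beta>" and \<beta>_less: "\<beta> < \<alpha>" and \<alpha>_less: "\<alpha> < 1"
    and X_pos: "0 < X" and Y_pos: "0 < Y"
    and VX: "X * \<alpha> * (1 - \<alpha>) = V" and VY: "Y * \<beta> * (1 - \<beta>) = V"
    and h_def: "h = X * \<alpha> - Y * \<beta>"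
begin

text \<open>At distance \<omega> / l from the critical point the cubic term of the phase and the
  shift of the exponent by \<nu> l are both of order 1; the quadratic term is smaller by a factor 1
  / l.\<close>

lemma saddle_pointwise:
  fixes N M n :: "nat \<Rightarrow> nat" and l :: "nat \<Rightarrow> real" and w :: "nat \<Rightarrow> complex"
  assumes l: "filterlim l at_top sequentially"
    and N: "(\<lambda>k. (real (N k) - X * l k ^ 3) / l k) \<longlonglongrightarrow> 0"
    and M: "(\<lambda>k. (real (M k) - Y * l k ^ 3) / l k) \<longlonglongrightarrow> 0"
    and n: "(\<lambda>k. (h * l k ^ 3 - real (n k)) / l k) \<longlonglongrightarrow> \<nu>"
    and w: "(\<lambda>k. of_real (l k) * w k) \<longlonglongrightarrow> \<omega>"
  shows "(\<lambda>k. saddle_quot (N k) (M k) \<alpha> \<beta> (1 + w k) / (1 + w k) ^ n k)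
    \<longlonglongrightarrow> exp (of_real \<nu> * \<omega> - of_real (V * (\<alpha> - \<beta>)) * \<omega> ^ 3 / 3)"
proof -
  define R :: "real \<Rightarrow> nat \<Rightarrow> complex" where
    "R = (\<lambda>c k. Ln (1 + of_real c * w k) - of_real c * w k + (of_real c * w k)\<^sup>2 / 2 - (of_real c * w k) ^ 3 / 3)"
  define E :: "nat \<Rightarrow> complex" where
    "E = (\<lambda>k. of_real (real (N k)) * Ln (1 + of_real \<alpha> * w k) - of_real (real (M k)) * Ln (1 + of_real \<beta> * w k) - of_real (real (n k)) * Ln (1 + of_real 1 * w k))"
  have il: "(\<lambda>k. 1 / l k) \<longlonglongrightarrow> 0"
    using tendsto_inverse_0_at_top[OF l] by (simp add: inverse_eq_divide)
  have lpos: "\<forall>\<^sub>F k in sequentially. 0 < l k" using l by (auto simp: filterlim_at_top_dense)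
  have n': "(\<lambda>k. (real (n k) - h * l k ^ 3) / l k) \<longlonglongrightarrow> - \<nu>"
    using tendsto_minus[OF n] unfolding minus_divide_left minus_diff_eq .
  have rN: "(\<lambda>k. real (N k) / l k ^ 3) \<longlonglongrightarrow> X" by (rule cubic_ratio_tendsto[OF l N])
  have rM: "(\<lambda>k. real (M k) / l k ^ 3) \<longlonglongrightarrow> Y" by (rule cubic_ratio_tendsto[OF l M])
  have rn: "(\<lambda>k. real (n k) / l k ^ 3) \<longlonglongrightarrow> h" by (rule cubic_ratio_tendsto[OF l n'])
  note remN = Ln_remainder_tendsto[OF l rN w, of \<alpha>] and remM = Ln_remainder_tendsto[OF l rM w, of \<beta>]
    and remn = Ln_remainder_tendsto[OF l rn w, of 1]
  define A1 where "A1 = (\<lambda>k. \<alpha> * ((real (N k) - X * l k ^ 3) / l k) - \<beta> * ((real (M k) - Y * l k ^ 3) / l k) + (h * l k ^ 3 - real (n k)) / l k)"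
  define A2 where "A2 = (\<lambda>k. (\<alpha>\<^sup>2 * ((real (N k) - X * l k ^ 3) / l k) - \<beta>\<^sup>2 * ((real (M k) - Y * l k ^ 3) / l k) + (h * l k ^ 3 - real (n k)) / l k) * (1 / l k))"
  define A3 where "A3 = (\<lambda>k. (\<alpha> ^ 3 * ((real (N k) - X * l k ^ 3) / l k) - \<beta> ^ 3 * ((real (M k) - Y * l k ^ 3) / l k) + (h * l k ^ 3 - real (n k)) / l k) * (1 / l k)\<^sup>2 - V * (\<alpha> - \<beta>))"
  have "A1 \<longlonglongrightarrow> \<alpha> * 0 - \<beta> * 0 + \<nu>" unfolding A1_def by (intro tendsto_intros N M n)
  then have A1: "A1 \<longlonglongrightarrow> \<nu>" by simp
  have "A2 \<longlonglongrightarrow> (\<alpha>\<^sup>2 * 0 - \<beta>\<^sup>2 * 0 + \<nu>) * 0" unfolding A2_def by (intro tendsto_intros N M n il)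
  then have A2: "A2 \<longlonglongrightarrow> 0" by simp
  have "A3 \<longlonglongrightarrow> (\<alpha> ^ 3 * 0 - \<beta> ^ 3 * 0 + \<nu>) * 0\<^sup>2 - V * (\<alpha> - \<beta>)" unfolding A3_def by (intro tendsto_intros N M n il)
  then have A3: "A3 \<longlonglongrightarrow> - (V * (\<alpha> - \<beta>))" by simp
  \<comment> \<open>This is the vanishing of the second derivative of the phase at 1;
    \<open>cu\<close> computes the third.\<close>
  have sq: "X * \<alpha>\<^sup>2 - Y * \<beta>\<^sup>2 = h"
    using VX VY unfolding h_def by (simp add: power2_eq_square algebra_simps)
  have cu: "X * \<alpha> ^ 3 - Y * \<beta> ^ 3 = h - V * (\<alpha> - \<beta>)"
  proof -
    have "X * \<alpha> ^ 3 = X * \<alpha> - (X * \<alpha> * (1 - \<alpha>)) * (1 + \<alpha>)" "Y * \<beta> ^ 3 = Y * \<beta> - (Y * \<beta> * (1 - \<beta>)) * (1 + \<beta>)"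
      by (simp_all add: power3_eq_cube algebra_simps)
    then show ?thesis unfolding VX VY h_def by (simp add: algebra_simps)
  qed
  have E_eq: "E k = of_real (A1 k) * (of_real (l k) * w k) - of_real (A2 k) * (of_real (l k) * w k)\<^sup>2 / 2 + of_real (A3 k) * (of_real (l k) * w k) ^ 3 / 3
      + (of_real (real (N k)) * R \<alpha> k - of_real (real (M k)) * R \<beta> k - of_real (real (n k)) * R 1 k)" if "0 < l k" for k
  proof -
    have a1: "A1 k * l k = N k * \<alpha> - M k * \<beta> - n k"
      using that by (simp add: A1_def h_def field_simps)
    have a2: "A2 k * l k ^ 2 = N k * \<alpha>\<^sup>2 - M k * \<beta>\<^sup>2 - n k"
    proof -
      have "A2 k * l k ^ 2 = N k * \<alpha>\<^sup>2 - M k * \<beta>\<^sup>2 - n k - (X * \<alpha>\<^sup>2 - Y * \<beta>\<^sup>2 - h) * l k ^ 3"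
        using that by (simp add: A2_def power2_eq_square field_simps)
      then show ?thesis unfolding sq by simp
    qed
    have a3: "A3 k * l k ^ 3 = N k * \<alpha> ^ 3 - M k * \<beta> ^ 3 - n k"
    proof -
      have "A3 k * l k ^ 3 = N k * \<alpha> ^ 3 - M k * \<beta> ^ 3 - n k - (X * \<alpha> ^ 3 - Y * \<beta> ^ 3 - h) * l k ^ 3 - V * (\<alpha> - \<beta>) * l k ^ 3"
        using that by (simp add: A3_def power2_eq_square power3_eq_cube field_simps)
      then show ?thesis unfolding cu by (simp add: algebra_simps)
    qed
    have "of_real (A1 k) * (of_real (l k) * w k) - of_real (A2 k) * (of_real (l k) * w k)\<^sup>2 / 2 + of_real (A3 k) * (of_real (l k) * w k) ^ 3 / 3 =
       of_real (A1 k * l k) * w k - of_real (A2 k * l k ^ 2) * (w k)\<^sup>2 / 2 + of_real (A3 k * l k ^ 3) * w k ^ 3 / 3"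
      by (simp add: power_mult_distrib mult.assoc)
    then show ?thesis unfolding a1 a2 a3 E_def R_def
      by (simp add: power_mult_distrib algebra_simps add_divide_distrib diff_divide_distrib)
  qed
  have "(\<lambda>k. of_real (A1 k) * (of_real (l k) * w k) - of_real (A2 k) * (of_real (l k) * w k)\<^sup>2 / 2 + of_real (A3 k) * (of_real (l k) * w k) ^ 3 / 3
      + (of_real (real (N k)) * R \<alpha> k - of_real (real (M k)) * R \<beta> k - of_real (real (n k)) * R 1 k))
    \<longlonglongrightarrow> of_real \<nu> * \<omega> - of_real 0 * \<omega>\<^sup>2 / 2 + of_real (- (V * (\<alpha> - \<beta>))) * \<omega> ^ 3 / 3 + (0 - 0 - 0)"
    unfolding R_def by (intro tendsto_intros A1 A2 A3 w remN remM remn) auto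
  then have "E \<longlonglongrightarrow> of_real \<nu> * \<omega> - of_real 0 * \<omega>\<^sup>2 / 2 + of_real (- (V * (\<alpha> - \<beta>))) * \<omega> ^ 3 / 3 + (0 - 0 - 0)"
    by (rule tendsto_cong[THEN iffD1, rotated]) (use lpos in \<open>eventually_elim, simp only: E_eq\<close>)
  then have "E \<longlonglongrightarrow> of_real \<nu> * \<omega> - of_real (V * (\<alpha> - \<beta>)) * \<omega> ^ 3 / 3" by simp
  then have lim: "(\<lambda>k. exp (E k)) \<longlonglongrightarrow> exp (of_real \<nu> * \<omega> - of_real (V * (\<alpha> - \<beta>)) * \<omega> ^ 3 / 3)"
    by (intro tendsto_intros)
  have "\<forall>\<^sub>F k in sequentially. exp (E k) = saddle_quot (N k) (M k) \<alpha> \<beta> (1 + w k) / (1 + w k) ^ n k"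
    using remN(2) remM(2) remn(2)
  proof eventually_elim
    case (elim k)
    have pw: "exp (of_real (real j) * Ln (1 + z)) = (1 + z) ^ j" if "norm z \<le> 1 / 2" for z and j :: nat
    proof -
      have "1 + z \<noteq> 0" using that by (auto simp: add_eq_0_iff)
      then show ?thesis by (simp add: exp_of_nat_mult)
    qed
    have "saddle_quot (N k) (M k) \<alpha> \<beta> (1 + w k) / (1 + w k) ^ n k =
       (1 + of_real \<alpha> * w k) ^ N k / (1 + of_real \<beta> * w k) ^ M k / (1 + of_real 1 * w k) ^ n k"
      unfolding saddle_quot_def by (simp add: algebra_simps)
    also have "\<dots> = exp (E k)"
      unfolding E_def exp_diff pw[OF elim(1)] pw[OF elim(2)] pw[OF elim(3)] ..
    finally show ?case ..
  qed
  then show ?thesis using lim by (rule tendsto_cong[THEN iffD1])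
qed

text \<open>The zero and the pole of \<open>saddle_quot\<close> lie on the negative axis at these
  distances from 0.\<close>

definition "zero_dist = (1 - \<alpha>) / \<alpha>"
definition "pole_dist = (1 - \<beta>) / \<beta>"

lemma dist_pos: "0 < zero_dist" "zero_dist < pole_dist"
  using \<beta>_pos \<beta>_less \<alpha>_less by (auto simp: zero_dist_def pole_dist_def divide_simps algebra_simps)

text \<open>The terms of order l^3 in D cancel at v = 1 and leave a factor 1 - v = 1 / l nearby, so
  D is of order l^2. Since the angle enters the decay quadratically, only angles of order 1 / l will
  matter.\<close>

lemma saddle_rate_tendsto:
  fixes N M n :: "nat \<Rightarrow> nat" and l :: "nat \<Rightarrow> real"
  assumes l: "filterlim l at_top sequentially"
    and N: "(\<lambda>k. (real (N k) - X * l k ^ 3) / l k) \<longlonglongrightarrow> 0"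
    and M: "(\<lambda>k. (real (M k) - Y * l k ^ 3) / l k) \<longlonglongrightarrow> 0"
    and n: "(\<lambda>k. (h * l k ^ 3 - real (n k)) / l k) \<longlonglongrightarrow> \<nu>"
  defines "v \<equiv> \<lambda>k. 1 - 1 / l k"
  defines "p \<equiv> \<lambda>k. saddle_centre zero_dist (v k)"
  defines "D \<equiv> \<lambda>k. real (N k) * ((zero_dist + p k) / (v k + zero_dist)\<^sup>2) - real (M k) * ((pole_dist + p k) / (v k + pole_dist)\<^sup>2)
    - real (n k) * (p k / (v k)\<^sup>2)"
  shows "(\<lambda>k. D k / (l k)\<^sup>2) \<longlonglongrightarrow> 2 * V * (\<alpha> - \<beta>) * (1 - saddle_centre zero_dist 1)"
proof -
  let ?d = zero_dist and ?e = pole_dist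
  have il: "(\<lambda>k. 1 / l k) \<longlonglongrightarrow> 0"
    using tendsto_inverse_0_at_top[OF l] by (simp add: inverse_eq_divide)
  have lpos: "\<forall>\<^sub>F k in sequentially. 1 < l k" using l by (auto simp: filterlim_at_top_dense)
  have "v \<longlonglongrightarrow> 1 - 0" unfolding v_def by (intro tendsto_intros il)
  then have v: "v \<longlonglongrightarrow> 1" by simp
  have p: "p \<longlonglongrightarrow> saddle_centre ?d 1" unfolding p_def saddle_centre_def by (intro tendsto_intros v) auto
  have d: "0 < ?d" "0 < ?e" using dist_pos by auto
  \<comment> \<open>After X = V (1 + d)^2 / d and its analogue for Y are inserted, zero and pole
    contribute V times a value of T each; the factor 1 - v becomes visible in the
    difference.\<close>
  define T where "T = (\<lambda>a v p. (2 * v + a * v - 1) / (v * (v + a)) + (1 - v) * ((v - p) * (2 * v + a + v * a) / (v\<^sup>2 * (v + a)\<^sup>2)) :: real)"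
  have T_eq: "(1 + a)\<^sup>2 * ((a + p) / (v + a)\<^sup>2) - p / v\<^sup>2 = a * T a v p" if "0 < a" "0 < v" for a v p :: real
  proof -
    have "(1 + a)\<^sup>2 * ((a + p) / (v + a)\<^sup>2) - p / v\<^sup>2 = ((1 + a)\<^sup>2 * v\<^sup>2 * (a + p) - p * (v + a)\<^sup>2) / (v\<^sup>2 * (v + a)\<^sup>2)"
      using that by (simp add: divide_simps)
    also have "(1 + a)\<^sup>2 * v\<^sup>2 * (a + p) - p * (v + a)\<^sup>2 = a * ((2 * v + a * v - 1) * (v * (v + a)) + (1 - v) * ((v - p) * (2 * v + a + v * a)))"
      by (simp add: power2_eq_square algebra_simps)
    also have "\<dots> / (v\<^sup>2 * (v + a)\<^sup>2) = a * T a v p"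
      using that unfolding T_def by (simp add: divide_simps power2_eq_square)
    finally show ?thesis .
  qed
  have Xd: "X = V / ?d * (1 + ?d)\<^sup>2"
    unfolding VX[symmetric] zero_dist_def using \<beta>_pos \<beta>_less \<alpha>_less by (simp add: field_simps power2_eq_square)
  have Ye: "Y = V / ?e * (1 + ?e)\<^sup>2"
    unfolding VY[symmetric] pole_dist_def using \<beta>_pos \<beta>_less \<alpha>_less by (simp add: field_simps power2_eq_square)
  have he: "h = V / ?d - V / ?e"
  proof -
    have "V / ?d = X * \<alpha>\<^sup>2"
      unfolding VX[symmetric] zero_dist_def using \<beta>_pos \<beta>_less \<alpha>_less by (simp add: power2_eq_square)
    moreover have "V / ?e = Y * \<beta>\<^sup>2"
      unfolding VY[symmetric] pole_dist_def using \<beta>_pos \<beta>_less \<alpha>_less by (simp add: power2_eq_square)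
    moreover have "X * \<alpha>\<^sup>2 - Y * \<beta>\<^sup>2 = h"
      using VX VY unfolding h_def by (simp add: power2_eq_square algebra_simps)
    ultimately show ?thesis by simp
  qed
  define B where "B = (\<lambda>v p. - ((?e - ?d) * (1 - v) / (v * (v + ?d) * (v + ?e)))
     + (v - p) * (2 * v + ?d + v * ?d) / (v\<^sup>2 * (v + ?d)\<^sup>2) - (v - p) * (2 * v + ?e + v * ?e) / (v\<^sup>2 * (v + ?e)\<^sup>2))"
  have diff: "T ?d v p - T ?e v p = (1 - v) * B v p" if "0 < v" for v p
  proof -
    have "(2 * v + ?d * v - 1) / (v * (v + ?d)) - (2 * v + ?e * v - 1) / (v * (v + ?e)) = (1 - v) * (- ((?e - ?d) * (1 - v) / (v * (v + ?d) * (v + ?e))))"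
      using that d by (simp add: divide_simps) (simp add: algebra_simps)
    then show ?thesis unfolding T_def B_def by (simp only: distrib_left right_diff_distrib)
  qed
  have S: "X * ((?d + p) / (v + ?d)\<^sup>2) - Y * ((?e + p) / (v + ?e)\<^sup>2) - h * (p / v\<^sup>2) = V * ((1 - v) * B v p)" if "0 < v" for v p
  proof -
    have "X * ((?d + p) / (v + ?d)\<^sup>2) - Y * ((?e + p) / (v + ?e)\<^sup>2) - h * (p / v\<^sup>2) =
      V / ?d * ((1 + ?d)\<^sup>2 * ((?d + p) / (v + ?d)\<^sup>2) - p / v\<^sup>2) - V / ?e * ((1 + ?e)\<^sup>2 * ((?e + p) / (v + ?e)\<^sup>2) - p / v\<^sup>2)"
    proof -
      have *: "A * a * x - B * b * y - (A - B) * z = A * (a * x - z) - B * (b * y - z)" for A B a b x y z :: real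
        by (simp add: algebra_simps)
      show ?thesis unfolding he by (subst Xd, subst Ye) (rule *)
    qed
    also have "\<dots> = V * (T ?d v p - T ?e v p)"
      unfolding T_eq[OF d(1) that] T_eq[OF d(2) that] using d by (simp add: right_diff_distrib)
    finally show ?thesis unfolding diff[OF that] .
  qed
  define Z where "Z = (\<lambda>k. ((real (N k) - X * l k ^ 3) / l k * ((?d + p k) / (v k + ?d)\<^sup>2) - (real (M k) - Y * l k ^ 3) / l k * ((?e + p k) / (v k + ?e)\<^sup>2)
       + (h * l k ^ 3 - real (n k)) / l k * (p k / (v k)\<^sup>2)) * (1 / l k))"
  have "(\<lambda>k. V * B (v k) (p k) + Z k)
     \<longlonglongrightarrow> V * (- ((?e - ?d) * (1 - 1) / (1 * (1 + ?d) * (1 + ?e))) + (1 - saddle_centre ?d 1) * (2 * 1 + ?d + 1 * ?d) / (1\<^sup>2 * (1 + ?d)\<^sup>2)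
        - (1 - saddle_centre ?d 1) * (2 * 1 + ?e + 1 * ?e) / (1\<^sup>2 * (1 + ?e)\<^sup>2))
       + (0 * ((?d + saddle_centre ?d 1) / (1 + ?d)\<^sup>2) - 0 * ((?e + saddle_centre ?d 1) / (1 + ?e)\<^sup>2) + \<nu> * (saddle_centre ?d 1 / 1\<^sup>2)) * 0"
    unfolding Z_def B_def by (intro tendsto_intros N M n v p il) (use d in auto)
  moreover have "V * (- ((?e - ?d) * (1 - 1) / (1 * (1 + ?d) * (1 + ?e))) + (1 - saddle_centre ?d 1) * (2 * 1 + ?d + 1 * ?d) / (1\<^sup>2 * (1 + ?d)\<^sup>2)
        - (1 - saddle_centre ?d 1) * (2 * 1 + ?e + 1 * ?e) / (1\<^sup>2 * (1 + ?e)\<^sup>2))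
       + (0 * ((?d + saddle_centre ?d 1) / (1 + ?d)\<^sup>2) - 0 * ((?e + saddle_centre ?d 1) / (1 + ?e)\<^sup>2) + \<nu> * (saddle_centre ?d 1 / 1\<^sup>2)) * 0
     = 2 * V * (\<alpha> - \<beta>) * (1 - saddle_centre ?d 1)"
  proof -
    have *: "x * (2 * 1 + a + 1 * a) / (1\<^sup>2 * (1 + a)\<^sup>2) = x * 2 * (1 / (1 + a))" if "0 < a" for x a :: real
      using that by (simp add: divide_simps power2_eq_square)
    have ab: "1 / (1 + ?d) = \<alpha>" "1 / (1 + ?e) = \<beta>"
      using \<beta>_pos \<beta>_less \<alpha>_less by (auto simp: zero_dist_def pole_dist_def field_simps)
    show ?thesis unfolding *[OF d(1)] *[OF d(2)] ab by (simp add: algebra_simps)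
  qed
  ultimately have "(\<lambda>k. V * B (v k) (p k) + Z k) \<longlonglongrightarrow> 2 * V * (\<alpha> - \<beta>) * (1 - saddle_centre ?d 1)" by (simp only:)
  moreover have "\<forall>\<^sub>F k in sequentially. V * B (v k) (p k) + Z k = D k / (l k)\<^sup>2"
    using lpos
  proof eventually_elim
    case (elim k)
    have vp: "0 < v k" using elim by (simp add: v_def)
    have l1: "l k * (1 - v k) = 1" using elim by (simp add: v_def)
    have "V * B (v k) (p k) = l k * (V * ((1 - v k) * B (v k) (p k)))"
    proof -
      have "l k * (V * ((1 - v k) * B (v k) (p k))) = (l k * (1 - v k)) * (V * B (v k) (p k))" by (simp only: mult_ac)
      then show ?thesis unfolding l1 by simp
    qed
    moreover have "P / (l k)\<^sup>2 = l k * X + (P - X * l k ^ 3) / l k * (1 / l k)" for P X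
      using elim by (simp add: field_simps power2_eq_square power3_eq_cube)
    then have div: "P * c / (l k)\<^sup>2 = l k * (X * c) + (P - X * l k ^ 3) / l k * c * (1 / l k)" for P X c
      by (metis (no_types) distrib_right mult.assoc mult.commute times_divide_eq_left)
    have "D k / (l k)\<^sup>2 = l k * (X * ((?d + p k) / (v k + ?d)\<^sup>2) - Y * ((?e + p k) / (v k + ?e)\<^sup>2) - h * (p k / (v k)\<^sup>2)) + Z k"
    proof -
      have nn: "(h * l k ^ 3 - real (n k)) / l k = - ((real (n k) - h * l k ^ 3) / l k)" by (simp add: minus_divide_left)
      show ?thesis unfolding D_def Z_def diff_divide_distrib[of _ _ "(l k)\<^sup>2"] nn
        unfolding div[of "real (N k)" _ X] div[of "real (M k)" _ Y] div[of "real (n k)" _ h]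
        by (simp only: left_diff_distrib right_diff_distrib distrib_right minus_mult_left[symmetric])
    qed
    ultimately show ?case unfolding S[OF vp] by simp
  qed
  ultimately show ?thesis by (rule tendsto_cong[THEN iffD1, rotated])
qed

end

section \<open>Taylor coefficients as integrals over a circle\<close>

definition saddle_fps :: "nat \<Rightarrow> nat \<Rightarrow> real \<Rightarrow> real \<Rightarrow> real fps" where
  "saddle_fps N M \<alpha> \<beta> = (fps_const (1 - \<alpha>) + fps_const \<alpha> * fps_X) ^ N * inverse (fps_const (1 - \<beta>) + fps_const \<beta> * fps_X) ^ M"

lemma saddle_fps_mult:
  assumes "\<beta> < 1"
  shows "saddle_fps N M \<alpha> \<beta> * (fps_const (1 - \<beta>) + fps_const \<beta> * fps_X) ^ M = (fps_const (1 - \<alpha>) + fps_const \<alpha> * fps_X) ^ N"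
proof -
  have "inverse (fps_const (1 - \<beta>) + fps_const \<beta> * fps_X) * (fps_const (1 - \<beta>) + fps_const \<beta> * fps_X) = 1"
    using assms by (intro inverse_mult_eq_1) simp
  then have "inverse (fps_const (1 - \<beta>) + fps_const \<beta> * fps_X) ^ M * (fps_const (1 - \<beta>) + fps_const \<beta> * fps_X) ^ M = 1"
    unfolding power_mult_distrib[symmetric] by simp
  then show ?thesis unfolding saddle_fps_def mult.assoc by simp
qed

definition complex_fps :: "real fps \<Rightarrow> complex fps" where
  "complex_fps F = Abs_fps (\<lambda>n. of_real (F $ n))"

lemma complex_fps_mult: "complex_fps (F * G) = complex_fps F * complex_fps G"
  by (simp add: complex_fps_def fps_eq_iff fps_mult_nth)

lemma complex_fps_power: "complex_fps (F ^ n) = complex_fps F ^ n"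
proof (induction n)
  case 0
  then show ?case by (simp add: complex_fps_def fps_eq_iff)
qed (simp add: complex_fps_mult)

lemma complex_fps_linear:
  "complex_fps (fps_const a + fps_const b * fps_X) = fps_const (of_real a) + fps_const (of_real b) * fps_X"
  by (simp add: complex_fps_def fps_eq_iff)

lemma has_fps_expansion_saddle:
  assumes "\<beta> < 1"
  shows "saddle_quot N M \<alpha> \<beta> has_fps_expansion complex_fps (saddle_fps N M \<alpha> \<beta>)"
proof -
  let ?n = "fps_const (of_real (1 - \<alpha>)) + fps_const (of_real \<alpha>) * fps_X :: complex fps"
  let ?d = "fps_const (of_real (1 - \<beta>)) + fps_const (of_real \<beta>) * fps_X :: complex fps"
  have nz: "fps_nth (?d ^ M) 0 \<noteq> 0" using assms by (simp add: fps_nth_power_0)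
  have "(\<lambda>u. (of_real (1 - \<alpha>) + of_real \<alpha> * u) ^ N / (of_real (1 - \<beta>) + of_real \<beta> * u) ^ M) has_fps_expansion ?n ^ N / ?d ^ M"
    by (intro has_fps_expansion_divide' nz fps_expansion_intros)
  moreover have "complex_fps (saddle_fps N M \<alpha> \<beta>) * ?d ^ M = ?n ^ N"
    using arg_cong[OF saddle_fps_mult[OF assms, of N M \<alpha>], of complex_fps]
    unfolding complex_fps_mult complex_fps_power complex_fps_linear .
  then have "?n ^ N / ?d ^ M = complex_fps (saddle_fps N M \<alpha> \<beta>)"
    using nz by (metis fps_zero_nth nonzero_mult_div_cancel_right)
  ultimately show ?thesis by (simp add: saddle_quot_def[abs_def])
qed

definition circle_point :: "real \<Rightarrow> real \<Rightarrow> real \<Rightarrow> complex" where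
  "circle_point p R x = of_real p + of_real R * cis (2 * pi * x)"

text \<open>The circle is parametrised by x in [0, 1]. The last factor is du / dx divided by 2 \<pi>
  i, so that no constant remains in the coefficient formula.\<close>

definition circle_integrand :: "nat \<Rightarrow> nat \<Rightarrow> real \<Rightarrow> real \<Rightarrow> nat \<Rightarrow> real \<Rightarrow> real \<Rightarrow> real \<Rightarrow> complex" where
  "circle_integrand N M \<alpha> \<beta> n p R x =
     saddle_quot N M \<alpha> \<beta> (circle_point p R x) / circle_point p R x ^ n * (of_real R * cis (2 * pi * x))"

lemma circle_integrand_reflect:
  "circle_integrand N M \<alpha> \<beta> n p R (1 - x) = cnj (circle_integrand N M \<alpha> \<beta> n p R x)"
proof -
  have "cis (2 * pi * (1 - x)) = cis (2 * pi) * cis (- (2 * pi * x))" unfolding cis_mult by (simp add: algebra_simps)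
  then have "cis (2 * pi * (1 - x)) = cnj (cis (2 * pi * x))" by (simp add: cis_cnj)
  then show ?thesis by (simp add: circle_integrand_def circle_point_def saddle_quot_def)
qed

lemma continuous_on_cis_line [continuous_intros]:
  "continuous_on S f \<Longrightarrow> continuous_on S (\<lambda>x. cis (f x))"
  unfolding cis_conv_exp by (intro continuous_intros)

context
  fixes N M n :: nat and \<alpha> \<beta> p R :: real
  assumes \<beta>: "0 < \<beta>" "\<beta> < 1" and p: "0 \<le> p" "p < R" and R: "R < (1 - \<beta>) / \<beta> + p"
begin

lemma circle_nonzero:
  fixes u :: complex
  shows "norm (u - of_real p) \<le> R \<Longrightarrow> 1 - of_real \<beta> + of_real \<beta> * u \<noteq> 0"
  "norm (u - of_real p) = R \<Longrightarrow> u \<noteq> 0"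
proof -
  show "1 - of_real \<beta> + of_real \<beta> * u \<noteq> 0" if u: "norm (u - of_real p) \<le> R"
  proof
    assume "1 - of_real \<beta> + of_real \<beta> * u = 0"
    moreover have "of_real \<beta> * u = (1 - of_real \<beta> + of_real \<beta> * u) - (1 - of_real \<beta>)" by simp
    ultimately have "of_real \<beta> * u = of_real (- (1 - \<beta>))" by simp
    then have "u = of_real (- (1 - \<beta>)) / of_real \<beta>" using \<beta> by (simp add: eq_divide_eq mult.commute)
    then have "u - of_real p = of_real (- ((1 - \<beta>) / \<beta> + p))" by (simp add: minus_divide_left)
    then have "norm (u - of_real p) = \<bar>- ((1 - \<beta>) / \<beta> + p)\<bar>" by (metis norm_of_real)
    then show False using u R by linarith
  qed
  show "u \<noteq> 0" if "norm (u - of_real p) = R" using that p by auto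
qed

lemma norm_circle_point: "norm (circle_point p R x - of_real p) = R"
  using p by (simp add: circle_point_def norm_mult)

lemma continuous_circle_integrand: "continuous_on S (circle_integrand N M \<alpha> \<beta> n p R)"
  unfolding circle_integrand_def saddle_quot_def
  using circle_nonzero[of "circle_point p R _"] norm_circle_point
  by (auto simp: circle_point_def intro!: continuous_intros)

text \<open>Cauchy's formula on a circle that need not be centred at 0: p < R puts 0 inside, and R <
  (1 - \<beta>) / \<beta> + p puts the pole outside.\<close>

lemma saddle_coeff_contour:
  "(circle_integrand N M \<alpha> \<beta> (Suc n) p R has_integral of_real (saddle_fps N M \<alpha> \<beta> $ n)) {0..1}"
proof -
  let ?f = "saddle_quot N M \<alpha> \<beta>"
  have "?f holomorphic_on cball (of_real p) R"
    unfolding saddle_quot_def using circle_nonzero(1)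
    by (intro holomorphic_intros) (auto simp: dist_norm norm_minus_commute)
  then have "((\<lambda>u. ?f u / (u - 0) ^ Suc n) has_contour_integral (2 * pi * \<i> / fact n * (deriv ^^ n) ?f 0)) (circlepath (of_real p) R)"
    using p by (intro Cauchy_has_contour_integral_higher_derivative_circlepath)
      (auto intro: holomorphic_on_imp_continuous_on holomorphic_on_subset)
  then have "((\<lambda>x. ?f (circlepath (of_real p) R x) / circlepath (of_real p) R x ^ Suc n * vector_derivative (circlepath (of_real p) R) (at x within {0..1}))
     has_integral (2 * pi * \<i> / fact n * (deriv ^^ n) ?f 0)) {0..1}"
    unfolding has_contour_integral_def by simp
  then have lim: "((\<lambda>x. 1 / (2 * pi * \<i>) * (?f (circlepath (of_real p) R x) / circlepath (of_real p) R x ^ Suc n * vector_derivative (circlepath (of_real p) R) (at x within {0..1})))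
     has_integral 1 / (2 * pi * \<i>) * (2 * pi * \<i> / fact n * (deriv ^^ n) ?f 0)) {0..1}"
    by (rule has_integral_mult_right)
  have coeff: "1 / (2 * pi * \<i>) * (2 * pi * \<i> / fact n * (deriv ^^ n) ?f 0) = of_real (saddle_fps N M \<alpha> \<beta> $ n)"
  proof -
    have "of_real (saddle_fps N M \<alpha> \<beta> $ n) = (deriv ^^ n) ?f 0 / fact n"
      using fps_nth_fps_expansion[OF has_fps_expansion_saddle[OF \<beta>(2), of N M \<alpha>], of n] by (simp add: complex_fps_def)
    then show ?thesis by simp
  qed
  have integrand: "1 / (2 * pi * \<i>) * (?f (circlepath (of_real p) R x) / circlepath (of_real p) R x ^ Suc n * vector_derivative (circlepath (of_real p) R) (at x within {0..1}))
     = circle_integrand N M \<alpha> \<beta> (Suc n) p R x" if "x \<in> {0..1}" for x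
  proof -
    have c: "circlepath (of_real p) R x = circle_point p R x"
      by (simp add: circlepath circle_point_def cis_conv_exp mult_ac)
    have d: "vector_derivative (circlepath (of_real p) R) (at x within {0..1}) = 2 * pi * \<i> * (of_real R * cis (2 * pi * x))"
      using that by (simp add: vector_derivative_circlepath01 cis_conv_exp mult_ac)
    have k: "1 / k * (A * (k * B)) = A * B" if "k \<noteq> 0" for k A B :: complex
      using that by simp
    show ?thesis unfolding c d circle_integrand_def by (rule k) simp
  qed
  show ?thesis by (rule has_integral_cong[THEN iffD1, OF integrand lim[unfolded coeff]])
qed

text \<open>The values at x and 1 - x are conjugate. On half of the circle the saddle sits at an end
  point, so that rescaling leads to an integral over a half-line as in
  \<open>airy_int\<close>.\<close>

lemma saddle_coeff_half:
  "saddle_fps N M \<alpha> \<beta> $ n = 2 * (LINT x:{0..1/2}|lborel. Re (circle_integrand N M \<alpha> \<beta> (Suc n) p R x))"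
proof -
  let ?g = "\<lambda>x. Re (circle_integrand N M \<alpha> \<beta> (Suc n) p R x)"
  have cont: "continuous_on S ?g" for S
    using continuous_circle_integrand[of S] unfolding circle_integrand_def saddle_quot_def
    using circle_nonzero[of "circle_point p R _"] norm_circle_point
    by (auto simp: circle_point_def intro!: continuous_intros)
  have "(?g has_integral saddle_fps N M \<alpha> \<beta> $ n) {0..1}"
    using has_integral_Re[OF saddle_coeff_contour] by simp
  then have "saddle_fps N M \<alpha> \<beta> $ n = integral {0..1} ?g" by (simp add: integral_unique)
  also have "\<dots> = integral {0..1/2} ?g + integral {1/2..1} ?g"
    by (rule Henstock_Kurzweil_Integration.integral_combine[symmetric]) (use integrable_continuous_real[OF cont] in auto)
  also have "\<dots> = (LINT x:{0..1/2}|lborel. ?g x) + (LINT x:{1/2..1}|lborel. ?g x)"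
    by (simp add: set_borel_integral_eq_integral borel_integrable_atLeastAtMost'[OF cont])
  also have "(LINT x:{1/2..1}|lborel. ?g x) = (LINT x:{0..1/2}|lborel. ?g x)"
  proof -
    have "(LINT x:{1/2..1}|lborel. ?g x) = \<bar>-1\<bar> *\<^sub>R (LINT x|lborel. indicator {1/2..1} (1 + (-1) * x) *\<^sub>R ?g (1 + (-1) * x))"
      unfolding set_lebesgue_integral_def by (rule lborel_integral_real_affine) simp
    also have "\<dots> = (LINT x:{0..1/2}|lborel. ?g x)"
    proof -
      have "indicator {1/2..1} (1 + (-1) * x) *\<^sub>R ?g (1 + (-1) * x) = indicator {0..1/2} x *\<^sub>R ?g x" for x :: real
        using circle_integrand_reflect[of N M \<alpha> \<beta> "Suc n" p R x] by (auto simp: indicator_def)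
      then show ?thesis unfolding set_lebesgue_integral_def by simp
    qed
    finally show ?thesis .
  qed
  finally show ?thesis by simp
qed

lemma saddle_coeff_scaled:
  assumes l: "0 < l"
  shows "l * saddle_fps N M \<alpha> \<beta> $ n = 2 * (LINT x|lborel. indicator {0..l/2} x * Re (circle_integrand N M \<alpha> \<beta> (Suc n) p R (x / l)))"
proof -
  let ?g = "\<lambda>x. Re (circle_integrand N M \<alpha> \<beta> (Suc n) p R x)"
  have "(LINT x:{0..1/2}|lborel. ?g x) = \<bar>1 / l\<bar> *\<^sub>R (LINT x|lborel. indicator {0..1/2} (0 + 1 / l * x) *\<^sub>R ?g (0 + 1 / l * x))"
    unfolding set_lebesgue_integral_def by (rule lborel_integral_real_affine) (use l in simp)
  also have "\<dots> = 1 / l * (LINT x|lborel. indicator {0..l/2} x * ?g (x / l))"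
  proof -
    have "indicator {0..1/2} (x / l) = (indicator {0..l/2} x :: real)" for x
      using l by (auto simp: indicator_def divide_simps)
    then show ?thesis using l by simp
  qed
  finally show ?thesis unfolding saddle_coeff_half using l by simp
qed

end

section \<open>Uniform domination on the circle\<close>

lemma one_minus_cos_bound:
  fixes x :: real
  assumes "0 \<le> x" "x \<le> 1 / 2"
  shows "8 * x\<^sup>2 \<le> 1 - cos (2 * pi * x)"
proof -
  have "convex_on {0..pi/2} (\<lambda>y. - sin y)"
    by (rule f''_ge0_imp_convex[where f' = "\<lambda>y. - cos y" and f'' = sin])
      (auto intro!: derivative_eq_intros sin_ge_zero)
  then have "- sin ((1 - 2 * x) *\<^sub>R 0 + (2 * x) *\<^sub>R (pi / 2)) \<le> (1 - 2 * x) * (- sin 0) + (2 * x) * (- sin (pi / 2))"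
    using assms by (intro convex_onD) auto
  then have "2 * x \<le> sin (pi * x)" by (simp add: mult.commute)
  then have "(2 * x)\<^sup>2 \<le> (sin (pi * x))\<^sup>2" using assms by (intro power_mono) auto
  moreover have "cos (2 * pi * x) = 1 - 2 * (sin (pi * x))\<^sup>2" using cos_double_sin[of "pi * x"] by (simp add: mult.assoc)
  ultimately show ?thesis by (simp add: power_mult_distrib)
qed

lemma norm_saddle_quot:
  assumes "0 < \<alpha>" "0 < \<beta>"
  shows "norm (saddle_quot N M \<alpha> \<beta> u) =
    \<alpha> ^ N / \<beta> ^ M * (norm (u + of_real ((1 - \<alpha>) / \<alpha>)) ^ N / norm (u + of_real ((1 - \<beta>) / \<beta>)) ^ M)"
proof -
  have "1 - of_real c + of_real c * u = of_real c * (u + of_real ((1 - c) / c))" if "0 < c" for c :: real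
  proof -
    have "of_real c * of_real ((1 - c) / c) = (of_real (1 - c) :: complex)"
      using that unfolding of_real_mult[symmetric] by simp
    then show ?thesis by (simp add: distrib_left del: of_real_divide)
  qed
  from this[OF assms(1)] this[OF assms(2)] show ?thesis
    using assms by (simp add: saddle_quot_def norm_divide norm_mult norm_power power_mult_distrib)
qed

lemma exp_neg_square_le:
  fixes c t :: real
  assumes "0 < c"
  shows "exp (- (c * t\<^sup>2)) \<le> exp (1 / (4 * c)) * exp (- t)"
proof -
  have "0 \<le> c * (t - 1 / (2 * c))\<^sup>2" using assms by simp
  also have "\<dots> = c * t\<^sup>2 - t + 1 / (4 * c)" using assms by (simp add: power2_eq_square field_simps)
  finally show ?thesis by (simp add: exp_add[symmetric])
qed

lemma scaled_rotation_tendsto: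
  fixes l :: "nat \<Rightarrow> real"
  assumes l: "filterlim l at_top sequentially"
  shows "(\<lambda>k. of_real (l k) * (cis (t / l k) - 1)) \<longlonglongrightarrow> \<i> * of_real t"
proof -
  have "((\<lambda>z. exp (\<i> * of_real t * z)) has_field_derivative \<i> * of_real t) (at 0)"
    by (rule derivative_eq_intros refl | simp)+
  then have "((\<lambda>h. (exp (\<i> * of_real t * (0 + h)) - exp (\<i> * of_real t * 0)) / h) \<longlongrightarrow> \<i> * of_real t) (at 0)"
    by (simp only: DERIV_def)
  moreover have "filterlim (\<lambda>k. of_real (1 / l k) :: complex) (at 0) sequentially"
  proof -
    have "(\<lambda>k. 1 / l k) \<longlonglongrightarrow> 0"
      using tendsto_inverse_0_at_top[OF l] by (simp add: inverse_eq_divide)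
    then have "(\<lambda>k. of_real (1 / l k) :: complex) \<longlonglongrightarrow> of_real 0" by (intro tendsto_intros)
    moreover have "\<forall>\<^sub>F k in sequentially. l k \<noteq> 0"
      using filterlim_at_top_dense[THEN iffD1, OF l, rule_format, of 0] by eventually_elim simp
    ultimately show ?thesis by (auto simp: filterlim_at elim: eventually_mono)
  qed
  ultimately have "(\<lambda>k. (exp (\<i> * of_real t * (0 + of_real (1 / l k))) - exp (\<i> * of_real t * 0)) / of_real (1 / l k)) \<longlonglongrightarrow> \<i> * of_real t"
    by (rule filterlim_compose)
  moreover have "(exp (\<i> * of_real t * (0 + of_real (1 / l k))) - exp (\<i> * of_real t * 0)) / of_real (1 / l k) = of_real (l k) * (cis (t / l k) - 1)" for k
    by (simp add: cis_conv_exp mult.commute)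
  ultimately show ?thesis by (simp only:)
qed

context saddle_parameters
begin

lemma V_pos: "0 < V"
  unfolding VX[symmetric] using X_pos \<beta>_pos \<beta>_less \<alpha>_less by (intro mult_pos_pos) auto

lemma h_pos: "0 < h"
proof -
  have "h = V / (1 - \<alpha>) - V / (1 - \<beta>)"
  proof -
    have "V / (1 - \<alpha>) = X * \<alpha>" unfolding VX[symmetric] using \<alpha>_less by simp
    moreover have "V / (1 - \<beta>) = Y * \<beta>" unfolding VY[symmetric] using \<beta>_less \<alpha>_less by simp
    ultimately show ?thesis by (simp add: h_def)
  qed
  then show ?thesis using V_pos \<beta>_less \<alpha>_less by (simp add: divide_strict_left_mono)
qed

text \<open>These are the conditions of the contour formula for the circle through v: 0 inside, the
  pole outside.\<close>

lemma centre_bounds: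
  assumes "0 < v"
  shows "0 \<le> saddle_centre zero_dist v" "saddle_centre zero_dist v < v - saddle_centre zero_dist v"
    "v - saddle_centre zero_dist v < (1 - \<beta>) / \<beta> + saddle_centre zero_dist v"
proof -
  have "zero_dist < (1 - \<beta>) / \<beta>" using dist_pos by (simp add: pole_dist_def)
  moreover have "saddle_centre zero_dist v = 0 \<and> v \<le> zero_dist \<or> saddle_centre zero_dist v = (v - zero_dist) / 2 \<and> zero_dist \<le> v"
    by (auto simp: saddle_centre_def max_def)
  ultimately have "0 \<le> saddle_centre zero_dist v \<and> saddle_centre zero_dist v < v - saddle_centre zero_dist v
    \<and> v - saddle_centre zero_dist v < (1 - \<beta>) / \<beta> + saddle_centre zero_dist v"
    using assms dist_pos(1) by auto
  then show "0 \<le> saddle_centre zero_dist v" "saddle_centre zero_dist v < v - saddle_centre zero_dist v"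
    "v - saddle_centre zero_dist v < (1 - \<beta>) / \<beta> + saddle_centre zero_dist v"
    by blast+
qed

text \<open>The estimate for the exponent a serves all smaller exponents a - i: points of the circle
  have modulus at most v, so the missing powers contribute v^i, the source of the decay in
  i.\<close>

lemma circle_integrand_bound:
  fixes N M a i :: nat and v :: real
  defines "p \<equiv> saddle_centre zero_dist v"
  defines "D \<equiv> real N * ((zero_dist + p) / (v + zero_dist)\<^sup>2) - real M * ((pole_dist + p) / (v + pole_dist)\<^sup>2) - real a * (p / v\<^sup>2)"
  assumes v: "0 < v" "v \<le> 1" and N: "0 < N" and D: "0 \<le> D" and i: "i \<le> a" and x: "0 \<le> x" "x \<le> 1 / 2"
  shows "norm (circle_integrand N M \<alpha> \<beta> (a - i) p (v - p) x)
    \<le> norm (saddle_quot N M \<alpha> \<beta> (of_real v)) / v ^ a * v ^ i * exp (- (D * (8 * (v - p) * x\<^sup>2)))"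
proof -
  note cb = centre_bounds[OF v(1), folded p_def]
  define u where "u = circle_point p (v - p) x"
  have u: "norm (u - of_real p) = v - p" using cb by (simp add: u_def circle_point_def norm_mult del: of_real_diff)
  have unz: "u \<noteq> 0" using u cb by auto
  have pos: "0 < \<alpha>" "0 < \<beta>" using \<beta>_pos \<beta>_less by auto
  have nv: "norm (of_real v + of_real d :: complex) = v + d" if "0 < d" for d
    using that v by (metis abs_of_pos add_pos_pos norm_of_real of_real_add)
  have un: "norm u \<le> v"
    using norm_triangle_ineq[of "u - of_real p" "of_real p"] u cb by simp
  have \<delta>: "8 * (v - p) * x\<^sup>2 \<le> v - Re u"
  proof -
    have "(v - p) * (8 * x\<^sup>2) \<le> (v - p) * (1 - cos (2 * pi * x))"
      using cb one_minus_cos_bound[OF x] by (intro mult_left_mono) auto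
    then show ?thesis by (simp add: u_def circle_point_def algebra_simps)
  qed
  have "norm (saddle_quot N M \<alpha> \<beta> u) / norm u ^ a \<le> norm (saddle_quot N M \<alpha> \<beta> (of_real v)) / v ^ a * exp (- D * (v - Re u))"
  proof -
    have "norm (u + of_real zero_dist) ^ N / (norm (u + of_real pole_dist) ^ M * norm u ^ a)
      \<le> (v + zero_dist) ^ N / ((v + pole_dist) ^ M * v ^ a) * exp (- D * (v - Re u))"
      unfolding D_def p_def using dist_pos v N D u unfolding D_def p_def by (intro saddle_modulus) auto
    from mult_left_mono[OF this, of "\<alpha> ^ N / \<beta> ^ M"] show ?thesis
      unfolding norm_saddle_quot[OF pos] zero_dist_def[symmetric] pole_dist_def[symmetric]
        nv[OF dist_pos(1)] nv[OF less_trans[OF dist_pos]]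
      using pos by (simp add: divide_divide_eq_left mult.assoc)
  qed
  also have "\<dots> \<le> norm (saddle_quot N M \<alpha> \<beta> (of_real v)) / v ^ a * exp (- (D * (8 * (v - p) * x\<^sup>2)))"
    using v mult_left_mono[OF \<delta> D] by (intro mult_left_mono) auto
  finally have main: "norm (saddle_quot N M \<alpha> \<beta> u) / norm u ^ a
    \<le> norm (saddle_quot N M \<alpha> \<beta> (of_real v)) / v ^ a * exp (- (D * (8 * (v - p) * x\<^sup>2)))" .
  have "norm (circle_integrand N M \<alpha> \<beta> (a - i) p (v - p) x) = norm (saddle_quot N M \<alpha> \<beta> u) / norm u ^ (a - i) * (v - p)"
    using cb by (simp add: circle_integrand_def u_def[symmetric] norm_divide norm_mult norm_power del: of_real_diff)
  also have "\<dots> = norm (saddle_quot N M \<alpha> \<beta> u) / norm u ^ a * (norm u ^ i * (v - p))"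
    using unz i by (simp add: power_diff)
  also have "\<dots> \<le> (norm (saddle_quot N M \<alpha> \<beta> (of_real v)) / v ^ a * exp (- (D * (8 * (v - p) * x\<^sup>2)))) * (v ^ i * 1)"
    using main un cb v by (intro mult_mono power_mono) auto
  finally show ?thesis by (simp add: mult_ac)
qed

end

section \<open>Convergence of the rescaled coefficients to the Airy function\<close>

locale saddle_scaling = saddle_parameters +
  fixes N M a :: "nat \<Rightarrow> nat" and l :: "nat \<Rightarrow> real" and \<sigma> s :: real
  assumes l_lim: "filterlim l at_top sequentially"
    and N_lim: "(\<lambda>k. (real (N k) - X * l k ^ 3) / l k) \<longlonglongrightarrow> 0"
    and M_lim: "(\<lambda>k. (real (M k) - Y * l k ^ 3) / l k) \<longlonglongrightarrow> 0"
    and a_lim: "(\<lambda>k. (h * l k ^ 3 - real (a k)) / l k) \<longlonglongrightarrow> \<sigma> * s"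
    and \<sigma>_pos: "0 < \<sigma>" and \<sigma>_cube: "\<sigma> ^ 3 = V * (\<alpha> - \<beta>)"
begin

text \<open>The coefficients are read downwards from a k, so that i is a distance from the edge; the
  Airy function appears for i of order l k.\<close>

definition scaled_coeff :: "nat \<Rightarrow> nat \<Rightarrow> real" where
  "scaled_coeff k i = (if i < a k then l k * saddle_fps (N k) (M k) \<alpha> \<beta> $ (a k - Suc i) else 0)"

text \<open>The circle passes at distance 1 / l k inside the critical point. Through the critical
  point itself both the decay in i and the leading part of the quadratic rate would be lost.\<close>

definition radial :: "nat \<Rightarrow> real" where "radial k = 1 - 1 / l k"
definition centre :: "nat \<Rightarrow> real" where "centre k = saddle_centre zero_dist (radial k)"

definition integrand :: "nat \<Rightarrow> nat \<Rightarrow> real \<Rightarrow> complex" where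
  "integrand k i x = circle_integrand (N k) (M k) \<alpha> \<beta> (a k - i) (centre k) (radial k - centre k) (x / l k)"

lemma inverse_lim: "(\<lambda>k. 1 / l k) \<longlonglongrightarrow> 0"
  using tendsto_inverse_0_at_top[OF l_lim] by (simp add: inverse_eq_divide)

lemma l_large: "\<forall>\<^sub>F k in sequentially. c < l k"
  using l_lim by (auto simp: filterlim_at_top_dense)

lemma radial_lim: "radial \<longlonglongrightarrow> 1"
proof -
  have "radial \<longlonglongrightarrow> 1 - 0" unfolding radial_def by (intro tendsto_intros inverse_lim)
  then show ?thesis by simp
qed

lemma centre_lim: "centre \<longlonglongrightarrow> saddle_centre zero_dist 1"
  unfolding centre_def saddle_centre_def by (intro tendsto_intros radial_lim) auto

lemma scaled_coeff_integral:
  assumes "1 < l k" "i < a k"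
  shows "scaled_coeff k i = 2 * (LINT x|lborel. indicator {0..l k/2} x * Re (integrand k i x))"
proof -
  have v: "0 < radial k" using assms by (simp add: radial_def)
  have "l k * saddle_fps (N k) (M k) \<alpha> \<beta> $ (a k - Suc i) = 2 * (LINT x|lborel. indicator {0..l k/2} x *
     Re (circle_integrand (N k) (M k) \<alpha> \<beta> (Suc (a k - Suc i)) (centre k) (radial k - centre k) (x / l k)))"
    unfolding centre_def by (rule saddle_coeff_scaled) (use assms \<beta>_pos \<beta>_less \<alpha>_less centre_bounds[OF v] in auto)
  then show ?thesis using assms by (simp add: scaled_coeff_def integrand_def Suc_diff_Suc)
qed

lemma measurable_integrand:
  assumes "1 < l k"
  shows "integrand k i \<in> borel_measurable borel"
proof -
  have v: "0 < radial k" using assms by (simp add: radial_def)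
  have "continuous_on UNIV (circle_integrand (N k) (M k) \<alpha> \<beta> (a k - i) (centre k) (radial k - centre k))"
    unfolding centre_def by (rule continuous_circle_integrand) (use \<beta>_pos \<beta>_less \<alpha>_less centre_bounds[OF v] in auto)
  then have "continuous_on UNIV (\<lambda>x. circle_integrand (N k) (M k) \<alpha> \<beta> (a k - i) (centre k) (radial k - centre k) (x / l k))"
    by (rule continuous_on_compose2) (use assms in \<open>auto intro!: continuous_intros\<close>)
  then show ?thesis unfolding integrand_def[abs_def] by (rule borel_measurable_continuous_onI)
qed

lemma integrand_bound:
  obtains C where "0 \<le> C" "\<forall>\<^sub>F k in sequentially. \<forall>i<a k. \<forall>x. 0 \<le> x \<longrightarrow> x \<le> l k / 2 \<longrightarrow>
     norm (integrand k i x) \<le> C * exp (- (real i / l k)) * exp (- x)"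
proof -
  define D where "D = (\<lambda>k. real (N k) * ((zero_dist + centre k) / (radial k + zero_dist)\<^sup>2) - real (M k) * ((pole_dist + centre k) / (radial k + pole_dist)\<^sup>2)
    - real (a k) * (centre k / (radial k)\<^sup>2))"
  define P where "P = (\<lambda>k. norm (saddle_quot (N k) (M k) \<alpha> \<beta> (of_real (radial k))) / radial k ^ a k)"
  let ?\<rho> = "1 - saddle_centre zero_dist 1"
  have \<rho>: "0 < ?\<rho>" using dist_pos by (simp add: saddle_centre_def)
  define L where "L = 2 * V * (\<alpha> - \<beta>) * ?\<rho> * (8 * ?\<rho>)"
  have L: "0 < L" using V_pos \<beta>_less \<rho> by (simp add: L_def)
  have "(\<lambda>k. D k / (l k)\<^sup>2) \<longlonglongrightarrow> 2 * V * (\<alpha> - \<beta>) * ?\<rho>"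
    using saddle_rate_tendsto[OF l_lim N_lim M_lim a_lim] unfolding D_def centre_def radial_def .
  then have "(\<lambda>k. D k / (l k)\<^sup>2 * (8 * (radial k - centre k))) \<longlonglongrightarrow> L"
    unfolding L_def by (intro tendsto_intros radial_lim centre_lim)
  then have rate: "\<forall>\<^sub>F k in sequentially. L / 2 < D k / (l k)\<^sup>2 * (8 * (radial k - centre k))"
    by (rule order_tendstoD) (use L in simp)
  obtain Q where Q: "\<forall>\<^sub>F k in sequentially. P k \<le> Q"
  proof -
    \<comment> \<open>At w = - 1 / l k, which is the radial point, the pointwise limit shows that
      the prefactor P is bounded.\<close>
    have "(\<lambda>k. of_real (l k) * of_real (- 1 / l k) :: complex) \<longlonglongrightarrow> - 1"
      by (rule tendsto_eventually) (use l_large[of 0] in eventually_elim, simp)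
    from tendsto_norm[OF saddle_pointwise[OF l_lim N_lim M_lim a_lim this]]
    have "(\<lambda>k. norm (saddle_quot (N k) (M k) \<alpha> \<beta> (1 + of_real (- 1 / l k)) / (1 + of_real (- 1 / l k)) ^ a k))
      \<longlonglongrightarrow> norm (exp (of_real (\<sigma> * s) * - 1 - of_real (V * (\<alpha> - \<beta>)) * (- 1) ^ 3 / 3 :: complex))" (is "_ \<longlonglongrightarrow> ?c") .
    then have "\<forall>\<^sub>F k in sequentially. norm (saddle_quot (N k) (M k) \<alpha> \<beta> (1 + of_real (- 1 / l k)) / (1 + of_real (- 1 / l k)) ^ a k) < ?c + 1"
      by (rule order_tendstoD) simp
    then have "\<forall>\<^sub>F k in sequentially. P k \<le> ?c + 1"
      using l_large[of 1]
    proof eventually_elim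
      case (elim k)
      have r: "1 + of_real (- 1 / l k) = (of_real (radial k) :: complex)" by (simp add: radial_def)
      have "norm (of_real (radial k) :: complex) = radial k" using elim unfolding norm_of_real by (simp add: radial_def)
      then show ?case using elim(1) unfolding r P_def by (simp add: norm_divide norm_power)
    qed
    then show thesis by (rule that)
  qed
  have "\<forall>\<^sub>F k in sequentially. X / 2 < real (N k) / l k ^ 3"
    using cubic_ratio_tendsto[OF l_lim N_lim] by (rule order_tendstoD) (use X_pos in simp)
  then have "\<forall>\<^sub>F k in sequentially. \<forall>i<a k. \<forall>x. 0 \<le> x \<longrightarrow> x \<le> l k / 2 \<longrightarrow>
     norm (integrand k i x) \<le> (max 0 Q * exp (1 / (4 * (L / 2)))) * exp (- (real i / l k)) * exp (- x)"
    using l_large[of 1] rate Q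
  proof eventually_elim
    case (elim k)
    have l: "1 < l k" by fact
    have v: "0 < radial k" "radial k \<le> 1" using l by (auto simp: radial_def)
    have R: "0 < radial k - centre k" using centre_bounds[OF v(1)] by (simp add: centre_def)
    have Nk: "0 < N k"
    proof (rule ccontr)
      assume "\<not> 0 < N k"
      then show False using elim(1) X_pos by simp
    qed
    have D: "0 \<le> D k"
    proof -
      have "0 < D k / (l k)\<^sup>2 * (8 * (radial k - centre k))" using elim(3) L by linarith
      then show ?thesis using R l by (auto simp: zero_less_mult_iff zero_less_divide_iff)
    qed
    show ?case
    proof (intro allI impI)
      fix i x assume i: "i < a k" and x: "0 \<le> x" "x \<le> l k / 2"
      have "norm (integrand k i x) \<le> P k * radial k ^ i * exp (- (D k * (8 * (radial k - centre k) * (x / l k)\<^sup>2)))"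
        unfolding integrand_def P_def D_def centre_def
        by (rule circle_integrand_bound) (use v Nk D i x l in \<open>auto simp: D_def centre_def divide_simps\<close>)
      also have "\<dots> \<le> max 0 Q * exp (- (real i / l k)) * (exp (1 / (4 * (L / 2))) * exp (- x))"
      proof (intro mult_mono)
        show "P k \<le> max 0 Q" using elim(4) by simp
        have "radial k \<le> exp (- (1 / l k))" using exp_ge_add_one_self[of "- (1 / l k)"] by (simp add: radial_def)
        then have "radial k ^ i \<le> exp (- (1 / l k)) ^ i" using v by (intro power_mono) auto
        then show "radial k ^ i \<le> exp (- (real i / l k))" by (simp add: exp_of_nat_mult[symmetric])
        have "L / 2 * x\<^sup>2 \<le> (D k / (l k)\<^sup>2 * (8 * (radial k - centre k))) * x\<^sup>2"
          using elim(3) by (intro mult_right_mono) auto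
        also have "\<dots> = D k * (8 * (radial k - centre k) * (x / l k)\<^sup>2)" by (simp add: power_divide)
        finally have "exp (- (D k * (8 * (radial k - centre k) * (x / l k)\<^sup>2))) \<le> exp (- (L / 2 * x\<^sup>2))" by simp
        also have "\<dots> \<le> exp (1 / (4 * (L / 2))) * exp (- x)" by (rule exp_neg_square_le) (use L in simp)
        finally show "exp (- (D k * (8 * (radial k - centre k) * (x / l k)\<^sup>2))) \<le> exp (1 / (4 * (L / 2))) * exp (- x)" .
      qed (use v in \<open>auto simp: P_def\<close>)
      finally show "norm (integrand k i x) \<le> (max 0 Q * exp (1 / (4 * (L / 2)))) * exp (- (real i / l k)) * exp (- x)"
        by (simp only: mult_ac)
    qed
  qed
  then show thesis by (intro that[of "max 0 Q * exp (1 / (4 * (L / 2)))"]) auto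
qed

lemma scaled_coeff_bound:
  obtains C where "0 \<le> C" "\<forall>\<^sub>F k in sequentially. \<forall>i. \<bar>scaled_coeff k i\<bar> \<le> C * exp (- (real i / l k))"
proof -
  obtain C where C: "0 \<le> C" "\<forall>\<^sub>F k in sequentially. \<forall>i<a k. \<forall>x. 0 \<le> x \<longrightarrow> x \<le> l k / 2 \<longrightarrow>
     norm (integrand k i x) \<le> C * exp (- (real i / l k)) * exp (- x)" by (rule integrand_bound)
  define J where "J = (LINT x|lborel. indicator {0..} x * exp (- x :: real))"
  have int: "integrable lborel (\<lambda>x::real. indicator {0..} x * exp (- x))"
    using set_integrable_exp_decay[of 1] by (simp add: set_integrable_def)
  have J: "0 \<le> J" unfolding J_def by (intro integral_nonneg_AE) (auto simp: indicator_def)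
  have "\<forall>\<^sub>F k in sequentially. \<forall>i. \<bar>scaled_coeff k i\<bar> \<le> (2 * (C * J)) * exp (- (real i / l k))"
    using C(2) l_large[of 1]
  proof eventually_elim
    case (elim k)
    show ?case
    proof
      fix i
      show "\<bar>scaled_coeff k i\<bar> \<le> (2 * (C * J)) * exp (- (real i / l k))"
      proof (cases "i < a k")
        case True
        let ?f = "\<lambda>x. indicator {0..l k/2} x * Re (integrand k i x)"
        let ?g = "\<lambda>x. (C * exp (- (real i / l k))) * (indicator {0..} x * exp (- x))"
        have le: "\<bar>?f x\<bar> \<le> ?g x" for x
        proof (cases "0 \<le> x \<and> x \<le> l k / 2")
          case True
          then have "\<bar>Re (integrand k i x)\<bar> \<le> C * exp (- (real i / l k)) * exp (- x)"
            using elim(1) \<open>i < a k\<close> order_trans[OF abs_Re_le_cmod] by blast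
          then show ?thesis using True by simp
        next
          case False
          then show ?thesis using C(1) by (auto simp: indicator_def)
        qed
        have ig: "integrable lborel ?g" by (intro integrable_mult_right int)
        have [measurable]: "integrand k i \<in> borel_measurable borel" using measurable_integrand elim by auto
        have "integrable lborel ?f"
          by (rule Bochner_Integration.integrable_bound[OF ig]) (use le in \<open>auto intro!: AE_I2 order_trans[OF _ abs_ge_self] simp del: mult_le_0_iff\<close>)
        then have "\<bar>LINT x|lborel. ?f x\<bar> \<le> (LINT x|lborel. ?g x)"
          by (rule integral_abs_bound_integral) (use ig le in auto)
        also have "\<dots> = C * exp (- (real i / l k)) * J" by (simp add: J_def)
        finally show ?thesis
          unfolding scaled_coeff_integral[OF elim(2) True] by (simp add: abs_mult mult_ac)
      qed (use C J in \<open>simp add: scaled_coeff_def\<close>)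
    qed
  qed
  then show thesis using C(1) J by (intro that[of "2 * (C * J)"]) auto
qed

text \<open>Near its rightmost point, on the scale 1 / l k, the circle looks like the vertical line
  through -1. Multiplied by - \<sigma> and conjugated, this is the contour Re w = \<sigma> of the
  Airy integral.\<close>

lemma integrand_tendsto:
  assumes i: "(\<lambda>k. real (i k) / (\<sigma> * l k)) \<longlonglongrightarrow> \<xi>" and small: "\<forall>\<^sub>F k in sequentially. i k < a k"
  defines "\<rho> \<equiv> 1 - saddle_centre zero_dist 1"
  shows "(\<lambda>k. integrand k (i k) x) \<longlonglongrightarrow> of_real \<rho> * cnj (airy_fun (s + \<xi>) (Complex \<sigma> (2 * pi * \<rho> * \<sigma> * x)))"
proof -
  define R where "R = (\<lambda>k. radial k - centre k)"
  define \<omega> where "\<omega> = - 1 + of_real \<rho> * (\<i> * of_real (2 * pi * x))"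
  define w where "w = (\<lambda>k. circle_point (centre k) (R k) (x / l k) - 1)"
  have R: "R \<longlonglongrightarrow> \<rho>" unfolding R_def \<rho>_def by (intro tendsto_intros radial_lim centre_lim)
  have rot: "(\<lambda>k. of_real (l k) * (cis (2 * pi * x / l k) - 1)) \<longlonglongrightarrow> \<i> * of_real (2 * pi * x)"
    by (rule scaled_rotation_tendsto[OF l_lim])
  have "(\<lambda>k. - 1 + of_real (R k) * (of_real (l k) * (cis (2 * pi * x / l k) - 1))) \<longlonglongrightarrow> \<omega>"
    unfolding \<omega>_def by (intro tendsto_intros R rot)
  moreover have "\<forall>\<^sub>F k in sequentially. - 1 + of_real (R k) * (of_real (l k) * (cis (2 * pi * x / l k) - 1)) = of_real (l k) * w k"
    using l_large[of 0]
  proof eventually_elim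
    case (elim k)
    have "l k * (centre k + R k - 1) = - 1" using elim by (simp add: R_def radial_def)
    then have "of_real (l k) * (of_real (centre k) + of_real (R k) - 1 :: complex) = - 1"
      by (metis of_real_1 of_real_add of_real_diff of_real_minus of_real_mult)
    moreover have "of_real (l k) * w k = of_real (l k) * (of_real (centre k) + of_real (R k) - 1) + of_real (R k) * (of_real (l k) * (cis (2 * pi * x / l k) - 1))"
      by (simp add: w_def circle_point_def algebra_simps)
    ultimately show ?case by simp
  qed
  ultimately have w: "(\<lambda>k. of_real (l k) * w k) \<longlonglongrightarrow> \<omega>" by (rule tendsto_cong[THEN iffD1, rotated])
  have n: "(\<lambda>k. (h * l k ^ 3 - real (a k - i k)) / l k) \<longlonglongrightarrow> \<sigma> * s + \<sigma> * \<xi>"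
  proof -
    have "(\<lambda>k. (h * l k ^ 3 - real (a k)) / l k + \<sigma> * (real (i k) / (\<sigma> * l k))) \<longlonglongrightarrow> \<sigma> * s + \<sigma> * \<xi>"
      by (intro tendsto_intros a_lim i)
    moreover have "\<forall>\<^sub>F k in sequentially. (h * l k ^ 3 - real (a k)) / l k + \<sigma> * (real (i k) / (\<sigma> * l k)) = (h * l k ^ 3 - real (a k - i k)) / l k"
      using small l_large[of 0]
      by eventually_elim (use \<sigma>_pos in \<open>simp add: of_nat_diff field_simps\<close>)
    ultimately show ?thesis by (rule tendsto_cong[THEN iffD1, rotated])
  qed
  have "(\<lambda>k. cis (2 * pi * (x / l k))) \<longlonglongrightarrow> 1"
  proof -
    have "(\<lambda>k. cis (2 * pi * (x * (1 / l k)))) \<longlonglongrightarrow> cis (2 * pi * (x * 0))"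
      unfolding cis_conv_exp by (intro tendsto_intros inverse_lim)
    then show ?thesis by simp
  qed
  with saddle_pointwise[OF l_lim N_lim M_lim n w]
  have "(\<lambda>k. saddle_quot (N k) (M k) \<alpha> \<beta> (1 + w k) / (1 + w k) ^ (a k - i k) * (of_real (R k) * cis (2 * pi * (x / l k))))
     \<longlonglongrightarrow> exp (of_real (\<sigma> * s + \<sigma> * \<xi>) * \<omega> - of_real (V * (\<alpha> - \<beta>)) * \<omega> ^ 3 / 3) * (of_real \<rho> * 1)"
    by (intro tendsto_mult tendsto_of_real R)
  moreover have "saddle_quot (N k) (M k) \<alpha> \<beta> (1 + w k) / (1 + w k) ^ (a k - i k) * (of_real (R k) * cis (2 * pi * (x / l k))) = integrand k (i k) x" for k
    by (simp add: integrand_def circle_integrand_def w_def R_def)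
  moreover have "exp (of_real (\<sigma> * s + \<sigma> * \<xi>) * \<omega> - of_real (V * (\<alpha> - \<beta>)) * \<omega> ^ 3 / 3) = cnj (airy_fun (s + \<xi>) (Complex \<sigma> (2 * pi * \<rho> * \<sigma> * x)))"
  proof -
    have c: "cnj (Complex \<sigma> (2 * pi * \<rho> * \<sigma> * x)) = - (of_real \<sigma> * \<omega>)" by (simp add: \<omega>_def complex_eq_iff)
    show ?thesis unfolding airy_fun_def exp_cnj complex_cnj_diff complex_cnj_divide complex_cnj_power complex_cnj_mult c \<sigma>_cube[symmetric]
      by (simp add: power_mult_distrib algebra_simps power3_eq_cube)
  qed
  ultimately show ?thesis by (simp add: mult.commute)
qed

end

context saddle_scaling
begin

text \<open>a k grows like h l^3 with h > 0, whereas i k is of order l.\<close>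

lemma eventually_below_a:
  assumes i: "(\<lambda>k. real (i k) / (\<sigma> * l k)) \<longlonglongrightarrow> \<xi>"
  shows "\<forall>\<^sub>F k in sequentially. i k < a k"
proof -
  have "(\<lambda>k. (real (a k) - h * l k ^ 3) / l k) \<longlonglongrightarrow> - (\<sigma> * s)"
    using tendsto_minus[OF a_lim] unfolding minus_divide_left minus_diff_eq .
  from cubic_ratio_tendsto[OF l_lim this] have a: "(\<lambda>k. real (a k) / l k ^ 3) \<longlonglongrightarrow> h" .
  have "(\<lambda>k. \<sigma> * (real (i k) / (\<sigma> * l k)) * (1 / l k)\<^sup>2) \<longlonglongrightarrow> \<sigma> * \<xi> * 0\<^sup>2"
    by (intro tendsto_intros i inverse_lim)
  then have "(\<lambda>k. real (a k) / l k ^ 3 - \<sigma> * (real (i k) / (\<sigma> * l k)) * (1 / l k)\<^sup>2) \<longlonglongrightarrow> h - 0"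
    by (intro tendsto_diff a) simp
  then have "\<forall>\<^sub>F k in sequentially. 0 < real (a k) / l k ^ 3 - \<sigma> * (real (i k) / (\<sigma> * l k)) * (1 / l k)\<^sup>2"
    by (rule order_tendstoD) (use h_pos in simp)
  then show ?thesis
    using l_large[of 0]
  proof eventually_elim
    case (elim k)
    have "\<sigma> * (real (i k) / (\<sigma> * l k)) * (1 / l k)\<^sup>2 = real (i k) / l k ^ 3"
      using \<sigma>_pos elim by (simp add: power2_eq_square power3_eq_cube)
    then have "real (i k) / l k ^ 3 < real (a k) / l k ^ 3" using elim(1) by simp
    then show ?case using elim(2) by (simp add: divide_less_cancel)
  qed
qed

text \<open>A dilation by 2 \<pi> \<rho> \<sigma>. The limiting radius \<rho> cancels, so the result
  does not depend on the centre of the circle.\<close>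

lemma airy_vertical_integral:
  assumes "0 < \<rho>"
  shows "2 * (LINT x|lborel. indicator {0..} x * Re (of_real \<rho> * cnj (airy_fun y (Complex \<sigma> (2 * pi * \<rho> * \<sigma> * x))))) = airy y / \<sigma>"
proof -
  define c where "c = 2 * pi * \<rho> * \<sigma>"
  have c: "0 < c" using assms \<sigma>_pos by (simp add: c_def)
  let ?g = "\<lambda>x. Re (airy_fun y (Complex \<sigma> x))"
  have "pi * airy y = Re (airy_int \<sigma> 0 y)" using airy_eq_Re_airy_int[OF \<sigma>_pos, of y] by simp
  also have "\<dots> = (LINT x|lborel. indicator {0..} x * ?g x)"
    using integral_Re[OF airy_int_integrable[OF \<sigma>_pos, of 0 y, unfolded set_integrable_def]]
    by (simp add: airy_int_def set_lebesgue_integral_def)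
  also have "\<dots> = \<bar>c\<bar> *\<^sub>R (LINT x|lborel. indicator {0..} (0 + c * x) * ?g (0 + c * x))"
    by (rule lborel_integral_real_affine) (use c in simp)
  also have "\<dots> = c * (LINT x|lborel. indicator {0..} x * ?g (c * x))"
  proof -
    have "indicator {0..} (c * x) = (indicator {0..} x :: real)" for x
      using c by (auto simp: indicator_def zero_le_mult_iff)
    then show ?thesis using c by simp
  qed
  finally have "(LINT x|lborel. indicator {0..} x * ?g (c * x)) = pi * airy y / c" using c by (simp add: field_simps)
  moreover have e: "indicator {0..} x * Re (of_real \<rho> * cnj (airy_fun y (Complex \<sigma> (2 * pi * \<rho> * \<sigma> * x)))) = \<rho> * (indicator {0..} x * ?g (c * x))" for x
    by (simp add: c_def)
  ultimately show ?thesis unfolding e integral_mult_right_zero using assms \<sigma>_pos by (simp add: c_def)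
qed

theorem scaled_coeff_tendsto:
  assumes i: "(\<lambda>k. real (i k) / (\<sigma> * l k)) \<longlonglongrightarrow> \<xi>"
  shows "(\<lambda>k. scaled_coeff k (i k)) \<longlonglongrightarrow> airy (s + \<xi>) / \<sigma>"
proof -
  define \<rho> where "\<rho> = 1 - saddle_centre zero_dist 1"
  have \<rho>: "0 < \<rho>" using dist_pos by (simp add: saddle_centre_def \<rho>_def)
  obtain C where C: "0 \<le> C" "\<forall>\<^sub>F k in sequentially. \<forall>i<a k. \<forall>x. 0 \<le> x \<longrightarrow> x \<le> l k / 2 \<longrightarrow>
     norm (integrand k i x) \<le> C * exp (- (real i / l k)) * exp (- x)" by (rule integrand_bound)
  note small = eventually_below_a[OF i]
  have "\<forall>\<^sub>F k in sequentially. i k < a k \<and> 1 < l k \<and> (\<forall>x. 0 \<le> x \<longrightarrow> x \<le> l k / 2 \<longrightarrow> norm (integrand k (i k) x) \<le> C * exp (- x))"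
    using small C(2) l_large[of 1]
  proof eventually_elim
    case (elim k)
    have "norm (integrand k (i k) x) \<le> C * exp (- x)" if x: "0 \<le> x" "x \<le> l k / 2" for x
    proof -
      have "norm (integrand k (i k) x) \<le> C * exp (- (real (i k) / l k)) * exp (- x)" using elim(2) elim(1) x by blast
      also have "\<dots> \<le> C * 1 * exp (- x)" using C(1) elim(3) by (intro mult_mono) auto
      finally show ?thesis by simp
    qed
    then show ?case using elim by auto
  qed
  then obtain K where K: "\<And>k. K \<le> k \<Longrightarrow> i k < a k" "\<And>k. K \<le> k \<Longrightarrow> 1 < l k"
    "\<And>k x. K \<le> k \<Longrightarrow> 0 \<le> x \<Longrightarrow> x \<le> l k / 2 \<Longrightarrow> norm (integrand k (i k) x) \<le> C * exp (- x)"
    unfolding eventually_sequentially by blast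
  let ?f = "\<lambda>k x. indicator {0..l k/2} x * Re (integrand k (i k) x)"
  let ?F = "\<lambda>x. indicator {0..} x * Re (of_real \<rho> * cnj (airy_fun (s + \<xi>) (Complex \<sigma> (2 * pi * \<rho> * \<sigma> * x))))"
  have lim: "(\<lambda>k. ?f k x) \<longlonglongrightarrow> ?F x" for x
  proof (cases "0 \<le> x")
    case True
    have "\<forall>\<^sub>F k in sequentially. indicator {0..l k/2} x = (1 :: real)"
      using l_large[of "2 * x"] by eventually_elim (use True in auto)
    then have "(\<lambda>k. indicator {0..l k/2} x :: real) \<longlonglongrightarrow> 1" by (rule tendsto_eventually)
    then have "(\<lambda>k. ?f k x) \<longlonglongrightarrow> 1 * Re (of_real \<rho> * cnj (airy_fun (s + \<xi>) (Complex \<sigma> (2 * pi * \<rho> * \<sigma> * x))))"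
      unfolding \<rho>_def by (intro tendsto_mult tendsto_Re integrand_tendsto[OF i small])
    then show ?thesis using True by simp
  qed (simp add: indicator_def)
  have meas: "?f (k + K) \<in> borel_measurable lborel" for k
    using measurable_integrand[OF K(2), of "k + K" "i (k + K)"] by measurable
  have int: "integrable lborel (\<lambda>x::real. indicator {0..} x * (C * exp (- x)))"
    using set_integrable_exp_decay[of C] by (simp add: set_integrable_def)
  have bound: "norm (?f (k + K) x) \<le> indicator {0..} x * (C * exp (- x))" for k x
  proof (cases "0 \<le> x \<and> x \<le> l (k + K) / 2")
    case True
    then have "norm (integrand (k + K) (i (k + K)) x) \<le> C * exp (- x)" by (intro K) auto
    then show ?thesis using True abs_Re_le_cmod[of "integrand (k + K) (i (k + K)) x"] by simp
  next
    case False
    then show ?thesis using C(1) by (auto simp: indicator_def)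
  qed
  have "(\<lambda>k. LINT x|lborel. ?f (k + K) x) \<longlonglongrightarrow> (LINT x|lborel. ?F x)"
  proof (rule integral_dominated_convergence[where w = "\<lambda>x. indicator {0..} x * (C * exp (- x))"])
    show "AE x in lborel. (\<lambda>k. ?f (k + K) x) \<longlonglongrightarrow> ?F x" using LIMSEQ_ignore_initial_segment[OF lim] by (intro AE_I2)
    show "?F \<in> borel_measurable lborel"
      by (rule borel_measurable_LIMSEQ_real[OF LIMSEQ_ignore_initial_segment[OF lim, where k = K] meas])
  qed (use meas int bound in auto)
  then have "(\<lambda>k. LINT x|lborel. ?f k x) \<longlonglongrightarrow> (LINT x|lborel. ?F x)" by (rule LIMSEQ_offset)
  then have "(\<lambda>k. 2 * (LINT x|lborel. ?f k x)) \<longlonglongrightarrow> 2 * (LINT x|lborel. ?F x)" by (intro tendsto_intros)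
  moreover have "\<forall>\<^sub>F k in sequentially. 2 * (LINT x|lborel. ?f k x) = scaled_coeff k (i k)"
    using eventually_ge_at_top[of K]
  proof eventually_elim
    case (elim k)
    show ?case by (rule scaled_coeff_integral[symmetric]) (use K elim in auto)
  qed
  ultimately have "(\<lambda>k. scaled_coeff k (i k)) \<longlonglongrightarrow> 2 * (LINT x|lborel. ?F x)" by (rule tendsto_cong[THEN iffD1, rotated])
  then show ?thesis unfolding airy_vertical_integral[OF \<rho>] .
qed

end

section \<open>From products of coefficients to the Airy kernel\<close>

lemma cell_ratio_tendsto:
  fixes c :: "nat \<Rightarrow> real"
  assumes c: "filterlim c at_top sequentially" and x: "s < x"
  shows "(\<lambda>k. real (cell s (c k) x) / c k) \<longlonglongrightarrow> x - s"
proof (rule tendsto_sandwich)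
  have pos: "\<forall>\<^sub>F k in sequentially. 0 < c k" using c by (auto simp: filterlim_at_top_dense)
  have ic: "(\<lambda>k. 1 / c k) \<longlonglongrightarrow> 0"
    using tendsto_inverse_0_at_top[OF c] by (simp add: inverse_eq_divide)
  show "\<forall>\<^sub>F k in sequentially. real (cell s (c k) x) / c k \<le> x - s"
    using pos by eventually_elim (use x cell_eq_iff[of s x] in force)
  show "\<forall>\<^sub>F k in sequentially. x - s - 1 / c k \<le> real (cell s (c k) x) / c k"
    using pos
  proof eventually_elim
    case (elim k)
    have "x < s + real (Suc (cell s (c k) x)) / c k" using cell_eq_iff[OF x elim] by blast
    then show ?case by (simp add: add_divide_distrib)
  qed
  have "(\<lambda>k. x - s - 1 / c k) \<longlonglongrightarrow> x - s - 0" by (intro tendsto_intros ic)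
  then show "(\<lambda>k. x - s - 1 / c k) \<longlonglongrightarrow> x - s" by simp
qed simp

lemma cell_integral_sum:
  fixes f :: "nat \<Rightarrow> real"
  assumes c: "0 < c" and z: "\<And>m. a \<le> m \<Longrightarrow> f m = 0"
  shows "integrable (ray 0) (\<lambda>x. f (cell 0 c x))" "(\<integral>x. f (cell 0 c x) \<partial>ray 0) = (\<Sum>m<a. f m) / c"
proof -
  have e: "(\<lambda>x. f (cell 0 c x)) = (\<lambda>x. \<Sum>m<a. f m * of_bool (cell 0 c x = m))"
  proof
    fix x
    show "f (cell 0 c x) = (\<Sum>m<a. f m * of_bool (cell 0 c x = m))"
      using z[of "cell 0 c x"] by (cases "cell 0 c x < a") (auto simp: of_bool_def if_distrib sum.delta cong: if_cong)
  qed
  show "integrable (ray 0) (\<lambda>x. f (cell 0 c x))"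
    unfolding e using cell_integral(1)[OF c] by (intro Bochner_Integration.integrable_sum integrable_mult_right)
  have "(\<integral>x. f (cell 0 c x) \<partial>ray 0) = (\<Sum>m<a. \<integral>x. f m * of_bool (cell 0 c x = m) \<partial>ray 0)"
    unfolding e using cell_integral(1)[OF c] by (intro Bochner_Integration.integral_sum integrable_mult_right)
  also have "\<dots> = (\<Sum>m<a. f m * (1 / c))"
    by (intro sum.cong refl) (simp only: integral_mult_right_zero cell_integral(2)[OF c])
  finally show "(\<integral>x. f (cell 0 c x) \<partial>ray 0) = (\<Sum>m<a. f m) / c" by (simp add: sum_divide_distrib)
qed

lemma cell_exp_le:
  assumes "0 < \<sigma>" "1 \<le> l" "0 < x"
  shows "exp (- (real (cell 0 (\<sigma> * l) x) / l)) \<le> exp 1 * exp (- \<sigma> * (x - 0))"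
proof -
  have c: "0 < \<sigma> * l" using assms by simp
  have "x < real (Suc (cell 0 (\<sigma> * l) x)) / (\<sigma> * l)" using cell_eq_iff[OF assms(3) c] by force
  then have "\<sigma> * x * l < real (cell 0 (\<sigma> * l) x) + 1" using c by (simp add: field_simps)
  then have "\<sigma> * x < (real (cell 0 (\<sigma> * l) x) + 1) / l" using assms by (simp add: field_simps)
  also have "\<dots> \<le> real (cell 0 (\<sigma> * l) x) / l + 1" using assms by (simp add: add_divide_distrib divide_le_eq)
  finally show ?thesis by (simp add: exp_add[symmetric])
qed

lemma airy_kernel_ray: "airy_kernel x y = (\<integral>z. airy (x + z) * airy (y + z) \<partial>ray 0)"
proof -
  have "(\<integral>z. airy (x + z) * airy (y + z) \<partial>ray 0) = (\<integral>z. indicator {0<..} z *\<^sub>R (airy (x + z) * airy (y + z)) \<partial>lborel)"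
    by (simp add: integral_restrict_space)
  also have "\<dots> = (\<integral>z. indicator {0..} z *\<^sub>R (airy (x + z) * airy (y + z)) \<partial>lborel)"
  proof (rule integral_cong_AE)
    show "AE z in lborel. indicator {0<..} z *\<^sub>R (airy (x + z) * airy (y + z)) = indicator {0..} z *\<^sub>R (airy (x + z) * airy (y + z))"
      using AE_lborel_singleton[of 0] by eventually_elim (auto simp: indicator_def)
  qed measurable
  finally show ?thesis by (simp add: airy_kernel_eq set_lebesgue_integral_def)
qed

text \<open>The sum over m is a Riemann sum, again written as an integral of step functions. Its
  limit is the product formula for the Airy kernel, and the exponential bounds on g and g' give the
  domination both of this integral and of the Fredholm expansion.\<close>

theorem airy_product_kernel_tendsto:
  fixes g g' :: "nat \<Rightarrow> nat \<Rightarrow> real" and l :: "nat \<Rightarrow> real" and a A :: "nat \<Rightarrow> nat"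
  assumes l: "filterlim l at_top sequentially" and \<sigma>: "0 < \<sigma>" and A: "filterlim A at_top sequentially" "\<And>k. a k \<le> A k"
    and zero: "\<And>k i. a k \<le> i \<Longrightarrow> g k i = 0"
    and bound: "0 \<le> C" "0 \<le> C'" "\<forall>\<^sub>F k in sequentially. \<forall>i. \<bar>g k i\<bar> \<le> C * exp (- (real i / l k))"
      "\<forall>\<^sub>F k in sequentially. \<forall>i. \<bar>g' k i\<bar> \<le> C' * exp (- (real i / l k))"
    and lim: "\<And>i \<xi>. (\<lambda>k. real (i k) / (\<sigma> * l k)) \<longlonglongrightarrow> \<xi> \<Longrightarrow> (\<lambda>k. g k (i k)) \<longlonglongrightarrow> airy (s + \<xi>) / \<sigma>"
      "\<And>i \<xi>. (\<lambda>k. real (i k) / (\<sigma> * l k)) \<longlonglongrightarrow> \<xi> \<Longrightarrow> (\<lambda>k. g' k (i k)) \<longlonglongrightarrow> airy (s + \<xi>) / \<sigma>"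
  defines "K \<equiv> \<lambda>k i j. \<Sum>m<a k. g k (i + m) / l k * (g' k (j + m) / l k)"
  shows "(\<lambda>k. \<Sum>n\<le>A k. (- 1) ^ n / fact n * (\<Sum>i\<in>{..<n} \<rightarrow>\<^sub>E {..<A k}. Determinant.det (mat n n (\<lambda>(p, q). K k (i p) (i q)))))
    \<longlonglongrightarrow> F_GUE s"
proof -
  \<comment> \<open>One unit of the Airy variable corresponds to \<sigma> l k sites.\<close>
  define c where "c = (\<lambda>k. \<sigma> * l k)"
  have c: "filterlim c at_top sequentially"
    unfolding c_def by (rule filterlim_tendsto_pos_mult_at_top[OF tendsto_const \<sigma> l])
  have ev: "\<forall>\<^sub>F k in sequentially. 1 \<le> l k \<and> (\<forall>i. \<bar>g k i\<bar> \<le> C * exp (- (real i / l k))) \<and> (\<forall>i. \<bar>g' k i\<bar> \<le> C' * exp (- (real i / l k)))"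
    using l[unfolded filterlim_at_top, rule_format, of 1] bound(3,4) by eventually_elim auto
  have K_int: "c k * K k i j = (\<integral>z. \<sigma>\<^sup>2 * (g k (i + cell 0 (c k) z) * g' k (j + cell 0 (c k) z)) \<partial>ray 0)"
    "integrable (ray 0) (\<lambda>z. \<sigma>\<^sup>2 * (g k (i + cell 0 (c k) z) * g' k (j + cell 0 (c k) z)))" if "1 \<le> l k" for k i j
  proof -
    have cp: "0 < c k" using that \<sigma> by (simp add: c_def)
    let ?f = "\<lambda>m. g k (i + m) * g' k (j + m)"
    have z: "?f m = 0" if "a k \<le> m" for m using that zero[of k "i + m"] by simp
    show "integrable (ray 0) (\<lambda>z. \<sigma>\<^sup>2 * (g k (i + cell 0 (c k) z) * g' k (j + cell 0 (c k) z)))"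
      by (rule integrable_mult_right[OF cell_integral_sum(1)[OF cp z]])
    have "(\<integral>z. \<sigma>\<^sup>2 * (g k (i + cell 0 (c k) z) * g' k (j + cell 0 (c k) z)) \<partial>ray 0) = \<sigma>\<^sup>2 * ((\<Sum>m<a k. ?f m) / c k)"
      unfolding integral_mult_right_zero by (subst cell_integral_sum(2)[OF cp z]) auto
    also have "\<dots> = c k * ((\<Sum>m<a k. ?f m) / (l k)\<^sup>2)"
      using that \<sigma> by (simp add: c_def power2_eq_square)
    also have "(\<Sum>m<a k. ?f m) / (l k)\<^sup>2 = K k i j"
      unfolding K_def sum_divide_distrib by (simp add: power2_eq_square)
    finally show "c k * K k i j = (\<integral>z. \<sigma>\<^sup>2 * (g k (i + cell 0 (c k) z) * g' k (j + cell 0 (c k) z)) \<partial>ray 0)" by simp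
  qed
  have prod_bound: "\<bar>\<sigma>\<^sup>2 * (g k (i + cell 0 (c k) z) * g' k (j + cell 0 (c k) z))\<bar>
     \<le> (\<sigma>\<^sup>2 * (C * C') * exp (- (real i / l k)) * exp (- (real j / l k)) * exp 1) * exp (- \<sigma> * (z - 0))"
    if k: "1 \<le> l k \<and> (\<forall>i. \<bar>g k i\<bar> \<le> C * exp (- (real i / l k))) \<and> (\<forall>i. \<bar>g' k i\<bar> \<le> C' * exp (- (real i / l k)))" and z: "0 < z"
    for k i j z
  proof -
    let ?m = "cell 0 (c k) z"
    have ex: "exp (- (real (i + m) / l k)) = exp (- (real i / l k)) * exp (- (real m / l k))" for i m
      by (simp add: exp_add[symmetric] add_divide_distrib)
    have "\<bar>g k (i + ?m) * g' k (j + ?m)\<bar> \<le> (C * exp (- (real (i + ?m) / l k))) * (C' * exp (- (real (j + ?m) / l k)))"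
      unfolding abs_mult by (intro mult_mono) (use k bound in \<open>auto simp del: of_nat_add\<close>)
    also have "\<dots> = C * C' * exp (- (real i / l k)) * exp (- (real j / l k)) * (exp (- (real ?m / l k)) * exp (- (real ?m / l k)))"
      unfolding ex by (simp only: mult_ac)
    also have "\<dots> \<le> C * C' * exp (- (real i / l k)) * exp (- (real j / l k)) * (exp 1 * exp (- \<sigma> * (z - 0)) * 1)"
      using bound(1,2) cell_exp_le[OF \<sigma> _ z, of "l k"] k unfolding c_def by (intro mult_left_mono mult_mono) auto
    finally have "\<sigma>\<^sup>2 * \<bar>g k (i + ?m) * g' k (j + ?m)\<bar> \<le> \<sigma>\<^sup>2 * (C * C' * exp (- (real i / l k)) * exp (- (real j / l k)) * (exp 1 * exp (- \<sigma> * (z - 0)) * 1))"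
      by (intro mult_left_mono) auto
    then show ?thesis unfolding abs_mult[of "\<sigma>\<^sup>2"] by (simp only: mult_ac abs_power2 mult_1_right)
  qed
  show ?thesis
    unfolding F_GUE_def
  proof (rule discrete_fredholm_tendsto[OF c A(1)])
    show "K k i j = 0" if "A k \<le> i" for k i j
      unfolding K_def using that A(2)[of k] zero by (intro sum.neutral) auto
    show "0 \<le> \<sigma>\<^sup>2 * (C * C') * exp 1 / \<sigma>" using \<sigma> bound by simp
    show "0 < \<sigma>" by (rule \<sigma>)
    show "\<forall>\<^sub>F k in sequentially. \<forall>i j. \<bar>c k * K k i j\<bar> \<le> \<sigma>\<^sup>2 * (C * C') * exp 1 / \<sigma> * exp (- \<sigma> * real i / c k) * exp (- \<sigma> * real j / c k)"
      using ev
    proof eventually_elim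
      case (elim k)
      show ?case
      proof (intro allI)
        fix i j
        have "\<bar>c k * K k i j\<bar> \<le> (\<integral>z. (\<sigma>\<^sup>2 * (C * C') * exp (- (real i / l k)) * exp (- (real j / l k)) * exp 1) * exp (- \<sigma> * (z - 0)) \<partial>ray 0)"
          unfolding K_int(1)[OF conjunct1[OF elim]]
          by (rule integral_abs_bound_integral[OF K_int(2)[OF conjunct1[OF elim]] integrable_mult_right[OF exp_ray_integral(1)[OF \<sigma>]] prod_bound[OF elim]])
            (simp add: space_restrict_space)
        also have "\<dots> = (\<sigma>\<^sup>2 * (C * C') * exp (- (real i / l k)) * exp (- (real j / l k)) * exp 1) * (1 / \<sigma>)"
          unfolding integral_mult_right_zero exp_ray_integral(2)[OF \<sigma>] ..
        also have "\<dots> = \<sigma>\<^sup>2 * (C * C') * exp 1 / \<sigma> * exp (- \<sigma> * real i / c k) * exp (- \<sigma> * real j / c k)"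
          using \<sigma> by (simp add: c_def)
        finally show "\<bar>c k * K k i j\<bar> \<le> \<sigma>\<^sup>2 * (C * C') * exp 1 / \<sigma> * exp (- \<sigma> * real i / c k) * exp (- \<sigma> * real j / c k)" .
      qed
    qed
    fix x y assume xy: "s < x" "s < y"
    let ?i = "\<lambda>k. cell s (c k) x" and ?j = "\<lambda>k. cell s (c k) y"
    obtain k0 where k0: "\<And>k. k0 \<le> k \<Longrightarrow> 1 \<le> l k \<and> (\<forall>i. \<bar>g k i\<bar> \<le> C * exp (- (real i / l k))) \<and> (\<forall>i. \<bar>g' k i\<bar> \<le> C' * exp (- (real i / l k)))"
      using ev unfolding eventually_sequentially by blast
    have ptw: "(\<lambda>k. \<sigma>\<^sup>2 * (g k (?i k + cell 0 (c k) z) * g' k (?j k + cell 0 (c k) z))) \<longlonglongrightarrow> airy (x + z) * airy (y + z)" if z: "0 < z" for z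
    proof -
      have r: "(\<lambda>k. real (cell s (c k) x + cell 0 (c k) z) / (\<sigma> * l k)) \<longlonglongrightarrow> (x - s) + (z - 0)" if "s < x" for x
        using tendsto_add[OF cell_ratio_tendsto[OF c that] cell_ratio_tendsto[OF c z]]
        by (simp add: c_def add_divide_distrib)
      have "(\<lambda>k. \<sigma>\<^sup>2 * (g k (?i k + cell 0 (c k) z) * g' k (?j k + cell 0 (c k) z)))
         \<longlonglongrightarrow> \<sigma>\<^sup>2 * (airy (s + ((x - s) + (z - 0))) / \<sigma> * (airy (s + ((y - s) + (z - 0))) / \<sigma>))"
        by (intro tendsto_intros lim r xy)
      then show ?thesis using \<sigma> by (simp add: power2_eq_square)
    qed
    have "(\<lambda>k. \<integral>z. \<sigma>\<^sup>2 * (g (k + k0) (?i (k + k0) + cell 0 (c (k + k0)) z) * g' (k + k0) (?j (k + k0) + cell 0 (c (k + k0)) z)) \<partial>ray 0)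
       \<longlonglongrightarrow> (\<integral>z. airy (x + z) * airy (y + z) \<partial>ray 0)"
    proof (rule integral_dominated_convergence[where w = "\<lambda>z. (\<sigma>\<^sup>2 * (C * C') * 1 * 1 * exp 1) * exp (- \<sigma> * (z - 0))"])
      show "integrable (ray 0) (\<lambda>z. (\<sigma>\<^sup>2 * (C * C') * 1 * 1 * exp 1) * exp (- \<sigma> * (z - 0)))"
        by (rule integrable_mult_right[OF exp_ray_integral(1)[OF \<sigma>]])
      show "AE z in ray 0. (\<lambda>k. \<sigma>\<^sup>2 * (g (k + k0) (?i (k + k0) + cell 0 (c (k + k0)) z) * g' (k + k0) (?j (k + k0) + cell 0 (c (k + k0)) z)))
          \<longlonglongrightarrow> airy (x + z) * airy (y + z)"
        using LIMSEQ_ignore_initial_segment[OF ptw] by (intro AE_I2) (simp add: space_restrict_space)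
      show "(\<lambda>z. airy (x + z) * airy (y + z)) \<in> borel_measurable (ray 0)"
        by (rule measurable_restrict_space1) measurable
      show "(\<lambda>z. \<sigma>\<^sup>2 * (g (k + k0) (?i (k + k0) + cell 0 (c (k + k0)) z) * g' (k + k0) (?j (k + k0) + cell 0 (c (k + k0)) z))) \<in> borel_measurable (ray 0)" for k
        by (rule borel_measurable_integrable[OF K_int(2)]) (use k0 in auto)
      show "AE z in ray 0. norm (\<sigma>\<^sup>2 * (g (k + k0) (?i (k + k0) + cell 0 (c (k + k0)) z) * g' (k + k0) (?j (k + k0) + cell 0 (c (k + k0)) z)))
          \<le> (\<sigma>\<^sup>2 * (C * C') * 1 * 1 * exp 1) * exp (- \<sigma> * (z - 0))" for k
      proof (intro AE_I2)
        fix z assume "z \<in> space (ray 0)"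
        then have z: "0 < z" by (simp add: space_restrict_space)
        have k1: "1 \<le> l (k + k0)" using k0[of "k + k0"] by simp
        have e1: "exp (- (real i / l (k + k0))) \<le> 1" for i using k1 by simp
        have "norm (\<sigma>\<^sup>2 * (g (k + k0) (?i (k + k0) + cell 0 (c (k + k0)) z) * g' (k + k0) (?j (k + k0) + cell 0 (c (k + k0)) z)))
           \<le> (\<sigma>\<^sup>2 * (C * C') * exp (- (real (?i (k + k0)) / l (k + k0))) * exp (- (real (?j (k + k0)) / l (k + k0))) * exp 1) * exp (- \<sigma> * (z - 0))"
          unfolding real_norm_def by (rule prod_bound[OF k0 z]) simp
        also have "\<dots> \<le> (\<sigma>\<^sup>2 * (C * C') * 1 * 1 * exp 1) * exp (- \<sigma> * (z - 0))"
          using bound(1,2) e1 by (intro mult_right_mono mult_mono) auto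
        finally show "norm (\<sigma>\<^sup>2 * (g (k + k0) (?i (k + k0) + cell 0 (c (k + k0)) z) * g' (k + k0) (?j (k + k0) + cell 0 (c (k + k0)) z)))
           \<le> (\<sigma>\<^sup>2 * (C * C') * 1 * 1 * exp 1) * exp (- \<sigma> * (z - 0))" .
      qed
    qed
    then have "(\<lambda>k. c (k + k0) * K (k + k0) (?i (k + k0)) (?j (k + k0))) \<longlonglongrightarrow> airy_kernel x y"
      unfolding airy_kernel_ray by (subst K_int(1)) (use k0 in auto)
    then show "(\<lambda>k. c k * K k (?i k) (?j k)) \<longlonglongrightarrow> airy_kernel x y" by (rule LIMSEQ_offset)
  qed
qed

section \<open>The hole kernel for equal parameters\<close>

definition coeff_seq :: "nat \<Rightarrow> nat \<Rightarrow> real \<Rightarrow> real \<Rightarrow> nat \<Rightarrow> nat \<Rightarrow> real" where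
  "coeff_seq N M \<alpha> \<beta> a i = (if i < a then saddle_fps N M \<alpha> \<beta> $ (a - Suc i) else 0)"

text \<open>Under z = - r w \<xi> one has z - r = - r (1 + w \<xi>) and 1 - r z = 1 + r^2 w \<xi>;
  dividing by the values at \<xi> = 1 gives \<alpha> and \<beta>.\<close>

lemma confluent_fps_scaled:
  assumes r: "0 < r" and w: "0 < w"
  shows "fps_compose ((fps_X - fps_const r) ^ N * geo_fps r ^ M) (fps_const (- (r * w)) * fps_X)
    = fps_const ((- (r * (1 + w))) ^ N / (1 + r\<^sup>2 * w) ^ M) * saddle_fps N M (w / (1 + w)) (r\<^sup>2 * w / (1 + r\<^sup>2 * w))"
proof -
  let ?c = "fps_const (- (r * w)) * fps_X :: real fps"
  define d where "d = 1 + r\<^sup>2 * w"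
  have d: "0 < d" using r w by (simp add: d_def add_pos_pos)
  have w1: "0 < 1 + w" using w by simp
  have c0: "?c $ 0 = 0" by simp
  have lin: "(fps_X - fps_const r) oo ?c = fps_const (- (r * (1 + w))) * (fps_const (1 - w / (1 + w)) + fps_const (w / (1 + w)) * fps_X)"
  proof -
    have "- (r * (1 + w)) * (1 - w / (1 + w)) = - r" "- (r * (1 + w)) * (w / (1 + w)) = - (r * w)"
      using w1 by (simp_all add: field_simps)
    then have "fps_const (- (r * (1 + w))) * (fps_const (1 - w / (1 + w)) + fps_const (w / (1 + w)) * fps_X) = fps_const (- r) + fps_const (- (r * w)) * fps_X"
      by (simp only: distrib_left mult.assoc[symmetric] fps_const_mult)
    then show ?thesis by (simp add: fps_compose_sub_distrib flip: fps_const_neg)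
  qed
  have geo: "geo_fps r oo ?c = fps_const (1 / d) * inverse (fps_const (1 - r\<^sup>2 * w / d) + fps_const (r\<^sup>2 * w / d) * fps_X)"
  proof -
    have "((1 - fps_const r * fps_X) * geo_fps r) oo ?c = 1" by (simp add: geo_fps_mult)
    then have 1: "(1 + fps_const (r\<^sup>2 * w) * fps_X) * (geo_fps r oo ?c) = 1"
      unfolding fps_compose_mult_distrib[OF c0] fps_compose_sub_distrib
      by (simp add: fps_compose_mult_distrib[OF c0] mult.assoc[symmetric] power2_eq_square flip: fps_const_neg)
    have "1 - r\<^sup>2 * w / d = 1 / d" using d by (simp add: field_simps) (simp add: d_def)
    then have "fps_const (1 - r\<^sup>2 * w / d) + fps_const (r\<^sup>2 * w / d) * fps_X = fps_const (1 / d) * (1 + fps_const (r\<^sup>2 * w) * fps_X)"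
      by (simp add: distrib_left mult.assoc[symmetric])
    then have "(fps_const (1 - r\<^sup>2 * w / d) + fps_const (r\<^sup>2 * w / d) * fps_X) * (fps_const d * (geo_fps r oo ?c))
        = (fps_const (1 / d) * fps_const d) * ((1 + fps_const (r\<^sup>2 * w) * fps_X) * (geo_fps r oo ?c))"
      by (simp only: mult_ac)
    also have "\<dots> = 1" unfolding 1 using d by simp
    finally have "inverse (fps_const (1 - r\<^sup>2 * w / d) + fps_const (r\<^sup>2 * w / d) * fps_X) = fps_const d * (geo_fps r oo ?c)"
      by (rule fps_inverse_unique)
    then have "fps_const (1 / d) * inverse (fps_const (1 - r\<^sup>2 * w / d) + fps_const (r\<^sup>2 * w / d) * fps_X) = (fps_const (1 / d) * fps_const d) * (geo_fps r oo ?c)"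
      by (simp only: mult.assoc)
    also have "\<dots> = geo_fps r oo ?c" using d by simp
    finally show ?thesis ..
  qed
  have "((fps_X - fps_const r) ^ N * geo_fps r ^ M) oo ?c = ((fps_X - fps_const r) oo ?c) ^ N * (geo_fps r oo ?c) ^ M"
    unfolding fps_compose_mult_distrib[OF c0] fps_compose_power[OF c0] ..
  also have "\<dots> = fps_const ((- (r * (1 + w))) ^ N * (1 / d) ^ M) * saddle_fps N M (w / (1 + w)) (r\<^sup>2 * w / d)"
    unfolding lin geo power_mult_distrib saddle_fps_def fps_const_power fps_const_mult[symmetric] by (simp only: mult_ac)
  finally show ?thesis by (simp only: d_def power_one_over times_divide_eq_right mult_1_right)
qed

lemma confluent_fps_nth:
  assumes r: "0 < r" and w: "0 < w"
  shows "(- (r * w)) ^ n * ((fps_X - fps_const r) ^ N * geo_fps r ^ M) $ n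
    = (- (r * (1 + w))) ^ N / (1 + r\<^sup>2 * w) ^ M * saddle_fps N M (w / (1 + w)) (r\<^sup>2 * w / (1 + r\<^sup>2 * w)) $ n"
  using arg_cong[OF confluent_fps_scaled[OF assms, of N M], of "\<lambda>f. fps_nth f n"]
  unfolding fps_compose_linear by simp

lemma bfps_confluent:
  "bfps (replicate M 0 @ replicate N r) (replicate N 0 @ replicate M r) = fps_X ^ M * ((fps_X - fps_const r) ^ N * geo_fps r ^ M)"
proof -
  have "geo_fps 0 = 1" using geo_fps_mult[of 0] by simp
  then show ?thesis by (simp add: bfps_def mult.assoc)
qed

text \<open>The mirror series has its own dilation w' = 1 / (r^2 w), chosen because - r w' is then
  the reciprocal of c = - r w; its parameters come out as 1 - \<beta> and 1 - \<alpha>. The two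
  dilations leave a conjugation by powers of c, which no principal minor sees. The zero parameters
  shift the two series by M and N, whence a + M = a' + N.\<close>

lemma hkernel_confluent:
  fixes M N a a' i j :: nat and r w :: real
  assumes r: "0 < r" and w: "0 < w" and a: "a + M = a' + N" and i: "i < a + M" and j: "j < a + M"
  defines "\<alpha> \<equiv> w / (1 + w)" and "\<beta> \<equiv> r\<^sup>2 * w / (1 + r\<^sup>2 * w)" and "c \<equiv> - (r * w)"
  shows "hkernel (replicate M 0 @ replicate N r) (replicate N 0 @ replicate M r) (a + M - Suc i) (a + M - Suc j) =
    c ^ i * (\<Sum>m<a. coeff_seq N M \<alpha> \<beta> a (i + m) * coeff_seq M N (1 - \<beta>) (1 - \<alpha>) a' (j + m)) * (1 / c) ^ j"
proof -
  define F where "F = (fps_X - fps_const r) ^ N * geo_fps r ^ M"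
  define F' where "F' = (fps_X - fps_const r) ^ M * geo_fps r ^ N"
  define w' where "w' = 1 / (r\<^sup>2 * w)"
  define d where "d = 1 + r\<^sup>2 * w"
  have d: "0 < d" using r w by (simp add: d_def add_pos_pos)
  have w': "0 < w'" using r w by (simp add: w'_def)
  have c: "c \<noteq> 0" using r w by (simp add: c_def)
  have c': "- (r * w') = 1 / c" using r w by (simp add: c_def w'_def power2_eq_square)
  have "w' / (1 + w') = 1 / d" "r\<^sup>2 * w' / (1 + r\<^sup>2 * w') = 1 / (1 + w)"
    using r w d by (simp_all add: w'_def d_def field_simps)
  moreover have "1 - \<beta> = 1 / d" "1 - \<alpha> = 1 / (1 + w)"
    using r w d unfolding \<beta>_def \<alpha>_def d_def[symmetric] by (simp_all add: field_simps) (simp_all add: d_def)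
  ultimately have ab: "w' / (1 + w') = 1 - \<beta>" "r\<^sup>2 * w' / (1 + r\<^sup>2 * w') = 1 - \<alpha>" by simp_all
  let ?A = "(- (r * (1 + w))) ^ N / (1 + r\<^sup>2 * w) ^ M"
  let ?A' = "(- (r * (1 + w'))) ^ M / (1 + r\<^sup>2 * w') ^ N"
  have Fn: "c ^ n * F $ n = ?A * saddle_fps N M \<alpha> \<beta> $ n" for n
    using confluent_fps_nth[OF r w, of n N M] unfolding F_def \<alpha>_def \<beta>_def c_def .
  have Fn': "(1 / c) ^ n * F' $ n = ?A' * saddle_fps M N (1 - \<beta>) (1 - \<alpha>) $ n" for n
    using confluent_fps_nth[OF r w', of n M N] unfolding F'_def ab c' .
  \<comment> \<open>The constants in front of the two dilated series combine to c^N / c^M, which the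
    index shift compensates.\<close>
  have AA: "?A * ?A' * c ^ M = c ^ N"
  proof -
    have A1: "?A' = (- (r * (1 + w'))) ^ M * (1 / (1 + r\<^sup>2 * w')) ^ N" by (simp only: power_one_over times_divide_eq_right mult_1_right)
    have A2: "1 / (1 + r\<^sup>2 * w') = w / (1 + w)" using r w by (simp add: w'_def field_simps)
    have A3: "- (r * (1 + w')) = d / c" using r w by (simp add: w'_def d_def c_def field_simps power2_eq_square)
    have A': "?A' = (d / c) ^ M * (w / (1 + w)) ^ N" unfolding A1 unfolding A2 A3 by (rule refl)
    have "?A * ?A' * c ^ M = ((- (r * (1 + w))) * (w / (1 + w))) ^ N * ((1 / d) * (d / c) * c) ^ M"
      unfolding A' d_def[symmetric] power_mult_distrib by (simp add: power_divide)
    also have "(- (r * (1 + w))) * (w / (1 + w)) = c" using w by (simp add: c_def)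
    also have "(1 / d) * (d / c) * c = 1" using c d by simp
    finally show ?thesis by simp
  qed
  have entry: "F $ (a - Suc (i + m)) * F' $ (a' - Suc (j + m)) =
     c ^ i * (saddle_fps N M \<alpha> \<beta> $ (a - Suc (i + m)) * saddle_fps M N (1 - \<beta>) (1 - \<alpha>) $ (a' - Suc (j + m))) * (1 / c) ^ j"
    if m: "i + m < a" "j + m < a'" for m
  proof -
    let ?n = "a - Suc (i + m)" and ?n' = "a' - Suc (j + m)"
    let ?S = "saddle_fps N M \<alpha> \<beta> $ ?n" and ?S' = "saddle_fps M N (1 - \<beta>) (1 - \<alpha>) $ ?n'"
    have "F $ ?n * F' $ ?n' * (c ^ ?n * (1 / c) ^ ?n') = (?A * ?S) * (?A' * ?S')"
      unfolding Fn[symmetric] Fn'[symmetric] by (simp only: mult_ac)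
    then have "F $ ?n * F' $ ?n' * (c ^ ?n * (1 / c) ^ ?n') * c ^ M = c ^ N * (?S * ?S')"
      unfolding AA[symmetric] by (simp only: mult_ac)
    moreover have "c ^ ?n * (1 / c) ^ ?n' * c ^ M * c ^ i = c ^ N * c ^ j"
    proof -
      have e: "?n + M + i = ?n' + (N + j)" using m a by simp
      have "c ^ ?n * (1 / c) ^ ?n' * c ^ M * c ^ i = c ^ (?n + M + i) * (1 / c) ^ ?n'" by (simp add: power_add mult_ac)
      also have "\<dots> = (c * (1 / c)) ^ ?n' * c ^ (N + j)" unfolding e power_add power_mult_distrib by (simp only: mult_ac)
      finally show ?thesis using c by (simp add: power_add)
    qed
    ultimately have "F $ ?n * F' $ ?n' * (c ^ N * c ^ j) = c ^ N * (?S * ?S') * c ^ i"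
      by (metis (no_types, lifting) mult.assoc)
    then have "F $ ?n * F' $ ?n' * c ^ j = c ^ i * (?S * ?S')"
      using c by (simp add: mult_ac)
    then have "F $ ?n * F' $ ?n' * c ^ j * (1 / c) ^ j = c ^ i * (?S * ?S') * (1 / c) ^ j" by simp
    then show ?thesis using c by (simp add: power_one_over)
  qed
  define k l where "k = a + M - Suc i" and "l = a + M - Suc j"
  have b1: "fps_nth (fps_X ^ M * F) (k - m) = (if i + m < a then F $ (a - Suc (i + m)) else 0)" if "m \<le> k" for m
    using that i a by (auto simp: fps_X_power_mult_nth k_def intro!: arg_cong[of _ _ "fps_nth F"])
  have b2: "fps_nth (fps_X ^ N * F') (l - m) = (if j + m < a' then F' $ (a' - Suc (j + m)) else 0)" if "m \<le> l" for m
    using that j a by (auto simp: fps_X_power_mult_nth l_def intro!: arg_cong[of _ _ "fps_nth F'"])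
  have "hkernel (replicate M 0 @ replicate N r) (replicate N 0 @ replicate M r) k l =
    (\<Sum>m\<le>min k l. (if i + m < a then F $ (a - Suc (i + m)) else 0) * (if j + m < a' then F' $ (a' - Suc (j + m)) else 0))"
    unfolding hkernel_def bfps_confluent F_def[symmetric] F'_def[symmetric] using b1 b2 by (intro sum.cong refl) simp
  also have "\<dots> = (\<Sum>m<a. (if i + m < a then F $ (a - Suc (i + m)) else 0) * (if j + m < a' then F' $ (a' - Suc (j + m)) else 0))"
    by (rule sum.mono_neutral_cong) (use a in \<open>auto simp: k_def l_def\<close>)
  also have "\<dots> = (\<Sum>m<a. c ^ i * (coeff_seq N M \<alpha> \<beta> a (i + m) * coeff_seq M N (1 - \<beta>) (1 - \<alpha>) a' (j + m)) * (1 / c) ^ j)"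
    using entry by (intro sum.cong refl) (auto simp: coeff_seq_def)
  finally show ?thesis unfolding k_def l_def by (simp add: sum_distrib_left sum_distrib_right)
qed

text \<open>The points below M + a are renumbered by their distance from this edge, which permutes
  the tuples; the powers of c cancel in every determinant.\<close>

theorem hole_det_confluent:
  fixes M N a a' :: nat and r w :: real
  assumes r: "0 < r" and w: "0 < w" and a: "a + M = a' + N"
  defines "\<alpha> \<equiv> w / (1 + w)" and "\<beta> \<equiv> r\<^sup>2 * w / (1 + r\<^sup>2 * w)"
  defines "K \<equiv> \<lambda>i j. \<Sum>m<a. coeff_seq N M \<alpha> \<beta> a (i + m) * coeff_seq M N (1 - \<beta>) (1 - \<alpha>) a' (j + m)"
  shows "hole_det (replicate M 0 @ replicate N r) (replicate N 0 @ replicate M r) (M + a) =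
    (\<Sum>n\<le>M + a. (- 1) ^ n / fact n * (\<Sum>i\<in>{..<n} \<rightarrow>\<^sub>E {..<M + a}. Determinant.det (mat n n (\<lambda>(p, q). K (i p) (i q)))))"
  unfolding hole_det_def
proof (rule sum.cong[OF refl], rule arg_cong[of _ _ "\<lambda>z. (- 1) ^ n / fact n * z" for n])
  fix n :: nat
  define c where "c = - (r * w)"
  have c: "c \<noteq> 0" using r w by (simp add: c_def)
  let ?h = "hkernel (replicate M 0 @ replicate N r) (replicate N 0 @ replicate M r)"
  let ?flip = "\<lambda>f. restrict (\<lambda>p. M + a - Suc (f p)) {..<n}"
  show "(\<Sum>k\<in>{..<n} \<rightarrow>\<^sub>E {..<M + a}. Determinant.det (mat n n (\<lambda>(i, j). ?h (k i) (k j)))) =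
    (\<Sum>i\<in>{..<n} \<rightarrow>\<^sub>E {..<M + a}. Determinant.det (mat n n (\<lambda>(p, q). K (i p) (i q))))"
  proof -
    have flip: "?flip (?flip f) = f" if f: "f \<in> {..<n} \<rightarrow>\<^sub>E {..<M + a}" for f
    proof
      fix x
      show "?flip (?flip f) x = f x"
      proof (cases "x < n")
        case True
        then have "f x < M + a" using f by (auto simp: PiE_iff)
        then show ?thesis using True by simp
      qed (use f in \<open>auto simp: PiE_iff extensional_def\<close>)
    qed
    have mem: "?flip f \<in> {..<n} \<rightarrow>\<^sub>E {..<M + a}" if f: "f \<in> {..<n} \<rightarrow>\<^sub>E {..<M + a}" for f
      using f by (auto simp: PiE_iff)
    have det: "Determinant.det (mat n n (\<lambda>(p, q). K (?flip f p) (?flip f q))) = Determinant.det (mat n n (\<lambda>(i, j). ?h (f i) (f j)))"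
      if f: "f \<in> {..<n} \<rightarrow>\<^sub>E {..<M + a}" for f
    proof -
    have "Determinant.det (mat n n (\<lambda>(i, j). ?h (f i) (f j))) = Determinant.det (mat n n (\<lambda>(p, q). c ^ ?flip f p * K (?flip f p) (?flip f q) * (1 / c) ^ ?flip f q))"
    proof (intro arg_cong[of _ _ Determinant.det] cong_mat refl, clarsimp)
      fix p q assume pq: "p < n" "q < n"
      then have fp: "f p < a + M" "f q < a + M" using f by (auto simp: PiE_iff add.commute)
      have "?h (a + M - Suc (a + M - Suc (f p))) (a + M - Suc (a + M - Suc (f q))) = c ^ (a + M - Suc (f p)) * K (a + M - Suc (f p)) (a + M - Suc (f q)) * (1 / c) ^ (a + M - Suc (f q))"
        unfolding K_def \<alpha>_def \<beta>_def c_def by (rule hkernel_confluent[OF r w a]) (use fp in auto)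
      then show "?h (f p) (f q) = c ^ (M + a - Suc (f p)) * K (M + a - Suc (f p)) (M + a - Suc (f q)) * (1 / c) ^ (M + a - Suc (f q))"
        using fp by (simp add: add.commute)
    qed
    also have "\<dots> = (\<Prod>p<n. c ^ ?flip f p) * (\<Prod>p<n. (1 / c) ^ ?flip f p) * Determinant.det (mat n n (\<lambda>(p, q). K (?flip f p) (?flip f q)))"
      by (rule det_scale)
    also have "(\<Prod>p<n. c ^ ?flip f p) * (\<Prod>p<n. (1 / c) ^ ?flip f p) = 1"
      using c by (simp add: prod.distrib[symmetric] power_mult_distrib[symmetric])
    finally show ?thesis by simp
    qed
    show ?thesis
      by (rule sum.reindex_bij_witness[of _ ?flip ?flip]) (use flip mem det in blast)+
  qed
qed

section \<open>The sequential sampling\<close>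

abbreviation coin :: "real \<Rightarrow> real \<Rightarrow> (bool \<times> bool) pmf" where
  "coin b1 b2 \<equiv> pair_pmf (bernoulli_pmf b1) (bernoulli_pmf b2)"

lemma expectation_pair_finite:
  fixes f :: "'a \<times> 'b \<Rightarrow> real"
  assumes p: "finite (set_pmf p)" and q: "finite (set_pmf q)"
  shows "measure_pmf.expectation (pair_pmf p q) f = measure_pmf.expectation p (\<lambda>a. measure_pmf.expectation q (\<lambda>b. f (a, b)))"
proof -
  have "pair_pmf p q = p \<bind> (\<lambda>a. map_pmf (Pair a) q)"
    by (simp add: pair_pmf_def map_pmf_def)
  then have "measure_pmf.expectation (pair_pmf p q) f = (\<Sum>a\<in>set_pmf p. pmf p a *\<^sub>R measure_pmf.expectation (map_pmf (Pair a) q) f)"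
    using p q by (simp add: pmf_expectation_bind[OF p])
  also have "\<dots> = measure_pmf.expectation p (\<lambda>a. measure_pmf.expectation q (\<lambda>b. f (a, b)))"
    by (subst integral_measure_pmf[OF p]) auto
  finally show ?thesis .
qed

lemma expectation_coin:
  fixes f :: "bool \<times> bool \<Rightarrow> real"
  assumes "0 \<le> b1" "b1 \<le> 1" "0 \<le> b2" "b2 \<le> 1"
  shows "measure_pmf.expectation (coin b1 b2) f =
    b1 * (b2 * f (True, True) + (1 - b2) * f (True, False)) + (1 - b1) * (b2 * f (False, True) + (1 - b2) * f (False, False))"
proof -
  have "measure_pmf.expectation (coin b1 b2) f = (\<Sum>c\<in>UNIV. pmf (coin b1 b2) c *\<^sub>R f c)"
    by (rule integral_measure_pmf) auto
  also have "(UNIV :: (bool \<times> bool) set) = {(True, True), (True, False), (False, True), (False, False)}"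
    by auto
  finally show ?thesis using assms by (simp add: pmf_pair algebra_simps)
qed

lemma finite_set_Pi_pmf_finite:
  fixes p :: "'a \<Rightarrow> 'b :: finite pmf"
  shows "finite A \<Longrightarrow> finite (set_pmf (Pi_pmf A d p))"
  by (rule finite_subset[OF set_Pi_pmf_subset' finite_PiE_dflt]) auto

section \<open>Edge states as functions of the coins\<close>

fun row_out :: "coins \<Rightarrow> nat \<Rightarrow> nat \<Rightarrow> bool \<Rightarrow> bool list \<Rightarrow> bool list" where
  "row_out c m k h [] = []"
| "row_out c m k h (v # vs) =
    bold_north (choose_type h v (c (Suc k, m))) # row_out c m (Suc k) (bold_east (choose_type h v (c (Suc k, m)))) vs"

text \<open>The south edges of row m + 1 in the first N columns. Paths only move up and to the
  right, so columns beyond N have no influence on them.\<close>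

primrec state :: "coins \<Rightarrow> nat \<Rightarrow> nat \<Rightarrow> bool list" where
  "state c N 0 = replicate N True"
| "state c N (Suc m) = row_out c (Suc m) 0 False (state c N m)"

lemma row_out_cong:
  "(\<And>i. k < i \<Longrightarrow> i \<le> k + length vs \<Longrightarrow> c (i, m) = c' (i, m)) \<Longrightarrow> row_out c m k h vs = row_out c' m k h vs"
  by (induction vs arbitrary: k h) auto

lemma length_row_out [simp]: "length (row_out c m k h vs) = length vs"
  by (induction vs arbitrary: k h) auto

lemma length_state [simp]: "length (state c N m) = N"
  by (induction m) auto

lemma state_cong: "(\<And>i j. i \<in> {1..N} \<Longrightarrow> j \<in> {1..m} \<Longrightarrow> c (i, j) = c' (i, j)) \<Longrightarrow> state c N m = state c' N m"
proof (induction m)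
  case (Suc m)
  have s: "state c N m = state c' N m" by (rule Suc.IH) (rule Suc.prems, auto)
  show ?case unfolding state.simps s by (rule row_out_cong) (rule Suc.prems, auto)
qed simp

definition south :: "coins \<Rightarrow> nat \<Rightarrow> nat \<Rightarrow> bool" where
  "south c i j \<longleftrightarrow> j \<le> 1 \<or> bold_north (sampled c i (j - 1))"

lemma row_out_sampled:
  "row_out c m k (k \<ge> 1 \<and> bold_east (sampled c k m)) (map (\<lambda>i. south c (Suc i) m) [k..<k + n]) = map (\<lambda>i. bold_north (sampled c (Suc i) m)) [k..<k + n]"
proof (induction n arbitrary: k)
  case (Suc n)
  have u: "[k..<k + Suc n] = k # [Suc k..<Suc k + n]" by (simp add: upt_conv_Cons)
  have t: "choose_type (k \<ge> 1 \<and> bold_east (sampled c k m)) (south c (Suc k) m) (c (Suc k, m)) = sampled c (Suc k) m"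
    by (subst (2) sampled.simps) (simp add: south_def Suc_le_eq)
  have "row_out c m k (k \<ge> 1 \<and> bold_east (sampled c k m)) (map (\<lambda>i. south c (Suc i) m) [k..<k + Suc n]) =
    bold_north (sampled c (Suc k) m) # row_out c m (Suc k) (Suc k \<ge> 1 \<and> bold_east (sampled c (Suc k) m)) (map (\<lambda>i. south c (Suc i) m) [Suc k..<Suc k + n])"
    unfolding u list.map row_out.simps t by simp
  then show ?case unfolding Suc.IH u by simp
qed simp

lemma state_sampled: "state c N m = map (\<lambda>i. south c (Suc i) (Suc m)) [0..<N]"
proof (induction m)
  case 0
  show ?case by (simp add: south_def map_replicate_const)
next
  case (Suc m)
  have "row_out c (Suc m) 0 False (map (\<lambda>i. south c (Suc i) (Suc m)) [0..<N]) = map (\<lambda>i. bold_north (sampled c (Suc i) (Suc m))) [0..<N]"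
    using row_out_sampled[of c "Suc m" 0 N] by simp
  then show ?case unfolding state.simps Suc.IH by (simp add: south_def)
qed

text \<open>The height reads the south edges of row M + 1, which are the north edges of row M or the
  boundary; so a row index M + 1 means only M sampled rows.\<close>

lemma height_sampled_config:
  assumes y: "nat \<lceil>y\<rceil> = Suc M" and x: "{i. 1 \<le> i \<and> real i \<le> x} = {1..N}"
  shows "height_function x y (sampled_config c) = count_list (state c N M) True"
proof -
  have s: "bold_south (sampled_config c (i, Suc M)) = south c i (Suc M)" if "1 \<le> i" for i
    using that by (simp add: sampled_config_def quadrant_def south_def) (subst sampled.simps, simp)
  have "height_function x y (sampled_config c) = card {i \<in> {1..N}. south c i (Suc M)}"
    unfolding height_function_def y using x s by (intro arg_cong[of _ _ card]) auto
  also have "{i \<in> {1..N}. south c i (Suc M)} = Suc ` {i \<in> {..<N}. south c (Suc i) (Suc M)}"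
    by (auto simp: image_iff) (metis Suc_le_D Suc_le_eq lessThan_iff One_nat_def)
  also have "card \<dots> = card {i \<in> {..<N}. south c (Suc i) (Suc M)}" by (simp add: card_image)
  also have "\<dots> = count_list (map (\<lambda>i. south c (Suc i) (Suc M)) [0..<N]) True"
  proof (induction N)
    case (Suc N)
    have "{i \<in> {..<Suc N}. south c (Suc i) (Suc M)} = (if south c (Suc N) (Suc M) then insert N else id) {i \<in> {..<N}. south c (Suc i) (Suc M)}"
      by (auto simp: less_Suc_eq)
    then show ?case using Suc by simp
  qed simp
  finally show ?thesis unfolding state_sampled .
qed

section \<open>Averaging over the coins gives the transfer operators\<close>

context
  fixes t r b1 b2 :: real
  assumes t: "0 < t" "t < 1" and r: "0 < r" "r < 1"
    and b1: "b1 = (1 - r\<^sup>2) / (1 - t * r\<^sup>2)" and b2: "b2 = t * b1"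
begin

lemma row_weight_bounds: "0 < r\<^sup>2" "r\<^sup>2 < 1" "t * r\<^sup>2 < r\<^sup>2" "0 < 1 - t * r\<^sup>2"
proof -
  show 1: "0 < r\<^sup>2" using r by simp
  show 2: "r\<^sup>2 < 1" using r by (simp add: power_less_one_iff)
  show 3: "t * r\<^sup>2 < r\<^sup>2" using 1 t by simp
  then show "0 < 1 - t * r\<^sup>2" using 2 by simp
qed

text \<open>After multiplication by 1 - t r^2 the coin probabilities are the vertex weights of
  \<open>sv_row\<close> at x = y = r.\<close>

lemma coin_weights:
  "b1 * (1 - t * r\<^sup>2) = 1 - r\<^sup>2" "(1 - b1) * (1 - t * r\<^sup>2) = (1 - t) * r\<^sup>2"
  "b2 * (1 - t * r\<^sup>2) = t * (1 - r\<^sup>2)" "(1 - b2) * (1 - t * r\<^sup>2) = 1 - t"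
proof -
  show 1: "b1 * (1 - t * r\<^sup>2) = 1 - r\<^sup>2" using row_weight_bounds by (simp add: b1)
  then show "(1 - b1) * (1 - t * r\<^sup>2) = (1 - t) * r\<^sup>2" by (simp add: left_diff_distrib)
  have 3: "b2 * (1 - t * r\<^sup>2) = t * (b1 * (1 - t * r\<^sup>2))" by (simp add: b2)
  then show "b2 * (1 - t * r\<^sup>2) = t * (1 - r\<^sup>2)" unfolding 1 .
  then show "(1 - b2) * (1 - t * r\<^sup>2) = 1 - t" by (simp add: algebra_simps)
qed

lemma coin_range: "0 < b1" "b1 < 1" "0 < b2" "b2 < 1"
proof -
  show 1: "0 < b1" using row_weight_bounds by (simp add: b1)
  show 2: "b1 < 1" using row_weight_bounds by (simp add: b1)
  show "0 < b2" using 1 t by (simp add: b2)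
  show "b2 < 1" using mult_strict_mono[of t 1 b1 1] 1 2 t by (simp add: b2)
qed

text \<open>Induction along the row: the first coin is independent of the others, and averaging over
  it reproduces the recursive clause of \<open>sv_row\<close>.\<close>

lemma row_expectation:
  "measure_pmf.expectation (Pi_pmf ((\<lambda>i. (i, m)) ` {Suc k..k + length vs}) d (\<lambda>_. coin b1 b2)) (\<lambda>c. F (row_out c m k h vs)) * (1 - t * r\<^sup>2) ^ length vs
    = sv_row t r h (replicate (length vs) r) vs F"
proof (induction vs arbitrary: k h F)
  case (Cons v vs)
  define w where "w = 1 - t * r\<^sup>2"
  define A where "A = (\<lambda>i. (i, m)) ` {Suc (Suc k)..Suc k + length vs}"
  let ?P = "Pi_pmf A d (\<lambda>_. coin b1 b2)"
  have A: "finite A" "(Suc k, m) \<notin> A" by (auto simp: A_def)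
  have I: "(\<lambda>i. (i, m)) ` {Suc k..k + length (v # vs)} = insert (Suc k, m) A"
  proof -
    have "{Suc k..k + length (v # vs)} = insert (Suc k) {Suc (Suc k)..Suc k + length vs}" by auto
    then show ?thesis by (simp add: A_def)
  qed
  define E :: "bool \<Rightarrow> (bool list \<Rightarrow> real) \<Rightarrow> real" where "E = (\<lambda>h F. measure_pmf.expectation ?P (\<lambda>c. F (row_out c m (Suc k) h vs)))"
  have IH: "E h F * w ^ length vs = sv_row t r h (replicate (length vs) r) vs F" for h F
    unfolding E_def w_def A_def by (rule Cons.IH)
  have upd: "row_out (f((Suc k, m) := y)) m (Suc k) h vs = row_out f m (Suc k) h vs" for f y h
    by (rule row_out_cong) auto
  have "measure_pmf.expectation (Pi_pmf ((\<lambda>i. (i, m)) ` {Suc k..k + length (v # vs)}) d (\<lambda>_. coin b1 b2)) (\<lambda>c. F (row_out c m k h (v # vs)))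
    = measure_pmf.expectation (coin b1 b2) (\<lambda>y. E (bold_east (choose_type h v y)) (\<lambda>ws. F (bold_north (choose_type h v y) # ws)))"
    unfolding I Pi_pmf_insert[OF A] integral_map_pmf E_def
    by (subst expectation_pair_finite) (auto simp: A finite_set_Pi_pmf_finite upd simp del: fun_upd_apply simp add: fun_upd_same)
  also have "\<dots> * w ^ length (v # vs) = sv_row t r h (replicate (length (v # vs)) r) (v # vs) F"
  proof -
    define G where "G = (\<lambda>h' v'. E h' (\<lambda>ws. F (v' # ws)))"
    have G: "sv_row t r h' (replicate (length vs) r) vs (\<lambda>ws. F (v' # ws)) = G h' v' * w ^ length vs" for h' v'
      unfolding G_def by (rule IH[symmetric])
    have e: "measure_pmf.expectation (coin b1 b2) (\<lambda>y. G (bold_east (choose_type h v y)) (bold_north (choose_type h v y))) * w =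
      (if h = v then w * G h v else (if h then t else 1) * (1 - r * r) * G h v + (1 - t) * (if h then 1 else r * r) * G v h)"
    proof -
      note W = coin_weights[folded w_def]
      have lin: "(A * X + B * Y) * w = (A * w) * X + (B * w) * Y" for A B X Y :: real
        by (simp add: algebra_simps)
      have const: "b1 * (b2 * X + (1 - b2) * X) + (1 - b1) * (b2 * X + (1 - b2) * X) = X" for X
        by (simp add: algebra_simps)
      \<comment> \<open>A path from the south consults only the first coin, so the second sums out;
        \<open>E2\<close> is the opposite case of a path from the west.\<close>
      have E1: "(b1 * (b2 * X + (1 - b2) * X) + (1 - b1) * (b2 * Y + (1 - b2) * Y)) * w = (1 - r * r) * X + ((1 - t) * (r * r)) * Y" for X Y
      proof -
        have "(b1 * (b2 * X + (1 - b2) * X) + (1 - b1) * (b2 * Y + (1 - b2) * Y)) = b1 * X + (1 - b1) * Y" by (simp add: algebra_simps)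
        then show ?thesis by (simp only: lin W power2_eq_square)
      qed
      have E2: "(b1 * (b2 * X + (1 - b2) * Y) + (1 - b1) * (b2 * X + (1 - b2) * Y)) * w = (t * (1 - r * r)) * X + (1 - t) * Y" for X Y
      proof -
        have "(b1 * (b2 * X + (1 - b2) * Y) + (1 - b1) * (b2 * X + (1 - b2) * Y)) = b2 * X + (1 - b2) * Y" by (simp add: algebra_simps)
        then show ?thesis by (simp only: lin W power2_eq_square)
      qed
      note coin_exp = expectation_coin[OF less_imp_le[OF coin_range(1)] less_imp_le[OF coin_range(2)] less_imp_le[OF coin_range(3)] less_imp_le[OF coin_range(4)]]
      have ct: "choose_type True True c = Type_a2" "choose_type False False c = Type_a1"
        "choose_type True False (a, b) = (if b then Type_b2 else Type_c2)" "choose_type False True (a, b) = (if a then Type_b1 else Type_c1)" for a b c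
        by (simp_all add: choose_type_def)
      have be: "bold_east Type_a1 = False" "bold_east Type_a2 = True" "bold_east Type_b1 = False" "bold_east Type_b2 = True" "bold_east Type_c1 = True" "bold_east Type_c2 = False"
        "bold_north Type_a1 = False" "bold_north Type_a2 = True" "bold_north Type_b1 = True" "bold_north Type_b2 = False" "bold_north Type_c1 = False" "bold_north Type_c2 = True"
        by (simp_all add: bold_east_def bold_north_def)
      show ?thesis
      proof (cases h; cases v)
        assume "h" "v"
        then show ?thesis by (simp only: coin_exp ct be if_True const) (simp add: mult.commute)
      next
        assume "h" "\<not> v"
        then show ?thesis by (simp only: coin_exp ct be if_True if_False E2) simp
      next
        assume "\<not> h" "v"
        then show ?thesis by (simp only: coin_exp ct be if_True if_False E1) simp
      next
        assume "\<not> h" "\<not> v"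
        then show ?thesis by (simp only: coin_exp ct be if_True if_False const) (simp add: mult.commute)
      qed
    qed
    let ?S = "sv_row t r h (replicate (length (v # vs)) r) (v # vs) F"
    have S: "?S = (if h = v then w * G h v else (if h then t else 1) * (1 - r * r) * G h v + (1 - t) * (if h then 1 else r * r) * G v h) * w ^ length vs"
    proof -
      have w: "1 - t * r * r = w" by (simp add: w_def power2_eq_square mult.assoc)
      have "?S = (if h = v then w * (G h v * w ^ length vs) else (if h then t else 1) * (1 - r * r) * (G h v * w ^ length vs) + (1 - t) * (if h then 1 else r * r) * (G v h * w ^ length vs))"
        unfolding length_Cons replicate_Suc sv_row.simps G w by (rule refl)
      also have "\<dots> = (if h = v then w * G h v else (if h then t else 1) * (1 - r * r) * G h v + (1 - t) * (if h then 1 else r * r) * G v h) * w ^ length vs"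
      proof -
        have "(if b then x * (P * z) else y * (P * z) + y' * (Q * z)) = (if b then x * P else y * P + y' * Q) * z" for b and x y y' z P Q :: real
          by (simp add: algebra_simps)
        then show ?thesis .
      qed
      finally show ?thesis .
    qed
    show ?thesis
      unfolding S e[symmetric] by (simp add: G_def mult.assoc)
  qed
  finally show ?case unfolding w_def .
qed simp

lemma sv_rows_snoc: "sv_rows t (ys @ [y]) xs vs F = sv_rows t ys xs vs (\<lambda>ws. sv_row t y False xs ws F)"
  by (induction ys arbitrary: vs) auto

text \<open>The coins of the last row are independent of the earlier ones, and averaging over them
  applies the innermost operator; so rows are split off at the end of the list.\<close>

lemma state_expectation:
  "measure_pmf.expectation (Pi_pmf ({1..N} \<times> {1..M}) d (\<lambda>_. coin b1 b2)) (\<lambda>c. F (state c N M)) * (1 - t * r\<^sup>2) ^ (N * M)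
    = sv_rows t (replicate M r) (replicate N r) (replicate N True) F"
proof (induction M arbitrary: F)
  case (Suc M)
  let ?A = "{1..N} \<times> {1..M}" and ?B = "(\<lambda>i. (i, Suc M)) ` {Suc 0..0 + N}"
  let ?P = "\<lambda>A. Pi_pmf A d (\<lambda>_. coin b1 b2)"
  have AB: "{1..N} \<times> {1..Suc M} = ?A \<union> ?B" by (auto simp: le_Suc_eq)
  have disj: "finite ?A" "finite ?B" "?A \<inter> ?B = {}" by auto
  have st: "state (\<lambda>x. if x \<in> ?A then f x else g x) N (Suc M) = row_out g (Suc M) 0 False (state f N M)" for f g
  proof -
    have "state (\<lambda>x. if x \<in> ?A then f x else g x) N M = state f N M" by (rule state_cong) auto
    moreover have "row_out (\<lambda>x. if x \<in> ?A then f x else g x) (Suc M) 0 False vs = row_out g (Suc M) 0 False vs" for vs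
      by (rule row_out_cong) auto
    ultimately show ?thesis by simp
  qed
  let ?w = "1 - t * r\<^sup>2"
  define inner where "inner = (\<lambda>f. measure_pmf.expectation (?P ?B) (\<lambda>g. F (row_out g (Suc M) 0 False (state f N M))))"
  have e1: "measure_pmf.expectation (?P ({1..N} \<times> {1..Suc M})) (\<lambda>c. F (state c N (Suc M))) = measure_pmf.expectation (?P ?A) inner"
    unfolding AB Pi_pmf_union[OF disj] integral_map_pmf inner_def
    by (subst expectation_pair_finite) (simp_all only: finite_set_Pi_pmf_finite disj prod.case st)
  have e2: "measure_pmf.expectation (?P ?A) (\<lambda>f. inner f * ?w ^ N) * ?w ^ (N * M) = measure_pmf.expectation (?P ?A) inner * ?w ^ (N * Suc M)"
    by (simp add: power_add)
  have e3: "inner f * ?w ^ N = sv_row t r False (replicate N r) (state f N M) F" for f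
    unfolding inner_def by (rule row_expectation[of "Suc M" 0 "state f N M" d F False, unfolded length_state])
  have "measure_pmf.expectation (?P ?A) (\<lambda>f. inner f * ?w ^ N) * ?w ^ (N * M) = sv_rows t (replicate M r @ [r]) (replicate N r) (replicate N True) F"
    unfolding e3 sv_rows_snoc by (rule Suc.IH)
  then show ?case unfolding e1 e2 by (simp add: replicate_append_same)
qed simp

end

text \<open>An event that depends on finitely many coins is a finite disjoint union of cylinders, on
  which the infinite product measure and \<open>Pi_pmf\<close> agree.\<close>

lemma coin_space_finite:
  assumes A: "finite A" "A \<subseteq> quadrant" and Q: "\<And>c c'. (\<And>v. v \<in> A \<Longrightarrow> c v = c' v) \<Longrightarrow> Q c = Q c'"
  shows "\<P>(c in coin_space b1 b2. Q c) = measure_pmf.prob (Pi_pmf A d (\<lambda>_. coin b1 b2)) {c. Q c}"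
proof -
  let ?M = "\<lambda>_ :: nat \<times> nat. measure_pmf (coin b1 b2)"
  interpret product_prob_space ?M quadrant by standard
  have cs: "coin_space b1 b2 = Pi\<^sub>M quadrant ?M" by (simp add: coin_space_def)
  define S where "S = {f \<in> PiE_dflt A d (\<lambda>_. UNIV). Q f}"
  have S: "finite S" unfolding S_def using A by (auto intro!: finite_subset[OF _ finite_PiE_dflt[of A "\<lambda>_. UNIV" d]])
  define cyl where "cyl f = prod_emb quadrant ?M A (Pi\<^sub>E A (\<lambda>v. {f v}))" for f
  have cyl_iff: "c \<in> cyl f \<longleftrightarrow> c \<in> space (coin_space b1 b2) \<and> (\<forall>v\<in>A. c v = f v)" for c f
    unfolding cyl_def cs by (auto simp: prod_emb_def space_PiM PiE_iff)
  have un: "{c \<in> space (coin_space b1 b2). Q c} = (\<Union>f\<in>S. cyl f)"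
  proof (intro equalityI subsetI)
    fix c assume c: "c \<in> {c \<in> space (coin_space b1 b2). Q c}"
    let ?f = "\<lambda>v. if v \<in> A then c v else d"
    have "Q ?f = Q c" by (rule Q) simp
    then have "?f \<in> S" using c by (auto simp: S_def PiE_dflt_def)
    moreover have "c \<in> cyl ?f" using c by (simp add: cyl_iff)
    ultimately show "c \<in> (\<Union>f\<in>S. cyl f)" by blast
  next
    fix c assume "c \<in> (\<Union>f\<in>S. cyl f)"
    then obtain f where f: "f \<in> S" "c \<in> cyl f" by blast
    then have "Q c = Q f" by (intro Q) (simp add: cyl_iff)
    then show "c \<in> {c \<in> space (coin_space b1 b2). Q c}" using f by (simp add: cyl_iff S_def)
  qed
  have disj: "disjoint_family_on cyl S"
  proof (unfold disjoint_family_on_def, intro ballI impI)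
    fix f g assume fg: "f \<in> S" "g \<in> S" "f \<noteq> g"
    show "cyl f \<inter> cyl g = {}"
    proof (rule ccontr)
      assume "cyl f \<inter> cyl g \<noteq> {}"
      then obtain c where "\<forall>v\<in>A. c v = f v" "\<forall>v\<in>A. c v = g v" by (auto simp: cyl_iff)
      then have "f v = g v" for v using fg by (cases "v \<in> A") (auto simp: S_def PiE_dflt_def simp del: split_paired_All)
      then have "f = g" by (rule ext)
      then show False using fg(3) by contradiction
    qed
  qed
  have m: "cyl f \<in> sets (coin_space b1 b2)" for f
    unfolding cyl_def cs using A by (intro sets_PiM_I) auto
  have v: "measure (coin_space b1 b2) (cyl f) = (\<Prod>v\<in>A. pmf (coin b1 b2) (f v))" for f
    unfolding cyl_def cs using A by (subst measure_PiM_emb) (auto simp: pmf.rep_eq)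
  interpret prob_space "coin_space b1 b2"
    unfolding cs by (rule prob_space_axioms)
  have "\<P>(c in coin_space b1 b2. Q c) = (\<Sum>f\<in>S. \<Prod>v\<in>A. pmf (coin b1 b2) (f v))"
    unfolding un v[symmetric] using S m disj by (intro finite_measure_finite_Union) auto
  also have "\<dots> = (\<Sum>f\<in>S. pmf (Pi_pmf A d (\<lambda>_. coin b1 b2)) f)"
    using A by (intro sum.cong refl) (subst pmf_Pi, auto simp: S_def PiE_dflt_def)
  also have "\<dots> = measure_pmf.prob (Pi_pmf A d (\<lambda>_. coin b1 b2)) S" by (rule measure_measure_pmf_finite[OF S, symmetric])
  also have "\<dots> = measure_pmf.prob (Pi_pmf A d (\<lambda>_. coin b1 b2)) {c. Q c}"
  proof (rule measure_prob_cong_0)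
    fix f assume f: "f \<in> {c. Q c} - S"
    then have "f \<notin> PiE_dflt A d (\<lambda>_. UNIV)" by (auto simp: S_def)
    then show "pmf (Pi_pmf A d (\<lambda>_. coin b1 b2)) f = 0" using A by (subst pmf_Pi) (auto simp: PiE_dflt_def)
  qed (auto simp: S_def)
  finally show ?thesis .
qed

theorem height_tail_eq:
  fixes t r b1 b2 x y :: real and M N b :: nat
  assumes t: "0 < t" "t < 1" and r: "0 < r" "r < 1"
    and b1: "b1 = (1 - r\<^sup>2) / (1 - t * r\<^sup>2)" and b2: "b2 = t * b1"
    and y: "nat \<lceil>y\<rceil> = Suc M" and x: "{i. 1 \<le> i \<and> real i \<le> x} = {1..N}"
  shows "\<P>(\<omega> in six_vertex_measure b1 b2. b \<le> height_function x y \<omega>) = sv_tail t (replicate M r) (replicate N r) b"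
proof -
  have yp: "0 < y" using y by (cases "0 < y") auto
  let ?c = "coin_space b1 b2"
  have ms: "{\<omega> \<in> space config_space. b \<le> height_function x y \<omega>} \<in> sets config_space"
    using measurable_sets[OF measurable_height_function[OF yp, of x], of "{b..}"]
    by (simp add: vimage_def Int_def conj_commute)
  have "\<P>(\<omega> in six_vertex_measure b1 b2. b \<le> height_function x y \<omega>) = measure ?c (sampled_config -` {\<omega> \<in> space config_space. b \<le> height_function x y \<omega>} \<inter> space ?c)"
    unfolding six_vertex_measure_def space_distr by (rule measure_distr[OF measurable_sampled_config ms])
  also have "sampled_config -` {\<omega> \<in> space config_space. b \<le> height_function x y \<omega>} \<inter> space ?c = {c \<in> space ?c. b \<le> count_list (state c N M) True}"
    using measurable_space[OF measurable_sampled_config] by (auto simp: height_sampled_config[OF y x])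
  also have "measure ?c \<dots> = measure_pmf.prob (Pi_pmf ({1..N} \<times> {1..M}) undefined (\<lambda>_. coin b1 b2)) {c. b \<le> count_list (state c N M) True}"
  proof (rule coin_space_finite)
    show "{1..N} \<times> {1..M} \<subseteq> quadrant" by (auto simp: quadrant_def)
    show "(b \<le> count_list (state c N M) True) = (b \<le> count_list (state c' N M) True)" if "\<And>v. v \<in> {1..N} \<times> {1..M} \<Longrightarrow> c v = c' v" for c c'
      using state_cong[of N M c c'] that by auto
  qed simp
  also have "\<dots> = measure_pmf.expectation (Pi_pmf ({1..N} \<times> {1..M}) undefined (\<lambda>_. coin b1 b2)) (\<lambda>c. of_bool (b \<le> count_list (state c N M) True))"
  proof -
    have "(\<lambda>c. of_bool (b \<le> count_list (state c N M) True) :: real) = indicator {c. b \<le> count_list (state c N M) True}"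
      by (auto simp: indicator_def)
    then show ?thesis by simp
  qed
  also have "\<dots> = sv_tail t (replicate M r) (replicate N r) b"
  proof -
    have "sv_norm t (replicate M r) (replicate N r) = (1 - t * r\<^sup>2) ^ (N * M)"
      by (simp add: sv_norm_def prod_list_replicate power_mult power2_eq_square mult.assoc)
    moreover have "(1 - t * r\<^sup>2) ^ (N * M) \<noteq> 0" using row_weight_bounds[OF t r b1 b2] by simp
    ultimately show ?thesis
      unfolding sv_tail_def using state_expectation[OF t r b1 b2, of N M undefined "\<lambda>ws. of_bool (b \<le> count_list ws True)"]
      by (simp add: nonzero_eq_divide_eq)
  qed
  finally show ?thesis .
qed

section \<open>The Tracy--Widom limit\<close>

lemma nat_filterlim_of_cubic:
  fixes M :: "nat \<Rightarrow> nat"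
  assumes l: "filterlim l at_top sequentially" and M: "(\<lambda>k. real (M k) / l k ^ 3) \<longlonglongrightarrow> Y" "0 < Y"
  shows "filterlim M at_top sequentially"
proof -
  have "filterlim (\<lambda>k. l k ^ 3) at_top sequentially" using l by (intro filterlim_pow_at_top) auto
  then have "filterlim (\<lambda>k. real (M k) / l k ^ 3 * l k ^ 3) at_top sequentially"
    by (rule filterlim_tendsto_pos_mult_at_top[OF M])
  moreover have "\<forall>\<^sub>F k in sequentially. real (M k) / l k ^ 3 * l k ^ 3 = real (M k)"
    using filterlim_at_top_dense[THEN iffD1, OF l, rule_format, of 0] by eventually_elim simp
  ultimately have "filterlim (\<lambda>k. real (M k)) at_top sequentially" by (rule filterlim_cong[THEN iffD1, OF refl refl, rotated])
  then show ?thesis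
    unfolding filterlim_at_top by (metis (mono_tags, lifting) eventually_mono of_nat_le_iff)
qed

text \<open>The two factors of the kernel are two instances of the same scaling limit. The mirror
  instance has (\<alpha>, \<beta>, X, Y) replaced by (1 - \<beta>, 1 - \<alpha>, Y, X), which
  preserves V and \<alpha> - \<beta>, hence also \<sigma>.\<close>

theorem hole_det_tendsto_F_GUE:
  fixes N M a :: "nat \<Rightarrow> nat" and l :: "nat \<Rightarrow> real" and r w X Y \<sigma> s V :: real
  defines "\<alpha> \<equiv> w / (1 + w)" and "\<beta> \<equiv> r\<^sup>2 * w / (1 + r\<^sup>2 * w)"
  assumes r: "0 < r" "r < 1" and w: "0 < w" and XY: "0 < X" "0 < Y"
    and V: "X * \<alpha> * (1 - \<alpha>) = V" "Y * \<beta> * (1 - \<beta>) = V"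
    and \<sigma>: "0 < \<sigma>" "\<sigma> ^ 3 = V * (\<alpha> - \<beta>)"
    and l: "filterlim l at_top sequentially"
    and N: "(\<lambda>k. (real (N k) - X * l k ^ 3) / l k) \<longlonglongrightarrow> 0"
    and M: "(\<lambda>k. (real (M k) - Y * l k ^ 3) / l k) \<longlonglongrightarrow> 0"
    and a: "(\<lambda>k. ((X * \<alpha> - Y * \<beta>) * l k ^ 3 - real (a k)) / l k) \<longlonglongrightarrow> \<sigma> * s"
  shows "(\<lambda>k. hole_det (replicate (M k) 0 @ replicate (N k) r) (replicate (N k) 0 @ replicate (M k) r) (M k + a k)) \<longlonglongrightarrow> F_GUE s"
proof -
  have r2: "0 < r\<^sup>2" "r\<^sup>2 < 1" using r by (auto simp: power_less_one_iff)
  have \<beta>: "0 < \<beta>" using r2 w by (simp add: \<beta>_def add_pos_pos)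
  have \<alpha>: "\<alpha> < 1" using w by (simp add: \<alpha>_def)
  have \<beta>\<alpha>: "\<beta> < \<alpha>"
  proof -
    have "r\<^sup>2 * w < 1 * w" using r2 w by (intro mult_strict_right_mono) auto
    then have "r\<^sup>2 * w * (1 + w) < w * (1 + r\<^sup>2 * w)" by (simp add: algebra_simps)
    then show ?thesis using r2 w by (simp add: \<alpha>_def \<beta>_def divide_simps add_pos_pos)
  qed
  interpret S1: saddle_scaling \<alpha> \<beta> X Y V "X * \<alpha> - Y * \<beta>" N M a l \<sigma> s
    by standard (use \<beta> \<alpha> \<beta>\<alpha> XY V \<sigma> l N M a in auto)
  \<comment> \<open>The subtraction of naturals is a true one eventually, because the mirror value Y
    (1 - \<beta>) - X (1 - \<alpha>) of h is positive.\<close>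
  define a' where "a' = (\<lambda>k. a k + M k - N k)"
  have lpos: "\<forall>\<^sub>F k in sequentially. 0 < l k" by (rule S1.l_large)
  have h': "Y * (1 - \<beta>) - X * (1 - \<alpha>) = (X * \<alpha> - Y * \<beta>) + Y - X" by (simp add: algebra_simps)
  have VY: "Y * (1 - \<beta>) * (1 - (1 - \<beta>)) = V" "X * (1 - \<alpha>) * (1 - (1 - \<alpha>)) = V"
    using V by (simp_all add: mult_ac)
  interpret P2: saddle_parameters "1 - \<beta>" "1 - \<alpha>" Y X V "Y * (1 - \<beta>) - X * (1 - \<alpha>)"
    by standard (use \<beta> \<alpha> \<beta>\<alpha> XY VY in auto)
  have "(\<lambda>k. ((X * \<alpha> - Y * \<beta>) * l k ^ 3 - real (a k)) / l k - (real (M k) - Y * l k ^ 3) / l k + (real (N k) - X * l k ^ 3) / l k) \<longlonglongrightarrow> \<sigma> * s - 0 + 0"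
    by (intro tendsto_intros a M N)
  moreover have "((X * \<alpha> - Y * \<beta>) * l k ^ 3 - real (a k)) / l k - (real (M k) - Y * l k ^ 3) / l k + (real (N k) - X * l k ^ 3) / l k
    = ((Y * (1 - \<beta>) - X * (1 - \<alpha>)) * l k ^ 3 - (real (a k) + real (M k) - real (N k))) / l k" for k
    unfolding h' by (simp add: diff_divide_distrib add_divide_distrib algebra_simps)
  ultimately have A: "(\<lambda>k. ((Y * (1 - \<beta>) - X * (1 - \<alpha>)) * l k ^ 3 - (real (a k) + real (M k) - real (N k))) / l k) \<longlonglongrightarrow> \<sigma> * s" by simp
  have "(\<lambda>k. ((real (a k) + real (M k) - real (N k)) - (Y * (1 - \<beta>) - X * (1 - \<alpha>)) * l k ^ 3) / l k) \<longlonglongrightarrow> - (\<sigma> * s)"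
    using tendsto_minus[OF A] unfolding minus_divide_left minus_diff_eq .
  from cubic_ratio_tendsto[OF l this] have "\<forall>\<^sub>F k in sequentially. 0 < (real (a k) + real (M k) - real (N k)) / l k ^ 3"
    by (rule order_tendstoD) (rule P2.h_pos)
  then have N_le: "\<forall>\<^sub>F k in sequentially. N k \<le> a k + M k"
    using lpos
  proof eventually_elim
    case (elim k)
    then have "0 < real (a k) + real (M k) - real (N k)" by (simp add: zero_less_divide_iff)
    then show ?case by linarith
  qed
  have "(\<lambda>k. ((Y * (1 - \<beta>) - X * (1 - \<alpha>)) * l k ^ 3 - real (a' k)) / l k) \<longlonglongrightarrow> \<sigma> * s"
    by (rule tendsto_cong[THEN iffD1, OF _ A]) (use N_le in \<open>eventually_elim, simp add: a'_def of_nat_diff\<close>)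
  then interpret S2: saddle_scaling "1 - \<beta>" "1 - \<alpha>" Y X V "Y * (1 - \<beta>) - X * (1 - \<alpha>)" M N a' l \<sigma> s
    by unfold_locales (use N M l \<sigma> in auto)
  obtain C where C: "0 \<le> C" "\<forall>\<^sub>F k in sequentially. \<forall>i. \<bar>S1.scaled_coeff k i\<bar> \<le> C * exp (- (real i / l k))"
    by (rule S1.scaled_coeff_bound)
  obtain C' where C': "0 \<le> C'" "\<forall>\<^sub>F k in sequentially. \<forall>i. \<bar>S2.scaled_coeff k i\<bar> \<le> C' * exp (- (real i / l k))"
    by (rule S2.scaled_coeff_bound)
  define K where "K = (\<lambda>k i j. \<Sum>m<a k. S1.scaled_coeff k (i + m) / l k * (S2.scaled_coeff k (j + m) / l k))"
  have M_top: "filterlim M at_top sequentially"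
    by (rule nat_filterlim_of_cubic[OF l cubic_ratio_tendsto[OF l M] XY(2)])
  have "(\<lambda>k. \<Sum>n\<le>M k + a k. (- 1) ^ n / fact n * (\<Sum>i\<in>{..<n} \<rightarrow>\<^sub>E {..<M k + a k}. Determinant.det (mat n n (\<lambda>(p, q). K k (i p) (i q)))))
    \<longlonglongrightarrow> F_GUE s"
    unfolding K_def
  proof (rule airy_product_kernel_tendsto[OF l \<sigma>(1) _ _ _ C(1) C'(1) C(2) C'(2)])
    show "filterlim (\<lambda>k. M k + a k) at_top sequentially"
      by (rule filterlim_at_top_mono[OF M_top]) simp
    show "S1.scaled_coeff k i = 0" if "a k \<le> i" for k i using that by (simp add: S1.scaled_coeff_def)
  qed (auto intro: S1.scaled_coeff_tendsto S2.scaled_coeff_tendsto)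
  moreover have "\<forall>\<^sub>F k in sequentially. (\<Sum>n\<le>M k + a k. (- 1) ^ n / fact n * (\<Sum>i\<in>{..<n} \<rightarrow>\<^sub>E {..<M k + a k}. Determinant.det (mat n n (\<lambda>(p, q). K k (i p) (i q)))))
    = hole_det (replicate (M k) 0 @ replicate (N k) r) (replicate (N k) 0 @ replicate (M k) r) (M k + a k)"
    using lpos N_le
  proof eventually_elim
    case (elim k)
    have "K k = (\<lambda>i j. \<Sum>m<a k. coeff_seq (N k) (M k) \<alpha> \<beta> (a k) (i + m) * coeff_seq (M k) (N k) (1 - \<beta>) (1 - \<alpha>) (a' k) (j + m))"
      unfolding K_def using elim by (intro ext sum.cong refl) (auto simp: S1.scaled_coeff_def S2.scaled_coeff_def coeff_seq_def)
    moreover have "a k + M k = a' k + N k" using elim by (simp add: a'_def)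
    ultimately show ?case
      using hole_det_confluent[OF r(1) w, of "a k" "M k" "a' k" "N k"] unfolding \<alpha>_def \<beta>_def by simp
  qed
  ultimately show ?thesis by (rule tendsto_cong[THEN iffD1, rotated])
qed

text \<open>For fixed m a shift of the threshold by 2 m is invisible on the scale l; so k tends to
  infinity first, and m is taken large enough for the remaining error.\<close>

theorem sv_tail_tendsto_F_GUE:
  fixes N M a :: "nat \<Rightarrow> nat" and l :: "nat \<Rightarrow> real" and r w X Y \<sigma> s V t :: real
  defines "\<alpha> \<equiv> w / (1 + w)" and "\<beta> \<equiv> r\<^sup>2 * w / (1 + r\<^sup>2 * w)"
  assumes t: "0 < t" "t < 1" and r: "0 < r" "r < 1" and w: "0 < w" and XY: "0 < X" "0 < Y"
    and V: "X * \<alpha> * (1 - \<alpha>) = V" "Y * \<beta> * (1 - \<beta>) = V"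
    and \<sigma>: "0 < \<sigma>" "\<sigma> ^ 3 = V * (\<alpha> - \<beta>)"
    and l: "filterlim l at_top sequentially"
    and N: "(\<lambda>k. (real (N k) - X * l k ^ 3) / l k) \<longlonglongrightarrow> 0"
    and M: "(\<lambda>k. (real (M k) - Y * l k ^ 3) / l k) \<longlonglongrightarrow> 0"
    and a: "(\<lambda>k. ((X * \<alpha> - Y * \<beta>) * l k ^ 3 - real (a k)) / l k) \<longlonglongrightarrow> \<sigma> * s"
    and a_top: "filterlim a at_top sequentially"
  shows "(\<lambda>k. sv_tail t (replicate (M k) r) (replicate (N k) r) (a k)) \<longlonglongrightarrow> F_GUE s"
proof -
  let ?D = "\<lambda>k n. hole_det (replicate (M k) 0 @ replicate (N k) r) (replicate (N k) 0 @ replicate (M k) r) (M k + n)"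
  let ?T = "\<lambda>k. sv_tail t (replicate (M k) r) (replicate (N k) r) (a k)"
  define e where "e = (\<lambda>m. exp (t ^ m / (1 - t)))"
  have il: "(\<lambda>k. 1 / l k) \<longlonglongrightarrow> 0"
    using tendsto_inverse_0_at_top[OF l] by (simp add: inverse_eq_divide)
  have D: "(\<lambda>k. ?D k (b k)) \<longlonglongrightarrow> F_GUE s" if b: "\<forall>\<^sub>F k in sequentially. real (b k) = real (a k) + c" for b c
  proof (rule hole_det_tendsto_F_GUE[OF r w XY, folded \<alpha>_def \<beta>_def, OF V \<sigma> l N M])
    have "(\<lambda>k. ((X * \<alpha> - Y * \<beta>) * l k ^ 3 - real (a k)) / l k - c * (1 / l k)) \<longlonglongrightarrow> \<sigma> * s - c * 0"
      by (intro tendsto_intros a il)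
    moreover have "\<forall>\<^sub>F k in sequentially. ((X * \<alpha> - Y * \<beta>) * l k ^ 3 - real (a k)) / l k - c * (1 / l k) = ((X * \<alpha> - Y * \<beta>) * l k ^ 3 - real (b k)) / l k"
      using b by eventually_elim (simp add: diff_divide_distrib add_divide_distrib)
    ultimately show "(\<lambda>k. ((X * \<alpha> - Y * \<beta>) * l k ^ 3 - real (b k)) / l k) \<longlonglongrightarrow> \<sigma> * s"
      by (simp add: tendsto_cong)
  qed
  have tm: "(\<lambda>m. t ^ m) \<longlonglongrightarrow> 0" using t by (intro LIMSEQ_power_zero) auto
  have e: "e \<longlonglongrightarrow> 1"
  proof -
    have "e \<longlonglongrightarrow> exp (0 / (1 - t))" unfolding e_def by (intro tendsto_intros tm) (use t in auto)
    then show ?thesis by simp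
  qed
  have ep: "0 < e m" for m by (simp add: e_def)
  show ?thesis
  proof (rule order_tendstoI)
    fix u assume u: "F_GUE s < u"
    have "(\<lambda>m. e m * (F_GUE s + t ^ m)) \<longlonglongrightarrow> 1 * (F_GUE s + 0)" by (intro tendsto_intros e tm)
    then have "\<forall>\<^sub>F m in sequentially. e m * (F_GUE s + t ^ m) < u" by (rule order_tendstoD) (use u in simp)
    then obtain m where m: "e m * (F_GUE s + t ^ m) < u" by (auto simp: eventually_sequentially)
    have big: "\<forall>\<^sub>F k in sequentially. 2 * m \<le> a k" using a_top by (simp add: filterlim_at_top)
    have "(\<lambda>k. e m * (?D k (a k - 2 * m) + t ^ m)) \<longlonglongrightarrow> e m * (F_GUE s + t ^ m)"
      by (intro tendsto_intros D[of _ "- real (2 * m)"]) (use big in \<open>eventually_elim, simp add: of_nat_diff\<close>)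
    then have "\<forall>\<^sub>F k in sequentially. e m * (?D k (a k - 2 * m) + t ^ m) < u" by (rule order_tendstoD) (rule m)
    then show "\<forall>\<^sub>F k in sequentially. ?T k < u"
      using big
    proof eventually_elim
      case (elim k)
      have "m \<le> a k - m" using elim by simp
      from confluent_tail_bounds(1)[OF t r this, of "M k" "N k"]
      have "?T k \<le> e m * (?D k (a k - 2 * m) + t ^ m)"
        using elim unfolding e_def by (simp add: mult_2)
      then show ?case using elim by linarith
    qed
  next
    fix u assume u: "u < F_GUE s"
    have "(\<lambda>m. F_GUE s / e m - t ^ m) \<longlonglongrightarrow> F_GUE s / 1 - 0" by (intro tendsto_intros e tm) auto
    then have "\<forall>\<^sub>F m in sequentially. u < F_GUE s / e m - t ^ m" by (rule order_tendstoD) (use u in simp)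
    then obtain m where m: "u < F_GUE s / e m - t ^ m" by (auto simp: eventually_sequentially)
    have "(\<lambda>k. ?D k (a k + 2 * m) / e m - t ^ m) \<longlonglongrightarrow> F_GUE s / e m - t ^ m"
      by (intro tendsto_intros D[of _ "real (2 * m)"]) (use ep[of m] in auto)
    then have "\<forall>\<^sub>F k in sequentially. u < ?D k (a k + 2 * m) / e m - t ^ m" by (rule order_tendstoD) (rule m)
    then show "\<forall>\<^sub>F k in sequentially. u < ?T k"
    proof eventually_elim
      case (elim k)
      have "m \<le> a k + m" by simp
      from confluent_tail_bounds(2)[OF t r this, of "M k" "N k"]
      have "?D k (a k + 2 * m) \<le> e m * (?T k + t ^ m)"
        unfolding e_def by (simp add: mult_2 add.assoc)
      then have "?D k (a k + 2 * m) / e m \<le> ?T k + t ^ m" using ep[of m] by (simp add: divide_le_eq mult.commute)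
      then show ?case using elim by linarith
    qed
  qed
qed

lemma bounded_difference_tendsto:
  fixes P Q l :: "nat \<Rightarrow> real"
  assumes l: "filterlim l at_top sequentially" and B: "\<forall>\<^sub>F k in sequentially. \<bar>P k - Q k\<bar> \<le> 1"
  shows "(\<lambda>k. (P k - Q k) / l k) \<longlonglongrightarrow> 0"
proof (rule Lim_null_comparison)
  show "\<forall>\<^sub>F k in sequentially. norm ((P k - Q k) / l k) \<le> 1 / l k"
    using B filterlim_at_top_dense[THEN iffD1, OF l, rule_format, of 0]
    by eventually_elim (simp add: divide_right_mono)
  show "(\<lambda>k. 1 / l k) \<longlonglongrightarrow> 0"
    using tendsto_inverse_0_at_top[OF l] by (simp add: inverse_eq_divide)
qed

section \<open>Identification of the constants of the limit theorem\<close>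

context
  fixes b1 b2 x y :: real
  assumes b2_pos: "0 < b2" and b2_less: "b2 < b1" and b1_less: "b1 < 1" and x: "x > 0" and y: "y > 0"
    and slope: "(1 - b1) / (1 - b2) < x / y" "x / y < (1 - b2) / (1 - b1)"
begin

definition "kappa = (1 - b1) / (1 - b2)"
definition "quot = sqrt (kappa * y / x)"
text \<open>The solution w of (1 + \<open>kappa\<close> w) / (1 + w) = \<open>quot\<close>. For
  positive w this equation is equivalent to x \<alpha> (1 - \<alpha>) = y \<beta> (1 - \<beta>) with
  \<alpha> = w / (1 + w) and \<beta> = \<open>kappa\<close> w / (1 + \<open>kappa\<close>
  w).\<close>

definition "weight = (1 - quot) / (quot - kappa)"

lemma kappa_bounds: "0 < kappa" "kappa < 1" "1 - kappa = (b1 - b2) / (1 - b2)"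
  using b2_pos b2_less b1_less by (auto simp: kappa_def field_simps)

text \<open>The two slope conditions are exactly \<open>quot\<close> < 1 and \<open>kappa\<close> <
  \<open>quot\<close>; together they make \<open>weight\<close> positive.\<close>

lemma quot_bounds: "0 < quot" "quot < 1" "kappa < quot" "quot\<^sup>2 = kappa * y / x"
proof -
  have q2: "0 < kappa * y / x" using kappa_bounds x y by simp
  show "0 < quot" unfolding quot_def using q2 by simp
  show q: "quot\<^sup>2 = kappa * y / x" unfolding quot_def using q2 by simp
  have "kappa * y < x" using slope(1) y unfolding kappa_def[symmetric] by (simp add: pos_less_divide_eq)
  then show "quot < 1" unfolding quot_def using x by (simp add: real_sqrt_lt_1_iff)
  have "x / y < 1 / kappa" using slope(2) by (simp add: kappa_def)
  then have "kappa * x < y" using kappa_bounds y by (simp add: field_simps)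
  then have "kappa * kappa * x < kappa * y" using kappa_bounds by simp
  then have "kappa\<^sup>2 < kappa * y / x" using x by (simp add: pos_less_divide_eq power2_eq_square)
  then show "kappa < quot" unfolding quot_def by (rule real_less_rsqrt)
qed

lemma weight_pos: "0 < weight"
  using quot_bounds by (simp add: weight_def)

lemma weight_ratios:
  "weight / (1 + weight) = (1 - quot) / (1 - kappa)"
  "kappa * weight / (1 + kappa * weight) = kappa * (1 - quot) / (quot * (1 - kappa))"
proof -
  have d: "0 < quot - kappa" using quot_bounds by simp
  have 1: "1 + weight = (1 - kappa) / (quot - kappa)" "1 + kappa * weight = quot * (1 - kappa) / (quot - kappa)"
    using d by (simp_all add: weight_def field_simps)
  show "weight / (1 + weight) = (1 - quot) / (1 - kappa)" unfolding 1 using d by (simp add: weight_def)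
  show "kappa * weight / (1 + kappa * weight) = kappa * (1 - quot) / (quot * (1 - kappa))"
    unfolding 1 using d by (simp add: weight_def)
qed

lemma kappa_y: "kappa * y = quot\<^sup>2 * x"
  using quot_bounds(4) x by simp

definition "variance = x * (1 - quot) * (quot - kappa) / (1 - kappa)\<^sup>2"

text \<open>This is the condition for a double critical point, with \<open>variance\<close> as the
  common value V.\<close>

lemma variance_eq:
  defines "\<alpha> \<equiv> (1 - quot) / (1 - kappa)" and "\<beta> \<equiv> kappa * (1 - quot) / (quot * (1 - kappa))"
  shows "x * \<alpha> * (1 - \<alpha>) = variance" "y * \<beta> * (1 - \<beta>) = variance"
proof -
  have k: "1 - kappa \<noteq> 0" and q: "quot \<noteq> 0" using kappa_bounds quot_bounds by auto
  have 1: "1 - \<alpha> = (quot - kappa) / (1 - kappa)" using k by (simp add: \<alpha>_def field_simps)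
  show "x * \<alpha> * (1 - \<alpha>) = variance" unfolding 1 by (simp add: variance_def \<alpha>_def power2_eq_square)
  have 2: "1 - \<beta> = (quot - kappa) / (quot * (1 - kappa))" using k q by (simp add: \<beta>_def field_simps)
  have "y * \<beta> * (1 - \<beta>) = (kappa * y) / quot\<^sup>2 * ((1 - quot) * (quot - kappa) / (1 - kappa)\<^sup>2)"
    unfolding 2 by (simp add: \<beta>_def power2_eq_square mult_ac)
  also have "(kappa * y) / quot\<^sup>2 = x" unfolding kappa_y using q by simp
  finally show "y * \<beta> * (1 - \<beta>) = variance" by (simp add: variance_def)
qed

text \<open>The limit shape is the value of h at which the first derivative of the phase vanishes at
  1; both sides equal x (1 - \<open>quot\<close>)^2 / (1 - \<open>kappa\<close>).\<close>

lemma limit_shape_eq: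
  "limit_shape b1 b2 x y = x * ((1 - quot) / (1 - kappa)) - y * (kappa * (1 - quot) / (quot * (1 - kappa)))"
proof -
  have k: "1 - kappa \<noteq> 0" and q: "quot \<noteq> 0" using kappa_bounds quot_bounds by auto
  have b: "0 < 1 - b2" using b2_less b1_less by simp
  have "1 - b1 = kappa * (1 - b2)" using b by (simp add: kappa_def)
  then have e: "y * (1 - b1) = quot\<^sup>2 * (x * (1 - b2))" using kappa_y by (metis mult.assoc mult.commute)
  have s: "sqrt (y * (1 - b1)) = quot * sqrt (x * (1 - b2))"
    unfolding e real_sqrt_mult[of "quot\<^sup>2"] using quot_bounds(1) by simp
  have "sqrt (y * (1 - b1)) - sqrt (x * (1 - b2)) = (quot - 1) * sqrt (x * (1 - b2))" unfolding s by (simp add: algebra_simps)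
  then have "(sqrt (y * (1 - b1)) - sqrt (x * (1 - b2)))\<^sup>2 = (quot - 1)\<^sup>2 * (x * (1 - b2))"
    using x b by (simp add: power_mult_distrib)
  moreover have "b1 - b2 = (1 - kappa) * (1 - b2)" using b by (simp add: kappa_bounds(3))
  ultimately have "limit_shape b1 b2 x y = (quot - 1)\<^sup>2 * x / (1 - kappa)" using b by (simp add: limit_shape_def)
  also have "\<dots> = (1 - quot) / (1 - kappa) * (x - quot * x)" by (simp add: power2_eq_square algebra_simps)
  also have "quot * x = (kappa * y) / quot" unfolding kappa_y using q by (simp add: power2_eq_square)
  also have "(1 - quot) / (1 - kappa) * (x - kappa * y / quot) = x * ((1 - quot) / (1 - kappa)) - y * (kappa * (1 - quot) / (quot * (1 - kappa)))"
  proof -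
    have "A * (x - kappa * y / quot) = x * A - y * (kappa / quot * A)" for A by (simp add: algebra_simps)
    then show ?thesis by (simp only: times_divide_times_eq)
  qed
  finally show ?thesis .
qed

text \<open>Cubing removes the fractional powers and exhibits \<sigma>^3 = V (\<alpha> - \<beta>),
  minus one half of the third derivative of the phase at 1.\<close>

lemma fluctuation_scale:
  "0 < fluctuation_scale b1 b2 x y"
  "fluctuation_scale b1 b2 x y ^ 3 = variance * ((1 - quot) / (1 - kappa) - kappa * (1 - quot) / (quot * (1 - kappa)))"
proof -
  have cube: "(a powr (c / 3)) ^ 3 = a powr c" if "0 < a" for a c :: real
    using that by (simp add: powr_realpow[symmetric] powr_powr)
  have k: "0 < kappa" "0 < 1 - kappa" and q: "0 < quot" "0 < 1 - quot" "0 < quot - kappa" using kappa_bounds quot_bounds by auto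
  have sk: "sqrt (kappa * x / y) = kappa / quot"
  proof -
    have "(kappa / quot)\<^sup>2 = kappa\<^sup>2 / (kappa * y / x)" unfolding power_divide quot_bounds(4) ..
    also have "\<dots> = kappa * x / y" using k by (simp add: power2_eq_square)
    finally have "kappa * x / y = (kappa / quot)\<^sup>2" ..
    then show ?thesis using k q by simp
  qed
  have sr: "kappa powr (-1/2) - kappa powr (1/2) = (1 - kappa) / sqrt kappa"
    using k by (simp add: powr_half_sqrt powr_minus_divide diff_divide_distrib real_div_sqrt)
  have form: "fluctuation_scale b1 b2 x y = kappa powr (-1/3) * (x powr (1/6) * y powr (1/6) / ((1 - kappa) / sqrt kappa))
         * (1 - kappa / quot) powr (2/3) * (1 - quot) powr (2/3)"
    unfolding fluctuation_scale_def Let_def kappa_def[symmetric] sk sr quot_def[symmetric] ..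
  have kq: "0 < 1 - kappa / quot" using q by simp
  show "0 < fluctuation_scale b1 b2 x y" unfolding form using k q kq x y by simp
  have "fluctuation_scale b1 b2 x y ^ 3 = kappa powr (-1) * (x powr (1/2) * y powr (1/2) / ((1 - kappa) / sqrt kappa) ^ 3)
         * (1 - kappa / quot) powr 2 * (1 - quot) powr 2"
  proof -
    have "(kappa powr (-1/3)) ^ 3 = kappa powr (-1)" "(x powr (1/6)) ^ 3 = x powr (1/2)" "(y powr (1/6)) ^ 3 = y powr (1/2)"
      "((1 - kappa / quot) powr (2/3)) ^ 3 = (1 - kappa / quot) powr 2" "((1 - quot) powr (2/3)) ^ 3 = (1 - quot) powr 2"
      using cube[of kappa "-1"] cube[of x "1/2"] cube[of y "1/2"] cube[of "1 - kappa / quot" 2] cube[of "1 - quot" 2] k q kq x y by simp_all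
    then show ?thesis unfolding form power_mult_distrib power_divide by (simp only:)
  qed
  also have "\<dots> = 1 / kappa * (sqrt x * sqrt y / ((1 - kappa) / sqrt kappa) ^ 3) * (1 - kappa / quot)\<^sup>2 * (1 - quot)\<^sup>2"
    using k q kq x y by (simp add: powr_half_sqrt powr_minus_divide powr_numeral)
  also have "\<dots> = (sqrt kappa * sqrt x * sqrt y) * (1 - kappa / quot)\<^sup>2 * (1 - quot)\<^sup>2 / (1 - kappa) ^ 3"
    using k by (simp add: field_simps power3_eq_cube)
  also have "sqrt kappa * sqrt x * sqrt y = x * quot"
  proof -
    have "sqrt kappa * sqrt x * sqrt y = sqrt ((kappa * y) * x)" by (simp add: real_sqrt_mult)
    also have "\<dots> = x * quot" unfolding kappa_y using x q by (simp add: real_sqrt_mult)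
    finally show ?thesis .
  qed
  also have "1 - kappa / quot = (quot - kappa) / quot" using q by (simp add: field_simps)
  finally have c: "fluctuation_scale b1 b2 x y ^ 3 = x * quot * ((quot - kappa) / quot)\<^sup>2 * (1 - quot)\<^sup>2 / (1 - kappa) ^ 3" .
  have d: "(1 - quot) / (1 - kappa) - kappa * (1 - quot) / (quot * (1 - kappa)) = (1 - quot) * (quot - kappa) / (quot * (1 - kappa))"
  proof -
    have "(1 - quot) / (1 - kappa) = (1 - quot) * quot / (quot * (1 - kappa))" using q by simp
    then show ?thesis by (simp add: diff_divide_distrib[symmetric] algebra_simps)
  qed
  show "fluctuation_scale b1 b2 x y ^ 3 = variance * ((1 - quot) / (1 - kappa) - kappa * (1 - quot) / (quot * (1 - kappa)))"
    unfolding c d variance_def using q k by (simp add: power2_eq_square power3_eq_cube mult_ac)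
qed

text \<open>Inverts the parametrisation of the coin probabilities by t and r^2.\<close>

lemma straight_weights:
  defines "t \<equiv> b2 / b1" and "r \<equiv> sqrt kappa"
  shows "0 < t" "t < 1" "0 < r" "r < 1" "b1 = (1 - r\<^sup>2) / (1 - t * r\<^sup>2)" "b2 = t * b1"
proof -
  have b: "0 < b1" "0 < 1 - b2" "0 < b1 - b2" using b2_pos b2_less b1_less by auto
  show "0 < t" "t < 1" "b2 = t * b1" using b2_pos b2_less b by (auto simp: t_def)
  show "0 < r" "r < 1" using kappa_bounds by (auto simp: r_def real_sqrt_lt_1_iff)
  have r2: "r\<^sup>2 = kappa" using kappa_bounds by (simp add: r_def)
  have "1 - t * kappa = (b1 - b2) / (b1 * (1 - b2))"
    unfolding t_def kappa_def using b by (simp add: field_simps)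
  then show "b1 = (1 - r\<^sup>2) / (1 - t * r\<^sup>2)" unfolding r2 kappa_bounds(3) using b by simp
qed

lemma height_limit_sequentially:
  fixes L :: "nat \<Rightarrow> real"
  assumes L: "filterlim L at_top sequentially"
  shows "(\<lambda>k. \<P>(\<omega> in six_vertex_measure b1 b2.
            (limit_shape b1 b2 x y * L k - real (height_function (L k * x) (L k * y) \<omega>))
              / (fluctuation_scale b1 b2 x y * L k powr (1/3)) \<le> s)) \<longlonglongrightarrow> F_GUE s"
proof -
  define h where "h = limit_shape b1 b2 x y"
  define \<sigma> where "\<sigma> = fluctuation_scale b1 b2 x y"
  define t where "t = b2 / b1"
  define r where "r = sqrt kappa"
  define \<alpha> where "\<alpha> = (1 - quot) / (1 - kappa)"
  define \<beta> where "\<beta> = kappa * (1 - quot) / (quot * (1 - kappa))"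
  define l where "l = (\<lambda>k. L k powr (1/3))"
  define N where "N = (\<lambda>k. nat \<lfloor>L k * x\<rfloor>)"
  \<comment> \<open>One less than the row that the height reads, because it reads south
    edges.\<close>
  define M where "M = (\<lambda>k. nat \<lceil>L k * y\<rceil> - 1)"
  define z where "z = (\<lambda>k. h * L k - s * \<sigma> * l k)"
  \<comment> \<open>The event of the theorem is that the height is at least the real number z k; the
    height is an integer, so z k may be rounded up.\<close>
  define a where "a = (\<lambda>k. nat \<lceil>z k\<rceil>)"
  note tr = straight_weights[folded t_def r_def]
  have \<sigma>: "0 < \<sigma>" "\<sigma> ^ 3 = variance * (\<alpha> - \<beta>)"
    using fluctuation_scale unfolding \<sigma>_def \<alpha>_def \<beta>_def by auto
  have ab: "weight / (1 + weight) = \<alpha>" "r\<^sup>2 * weight / (1 + r\<^sup>2 * weight) = \<beta>"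
    using weight_ratios kappa_bounds unfolding \<alpha>_def \<beta>_def r_def by simp_all
  have h: "h = x * \<alpha> - y * \<beta>" unfolding h_def \<alpha>_def \<beta>_def by (rule limit_shape_eq)
  have Lpos: "\<forall>\<^sub>F k in sequentially. 0 < L k" using L by (auto simp: filterlim_at_top_dense)
  have l: "filterlim l at_top sequentially"
    unfolding l_def by (rule filterlim_compose[OF _ L]) real_asymp
  have l3: "\<forall>\<^sub>F k in sequentially. l k ^ 3 = L k"
    using Lpos by eventually_elim (simp add: l_def powr_realpow[symmetric] powr_powr)
  have lpos: "\<forall>\<^sub>F k in sequentially. 0 < l k" using l by (auto simp: filterlim_at_top_dense)
  have N: "(\<lambda>k. (real (N k) - x * l k ^ 3) / l k) \<longlonglongrightarrow> 0"
    by (rule bounded_difference_tendsto[OF l], use l3 Lpos in eventually_elim)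
      (use x in \<open>simp add: N_def mult.commute\<close>, linarith)
  have M: "(\<lambda>k. (real (M k) - y * l k ^ 3) / l k) \<longlonglongrightarrow> 0"
  proof (rule bounded_difference_tendsto[OF l], use l3 Lpos in eventually_elim)
    case (elim k)
    have "0 < L k * y" using elim y by simp
    then show ?case unfolding elim(1) M_def by (simp add: mult.commute[of y]) linarith
  qed
  have params: "saddle_parameters \<alpha> \<beta> x y variance h"
  proof -
    have "0 < \<beta>" unfolding \<beta>_def using kappa_bounds(1,2) quot_bounds(1-3) by (intro divide_pos_pos mult_pos_pos) auto
    moreover have "\<alpha> < 1" unfolding \<alpha>_def using kappa_bounds(1,2) quot_bounds(1-3) by (simp add: divide_less_eq)
    moreover have "\<beta> < \<alpha>"
    proof -
      have "\<beta> = \<alpha> * (kappa / quot)" by (simp add: \<alpha>_def \<beta>_def mult_ac)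
      moreover have "0 < \<alpha>" using kappa_bounds(1,2) quot_bounds(1-3) by (simp add: \<alpha>_def)
      ultimately show ?thesis using quot_bounds(1-3) by (simp add: pos_divide_less_eq)
    qed
    ultimately show ?thesis
      using x y h variance_eq unfolding \<alpha>_def[symmetric] \<beta>_def[symmetric] by unfold_locales auto
  qed
  have il: "(\<lambda>k. 1 / l k) \<longlonglongrightarrow> 0"
    using tendsto_inverse_0_at_top[OF l] by (simp add: inverse_eq_divide)
  have z_ratio: "(\<lambda>k. z k / l k ^ 3) \<longlonglongrightarrow> h"
  proof -
    have "(\<lambda>k. h - s * \<sigma> * (1 / l k)\<^sup>2) \<longlonglongrightarrow> h - s * \<sigma> * 0\<^sup>2" by (intro tendsto_intros il)
    moreover have "\<forall>\<^sub>F k in sequentially. h - s * \<sigma> * (1 / l k)\<^sup>2 = z k / l k ^ 3"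
      using l3 lpos
    proof eventually_elim
      case (elim k)
      show ?case unfolding z_def elim(1)[symmetric] using elim(2) by (simp add: field_simps power2_eq_square power3_eq_cube)
    qed
    ultimately show ?thesis by (simp add: tendsto_cong)
  qed
  then have "\<forall>\<^sub>F k in sequentially. 0 < z k / l k ^ 3"
    by (rule order_tendstoD) (rule saddle_parameters.h_pos[OF params])
  then have z_pos: "\<forall>\<^sub>F k in sequentially. 0 < z k"
    using lpos by eventually_elim (simp add: zero_less_divide_iff)
  have a_z: "\<forall>\<^sub>F k in sequentially. \<bar>real (a k) - z k\<bar> \<le> 1"
    using z_pos
  proof eventually_elim
    case (elim k)
    then show ?case unfolding a_def by simp linarith
  qed
  have a: "(\<lambda>k. ((x * \<alpha> - y * \<beta>) * l k ^ 3 - real (a k)) / l k) \<longlonglongrightarrow> \<sigma> * s"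
  proof -
    have "(\<lambda>k. s * \<sigma> - (real (a k) - z k) / l k) \<longlonglongrightarrow> s * \<sigma> - 0"
      by (intro tendsto_intros bounded_difference_tendsto[OF l a_z])
    moreover have "\<forall>\<^sub>F k in sequentially. s * \<sigma> - (real (a k) - z k) / l k = ((x * \<alpha> - y * \<beta>) * l k ^ 3 - real (a k)) / l k"
      using l3 lpos by eventually_elim (simp add: z_def h field_simps)
    ultimately show ?thesis by (simp add: tendsto_cong mult.commute)
  qed
  have a_top: "filterlim a at_top sequentially"
  proof (rule nat_filterlim_of_cubic[OF l _ saddle_parameters.h_pos[OF params]])
    have "(\<lambda>k. z k / l k ^ 3 + (real (a k) - z k) / l k * (1 / l k)\<^sup>2) \<longlonglongrightarrow> h + 0 * 0\<^sup>2"
      by (intro tendsto_intros z_ratio il bounded_difference_tendsto[OF l a_z])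
    moreover have "\<forall>\<^sub>F k in sequentially. z k / l k ^ 3 + (real (a k) - z k) / l k * (1 / l k)\<^sup>2 = real (a k) / l k ^ 3"
      using lpos by eventually_elim (simp add: field_simps power2_eq_square power3_eq_cube)
    ultimately show "(\<lambda>k. real (a k) / l k ^ 3) \<longlonglongrightarrow> h" by (simp add: tendsto_cong)
  qed
  have "(\<lambda>k. sv_tail t (replicate (M k) r) (replicate (N k) r) (a k)) \<longlonglongrightarrow> F_GUE s"
    by (rule sv_tail_tendsto_F_GUE[where r = r and X = x and Y = y and \<sigma> = \<sigma> and V = variance and w = weight, unfolded ab, OF tr(1-4) weight_pos x y _ _ \<sigma> l N M a a_top])
      (use variance_eq in \<open>simp_all add: \<alpha>_def \<beta>_def\<close>)
  moreover have "\<forall>\<^sub>F k in sequentially. sv_tail t (replicate (M k) r) (replicate (N k) r) (a k) =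
    \<P>(\<omega> in six_vertex_measure b1 b2. (h * L k - real (height_function (L k * x) (L k * y) \<omega>)) / (\<sigma> * L k powr (1/3)) \<le> s)"
    using Lpos lpos
  proof eventually_elim
    case (elim k)
    have ceil: "nat \<lceil>L k * y\<rceil> = Suc (M k)"
    proof -
      have "0 < L k * y" using elim y by simp
      then have "0 < \<lceil>L k * y\<rceil>" by simp
      then show ?thesis unfolding M_def by simp
    qed
    have cols: "{i::nat. 1 \<le> i \<and> real i \<le> L k * x} = {1..N k}"
      using elim x by (auto simp: N_def le_nat_floor) (metis le_floor_iff nat_le_iff of_int_of_nat_eq le_nat_iff floor_less_zero not_less less_le zero_le_mult_iff zle_int)
    have ev: "(h * L k - real H) / (\<sigma> * L k powr (1/3)) \<le> s \<longleftrightarrow> a k \<le> H" for H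
    proof -
      have "0 < \<sigma> * l k" using \<sigma> elim by simp
      then have "(h * L k - real H) / (\<sigma> * l k) \<le> s \<longleftrightarrow> z k \<le> real H" by (simp add: z_def divide_le_eq algebra_simps)
      also have "\<dots> \<longleftrightarrow> a k \<le> H" unfolding a_def by (simp add: nat_le_iff ceiling_le_iff)
      finally show ?thesis unfolding l_def .
    qed
    show ?case unfolding ev by (rule height_tail_eq[OF tr ceil cols, symmetric])
  qed
  ultimately show ?thesis unfolding h_def[symmetric] \<sigma>_def[symmetric] by (rule tendsto_cong[THEN iffD1, rotated])
qed

end

theorem theorem1p2:
  fixes b1 b2 x y s :: real
  assumes "0 < b2" and "b2 < b1" and "b1 < 1"
    and "x > 0" and "y > 0"
    and "(1 - b1) / (1 - b2) < x / y" and "x / y < (1 - b2) / (1 - b1)"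
  shows "((\<lambda>L::real. \<P>(\<omega> in six_vertex_measure b1 b2.
            (limit_shape b1 b2 x y * L - real (height_function (L * x) (L * y) \<omega>))
              / (fluctuation_scale b1 b2 x y * L powr (1/3)) \<le> s))
          \<longlongrightarrow> F_GUE s) at_top"
  by (rule tendsto_at_topI_sequentially) (rule height_limit_sequentially[OF assms])

end
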